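(* Let $\mathbb{T}=(\Sigma,E)$ be an algebraic theory and $(\mathcal{S},\Gamma,\mathit{ar},\mathit{coar})$ a monoidal signature. The category $\mathbf{Tape}_{\Gamma}^{\mathbb{T}}$ of $\mathbb{T}$-tape diagrams, equipped with $\oplus$ (concatenation of words of words on objects, $\oplus$ of tapes on arrows, symmetries $\sigma^\oplus$, monoids $\nabla_P,¡_P$), with $\otimes$ (the product of words of words on objects, $\mathfrak{t}_1\otimes\mathfrak{t}_2:=L_P(\mathfrak{t}_2);R_S(\mathfrak{t}_1)$ on arrows), with left distributor $\delta^l$ as defined below, with the inclusion $\mathcal{S}\to\mathbf{Tape}_{\Gamma}^{\mathbb{T}}$ of sorts (as one-letter monomials) and with the morphism $\mathbf{L}_{\mathbb{T}}^{op}\to\mathbf{Tape}_{\Gamma}^{\mathbb{T}}$ sending each operation $f\in\Sigma$ of arity $n$ (as the arrow $f(x_1,\dots,x_n)\colon n\to1$ of $\mathbf{L}_{\mathbb{T}}$) to $f_1\colon 1\to\bigoplus^n1$, is the free sesquistrict $\mathbb{T}$-rig category generated by $(\mathcal{S},\Gamma)$, via the interpretation $A\mapsto A$, $s\mapsto\lceil s\rceil$.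
   Context: Composition is diagrammatic. Algebraic theory $\mathbb{T}=(\Sigma,E)$: operation symbols with arities, equations $E$ between $\Sigma$-terms. $\mathbf{L}_{\mathbb{T}}$: objects natural numbers, arrows $n\to m$ tuples of $m$ terms in $x_1,\dots,x_n$ modulo $E$, composition by substitution, product = addition. $\aleph_0$: strict fc category freely generated by one object (finite ordinals, functions); $d\colon\aleph_0\to\mathbf{L}_{\mathbb{T}}^{op}$ the identity-on-objects fc morphism; for an fc rig category $\mathcal{C}$, $c\colon\aleph_0\to\mathcal{C}$ the fc morphism with $n\mapsto\bigoplus^n1$ (right-bracketed). Rig category: symmetric monoidal $(\otimes,1)$, $(\oplus,0)$, natural isos $\delta^l_{X,Y,Z}\colon X\otimes(Y\oplus Z)\to(X\otimes Y)\oplus(X\otimes Z)$, $\delta^r$, $\lambda^\bullet\colon0\otimes X\to0$, $\rho^\bullet\colon X\otimes0\to0$ with Laplaza's axioms. fc category: symmetric monoidal $(\oplus,0)$ with natural coherent commutative monoids $(\nabla_X\colon X\oplus X\to X,¡_X\colon0\to X)$; fc morphism: strong symmetric monoidal functor preserving them. $\mathbb{T}$-rig category: fc rig category $\mathcal{C}$ with fc morphism $i\colon\mathbf{L}_{\mathbb{T}}^{op}\to\mathcal{C}$ with $d;i=c$; morphism of $\mathbb{T}$-rig categories $(\mathcal{C},i)\to(\mathcal{D},j)$: rig functor preserving the monoids with $i;F=j$. A right strict rig category: both monoidal structures strict and $\lambda^\bullet,\rho^\bullet,\delta^r$ identities. A sesquistrict rig category is a functor $H\colon\mathcal{M}\to\mathcal{C}$,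 $\mathcal{M}$ discrete, $\mathcal{C}$ right strict rig, with $\delta^l_{H(A),X,Y}$ an identity for all $A$; a sesquistrict rig functor $(H\colon\mathcal{M}\to\mathcal{C})\to(H'\colon\mathcal{M}'\to\mathcal{C}')$ is a pair $(\alpha\colon\mathcal{M}\to\mathcal{M}',\beta\colon\mathcal{C}\to\mathcal{C}')$ with $\beta$ strict symmetric monoidal for both products and preserving $\delta^l$, and $\alpha;H'=H;\beta$. A sesquistrict $\mathbb{T}$-rig category is a sesquistrict rig category $H\colon\mathcal{M}\to\mathcal{C}$ with $\mathcal{C}$ a $\mathbb{T}$-rig category; morphisms are sesquistrict rig functors whose $\beta$ is a morphism of $\mathbb{T}$-rig categories. A monoidal signature $(\mathcal{S},\Gamma,\mathit{ar},\mathit{coar})$: sorts $\mathcal{S}$, generators $\Gamma$ with arity and coarity words in $\mathcal{S}^\star$. An interpretation of it in $H\colon\mathcal{M}\to\mathcal{D}$ is $(\alpha_\mathcal{S}\colon\mathcal{S}\to\mathrm{Ob}(\mathcal{M}),\alpha_\Gamma\colon\Gamma\to\mathrm{Ar}(\mathcal{D}))$ with $\alpha_\Gamma(s)$ from $(\alpha_\mathcal{S};H)^\sharp(\mathit{ar}(s))$ to $(\alpha_\mathcal{S};H)^\sharp(\mathit{coar}(s))$ ($\sharp$ = right-bracketed $\otimes$-extension). $H$ is freely generated by the signature via an interpretation $(\alpha_\mathcal{S},\alpha_\Gamma)$ if for every sesquistrict $\mathbb{T}$-rig $H'$ and interpretation $(\alpha'_\mathcal{S},\alpha'_\Gamma)$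 there is a unique morphism $(\alpha,\beta)$ with $\alpha_\mathcal{S};\alpha=\alpha'_\mathcal{S}$ and $\alpha_\Gamma;\beta=\alpha'_\Gamma$. Tapes. $A,B\in\mathcal{S}$; $U,V,W\in\mathcal{S}^\star$ (words, concatenation $UV$, empty word $1$); $P,Q,R,S\in(\mathcal{S}^\star)^\star$ (words of words, concatenation $P\oplus Q$, empty $0$); $P\otimes Q:=\bigoplus_i\bigoplus_jU_iV_j$ for $P=\bigoplus_iU_i$, $Q=\bigoplus_jV_j$. Circuits: $c::=\mathrm{id}_A\mid\mathrm{id}_1\mid s\mid\sigma_{A,B}\mid c;c\mid c\otimes c$ ($s\in\Gamma$, $s\colon\mathit{ar}(s)\to\mathit{coar}(s)$, $\sigma_{A,B}\colon AB\to BA$), typed $U\to V$, modulo the axioms of strict symmetric monoidal categories. Tapes: $\mathfrak{t}::=\mathrm{id}_U\mid\mathrm{id}_0\mid\lceil c\rceil\mid\sigma^\oplus_{U,V}\mid\mathfrak{t};\mathfrak{t}\mid\mathfrak{t}\oplus\mathfrak{t}\mid ¡_U\mid\nabla_U\mid f_U$ with $\lceil c\rceil\colon U\to V$ for $c\colon U\to V$, $\sigma^\oplus_{U,V}\colon U\oplus V\to V\oplus U$, $¡_U\colon0\to U$, $\nabla_U\colon U\oplus U\to U$, $f_U\colon U\to\bigoplus^nU$ for $f\in\Sigma$ of arity $n$. Derived: $\mathrm{id}_{U\oplus P'}=\mathrm{id}_U\oplus\mathrm{id}_{P'}$, $¡_0=\mathrm{id}_0$, $¡_{U\oplus P'}=¡_U\oplus¡_{P'}$,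 $\nabla_0=\mathrm{id}_0$, $\nabla_{U\oplus P'}=(\mathrm{id}_U\oplus\sigma^\oplus_{U,P'}\oplus\mathrm{id}_{P'});(\nabla_U\oplus\nabla_{P'})$, $\sigma^\oplus_{P,Q}$ by the usual induction, $f_0=\mathrm{id}_0$, $f_{U\oplus P'}=(f_U\oplus f_{P'});(\delta^l_{\bigoplus^n1,U,P'})^{-1}$; $\delta^l_{0,Q,R}=\mathrm{id}_0$, $\delta^l_{U\oplus P',Q,R}=(\mathrm{id}_{U(Q\oplus R)}\oplus\delta^l_{P',Q,R});(\mathrm{id}_{UQ}\oplus\sigma^\oplus_{UR,P'Q}\oplus\mathrm{id}_{P'R})$. For a $\Sigma$-term $t$ in $x_1,\dots,x_n$: $(x_i)_U=¡_{\bigoplus^{i-1}U}\oplus\mathrm{id}_U\oplus¡_{\bigoplus^{n-i}U}$, $(f(t_1,\dots,t_m))_U=f_U;((t_1)_U\oplus\dots\oplus(t_m)_U);\nabla^m_{\bigoplus^nU}$ with $\nabla^0_P=¡_P$, $\nabla^{m+1}_P=(\mathrm{id}_P\oplus\nabla^m_P);\nabla_P$. Whiskerings: $L_U$ (resp. $R_U$) sends $\mathrm{id}_0\mapsto\mathrm{id}_0$, $\lceil c\rceil\mapsto\lceil\mathrm{id}_U\otimes c\rceil$ (resp. $\lceil c\otimes\mathrm{id}_U\rceil$), $\sigma^\oplus_{V,W}\mapsto\sigma^\oplus_{UV,UW}$ (resp. $\sigma^\oplus_{VU,WU}$), $\nabla_V\mapsto\nabla_{UV}$, $¡_V\mapsto¡_{UV}$,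 $f_V\mapsto f_{UV}$ (resp. with $VU$), and preserves $;$ and $\oplus$; $L_0(\mathfrak{t})=R_0(\mathfrak{t})=\mathrm{id}_0$, $L_{W\oplus S'}(\mathfrak{t})=L_W(\mathfrak{t})\oplus L_{S'}(\mathfrak{t})$, $R_{W\oplus S'}(\mathfrak{t})=\delta^l_{P,W,S'};(R_W(\mathfrak{t})\oplus R_{S'}(\mathfrak{t}));(\delta^l_{Q,W,S'})^{-1}$ for $\mathfrak{t}\colon P\to Q$; for $\mathfrak{t}_1\colon P\to Q$, $\mathfrak{t}_2\colon R\to S$, $\mathfrak{t}_1\otimes\mathfrak{t}_2:=L_P(\mathfrak{t}_2);R_S(\mathfrak{t}_1)$. $\mathbf{Tape}_{\Gamma}^{\mathbb{T}}$ has objects $(\mathcal{S}^\star)^\star$ and arrows typed tapes modulo the smallest congruence (w.r.t. $;$, $\oplus$, $\otimes$) containing: the strict symmetric monoidal category axioms for $(;,\oplus,\sigma^\oplus)$; commutative monoid axioms for $(\nabla_U,¡_U)$; $\nabla_U;\lceil c\rceil=(\lceil c\rceil\oplus\lceil c\rceil);\nabla_V$, $¡_U;\lceil c\rceil=¡_V$; $\nabla_U;f_U=(f_U\oplus f_U);\nabla_{\bigoplus^nU}$, $¡_U;f_U=¡_{\bigoplus^nU}$; $\mathfrak{t};f_Q=f_P;\bigoplus^n\mathfrak{t}$ for all tapes $\mathfrak{t}\colon P\to Q$; $\lceil\mathrm{id}_U\rceil=\mathrm{id}_U$, $\lceil c;d\rceil=\lceil c\rceil;\lceil d\rceil$; and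 $t_U=t'_U$ for all $(t,t')\in E$. *)

theory Defs
  imports Main
begin

section \<open>Categories and symmetric monoidal categories\<close>

text \<open>Composition is diagrammatic throughout: \<open>Comp C f g\<close> is "first \<open>f\<close>, then \<open>g\<close>".
  Functions on objects and arrows are only meaningful on \<open>Obj C\<close>, \<open>Arr C\<close>, and composition only
  on composable arrows.\<close>

record ('o, 'a) cat =
  Obj :: "'o set"
  Arr :: "'a set"
  Dom :: "'a \<Rightarrow> 'o"
  Cod :: "'a \<Rightarrow> 'o"
  Id :: "'o \<Rightarrow> 'a"
  Comp :: "'a \<Rightarrow> 'a \<Rightarrow> 'a"

definition Hom :: "('o, 'a) cat \<Rightarrow> 'o \<Rightarrow> 'o \<Rightarrow> 'a set" where
  "Hom C X Y = {f \<in> Arr C. Dom C f = X \<and> Cod C f = Y}"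

locale category =
  fixes C :: "('o, 'a) cat"
  assumes Dom_in_Obj: "f \<in> Arr C \<Longrightarrow> Dom C f \<in> Obj C"
    and Cod_in_Obj: "f \<in> Arr C \<Longrightarrow> Cod C f \<in> Obj C"
    and Id_in_Hom: "X \<in> Obj C \<Longrightarrow> Id C X \<in> Hom C X X"
    and Comp_in_Hom: "f \<in> Hom C X Y \<Longrightarrow> g \<in> Hom C Y Z \<Longrightarrow> Comp C f g \<in> Hom C X Z"
    and Id_Comp: "f \<in> Hom C X Y \<Longrightarrow> Comp C (Id C X) f = f"
    and Comp_Id: "f \<in> Hom C X Y \<Longrightarrow> Comp C f (Id C Y) = f"
    and Comp_assoc: "f \<in> Hom C W X \<Longrightarrow> g \<in> Hom C X Y \<Longrightarrow> h \<in> Hom C Y Z \<Longrightarrow>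
      Comp C (Comp C f g) h = Comp C f (Comp C g h)"

definition op_cat :: "('o, 'a) cat \<Rightarrow> ('o, 'a) cat" where
  "op_cat C = C\<lparr>Dom := Cod C, Cod := Dom C, Comp := \<lambda>f g. Comp C g f\<rparr>"

definition inverse_arrows :: "('o, 'a) cat \<Rightarrow> 'a \<Rightarrow> 'a \<Rightarrow> bool" where
  "inverse_arrows C f g \<longleftrightarrow> f \<in> Arr C \<and> g \<in> Hom C (Cod C f) (Dom C f) \<and>
     Comp C f g = Id C (Dom C f) \<and> Comp C g f = Id C (Cod C f)"

definition is_iso :: "('o, 'a) cat \<Rightarrow> 'a \<Rightarrow> bool" where
  "is_iso C f \<longleftrightarrow> (\<exists>g. inverse_arrows C f g)"

definition inv_of :: "('o, 'a) cat \<Rightarrow> 'a \<Rightarrow> 'a" where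
  "inv_of C f = (THE g. inverse_arrows C f g)"

definition is_identity :: "('o, 'a) cat \<Rightarrow> 'a \<Rightarrow> bool" where
  "is_identity C f \<longleftrightarrow> (\<exists>X \<in> Obj C. f = Id C X)"

text \<open>The monoidal structure on a category: product on objects and on arrows, unit, and the
  coherence families \<open>assoc X Y Z : (X Y) Z \<rightarrow> X (Y Z)\<close>, \<open>lunit X : I X \<rightarrow> X\<close>,
  \<open>runit X : X I \<rightarrow> X\<close>, \<open>symm X Y : X Y \<rightarrow> Y X\<close>.\<close>

record ('o, 'a) tensor =
  tob :: "'o \<Rightarrow> 'o \<Rightarrow> 'o"
  tar :: "'a \<Rightarrow> 'a \<Rightarrow> 'a"
  tunit :: "'o"
  assoc :: "'o \<Rightarrow> 'o \<Rightarrow> 'o \<Rightarrow> 'a"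
  lunit :: "'o \<Rightarrow> 'a"
  runit :: "'o \<Rightarrow> 'a"
  symm :: "'o \<Rightarrow> 'o \<Rightarrow> 'a"

locale monoidal_syntax =
  fixes C :: "('o, 'a) cat" and M :: "('o, 'a) tensor"
begin

abbreviation Seq (infixl "\<Zsemi>" 55) where "f \<Zsemi> g \<equiv> Comp C f g"
abbreviation tensor_obj (infixr "\<odot>" 70) where "X \<odot> Y \<equiv> tob M X Y"
abbreviation tensor_arr (infixr "\<odot>\<^sub>a" 70) where "f \<odot>\<^sub>a g \<equiv> tar M f g"
abbreviation "\<iota> \<equiv> Id C"
abbreviation "I \<equiv> tunit M"

text \<open>The canonical isomorphism \<open>(W X) (Y Z) \<rightarrow> (W Y) (X Z)\<close>.\<close>

definition mid4 :: "'o \<Rightarrow> 'o \<Rightarrow> 'o \<Rightarrow> 'o \<Rightarrow> 'a" where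
  "mid4 W X Y Z =
     assoc M W X (Y \<odot> Z) \<Zsemi> (\<iota> W \<odot>\<^sub>a inv_of C (assoc M X Y Z)) \<Zsemi> (\<iota> W \<odot>\<^sub>a (symm M X Y \<odot>\<^sub>a \<iota> Z))
       \<Zsemi> (\<iota> W \<odot>\<^sub>a assoc M Y X Z) \<Zsemi> inv_of C (assoc M W Y (X \<odot> Z))"

end

locale symmetric_monoidal = category C + monoidal_syntax C M
  for C :: "('o, 'a) cat" and M :: "('o, 'a) tensor" +
  assumes tensor_in_Obj: "X \<in> Obj C \<Longrightarrow> Y \<in> Obj C \<Longrightarrow> X \<odot> Y \<in> Obj C"
    and unit_in_Obj: "I \<in> Obj C"
    and tensor_in_Hom: "f \<in> Hom C X X' \<Longrightarrow> g \<in> Hom C Y Y' \<Longrightarrow> f \<odot>\<^sub>a g \<in> Hom C (X \<odot> Y) (X' \<odot> Y')"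
    and tensor_Id: "X \<in> Obj C \<Longrightarrow> Y \<in> Obj C \<Longrightarrow> \<iota> X \<odot>\<^sub>a \<iota> Y = \<iota> (X \<odot> Y)"
    and interchange: "f \<in> Hom C X X' \<Longrightarrow> f' \<in> Hom C X' X'' \<Longrightarrow> g \<in> Hom C Y Y' \<Longrightarrow> g' \<in> Hom C Y' Y'' \<Longrightarrow>
      (f \<Zsemi> f') \<odot>\<^sub>a (g \<Zsemi> g') = (f \<odot>\<^sub>a g) \<Zsemi> (f' \<odot>\<^sub>a g')"
    and assoc_in_Hom: "X \<in> Obj C \<Longrightarrow> Y \<in> Obj C \<Longrightarrow> Z \<in> Obj C \<Longrightarrow>
      assoc M X Y Z \<in> Hom C ((X \<odot> Y) \<odot> Z) (X \<odot> (Y \<odot> Z))"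
    and assoc_iso: "X \<in> Obj C \<Longrightarrow> Y \<in> Obj C \<Longrightarrow> Z \<in> Obj C \<Longrightarrow> is_iso C (assoc M X Y Z)"
    and assoc_natural: "f \<in> Hom C X X' \<Longrightarrow> g \<in> Hom C Y Y' \<Longrightarrow> h \<in> Hom C Z Z' \<Longrightarrow>
      ((f \<odot>\<^sub>a g) \<odot>\<^sub>a h) \<Zsemi> assoc M X' Y' Z' = assoc M X Y Z \<Zsemi> (f \<odot>\<^sub>a (g \<odot>\<^sub>a h))"
    and lunit_in_Hom: "X \<in> Obj C \<Longrightarrow> lunit M X \<in> Hom C (I \<odot> X) X"
    and lunit_iso: "X \<in> Obj C \<Longrightarrow> is_iso C (lunit M X)"
    and lunit_natural: "f \<in> Hom C X X' \<Longrightarrow> (\<iota> I \<odot>\<^sub>a f) \<Zsemi> lunit M X' = lunit M X \<Zsemi> f"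
    and runit_in_Hom: "X \<in> Obj C \<Longrightarrow> runit M X \<in> Hom C (X \<odot> I) X"
    and runit_iso: "X \<in> Obj C \<Longrightarrow> is_iso C (runit M X)"
    and runit_natural: "f \<in> Hom C X X' \<Longrightarrow> (f \<odot>\<^sub>a \<iota> I) \<Zsemi> runit M X' = runit M X \<Zsemi> f"
    and symm_in_Hom: "X \<in> Obj C \<Longrightarrow> Y \<in> Obj C \<Longrightarrow> symm M X Y \<in> Hom C (X \<odot> Y) (Y \<odot> X)"
    and symm_natural: "f \<in> Hom C X X' \<Longrightarrow> g \<in> Hom C Y Y' \<Longrightarrow>
      (f \<odot>\<^sub>a g) \<Zsemi> symm M X' Y' = symm M X Y \<Zsemi> (g \<odot>\<^sub>a f)"
    and pentagon: "W \<in> Obj C \<Longrightarrow> X \<in> Obj C \<Longrightarrow> Y \<in> Obj C \<Longrightarrow> Z \<in> Obj C \<Longrightarrow>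
      assoc M (W \<odot> X) Y Z \<Zsemi> assoc M W X (Y \<odot> Z) =
      (assoc M W X Y \<odot>\<^sub>a \<iota> Z) \<Zsemi> assoc M W (X \<odot> Y) Z \<Zsemi> (\<iota> W \<odot>\<^sub>a assoc M X Y Z)"
    and triangle: "X \<in> Obj C \<Longrightarrow> Y \<in> Obj C \<Longrightarrow>
      assoc M X I Y \<Zsemi> (\<iota> X \<odot>\<^sub>a lunit M Y) = runit M X \<odot>\<^sub>a \<iota> Y"
    and symm_symm: "X \<in> Obj C \<Longrightarrow> Y \<in> Obj C \<Longrightarrow> symm M X Y \<Zsemi> symm M Y X = \<iota> (X \<odot> Y)"
    and hexagon: "X \<in> Obj C \<Longrightarrow> Y \<in> Obj C \<Longrightarrow> Z \<in> Obj C \<Longrightarrow>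
      assoc M X Y Z \<Zsemi> symm M X (Y \<odot> Z) \<Zsemi> assoc M Y Z X =
      (symm M X Y \<odot>\<^sub>a \<iota> Z) \<Zsemi> assoc M Y X Z \<Zsemi> (\<iota> Y \<odot>\<^sub>a symm M X Z)"

definition strict_tensor :: "('o, 'a) cat \<Rightarrow> ('o, 'a) tensor \<Rightarrow> bool" where
  "strict_tensor C M \<longleftrightarrow>
     (\<forall>X \<in> Obj C. \<forall>Y \<in> Obj C. \<forall>Z \<in> Obj C. is_identity C (assoc M X Y Z)) \<and>
     (\<forall>X \<in> Obj C. is_identity C (lunit M X) \<and> is_identity C (runit M X))"

section \<open>Strong symmetric monoidal functors\<close>

text \<open>\<open>mu F X Y : F X F Y \<rightarrow> F (X Y)\<close> and \<open>eps F : I \<rightarrow> F I\<close> are the comparison isomorphisms.\<close>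

record ('o, 'a, 'p, 'b) mfun =
  omap :: "'o \<Rightarrow> 'p"
  amap :: "'a \<Rightarrow> 'b"
  mu :: "'o \<Rightarrow> 'o \<Rightarrow> 'b"
  eps :: "'b"

locale strong_symmetric_monoidal_functor = monoidal_syntax C M
  for B :: "('p, 'b) cat" and L :: "('p, 'b) tensor"
    and C :: "('o, 'a) cat" and M :: "('o, 'a) tensor"
    and F :: "('p, 'b, 'o, 'a) mfun" +
  assumes omap_in_Obj: "X \<in> Obj B \<Longrightarrow> omap F X \<in> Obj C"
    and amap_in_Hom: "f \<in> Hom B X Y \<Longrightarrow> amap F f \<in> Hom C (omap F X) (omap F Y)"
    and amap_Id: "X \<in> Obj B \<Longrightarrow> amap F (Id B X) = Id C (omap F X)"
    and amap_Comp: "f \<in> Hom B X Y \<Longrightarrow> g \<in> Hom B Y Z \<Longrightarrow>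
      amap F (Comp B f g) = Comp C (amap F f) (amap F g)"
    and mu_in_Hom: "X \<in> Obj B \<Longrightarrow> Y \<in> Obj B \<Longrightarrow>
      mu F X Y \<in> Hom C (omap F X \<odot> omap F Y) (omap F (tob L X Y))"
    and mu_iso: "X \<in> Obj B \<Longrightarrow> Y \<in> Obj B \<Longrightarrow> is_iso C (mu F X Y)"
    and mu_natural: "f \<in> Hom B X X' \<Longrightarrow> g \<in> Hom B Y Y' \<Longrightarrow>
      (amap F f \<odot>\<^sub>a amap F g) \<Zsemi> mu F X' Y' = mu F X Y \<Zsemi> amap F (tar L f g)"
    and eps_in_Hom: "eps F \<in> Hom C (tunit M) (omap F (tunit L))"
    and eps_iso: "is_iso C (eps F)"
    and mu_assoc: "X \<in> Obj B \<Longrightarrow> Y \<in> Obj B \<Longrightarrow> Z \<in> Obj B \<Longrightarrow>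
      (mu F X Y \<odot>\<^sub>a \<iota> (omap F Z)) \<Zsemi> mu F (tob L X Y) Z \<Zsemi> amap F (assoc L X Y Z) =
      assoc M (omap F X) (omap F Y) (omap F Z) \<Zsemi> (\<iota> (omap F X) \<odot>\<^sub>a mu F Y Z) \<Zsemi> mu F X (tob L Y Z)"
    and mu_lunit: "X \<in> Obj B \<Longrightarrow>
      (eps F \<odot>\<^sub>a \<iota> (omap F X)) \<Zsemi> mu F (tunit L) X \<Zsemi> amap F (lunit L X) = lunit M (omap F X)"
    and mu_runit: "X \<in> Obj B \<Longrightarrow>
      (\<iota> (omap F X) \<odot>\<^sub>a eps F) \<Zsemi> mu F X (tunit L) \<Zsemi> amap F (runit L X) = runit M (omap F X)"
    and mu_symm: "X \<in> Obj B \<Longrightarrow> Y \<in> Obj B \<Longrightarrow>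
      mu F X Y \<Zsemi> amap F (symm L X Y) = symm M (omap F X) (omap F Y) \<Zsemi> mu F Y X"

definition mfun_comp ::
  "('q, 'c) cat \<Rightarrow> ('o, 'a, 'p, 'b) mfun \<Rightarrow> ('p, 'b, 'q, 'c) mfun \<Rightarrow> ('o, 'a, 'q, 'c) mfun" where
  "mfun_comp E F G =
     \<lparr>omap = \<lambda>X. omap G (omap F X),
      amap = \<lambda>f. amap G (amap F f),
      mu = \<lambda>X Y. Comp E (mu G (omap F X) (omap F Y)) (amap G (mu F X Y)),
      eps = Comp E (eps G) (amap G (eps F))\<rparr>"

text \<open>Equality of monoidal functors out of \<open>C\<close>, i.e. regardless of the junk values off \<open>C\<close>.\<close>

definition mfun_eq :: "('o, 'a) cat \<Rightarrow> ('o, 'a, 'p, 'b) mfun \<Rightarrow> ('o, 'a, 'p, 'b) mfun \<Rightarrow> bool" where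
  "mfun_eq C F G \<longleftrightarrow>
     (\<forall>X \<in> Obj C. omap F X = omap G X) \<and> (\<forall>f \<in> Arr C. amap F f = amap G f) \<and>
     (\<forall>X \<in> Obj C. \<forall>Y \<in> Obj C. mu F X Y = mu G X Y) \<and> eps F = eps G"

section \<open>Finite coproduct categories\<close>

record ('o, 'a) fc =
  fcat :: "('o, 'a) cat"
  fsum :: "('o, 'a) tensor"
  nabla :: "'o \<Rightarrow> 'a"
  cobang :: "'o \<Rightarrow> 'a"

locale fc_category = symmetric_monoidal C M
  for C :: "('o, 'a) cat" and M :: "('o, 'a) tensor" +
  fixes nab :: "'o \<Rightarrow> 'a" and cob :: "'o \<Rightarrow> 'a"
  assumes nabla_in_Hom: "X \<in> Obj C \<Longrightarrow> nab X \<in> Hom C (X \<odot> X) X"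
    and cobang_in_Hom: "X \<in> Obj C \<Longrightarrow> cob X \<in> Hom C I X"
    and nabla_assoc: "X \<in> Obj C \<Longrightarrow>
      (nab X \<odot>\<^sub>a \<iota> X) \<Zsemi> nab X = assoc M X X X \<Zsemi> (\<iota> X \<odot>\<^sub>a nab X) \<Zsemi> nab X"
    and nabla_lunit: "X \<in> Obj C \<Longrightarrow> (cob X \<odot>\<^sub>a \<iota> X) \<Zsemi> nab X = lunit M X"
    and nabla_runit: "X \<in> Obj C \<Longrightarrow> (\<iota> X \<odot>\<^sub>a cob X) \<Zsemi> nab X = runit M X"
    and nabla_comm: "X \<in> Obj C \<Longrightarrow> symm M X X \<Zsemi> nab X = nab X"
    and nabla_natural: "f \<in> Hom C X Y \<Longrightarrow> nab X \<Zsemi> f = (f \<odot>\<^sub>a f) \<Zsemi> nab Y"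
    and cobang_natural: "f \<in> Hom C X Y \<Longrightarrow> cob X \<Zsemi> f = cob Y"
    and nabla_sum: "X \<in> Obj C \<Longrightarrow> Y \<in> Obj C \<Longrightarrow>
      nab (X \<odot> Y) = mid4 X Y X Y \<Zsemi> (nab X \<odot>\<^sub>a nab Y)"
    and nabla_zero: "nab I = lunit M I"
    and cobang_sum: "X \<in> Obj C \<Longrightarrow> Y \<in> Obj C \<Longrightarrow>
      cob (X \<odot> Y) = inv_of C (lunit M I) \<Zsemi> (cob X \<odot>\<^sub>a cob Y)"
    and cobang_zero: "cob I = \<iota> I"

definition fc_morphism :: "('o, 'a) fc \<Rightarrow> ('p, 'b) fc \<Rightarrow> ('o, 'a, 'p, 'b) mfun \<Rightarrow> bool" where
  "fc_morphism K L F \<longleftrightarrow>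
     strong_symmetric_monoidal_functor (fcat K) (fsum K) (fcat L) (fsum L) F \<and>
     (\<forall>X \<in> Obj (fcat K).
        Comp (fcat L) (mu F X X) (amap F (nabla K X)) = nabla L (omap F X) \<and>
        Comp (fcat L) (eps F) (amap F (cobang K X)) = cobang L (omap F X))"

text \<open>The strict fc category of finite ordinals: \<open>(m, ks)\<close> is the function
  \<open>i \<mapsto> ks ! i\<close> from \<open>{..<length ks}\<close> to \<open>{..<m}\<close>.\<close>

definition aleph0_cat :: "(nat, nat \<times> nat list) cat" where
  "aleph0_cat =
     \<lparr>Obj = UNIV,
      Arr = {(m, ks). \<forall>k \<in> set ks. k < m},
      Dom = \<lambda>(m, ks). length ks,
      Cod = fst,
      Id = \<lambda>n. (n, [0..<n]),
      Comp = \<lambda>(m, ks) (p, ls). (p, map (\<lambda>k. ls ! k) ks)\<rparr>"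

definition aleph0 :: "(nat, nat \<times> nat list) fc" where
  "aleph0 =
     \<lparr>fcat = aleph0_cat,
      fsum =
        \<lparr>tob = (+),
         tar = \<lambda>(m, ks) (m', ks'). (m + m', ks @ map (\<lambda>k. m + k) ks'),
         tunit = 0,
         assoc = \<lambda>k m n. Id aleph0_cat (k + m + n),
         lunit = Id aleph0_cat,
         runit = Id aleph0_cat,
         symm = \<lambda>m n. (n + m, [n..<n + m] @ [0..<n])\<rparr>,
      nabla = \<lambda>n. (n, [0..<n] @ [0..<n]),
      cobang = \<lambda>n. (n, [])\<rparr>"

text \<open>The canonical fc morphism from \<open>aleph0\<close> to an fc category with \<open>n \<mapsto> X \<oplus> (X \<oplus> (\<dots> \<oplus> 0))\<close>: a function
  is sent to the copairing of the coproduct injections that it selects.\<close>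

locale canonical_fc = monoidal_syntax C M
  for C :: "('o, 'a) cat" and M :: "('o, 'a) tensor" +
  fixes nab :: "'o \<Rightarrow> 'a" and cob :: "'o \<Rightarrow> 'a" and X :: 'o
begin

primrec nsum :: "nat \<Rightarrow> 'o" where
  "nsum 0 = I"
| "nsum (Suc n) = X \<odot> nsum n"

fun inj :: "nat \<Rightarrow> nat \<Rightarrow> 'a" where
  "inj 0 k = undefined"
| "inj (Suc n) 0 = inv_of C (runit M X) \<Zsemi> (\<iota> X \<odot>\<^sub>a cob (nsum n))"
| "inj (Suc n) (Suc k) = inv_of C (lunit M X) \<Zsemi> (cob X \<odot>\<^sub>a inj n k)"

primrec copair :: "nat \<Rightarrow> nat list \<Rightarrow> 'a" where
  "copair n [] = cob (nsum n)"
| "copair n (k # ks) = (inj n k \<odot>\<^sub>a copair n ks) \<Zsemi> nab (nsum n)"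

primrec nsum_add :: "nat \<Rightarrow> nat \<Rightarrow> 'a" where
  "nsum_add 0 n = lunit M (nsum n)"
| "nsum_add (Suc m) n = assoc M X (nsum m) (nsum n) \<Zsemi> (\<iota> X \<odot>\<^sub>a nsum_add m n)"

definition canonical :: "(nat, nat \<times> nat list, 'o, 'a) mfun" where
  "canonical = \<lparr>omap = nsum, amap = \<lambda>(n, ks). copair n ks, mu = nsum_add, eps = \<iota> I\<rparr>"

end

section \<open>Algebraic theories and the category \<open>L\<close>\<close>

datatype 'f trm = Var nat | Fn 'f "'f trm list"

record 'f alg_theory =
  ops :: "'f set"
  arity :: "'f \<Rightarrow> nat"
  eqs :: "('f trm \<times> 'f trm) set"

text \<open>\<open>wf_trm T n t\<close>: \<open>t\<close> is a term in the first \<open>n\<close> variables, which are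
  \<open>Var 0, \<dots>, Var (n - 1)\<close>.\<close>

inductive wf_trm :: "'f alg_theory \<Rightarrow> nat \<Rightarrow> 'f trm \<Rightarrow> bool" for T and n where
  "i < n \<Longrightarrow> wf_trm T n (Var i)"
| "f \<in> ops T \<Longrightarrow> length ts = arity T f \<Longrightarrow> (\<And>t. t \<in> set ts \<Longrightarrow> wf_trm T n t) \<Longrightarrow> wf_trm T n (Fn f ts)"

definition algebraic_theory :: "'f alg_theory \<Rightarrow> bool" where
  "algebraic_theory T \<longleftrightarrow> (\<forall>(t, t') \<in> eqs T. \<exists>n. wf_trm T n t \<and> wf_trm T n t')"

primrec subst :: "(nat \<Rightarrow> 'f trm) \<Rightarrow> 'f trm \<Rightarrow> 'f trm" where
  "subst s (Var i) = s i"
| "subst s (Fn f ts) = Fn f (map (subst s) ts)"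

text \<open>Equality modulo the equations of \<open>T\<close> of terms in \<open>n\<close> variables. An equation carries no
  variable context of its own; it is read in any context in which both sides are terms.\<close>

inductive trm_eq :: "'f alg_theory \<Rightarrow> nat \<Rightarrow> 'f trm \<Rightarrow> 'f trm \<Rightarrow> bool" for T and n where
  refl: "wf_trm T n t \<Longrightarrow> trm_eq T n t t"
| sym: "trm_eq T n t u \<Longrightarrow> trm_eq T n u t"
| trans: "trm_eq T n t u \<Longrightarrow> trm_eq T n u v \<Longrightarrow> trm_eq T n t v"
| cong: "f \<in> ops T \<Longrightarrow> length ts = arity T f \<Longrightarrow> list_all2 (trm_eq T n) ts us \<Longrightarrow>
    trm_eq T n (Fn f ts) (Fn f us)"
| ax: "(t, t') \<in> eqs T \<Longrightarrow> wf_trm T m t \<Longrightarrow> wf_trm T m t' \<Longrightarrow> (\<forall>i<m. wf_trm T n (s i)) \<Longrightarrow>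
    trm_eq T n (subst s t) (subst s t')"

definition trm_class :: "'f alg_theory \<Rightarrow> nat \<Rightarrow> 'f trm \<Rightarrow> 'f trm set" where
  "trm_class T n t = {u. trm_eq T n t u}"

definition rep :: "'x set \<Rightarrow> 'x" where
  "rep A = (SOME x. x \<in> A)"

text \<open>The arrow \<open>(n, ts) : n \<rightarrow> length ts\<close> is a tuple of classes of terms in \<open>n\<close> variables.\<close>

definition lawvere :: "'f alg_theory \<Rightarrow> (nat, nat \<times> 'f trm set list) cat" where
  "lawvere T =
     \<lparr>Obj = UNIV,
      Arr = {(n, ts). \<forall>c \<in> set ts. \<exists>t. wf_trm T n t \<and> c = trm_class T n t},
      Dom = fst,
      Cod = \<lambda>(n, ts). length ts,
      Id = \<lambda>n. (n, map (\<lambda>i. trm_class T n (Var i)) [0..<n]),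
      Comp = \<lambda>(n, ts) (m, us).
        (n, map (\<lambda>u. trm_class T n (subst (\<lambda>i. rep (ts ! i)) (rep u))) us)\<rparr>"

text \<open>The action on arrows of the identity-on-objects functor from finite ordinals.\<close>

definition d_arr :: "'f alg_theory \<Rightarrow> nat \<times> nat list \<Rightarrow> nat \<times> 'f trm set list" where
  "d_arr T = (\<lambda>(n, ks). (n, map (\<lambda>k. trm_class T n (Var k)) ks))"

definition lawvere_op :: "'f alg_theory \<Rightarrow> (nat, nat \<times> 'f trm set list) fc" where
  "lawvere_op T =
     \<lparr>fcat = op_cat (lawvere T),
      fsum =
        \<lparr>tob = (+),
         tar = \<lambda>(n, ts) (m, us). (n + m,
           map (\<lambda>t. trm_class T (n + m) (rep t)) ts @
           map (\<lambda>u. trm_class T (n + m) (subst (\<lambda>i. Var (n + i)) (rep u))) us),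
         tunit = 0,
         assoc = \<lambda>k m n. Id (lawvere T) (k + m + n),
         lunit = Id (lawvere T),
         runit = Id (lawvere T),
         symm = \<lambda>m n. d_arr T (symm (fsum aleph0) m n)\<rparr>,
      nabla = \<lambda>n. d_arr T (nabla aleph0 n),
      cobang = \<lambda>n. d_arr T (cobang aleph0 n)\<rparr>"

definition d_morphism :: "'f alg_theory \<Rightarrow> (nat, nat \<times> nat list, nat, nat \<times> 'f trm set list) mfun" where
  "d_morphism T =
     \<lparr>omap = \<lambda>n. n, amap = d_arr T, mu = \<lambda>m n. Id (lawvere T) (m + n), eps = Id (lawvere T) 0\<rparr>"

text \<open>The operation \<open>f\<close> as an arrow \<open>arity f \<rightarrow> 1\<close> of \<open>lawvere T\<close>.\<close>

definition op_arrow :: "'f alg_theory \<Rightarrow> 'f \<Rightarrow> nat \<times> 'f trm set list" where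
  "op_arrow T f = (arity T f, [trm_class T (arity T f) (Fn f (map Var [0..<arity T f]))])"

section \<open>Rig categories\<close>

record ('o, 'a) rig =
  rcat :: "('o, 'a) cat"
  rsum :: "('o, 'a) tensor"
  rprod :: "('o, 'a) tensor"
  distl :: "'o \<Rightarrow> 'o \<Rightarrow> 'o \<Rightarrow> 'a"
  distr :: "'o \<Rightarrow> 'o \<Rightarrow> 'o \<Rightarrow> 'a"
  annl :: "'o \<Rightarrow> 'a"
  annr :: "'o \<Rightarrow> 'a"

locale rig_syntax =
  fixes R :: "('o, 'a, 'z) rig_scheme"
begin

abbreviation Seq (infixl "\<Zsemi>" 55) where "f \<Zsemi> g \<equiv> Comp (rcat R) f g"
abbreviation sum_obj (infixr "\<oplus>" 65) where "X \<oplus> Y \<equiv> tob (rsum R) X Y"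
abbreviation sum_arr (infixr "\<oplus>\<^sub>a" 65) where "f \<oplus>\<^sub>a g \<equiv> tar (rsum R) f g"
abbreviation prod_obj (infixr "\<otimes>" 70) where "X \<otimes> Y \<equiv> tob (rprod R) X Y"
abbreviation prod_arr (infixr "\<otimes>\<^sub>a" 70) where "f \<otimes>\<^sub>a g \<equiv> tar (rprod R) f g"
abbreviation zero_obj ("\<zero>") where "\<zero> \<equiv> tunit (rsum R)"
abbreviation one_obj ("\<one>") where "\<one> \<equiv> tunit (rprod R)"
abbreviation "\<iota> \<equiv> Id (rcat R)"
abbreviation "Ob \<equiv> Obj (rcat R)"
abbreviation "hom \<equiv> Hom (rcat R)"
abbreviation "\<alpha>\<^sub>s \<equiv> assoc (rsum R)"
abbreviation "l\<^sub>s \<equiv> lunit (rsum R)"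
abbreviation "r\<^sub>s \<equiv> runit (rsum R)"
abbreviation "\<sigma>\<^sub>s \<equiv> symm (rsum R)"
abbreviation "\<alpha>\<^sub>p \<equiv> assoc (rprod R)"
abbreviation "l\<^sub>p \<equiv> lunit (rprod R)"
abbreviation "r\<^sub>p \<equiv> runit (rprod R)"
abbreviation "\<sigma>\<^sub>p \<equiv> symm (rprod R)"
abbreviation "\<delta>\<^sub>l \<equiv> distl R"
abbreviation "\<delta>\<^sub>r \<equiv> distr R"
abbreviation "l\<^sub>0 \<equiv> annl R"
abbreviation "r\<^sub>0 \<equiv> annr R"
abbreviation "mid4\<^sub>s \<equiv> monoidal_syntax.mid4 (rcat R) (rsum R)"

end

text \<open>The assumptions \<open>laplaza_1\<close>, \<dots>, \<open>laplaza_24\<close> are the 24 coherence conditions I--XXIV of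
  Laplaza's ``Coherence for distributivity''.\<close>

locale rig_category = rig_syntax R
  for R :: "('o, 'a, 'z) rig_scheme" +
  assumes sum_symmetric_monoidal: "symmetric_monoidal (rcat R) (rsum R)"
    and prod_symmetric_monoidal: "symmetric_monoidal (rcat R) (rprod R)"
    and distl_in_Hom: "X \<in> Ob \<Longrightarrow> Y \<in> Ob \<Longrightarrow> Z \<in> Ob \<Longrightarrow>
      \<delta>\<^sub>l X Y Z \<in> hom (X \<otimes> (Y \<oplus> Z)) ((X \<otimes> Y) \<oplus> (X \<otimes> Z))"
    and distl_iso: "X \<in> Ob \<Longrightarrow> Y \<in> Ob \<Longrightarrow> Z \<in> Ob \<Longrightarrow> is_iso (rcat R) (\<delta>\<^sub>l X Y Z)"
    and distl_natural: "f \<in> hom X X' \<Longrightarrow> g \<in> hom Y Y' \<Longrightarrow> h \<in> hom Z Z' \<Longrightarrow>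
      (f \<otimes>\<^sub>a (g \<oplus>\<^sub>a h)) \<Zsemi> \<delta>\<^sub>l X' Y' Z' = \<delta>\<^sub>l X Y Z \<Zsemi> ((f \<otimes>\<^sub>a g) \<oplus>\<^sub>a (f \<otimes>\<^sub>a h))"
    and distr_in_Hom: "X \<in> Ob \<Longrightarrow> Y \<in> Ob \<Longrightarrow> Z \<in> Ob \<Longrightarrow>
      \<delta>\<^sub>r X Y Z \<in> hom ((X \<oplus> Y) \<otimes> Z) ((X \<otimes> Z) \<oplus> (Y \<otimes> Z))"
    and distr_iso: "X \<in> Ob \<Longrightarrow> Y \<in> Ob \<Longrightarrow> Z \<in> Ob \<Longrightarrow> is_iso (rcat R) (\<delta>\<^sub>r X Y Z)"
    and distr_natural: "f \<in> hom X X' \<Longrightarrow> g \<in> hom Y Y' \<Longrightarrow> h \<in> hom Z Z' \<Longrightarrow>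
      ((f \<oplus>\<^sub>a g) \<otimes>\<^sub>a h) \<Zsemi> \<delta>\<^sub>r X' Y' Z' = \<delta>\<^sub>r X Y Z \<Zsemi> ((f \<otimes>\<^sub>a h) \<oplus>\<^sub>a (g \<otimes>\<^sub>a h))"
    and annl_in_Hom: "X \<in> Ob \<Longrightarrow> l\<^sub>0 X \<in> hom (\<zero> \<otimes> X) \<zero>"
    and annl_iso: "X \<in> Ob \<Longrightarrow> is_iso (rcat R) (l\<^sub>0 X)"
    and annl_natural: "f \<in> hom X X' \<Longrightarrow> (\<iota> \<zero> \<otimes>\<^sub>a f) \<Zsemi> l\<^sub>0 X' = l\<^sub>0 X"
    and annr_in_Hom: "X \<in> Ob \<Longrightarrow> r\<^sub>0 X \<in> hom (X \<otimes> \<zero>) \<zero>"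
    and annr_iso: "X \<in> Ob \<Longrightarrow> is_iso (rcat R) (r\<^sub>0 X)"
    and annr_natural: "f \<in> hom X X' \<Longrightarrow> (f \<otimes>\<^sub>a \<iota> \<zero>) \<Zsemi> r\<^sub>0 X' = r\<^sub>0 X"
    and laplaza_1: "X \<in> Ob \<Longrightarrow> Y \<in> Ob \<Longrightarrow> Z \<in> Ob \<Longrightarrow>
      (\<iota> X \<otimes>\<^sub>a \<sigma>\<^sub>s Y Z) \<Zsemi> \<delta>\<^sub>l X Z Y = \<delta>\<^sub>l X Y Z \<Zsemi> \<sigma>\<^sub>s (X \<otimes> Y) (X \<otimes> Z)"
    and laplaza_2: "X \<in> Ob \<Longrightarrow> Y \<in> Ob \<Longrightarrow> Z \<in> Ob \<Longrightarrow>
      \<sigma>\<^sub>p (X \<oplus> Y) Z \<Zsemi> \<delta>\<^sub>l Z X Y = \<delta>\<^sub>r X Y Z \<Zsemi> (\<sigma>\<^sub>p X Z \<oplus>\<^sub>a \<sigma>\<^sub>p Y Z)"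
    and laplaza_3: "X \<in> Ob \<Longrightarrow> Y \<in> Ob \<Longrightarrow> Z \<in> Ob \<Longrightarrow>
      (\<sigma>\<^sub>s X Y \<otimes>\<^sub>a \<iota> Z) \<Zsemi> \<delta>\<^sub>r Y X Z = \<delta>\<^sub>r X Y Z \<Zsemi> \<sigma>\<^sub>s (X \<otimes> Z) (Y \<otimes> Z)"
    and laplaza_4: "W \<in> Ob \<Longrightarrow> X \<in> Ob \<Longrightarrow> Y \<in> Ob \<Longrightarrow> Z \<in> Ob \<Longrightarrow>
      (\<alpha>\<^sub>s W X Y \<otimes>\<^sub>a \<iota> Z) \<Zsemi> \<delta>\<^sub>r W (X \<oplus> Y) Z \<Zsemi> (\<iota> (W \<otimes> Z) \<oplus>\<^sub>a \<delta>\<^sub>r X Y Z) =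
      \<delta>\<^sub>r (W \<oplus> X) Y Z \<Zsemi> (\<delta>\<^sub>r W X Z \<oplus>\<^sub>a \<iota> (Y \<otimes> Z)) \<Zsemi> \<alpha>\<^sub>s (W \<otimes> Z) (X \<otimes> Z) (Y \<otimes> Z)"
    and laplaza_5: "W \<in> Ob \<Longrightarrow> X \<in> Ob \<Longrightarrow> Y \<in> Ob \<Longrightarrow> Z \<in> Ob \<Longrightarrow>
      (\<iota> W \<otimes>\<^sub>a \<alpha>\<^sub>s X Y Z) \<Zsemi> \<delta>\<^sub>l W X (Y \<oplus> Z) \<Zsemi> (\<iota> (W \<otimes> X) \<oplus>\<^sub>a \<delta>\<^sub>l W Y Z) =
      \<delta>\<^sub>l W (X \<oplus> Y) Z \<Zsemi> (\<delta>\<^sub>l W X Y \<oplus>\<^sub>a \<iota> (W \<otimes> Z)) \<Zsemi> \<alpha>\<^sub>s (W \<otimes> X) (W \<otimes> Y) (W \<otimes> Z)"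
    and laplaza_6: "W \<in> Ob \<Longrightarrow> X \<in> Ob \<Longrightarrow> Y \<in> Ob \<Longrightarrow> Z \<in> Ob \<Longrightarrow>
      \<alpha>\<^sub>p W X (Y \<oplus> Z) \<Zsemi> (\<iota> W \<otimes>\<^sub>a \<delta>\<^sub>l X Y Z) \<Zsemi> \<delta>\<^sub>l W (X \<otimes> Y) (X \<otimes> Z) =
      \<delta>\<^sub>l (W \<otimes> X) Y Z \<Zsemi> (\<alpha>\<^sub>p W X Y \<oplus>\<^sub>a \<alpha>\<^sub>p W X Z)"
    and laplaza_7: "W \<in> Ob \<Longrightarrow> X \<in> Ob \<Longrightarrow> Y \<in> Ob \<Longrightarrow> Z \<in> Ob \<Longrightarrow>
      \<alpha>\<^sub>p (W \<oplus> X) Y Z \<Zsemi> \<delta>\<^sub>r W X (Y \<otimes> Z) =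
      (\<delta>\<^sub>r W X Y \<otimes>\<^sub>a \<iota> Z) \<Zsemi> \<delta>\<^sub>r (W \<otimes> Y) (X \<otimes> Y) Z \<Zsemi> (\<alpha>\<^sub>p W Y Z \<oplus>\<^sub>a \<alpha>\<^sub>p X Y Z)"
    and laplaza_8: "W \<in> Ob \<Longrightarrow> X \<in> Ob \<Longrightarrow> Y \<in> Ob \<Longrightarrow> Z \<in> Ob \<Longrightarrow>
      \<alpha>\<^sub>p W (X \<oplus> Y) Z \<Zsemi> (\<iota> W \<otimes>\<^sub>a \<delta>\<^sub>r X Y Z) \<Zsemi> \<delta>\<^sub>l W (X \<otimes> Z) (Y \<otimes> Z) =
      (\<delta>\<^sub>l W X Y \<otimes>\<^sub>a \<iota> Z) \<Zsemi> \<delta>\<^sub>r (W \<otimes> X) (W \<otimes> Y) Z \<Zsemi> (\<alpha>\<^sub>p W X Z \<oplus>\<^sub>a \<alpha>\<^sub>p W Y Z)"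
    and laplaza_9: "W \<in> Ob \<Longrightarrow> X \<in> Ob \<Longrightarrow> Y \<in> Ob \<Longrightarrow> Z \<in> Ob \<Longrightarrow>
      \<delta>\<^sub>l (W \<oplus> X) Y Z \<Zsemi> (\<delta>\<^sub>r W X Y \<oplus>\<^sub>a \<delta>\<^sub>r W X Z) \<Zsemi> mid4\<^sub>s (W \<otimes> Y) (X \<otimes> Y) (W \<otimes> Z) (X \<otimes> Z) =
      \<delta>\<^sub>r W X (Y \<oplus> Z) \<Zsemi> (\<delta>\<^sub>l W Y Z \<oplus>\<^sub>a \<delta>\<^sub>l X Y Z)"
    and laplaza_10: "l\<^sub>0 \<zero> = r\<^sub>0 \<zero>"
    and laplaza_11: "X \<in> Ob \<Longrightarrow> Y \<in> Ob \<Longrightarrow> \<delta>\<^sub>l \<zero> X Y \<Zsemi> (l\<^sub>0 X \<oplus>\<^sub>a l\<^sub>0 Y) \<Zsemi> l\<^sub>s \<zero> = l\<^sub>0 (X \<oplus> Y)"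
    and laplaza_12: "X \<in> Ob \<Longrightarrow> Y \<in> Ob \<Longrightarrow> \<delta>\<^sub>r X Y \<zero> \<Zsemi> (r\<^sub>0 X \<oplus>\<^sub>a r\<^sub>0 Y) \<Zsemi> l\<^sub>s \<zero> = r\<^sub>0 (X \<oplus> Y)"
    and laplaza_13: "r\<^sub>0 \<one> = l\<^sub>p \<zero>"
    and laplaza_14: "l\<^sub>0 \<one> = r\<^sub>p \<zero>"
    and laplaza_15: "X \<in> Ob \<Longrightarrow> \<sigma>\<^sub>p X \<zero> \<Zsemi> l\<^sub>0 X = r\<^sub>0 X"
    and laplaza_16: "X \<in> Ob \<Longrightarrow> Y \<in> Ob \<Longrightarrow> \<alpha>\<^sub>p \<zero> X Y \<Zsemi> l\<^sub>0 (X \<otimes> Y) = (l\<^sub>0 X \<otimes>\<^sub>a \<iota> Y) \<Zsemi> l\<^sub>0 Y"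
    and laplaza_17: "X \<in> Ob \<Longrightarrow> Y \<in> Ob \<Longrightarrow>
      \<alpha>\<^sub>p X \<zero> Y \<Zsemi> (\<iota> X \<otimes>\<^sub>a l\<^sub>0 Y) \<Zsemi> r\<^sub>0 X = (r\<^sub>0 X \<otimes>\<^sub>a \<iota> Y) \<Zsemi> l\<^sub>0 Y"
    and laplaza_18: "X \<in> Ob \<Longrightarrow> Y \<in> Ob \<Longrightarrow> \<alpha>\<^sub>p X Y \<zero> \<Zsemi> (\<iota> X \<otimes>\<^sub>a r\<^sub>0 Y) \<Zsemi> r\<^sub>0 X = r\<^sub>0 (X \<otimes> Y)"
    and laplaza_19: "X \<in> Ob \<Longrightarrow> Y \<in> Ob \<Longrightarrow>
      \<delta>\<^sub>l X \<zero> Y \<Zsemi> (r\<^sub>0 X \<oplus>\<^sub>a \<iota> (X \<otimes> Y)) \<Zsemi> l\<^sub>s (X \<otimes> Y) = \<iota> X \<otimes>\<^sub>a l\<^sub>s Y"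
    and laplaza_20: "X \<in> Ob \<Longrightarrow> Y \<in> Ob \<Longrightarrow>
      \<delta>\<^sub>r \<zero> Y X \<Zsemi> (l\<^sub>0 X \<oplus>\<^sub>a \<iota> (Y \<otimes> X)) \<Zsemi> l\<^sub>s (Y \<otimes> X) = l\<^sub>s Y \<otimes>\<^sub>a \<iota> X"
    and laplaza_21: "X \<in> Ob \<Longrightarrow> Y \<in> Ob \<Longrightarrow>
      \<delta>\<^sub>l X Y \<zero> \<Zsemi> (\<iota> (X \<otimes> Y) \<oplus>\<^sub>a r\<^sub>0 X) \<Zsemi> r\<^sub>s (X \<otimes> Y) = \<iota> X \<otimes>\<^sub>a r\<^sub>s Y"
    and laplaza_22: "X \<in> Ob \<Longrightarrow> Y \<in> Ob \<Longrightarrow>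
      \<delta>\<^sub>r Y \<zero> X \<Zsemi> (\<iota> (Y \<otimes> X) \<oplus>\<^sub>a l\<^sub>0 X) \<Zsemi> r\<^sub>s (Y \<otimes> X) = r\<^sub>s Y \<otimes>\<^sub>a \<iota> X"
    and laplaza_23: "X \<in> Ob \<Longrightarrow> Y \<in> Ob \<Longrightarrow> \<delta>\<^sub>l \<one> X Y \<Zsemi> (l\<^sub>p X \<oplus>\<^sub>a l\<^sub>p Y) = l\<^sub>p (X \<oplus> Y)"
    and laplaza_24: "X \<in> Ob \<Longrightarrow> Y \<in> Ob \<Longrightarrow> \<delta>\<^sub>r X Y \<one> \<Zsemi> (r\<^sub>p X \<oplus>\<^sub>a r\<^sub>p Y) = r\<^sub>p (X \<oplus> Y)"

definition right_strict_rig :: "('o, 'a, 'z) rig_scheme \<Rightarrow> bool" where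
  "right_strict_rig R \<longleftrightarrow> rig_category R \<and>
     strict_tensor (rcat R) (rsum R) \<and> strict_tensor (rcat R) (rprod R) \<and>
     (\<forall>X \<in> Obj (rcat R). is_identity (rcat R) (annl R X) \<and> is_identity (rcat R) (annr R X)) \<and>
     (\<forall>X \<in> Obj (rcat R). \<forall>Y \<in> Obj (rcat R). \<forall>Z \<in> Obj (rcat R). is_identity (rcat R) (distr R X Y Z))"

text \<open>Rig functors: strong symmetric monoidal for both structures and compatible with the
  distributors and annihilators.\<close>

record ('o, 'a, 'p, 'b) rig_fun =
  robj :: "'o \<Rightarrow> 'p"
  rarr :: "'a \<Rightarrow> 'b"
  mu_sum :: "'o \<Rightarrow> 'o \<Rightarrow> 'b"
  eps_sum :: "'b"
  mu_prod :: "'o \<Rightarrow> 'o \<Rightarrow> 'b"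
  eps_prod :: "'b"

definition sum_fun :: "('o, 'a, 'p, 'b) rig_fun \<Rightarrow> ('o, 'a, 'p, 'b) mfun" where
  "sum_fun F = \<lparr>omap = robj F, amap = rarr F, mu = mu_sum F, eps = eps_sum F\<rparr>"

definition prod_fun :: "('o, 'a, 'p, 'b) rig_fun \<Rightarrow> ('o, 'a, 'p, 'b) mfun" where
  "prod_fun F = \<lparr>omap = robj F, amap = rarr F, mu = mu_prod F, eps = eps_prod F\<rparr>"

locale rig_functor = rig_syntax R
  for Q :: "('p, 'b, 'y) rig_scheme" and R :: "('o, 'a, 'z) rig_scheme"
    and F :: "('p, 'b, 'o, 'a) rig_fun" +
  assumes sum_functor:
      "strong_symmetric_monoidal_functor (rcat Q) (rsum Q) (rcat R) (rsum R) (sum_fun F)"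
    and prod_functor:
      "strong_symmetric_monoidal_functor (rcat Q) (rprod Q) (rcat R) (rprod R) (prod_fun F)"
    and preserves_distl: "X \<in> Obj (rcat Q) \<Longrightarrow> Y \<in> Obj (rcat Q) \<Longrightarrow> Z \<in> Obj (rcat Q) \<Longrightarrow>
      (\<iota> (robj F X) \<otimes>\<^sub>a mu_sum F Y Z) \<Zsemi> mu_prod F X (tob (rsum Q) Y Z) \<Zsemi> rarr F (distl Q X Y Z) =
      \<delta>\<^sub>l (robj F X) (robj F Y) (robj F Z) \<Zsemi> (mu_prod F X Y \<oplus>\<^sub>a mu_prod F X Z)
        \<Zsemi> mu_sum F (tob (rprod Q) X Y) (tob (rprod Q) X Z)"
    and preserves_distr: "X \<in> Obj (rcat Q) \<Longrightarrow> Y \<in> Obj (rcat Q) \<Longrightarrow> Z \<in> Obj (rcat Q) \<Longrightarrow>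
      (mu_sum F X Y \<otimes>\<^sub>a \<iota> (robj F Z)) \<Zsemi> mu_prod F (tob (rsum Q) X Y) Z \<Zsemi> rarr F (distr Q X Y Z) =
      \<delta>\<^sub>r (robj F X) (robj F Y) (robj F Z) \<Zsemi> (mu_prod F X Z \<oplus>\<^sub>a mu_prod F Y Z)
        \<Zsemi> mu_sum F (tob (rprod Q) X Z) (tob (rprod Q) Y Z)"
    and preserves_annl: "X \<in> Obj (rcat Q) \<Longrightarrow>
      (eps_sum F \<otimes>\<^sub>a \<iota> (robj F X)) \<Zsemi> mu_prod F (tunit (rsum Q)) X \<Zsemi> rarr F (annl Q X) =
      l\<^sub>0 (robj F X) \<Zsemi> eps_sum F"
    and preserves_annr: "X \<in> Obj (rcat Q) \<Longrightarrow>
      (\<iota> (robj F X) \<otimes>\<^sub>a eps_sum F) \<Zsemi> mu_prod F X (tunit (rsum Q)) \<Zsemi> rarr F (annr Q X) =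
      r\<^sub>0 (robj F X) \<Zsemi> eps_sum F"

definition strict_rig_fun ::
  "('o, 'a, 'y) rig_scheme \<Rightarrow> ('p, 'b, 'z) rig_scheme \<Rightarrow> ('o, 'a, 'p, 'b) rig_fun \<Rightarrow> bool" where
  "strict_rig_fun C D F \<longleftrightarrow>
     (\<forall>X \<in> Obj (rcat C). \<forall>Y \<in> Obj (rcat C).
        is_identity (rcat D) (mu_sum F X Y) \<and> is_identity (rcat D) (mu_prod F X Y)) \<and>
     is_identity (rcat D) (eps_sum F) \<and> is_identity (rcat D) (eps_prod F)"

definition rig_fun_eq ::
  "('o, 'a, 'y) rig_scheme \<Rightarrow> ('o, 'a, 'p, 'b) rig_fun \<Rightarrow> ('o, 'a, 'p, 'b) rig_fun \<Rightarrow> bool" where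
  "rig_fun_eq C F G \<longleftrightarrow>
     mfun_eq (rcat C) (sum_fun F) (sum_fun G) \<and> mfun_eq (rcat C) (prod_fun F) (prod_fun G)"

section \<open>Rig categories over an algebraic theory\<close>

record ('o, 'a) fc_rig = "('o, 'a) rig" +
  rnabla :: "'o \<Rightarrow> 'a"
  rcobang :: "'o \<Rightarrow> 'a"

definition sum_fc :: "('o, 'a, 'z) fc_rig_scheme \<Rightarrow> ('o, 'a) fc" where
  "sum_fc R = \<lparr>fcat = rcat R, fsum = rsum R, nabla = rnabla R, cobang = rcobang R\<rparr>"

definition fc_rig_category :: "('o, 'a, 'z) fc_rig_scheme \<Rightarrow> bool" where
  "fc_rig_category R \<longleftrightarrow> rig_category R \<and> fc_category (rcat R) (rsum R) (rnabla R) (rcobang R)"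

record ('o, 'a, 'f) theory_rig = "('o, 'a) fc_rig" +
  incl :: "(nat, nat \<times> 'f trm set list, 'o, 'a) mfun"

definition theory_rig_category :: "'f alg_theory \<Rightarrow> ('o, 'a, 'f) theory_rig \<Rightarrow> bool" where
  "theory_rig_category T R \<longleftrightarrow> fc_rig_category R \<and>
     fc_morphism (lawvere_op T) (sum_fc R) (incl R) \<and>
     mfun_eq aleph0_cat (mfun_comp (rcat R) (d_morphism T) (incl R))
       (canonical_fc.canonical (rcat R) (rsum R) (rnabla R) (rcobang R) (tunit (rprod R)))"

definition theory_rig_morphism ::
  "'f alg_theory \<Rightarrow> ('o, 'a, 'f) theory_rig \<Rightarrow> ('p, 'b, 'f) theory_rig \<Rightarrow>
   ('o, 'a, 'p, 'b) rig_fun \<Rightarrow> bool" where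
  "theory_rig_morphism T C D F \<longleftrightarrow> rig_functor C D F \<and>
     fc_morphism (sum_fc C) (sum_fc D) (sum_fun F) \<and>
     mfun_eq (fcat (lawvere_op T)) (mfun_comp (rcat D) (incl C) (sum_fun F)) (incl D)"

text \<open>A discrete category is given by its set of objects, and a functor out of it by its action
  on objects.\<close>

record ('m, 'o, 'a, 'f) sesqui =
  base :: "'m set"
  bmap :: "'m \<Rightarrow> 'o"
  srig :: "('o, 'a, 'f) theory_rig"

definition sesquistrict_rig_category :: "('m, 'o, 'a, 'f) sesqui \<Rightarrow> bool" where
  "sesquistrict_rig_category H \<longleftrightarrow> right_strict_rig (srig H) \<and>
     (\<forall>A \<in> base H. bmap H A \<in> Obj (rcat (srig H))) \<and>
     (\<forall>A \<in> base H. \<forall>X \<in> Obj (rcat (srig H)). \<forall>Y \<in> Obj (rcat (srig H)).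
        is_identity (rcat (srig H)) (distl (srig H) (bmap H A) X Y))"

definition sesquistrict_rig_functor ::
  "('m, 'o, 'a, 'f) sesqui \<Rightarrow> ('n, 'p, 'b, 'f) sesqui \<Rightarrow> ('m \<Rightarrow> 'n) \<Rightarrow> ('o, 'a, 'p, 'b) rig_fun \<Rightarrow> bool"
  where
  "sesquistrict_rig_functor H H' \<alpha> \<beta> \<longleftrightarrow>
     (\<forall>A \<in> base H. \<alpha> A \<in> base H') \<and>
     rig_functor (srig H) (srig H') \<beta> \<and> strict_rig_fun (srig H) (srig H') \<beta> \<and>
     (\<forall>A \<in> base H. bmap H' (\<alpha> A) = robj \<beta> (bmap H A))"

definition sesquistrict_theory_rig_category ::
  "'f alg_theory \<Rightarrow> ('m, 'o, 'a, 'f) sesqui \<Rightarrow> bool" where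
  "sesquistrict_theory_rig_category T H \<longleftrightarrow>
     sesquistrict_rig_category H \<and> theory_rig_category T (srig H)"

definition sesquistrict_theory_rig_morphism ::
  "'f alg_theory \<Rightarrow> ('m, 'o, 'a, 'f) sesqui \<Rightarrow> ('n, 'p, 'b, 'f) sesqui \<Rightarrow>
   ('m \<Rightarrow> 'n) \<Rightarrow> ('o, 'a, 'p, 'b) rig_fun \<Rightarrow> bool" where
  "sesquistrict_theory_rig_morphism T H H' \<alpha> \<beta> \<longleftrightarrow>
     sesquistrict_rig_functor H H' \<alpha> \<beta> \<and> theory_rig_morphism T (srig H) (srig H') \<beta>"

section \<open>Monoidal signatures and freeness\<close>

record ('s, 'g) monsig =
  sorts :: "'s set"
  gens :: "'g set"
  ar :: "'g \<Rightarrow> 's list"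
  coar :: "'g \<Rightarrow> 's list"

definition monoidal_signature :: "('s, 'g) monsig \<Rightarrow> bool" where
  "monoidal_signature \<Gamma> \<longleftrightarrow> (\<forall>s \<in> gens \<Gamma>. ar \<Gamma> s \<in> lists (sorts \<Gamma>) \<and> coar \<Gamma> s \<in> lists (sorts \<Gamma>))"

definition word_ext :: "('m, 'o, 'a, 'f) sesqui \<Rightarrow> ('s \<Rightarrow> 'm) \<Rightarrow> 's list \<Rightarrow> 'o" where
  "word_ext H aS w =
     foldr (\<lambda>A X. tob (rprod (srig H)) (bmap H (aS A)) X) w (tunit (rprod (srig H)))"

definition is_interpretation ::
  "('s, 'g) monsig \<Rightarrow> ('m, 'o, 'a, 'f) sesqui \<Rightarrow> ('s \<Rightarrow> 'm) \<Rightarrow> ('g \<Rightarrow> 'a) \<Rightarrow> bool" where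
  "is_interpretation \<Gamma> H aS aG \<longleftrightarrow>
     (\<forall>A \<in> sorts \<Gamma>. aS A \<in> base H) \<and>
     (\<forall>s \<in> gens \<Gamma>. aG s \<in> Hom (rcat (srig H)) (word_ext H aS (ar \<Gamma> s)) (word_ext H aS (coar \<Gamma> s)))"

text \<open>The first argument fixes the types in which the competing structures \<open>H'\<close> live; a statement
  with those types left as type variables ranges over all of them. Morphisms are compared on the
  objects and arrows of their source only.\<close>

definition freely_generated ::
  "('n \<times> 'p \<times> 'b) itself \<Rightarrow> 'f alg_theory \<Rightarrow> ('s, 'g) monsig \<Rightarrow> ('m, 'o, 'a, 'f) sesqui \<Rightarrow>
   ('s \<Rightarrow> 'm) \<Rightarrow> ('g \<Rightarrow> 'a) \<Rightarrow> bool" where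
  "freely_generated _ T \<Gamma> H aS aG \<longleftrightarrow>
     sesquistrict_theory_rig_category T H \<and> is_interpretation \<Gamma> H aS aG \<and>
     (\<forall>(H' :: ('n, 'p, 'b, 'f) sesqui) aS' aG'.
        sesquistrict_theory_rig_category T H' \<and> is_interpretation \<Gamma> H' aS' aG' \<longrightarrow>
        (let extends = \<lambda>\<alpha> \<beta>. sesquistrict_theory_rig_morphism T H H' \<alpha> \<beta> \<and>
               (\<forall>A \<in> sorts \<Gamma>. \<alpha> (aS A) = aS' A) \<and> (\<forall>s \<in> gens \<Gamma>. rarr \<beta> (aG s) = aG' s)
         in (\<exists>\<alpha> \<beta>. extends \<alpha> \<beta> \<and>
              (\<forall>\<alpha>' \<beta>'. extends \<alpha>' \<beta>' \<longrightarrow>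
                 (\<forall>A \<in> base H. \<alpha>' A = \<alpha> A) \<and> rig_fun_eq (srig H) \<beta>' \<beta>))))"

section \<open>Circuits\<close>

datatype ('s, 'g) circ =
  CId 's
| CUnit
| CGen 'g
| CSym 's 's
| CSeq "('s, 'g) circ" "('s, 'g) circ"
| CPar "('s, 'g) circ" "('s, 'g) circ"

primrec cdom :: "('s, 'g) monsig \<Rightarrow> ('s, 'g) circ \<Rightarrow> 's list" where
  "cdom \<Gamma> (CId A) = [A]"
| "cdom \<Gamma> CUnit = []"
| "cdom \<Gamma> (CGen s) = ar \<Gamma> s"
| "cdom \<Gamma> (CSym A B) = [A, B]"
| "cdom \<Gamma> (CSeq c d) = cdom \<Gamma> c"
| "cdom \<Gamma> (CPar c d) = cdom \<Gamma> c @ cdom \<Gamma> d"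

primrec ccod :: "('s, 'g) monsig \<Rightarrow> ('s, 'g) circ \<Rightarrow> 's list" where
  "ccod \<Gamma> (CId A) = [A]"
| "ccod \<Gamma> CUnit = []"
| "ccod \<Gamma> (CGen s) = coar \<Gamma> s"
| "ccod \<Gamma> (CSym A B) = [B, A]"
| "ccod \<Gamma> (CSeq c d) = ccod \<Gamma> d"
| "ccod \<Gamma> (CPar c d) = ccod \<Gamma> c @ ccod \<Gamma> d"

primrec wt_circ :: "('s, 'g) monsig \<Rightarrow> ('s, 'g) circ \<Rightarrow> bool" where
  "wt_circ \<Gamma> (CId A) \<longleftrightarrow> A \<in> sorts \<Gamma>"
| "wt_circ \<Gamma> CUnit \<longleftrightarrow> True"
| "wt_circ \<Gamma> (CGen s) \<longleftrightarrow> s \<in> gens \<Gamma>"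
| "wt_circ \<Gamma> (CSym A B) \<longleftrightarrow> A \<in> sorts \<Gamma> \<and> B \<in> sorts \<Gamma>"
| "wt_circ \<Gamma> (CSeq c d) \<longleftrightarrow> wt_circ \<Gamma> c \<and> wt_circ \<Gamma> d \<and> ccod \<Gamma> c = cdom \<Gamma> d"
| "wt_circ \<Gamma> (CPar c d) \<longleftrightarrow> wt_circ \<Gamma> c \<and> wt_circ \<Gamma> d"

definition cid :: "'s list \<Rightarrow> ('s, 'g) circ" where
  "cid U = foldr (\<lambda>A c. CPar (CId A) c) U CUnit"

text \<open>\<open>csym1 A V : A V \<rightarrow> V A\<close> and \<open>csym U V : U V \<rightarrow> V U\<close>.\<close>

primrec csym1 :: "'s \<Rightarrow> 's list \<Rightarrow> ('s, 'g) circ" where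
  "csym1 A [] = CId A"
| "csym1 A (B # V) = CSeq (CPar (CSym A B) (cid V)) (CPar (CId B) (csym1 A V))"

primrec csym :: "'s list \<Rightarrow> 's list \<Rightarrow> ('s, 'g) circ" where
  "csym [] V = cid V"
| "csym (A # U) V = CSeq (CPar (CId A) (csym U V)) (CPar (csym1 A V) (cid U))"

text \<open>Equality of circuits modulo the axioms of strict symmetric monoidal categories.\<close>

inductive circ_eq :: "('s, 'g) monsig \<Rightarrow> ('s, 'g) circ \<Rightarrow> ('s, 'g) circ \<Rightarrow> bool" for \<Gamma> where
  refl: "wt_circ \<Gamma> c \<Longrightarrow> circ_eq \<Gamma> c c"
| sym: "circ_eq \<Gamma> c d \<Longrightarrow> circ_eq \<Gamma> d c"
| trans: "circ_eq \<Gamma> c d \<Longrightarrow> circ_eq \<Gamma> d e \<Longrightarrow> circ_eq \<Gamma> c e"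
| seq_cong: "circ_eq \<Gamma> c c' \<Longrightarrow> circ_eq \<Gamma> d d' \<Longrightarrow> ccod \<Gamma> c = cdom \<Gamma> d \<Longrightarrow>
    circ_eq \<Gamma> (CSeq c d) (CSeq c' d')"
| par_cong: "circ_eq \<Gamma> c c' \<Longrightarrow> circ_eq \<Gamma> d d' \<Longrightarrow> circ_eq \<Gamma> (CPar c d) (CPar c' d')"
| seq_assoc: "wt_circ \<Gamma> (CSeq (CSeq c d) e) \<Longrightarrow>
    circ_eq \<Gamma> (CSeq (CSeq c d) e) (CSeq c (CSeq d e))"
| id_seq: "wt_circ \<Gamma> c \<Longrightarrow> circ_eq \<Gamma> (CSeq (cid (cdom \<Gamma> c)) c) c"
| seq_id: "wt_circ \<Gamma> c \<Longrightarrow> circ_eq \<Gamma> (CSeq c (cid (ccod \<Gamma> c))) c"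
| par_assoc: "wt_circ \<Gamma> c \<Longrightarrow> wt_circ \<Gamma> d \<Longrightarrow> wt_circ \<Gamma> e \<Longrightarrow>
    circ_eq \<Gamma> (CPar (CPar c d) e) (CPar c (CPar d e))"
| unit_par: "wt_circ \<Gamma> c \<Longrightarrow> circ_eq \<Gamma> (CPar CUnit c) c"
| par_unit: "wt_circ \<Gamma> c \<Longrightarrow> circ_eq \<Gamma> (CPar c CUnit) c"
| interchange: "wt_circ \<Gamma> (CSeq c d) \<Longrightarrow> wt_circ \<Gamma> (CSeq c' d') \<Longrightarrow>
    circ_eq \<Gamma> (CSeq (CPar c c') (CPar d d')) (CPar (CSeq c d) (CSeq c' d'))"
| sym_sym: "A \<in> sorts \<Gamma> \<Longrightarrow> B \<in> sorts \<Gamma> \<Longrightarrow>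
    circ_eq \<Gamma> (CSeq (CSym A B) (CSym B A)) (cid [A, B])"
| sym_natural: "wt_circ \<Gamma> c \<Longrightarrow> wt_circ \<Gamma> d \<Longrightarrow>
    circ_eq \<Gamma> (CSeq (CPar c d) (csym (ccod \<Gamma> c) (ccod \<Gamma> d)))
      (CSeq (csym (cdom \<Gamma> c) (cdom \<Gamma> d)) (CPar d c))"

section \<open>Tapes\<close>

type_synonym 's poly = "'s list list"

text \<open>Words are monomials and words of words are polynomials; the product of polynomials lists the
  products of monomials in lexicographic order.\<close>

definition poly_prod :: "'s poly \<Rightarrow> 's poly \<Rightarrow> 's poly" where
  "poly_prod P Q = concat (map (\<lambda>U. map (\<lambda>V. U @ V) Q) P)"

datatype ('s, 'g, 'f) tape =
  TId "'s list"
| TZero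
| TCirc "('s, 'g) circ"
| TSym "'s list" "'s list"
| TSeq "('s, 'g, 'f) tape" "('s, 'g, 'f) tape"
| TPar "('s, 'g, 'f) tape" "('s, 'g, 'f) tape"
| TCobang "'s list"
| TNabla "'s list"
| TOp 'f "'s list"

primrec tid :: "'s poly \<Rightarrow> ('s, 'g, 'f) tape" where
  "tid [] = TZero"
| "tid (U # P) = TPar (TId U) (tid P)"

primrec tcobang :: "'s poly \<Rightarrow> ('s, 'g, 'f) tape" where
  "tcobang [] = TZero"
| "tcobang (U # P) = TPar (TCobang U) (tcobang P)"

primrec tsym1 :: "'s list \<Rightarrow> 's poly \<Rightarrow> ('s, 'g, 'f) tape" where
  "tsym1 U [] = TId U"
| "tsym1 U (V # Q) = TSeq (TPar (TSym U V) (tid Q)) (TPar (TId V) (tsym1 U Q))"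

primrec tsym :: "'s poly \<Rightarrow> 's poly \<Rightarrow> ('s, 'g, 'f) tape" where
  "tsym [] Q = tid Q"
| "tsym (U # P) Q = TSeq (TPar (TId U) (tsym P Q)) (TPar (tsym1 U Q) (tid P))"

primrec tnabla :: "'s poly \<Rightarrow> ('s, 'g, 'f) tape" where
  "tnabla [] = TZero"
| "tnabla (U # P) =
     TSeq (TPar (TId U) (TPar (tsym P [U]) (tid P))) (TPar (TNabla U) (tnabla P))"

primrec tdistl :: "'s poly \<Rightarrow> 's poly \<Rightarrow> 's poly \<Rightarrow> ('s, 'g, 'f) tape" where
  "tdistl [] Q R = TZero"
| "tdistl (U # P) Q R =
     TSeq (TPar (tid (poly_prod [U] (Q @ R))) (tdistl P Q R))
       (TPar (tid (poly_prod [U] Q))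
         (TPar (tsym (poly_prod [U] R) (poly_prod P Q)) (tid (poly_prod P R))))"

primrec tdistl_inv :: "'s poly \<Rightarrow> 's poly \<Rightarrow> 's poly \<Rightarrow> ('s, 'g, 'f) tape" where
  "tdistl_inv [] Q R = TZero"
| "tdistl_inv (U # P) Q R =
     TSeq (TPar (tid (poly_prod [U] Q))
         (TPar (tsym (poly_prod P Q) (poly_prod [U] R)) (tid (poly_prod P R))))
       (TPar (tid (poly_prod [U] (Q @ R))) (tdistl_inv P Q R))"

text \<open>The unit word is \<open>[]\<close>, so \<open>replicate n []\<close> is the \<open>n\<close>-fold sum of the tensor unit and
  \<open>concat (replicate n P)\<close> is the \<open>n\<close>-fold sum of \<open>P\<close>.\<close>

primrec tops :: "'f alg_theory \<Rightarrow> 'f \<Rightarrow> 's poly \<Rightarrow> ('s, 'g, 'f) tape" where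
  "tops T f [] = TZero"
| "tops T f (U # P) =
     TSeq (TPar (TOp f U) (tops T f P)) (tdistl_inv (replicate (arity T f) []) [U] P)"

definition tsum :: "('s, 'g, 'f) tape list \<Rightarrow> ('s, 'g, 'f) tape" where
  "tsum ts = foldr TPar ts TZero"

primrec tnabla_n :: "nat \<Rightarrow> 's poly \<Rightarrow> ('s, 'g, 'f) tape" where
  "tnabla_n 0 P = tcobang P"
| "tnabla_n (Suc m) P = TSeq (TPar (tid P) (tnabla_n m P)) (tnabla P)"

text \<open>\<open>trm_tape n U t\<close> is the tape of the term \<open>t\<close> in \<open>n\<close> variables at the monomial \<open>U\<close>.\<close>

primrec trm_tape :: "nat \<Rightarrow> 's list \<Rightarrow> 'f trm \<Rightarrow> ('s, 'g, 'f) tape" where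
  "trm_tape n U (Var i) =
     TPar (tcobang (replicate i U)) (TPar (TId U) (tcobang (replicate (n - Suc i) U)))"
| "trm_tape n U (Fn f ts) =
     TSeq (TSeq (TOp f U) (tsum (map (trm_tape n U) ts))) (tnabla_n (length ts) (replicate n U))"

primrec tdom :: "'f alg_theory \<Rightarrow> ('s, 'g) monsig \<Rightarrow> ('s, 'g, 'f) tape \<Rightarrow> 's poly" where
  "tdom T \<Gamma> (TId U) = [U]"
| "tdom T \<Gamma> TZero = []"
| "tdom T \<Gamma> (TCirc c) = [cdom \<Gamma> c]"
| "tdom T \<Gamma> (TSym U V) = [U, V]"
| "tdom T \<Gamma> (TSeq t u) = tdom T \<Gamma> t"
| "tdom T \<Gamma> (TPar t u) = tdom T \<Gamma> t @ tdom T \<Gamma> u"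
| "tdom T \<Gamma> (TCobang U) = []"
| "tdom T \<Gamma> (TNabla U) = [U, U]"
| "tdom T \<Gamma> (TOp f U) = [U]"

primrec tcod :: "'f alg_theory \<Rightarrow> ('s, 'g) monsig \<Rightarrow> ('s, 'g, 'f) tape \<Rightarrow> 's poly" where
  "tcod T \<Gamma> (TId U) = [U]"
| "tcod T \<Gamma> TZero = []"
| "tcod T \<Gamma> (TCirc c) = [ccod \<Gamma> c]"
| "tcod T \<Gamma> (TSym U V) = [V, U]"
| "tcod T \<Gamma> (TSeq t u) = tcod T \<Gamma> u"
| "tcod T \<Gamma> (TPar t u) = tcod T \<Gamma> t @ tcod T \<Gamma> u"
| "tcod T \<Gamma> (TCobang U) = [U]"
| "tcod T \<Gamma> (TNabla U) = [U]"
| "tcod T \<Gamma> (TOp f U) = replicate (arity T f) U"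

primrec wt_tape :: "'f alg_theory \<Rightarrow> ('s, 'g) monsig \<Rightarrow> ('s, 'g, 'f) tape \<Rightarrow> bool" where
  "wt_tape T \<Gamma> (TId U) \<longleftrightarrow> U \<in> lists (sorts \<Gamma>)"
| "wt_tape T \<Gamma> TZero \<longleftrightarrow> True"
| "wt_tape T \<Gamma> (TCirc c) \<longleftrightarrow> wt_circ \<Gamma> c"
| "wt_tape T \<Gamma> (TSym U V) \<longleftrightarrow> U \<in> lists (sorts \<Gamma>) \<and> V \<in> lists (sorts \<Gamma>)"
| "wt_tape T \<Gamma> (TSeq t u) \<longleftrightarrow> wt_tape T \<Gamma> t \<and> wt_tape T \<Gamma> u \<and> tcod T \<Gamma> t = tdom T \<Gamma> u"
| "wt_tape T \<Gamma> (TPar t u) \<longleftrightarrow> wt_tape T \<Gamma> t \<and> wt_tape T \<Gamma> u"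
| "wt_tape T \<Gamma> (TCobang U) \<longleftrightarrow> U \<in> lists (sorts \<Gamma>)"
| "wt_tape T \<Gamma> (TNabla U) \<longleftrightarrow> U \<in> lists (sorts \<Gamma>)"
| "wt_tape T \<Gamma> (TOp f U) \<longleftrightarrow> f \<in> ops T \<and> U \<in> lists (sorts \<Gamma>)"

text \<open>Left and right whiskerings, first by a monomial and then by a polynomial.\<close>

primrec lwhisk1 :: "'s list \<Rightarrow> ('s, 'g, 'f) tape \<Rightarrow> ('s, 'g, 'f) tape" where
  "lwhisk1 U (TId V) = TId (U @ V)"
| "lwhisk1 U TZero = TZero"
| "lwhisk1 U (TCirc c) = TCirc (CPar (cid U) c)"
| "lwhisk1 U (TSym V W) = TSym (U @ V) (U @ W)"
| "lwhisk1 U (TSeq t u) = TSeq (lwhisk1 U t) (lwhisk1 U u)"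
| "lwhisk1 U (TPar t u) = TPar (lwhisk1 U t) (lwhisk1 U u)"
| "lwhisk1 U (TCobang V) = TCobang (U @ V)"
| "lwhisk1 U (TNabla V) = TNabla (U @ V)"
| "lwhisk1 U (TOp f V) = TOp f (U @ V)"

primrec rwhisk1 :: "'s list \<Rightarrow> ('s, 'g, 'f) tape \<Rightarrow> ('s, 'g, 'f) tape" where
  "rwhisk1 U (TId V) = TId (V @ U)"
| "rwhisk1 U TZero = TZero"
| "rwhisk1 U (TCirc c) = TCirc (CPar c (cid U))"
| "rwhisk1 U (TSym V W) = TSym (V @ U) (W @ U)"
| "rwhisk1 U (TSeq t u) = TSeq (rwhisk1 U t) (rwhisk1 U u)"
| "rwhisk1 U (TPar t u) = TPar (rwhisk1 U t) (rwhisk1 U u)"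
| "rwhisk1 U (TCobang V) = TCobang (V @ U)"
| "rwhisk1 U (TNabla V) = TNabla (V @ U)"
| "rwhisk1 U (TOp f V) = TOp f (V @ U)"

primrec lwhisk :: "'s poly \<Rightarrow> ('s, 'g, 'f) tape \<Rightarrow> ('s, 'g, 'f) tape" where
  "lwhisk [] t = TZero"
| "lwhisk (W # S) t = TPar (lwhisk1 W t) (lwhisk S t)"

primrec rwhisk ::
  "'f alg_theory \<Rightarrow> ('s, 'g) monsig \<Rightarrow> 's poly \<Rightarrow> ('s, 'g, 'f) tape \<Rightarrow> ('s, 'g, 'f) tape" where
  "rwhisk T \<Gamma> [] t = TZero"
| "rwhisk T \<Gamma> (W # S) t =
     TSeq (TSeq (tdistl (tdom T \<Gamma> t) [W] S) (TPar (rwhisk1 W t) (rwhisk T \<Gamma> S t)))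
       (tdistl_inv (tcod T \<Gamma> t) [W] S)"

definition tprod ::
  "'f alg_theory \<Rightarrow> ('s, 'g) monsig \<Rightarrow> ('s, 'g, 'f) tape \<Rightarrow> ('s, 'g, 'f) tape \<Rightarrow> ('s, 'g, 'f) tape" where
  "tprod T \<Gamma> t u = TSeq (lwhisk (tdom T \<Gamma> t) u) (rwhisk T \<Gamma> (tcod T \<Gamma> u) t)"

text \<open>The congruence on tapes. The rule \<open>circ\<close> accounts for the circuits inside tapes being
  taken modulo \<open>circ_eq\<close>.\<close>

inductive tape_eq ::
  "'f alg_theory \<Rightarrow> ('s, 'g) monsig \<Rightarrow> ('s, 'g, 'f) tape \<Rightarrow> ('s, 'g, 'f) tape \<Rightarrow> bool" for T \<Gamma> where
  refl: "wt_tape T \<Gamma> t \<Longrightarrow> tape_eq T \<Gamma> t t"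
| sym: "tape_eq T \<Gamma> t u \<Longrightarrow> tape_eq T \<Gamma> u t"
| trans: "tape_eq T \<Gamma> t u \<Longrightarrow> tape_eq T \<Gamma> u v \<Longrightarrow> tape_eq T \<Gamma> t v"
| seq_cong: "tape_eq T \<Gamma> t t' \<Longrightarrow> tape_eq T \<Gamma> u u' \<Longrightarrow> tcod T \<Gamma> t = tdom T \<Gamma> u \<Longrightarrow>
    tape_eq T \<Gamma> (TSeq t u) (TSeq t' u')"
| sum_cong: "tape_eq T \<Gamma> t t' \<Longrightarrow> tape_eq T \<Gamma> u u' \<Longrightarrow> tape_eq T \<Gamma> (TPar t u) (TPar t' u')"
| prod_cong: "tape_eq T \<Gamma> t t' \<Longrightarrow> tape_eq T \<Gamma> u u' \<Longrightarrow>
    tape_eq T \<Gamma> (tprod T \<Gamma> t u) (tprod T \<Gamma> t' u')"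
| seq_assoc: "wt_tape T \<Gamma> (TSeq (TSeq t u) v) \<Longrightarrow>
    tape_eq T \<Gamma> (TSeq (TSeq t u) v) (TSeq t (TSeq u v))"
| id_seq: "wt_tape T \<Gamma> t \<Longrightarrow> tape_eq T \<Gamma> (TSeq (tid (tdom T \<Gamma> t)) t) t"
| seq_id: "wt_tape T \<Gamma> t \<Longrightarrow> tape_eq T \<Gamma> (TSeq t (tid (tcod T \<Gamma> t))) t"
| sum_assoc: "wt_tape T \<Gamma> t \<Longrightarrow> wt_tape T \<Gamma> u \<Longrightarrow> wt_tape T \<Gamma> v \<Longrightarrow>
    tape_eq T \<Gamma> (TPar (TPar t u) v) (TPar t (TPar u v))"
| zero_sum: "wt_tape T \<Gamma> t \<Longrightarrow> tape_eq T \<Gamma> (TPar TZero t) t"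
| sum_zero: "wt_tape T \<Gamma> t \<Longrightarrow> tape_eq T \<Gamma> (TPar t TZero) t"
| interchange: "wt_tape T \<Gamma> (TSeq t u) \<Longrightarrow> wt_tape T \<Gamma> (TSeq t' u') \<Longrightarrow>
    tape_eq T \<Gamma> (TSeq (TPar t t') (TPar u u')) (TPar (TSeq t u) (TSeq t' u'))"
| sym_sym: "U \<in> lists (sorts \<Gamma>) \<Longrightarrow> V \<in> lists (sorts \<Gamma>) \<Longrightarrow>
    tape_eq T \<Gamma> (TSeq (TSym U V) (TSym V U)) (tid [U, V])"
| sym_natural: "wt_tape T \<Gamma> t \<Longrightarrow> wt_tape T \<Gamma> u \<Longrightarrow>
    tape_eq T \<Gamma> (TSeq (TPar t u) (tsym (tcod T \<Gamma> t) (tcod T \<Gamma> u)))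
      (TSeq (tsym (tdom T \<Gamma> t) (tdom T \<Gamma> u)) (TPar u t))"
| nabla_assoc: "U \<in> lists (sorts \<Gamma>) \<Longrightarrow>
    tape_eq T \<Gamma> (TSeq (TPar (TNabla U) (TId U)) (TNabla U))
      (TSeq (TPar (TId U) (TNabla U)) (TNabla U))"
| nabla_unit: "U \<in> lists (sorts \<Gamma>) \<Longrightarrow>
    tape_eq T \<Gamma> (TSeq (TPar (TCobang U) (TId U)) (TNabla U)) (TId U)"
| nabla_comm: "U \<in> lists (sorts \<Gamma>) \<Longrightarrow> tape_eq T \<Gamma> (TSeq (TSym U U) (TNabla U)) (TNabla U)"
| nabla_circ: "wt_circ \<Gamma> c \<Longrightarrow>
    tape_eq T \<Gamma> (TSeq (TNabla (cdom \<Gamma> c)) (TCirc c))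
      (TSeq (TPar (TCirc c) (TCirc c)) (TNabla (ccod \<Gamma> c)))"
| cobang_circ: "wt_circ \<Gamma> c \<Longrightarrow>
    tape_eq T \<Gamma> (TSeq (TCobang (cdom \<Gamma> c)) (TCirc c)) (TCobang (ccod \<Gamma> c))"
| nabla_op: "f \<in> ops T \<Longrightarrow> U \<in> lists (sorts \<Gamma>) \<Longrightarrow>
    tape_eq T \<Gamma> (TSeq (TNabla U) (TOp f U))
      (TSeq (TPar (TOp f U) (TOp f U)) (tnabla (replicate (arity T f) U)))"
| cobang_op: "f \<in> ops T \<Longrightarrow> U \<in> lists (sorts \<Gamma>) \<Longrightarrow>
    tape_eq T \<Gamma> (TSeq (TCobang U) (TOp f U)) (tcobang (replicate (arity T f) U))"
| op_natural: "wt_tape T \<Gamma> t \<Longrightarrow> f \<in> ops T \<Longrightarrow>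
    tape_eq T \<Gamma> (TSeq t (tops T f (tcod T \<Gamma> t)))
      (TSeq (tops T f (tdom T \<Gamma> t)) (tsum (replicate (arity T f) t)))"
| circ: "circ_eq \<Gamma> c d \<Longrightarrow> tape_eq T \<Gamma> (TCirc c) (TCirc d)"
| circ_id: "U \<in> lists (sorts \<Gamma>) \<Longrightarrow> tape_eq T \<Gamma> (TCirc (cid U)) (TId U)"
| circ_seq: "wt_circ \<Gamma> (CSeq c d) \<Longrightarrow>
    tape_eq T \<Gamma> (TCirc (CSeq c d)) (TSeq (TCirc c) (TCirc d))"
| theory_ax: "(t, t') \<in> eqs T \<Longrightarrow> wf_trm T n t \<Longrightarrow> wf_trm T n t' \<Longrightarrow> U \<in> lists (sorts \<Gamma>) \<Longrightarrow>
    tape_eq T \<Gamma> (trm_tape n U t) (trm_tape n U t')"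

section \<open>The sesquistrict rig category of tapes\<close>

text \<open>The symmetry of the product. A right strict rig category forces
  \<open>symm P (V \<oplus> Q) = distl P V Q; (symm P V \<oplus> symm P Q)\<close>, which reduces it to the symmetries \<open>csym U V\<close> of monomials.\<close>

primrec tsym_prod :: "'s poly \<Rightarrow> 's poly \<Rightarrow> ('s, 'g, 'f) tape" where
  "tsym_prod P [] = TZero"
| "tsym_prod P (V # Q) =
     TSeq (tdistl P [V] Q) (TPar (tsum (map (\<lambda>U. TCirc (csym U V)) P)) (tsym_prod P Q))"

definition tape_class ::
  "'f alg_theory \<Rightarrow> ('s, 'g) monsig \<Rightarrow> ('s, 'g, 'f) tape \<Rightarrow> ('s, 'g, 'f) tape set" where
  "tape_class T \<Gamma> t = {u. tape_eq T \<Gamma> t u}"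

definition tape_cat ::
  "'f alg_theory \<Rightarrow> ('s, 'g) monsig \<Rightarrow> ('s poly, ('s, 'g, 'f) tape set) cat" where
  "tape_cat T \<Gamma> =
     \<lparr>Obj = lists (lists (sorts \<Gamma>)),
      Arr = {tape_class T \<Gamma> t | t. wt_tape T \<Gamma> t},
      Dom = \<lambda>a. tdom T \<Gamma> (rep a),
      Cod = \<lambda>a. tcod T \<Gamma> (rep a),
      Id = \<lambda>P. tape_class T \<Gamma> (tid P),
      Comp = \<lambda>a b. tape_class T \<Gamma> (TSeq (rep a) (rep b))\<rparr>"

definition tape_sum ::
  "'f alg_theory \<Rightarrow> ('s, 'g) monsig \<Rightarrow> ('s poly, ('s, 'g, 'f) tape set) tensor" where
  "tape_sum T \<Gamma> =
     \<lparr>tob = (@),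
      tar = \<lambda>a b. tape_class T \<Gamma> (TPar (rep a) (rep b)),
      tunit = [],
      assoc = \<lambda>P Q R. tape_class T \<Gamma> (tid (P @ Q @ R)),
      lunit = \<lambda>P. tape_class T \<Gamma> (tid P),
      runit = \<lambda>P. tape_class T \<Gamma> (tid P),
      symm = \<lambda>P Q. tape_class T \<Gamma> (tsym P Q)\<rparr>"

definition tape_prod ::
  "'f alg_theory \<Rightarrow> ('s, 'g) monsig \<Rightarrow> ('s poly, ('s, 'g, 'f) tape set) tensor" where
  "tape_prod T \<Gamma> =
     \<lparr>tob = poly_prod,
      tar = \<lambda>a b. tape_class T \<Gamma> (tprod T \<Gamma> (rep a) (rep b)),
      tunit = [[]],
      assoc = \<lambda>P Q R. tape_class T \<Gamma> (tid (poly_prod P (poly_prod Q R))),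
      lunit = \<lambda>P. tape_class T \<Gamma> (tid P),
      runit = \<lambda>P. tape_class T \<Gamma> (tid P),
      symm = \<lambda>P Q. tape_class T \<Gamma> (tsym_prod P Q)\<rparr>"

text \<open>The morphism from \<open>lawvere_op T\<close>: an arrow \<open>n \<rightarrow> m\<close> of \<open>lawvere T\<close>, i.e. an \<open>m\<close>-tuple of
  terms in \<open>n\<close> variables, is sent to the copairing of the tapes of its components.\<close>

definition tape_incl ::
  "'f alg_theory \<Rightarrow> ('s, 'g) monsig \<Rightarrow>
   (nat, nat \<times> 'f trm set list, 's poly, ('s, 'g, 'f) tape set) mfun" where
  "tape_incl T \<Gamma> =
     \<lparr>omap = \<lambda>n. replicate n [],
      amap = \<lambda>(n, ts). tape_class T \<Gamma>
        (TSeq (tsum (map (\<lambda>c. trm_tape n [] (rep c)) ts)) (tnabla_n (length ts) (replicate n []))),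
      mu = \<lambda>m n. tape_class T \<Gamma> (tid (replicate (m + n) [])),
      eps = tape_class T \<Gamma> (tid [])\<rparr>"

definition tape_rig ::
  "'f alg_theory \<Rightarrow> ('s, 'g) monsig \<Rightarrow> ('s poly, ('s, 'g, 'f) tape set, 'f) theory_rig" where
  "tape_rig T \<Gamma> =
     \<lparr>rcat = tape_cat T \<Gamma>,
      rsum = tape_sum T \<Gamma>,
      rprod = tape_prod T \<Gamma>,
      distl = \<lambda>P Q R. tape_class T \<Gamma> (tdistl P Q R),
      distr = \<lambda>P Q R. tape_class T \<Gamma> (tid (poly_prod (P @ Q) R)),
      annl = \<lambda>P. tape_class T \<Gamma> (tid []),
      annr = \<lambda>P. tape_class T \<Gamma> (tid []),
      rnabla = \<lambda>P. tape_class T \<Gamma> (tnabla P),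
      rcobang = \<lambda>P. tape_class T \<Gamma> (tcobang P),
      incl = tape_incl T \<Gamma>\<rparr>"

definition tape_sesqui ::
  "'f alg_theory \<Rightarrow> ('s, 'g) monsig \<Rightarrow> ('s, 's poly, ('s, 'g, 'f) tape set, 'f) sesqui" where
  "tape_sesqui T \<Gamma> = \<lparr>base = sorts \<Gamma>, bmap = \<lambda>A. [[A]], srig = tape_rig T \<Gamma>\<rparr>"

definition tape_gen ::
  "'f alg_theory \<Rightarrow> ('s, 'g) monsig \<Rightarrow> 'g \<Rightarrow> ('s, 'g, 'f) tape set" where
  "tape_gen T \<Gamma> s = tape_class T \<Gamma> (TCirc (CGen s))"

end

theory Submission imports Defs begin

text \<open>The monoids \<open>tnabla P\<close>, \<open>tcobang P\<close> are natural for all tapes because they are so for the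
  generators; hence the sum of tapes is a coproduct, and an arrow out of a sum is determined by its
  composites with the injections. Every coherence condition of a right strict rig category can
  therefore be tested on injections, where it becomes trivial once both whiskerings are known to
  preserve coproducts. The remaining point is that the two ways of whiskering \<open>t\<close> past \<open>u\<close> agree: for
  circuits and operations this is an axiom, and it propagates along composition and copairing.

  For freeness, a tape is interpreted in a sesquistrict target by recursion on its syntax. The
  target, too, has coproducts as sums, its left distributor at a word is an identity, and the
  functor from \<open>lawvere_op T\<close> sends a tuple to the copairing of its components; so the derived
  tapes receive their intended meaning and the interpretation respects the congruence. A strict
  morphism has no choice on generators, since \<open>TOp f U\<close> is \<open>TOp f []\<close> tensored with \<open>U\<close>, and so
  the interpretation is the only extension.\<close>

section \<open>Strict monoidal categories\<close>

text \<open>Strictness is given as the statement that coherence arrows are identities. To compute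
  with it, it has to become equations between objects and between arrows; this is the role of
  \<open>strict_monoidal\<close>, \<open>strict_cocart\<close> and \<open>dist_rig\<close>. The last
  is used on both sides: tapes are an instance with inverse distributor \<open>tdistl_inv\<close>,
  and every right strict target is an instance with inverse distributor \<open>inv_of\<close>. An
  operation \<open>g\<close> at the product of \<open>P\<close> with a monomial \<open>V\<close>,
  which is what the axiom \<open>op_natural\<close> speaks of, is not the whiskering by
  \<open>P\<close> of \<open>TOp g V\<close>: the copies are grouped differently. The two differ by
  the permutation \<open>shuffle\<close>, and moving an arbitrary tape past an operation on the
  right is \<open>op_natural\<close> corrected by it (\<open>slides_op\<close>). Whiskering respects
  the congruence because closure under the product is one of its rules. The counterpart is paid for
  in \<open>ti_tprod\<close>: the interpretation must send \<open>tprod\<close> to the product of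
  the target, which requires that an operation may be tensored with a word on either side
  (\<open>wd_opr\<close>).\<close>

lemma HomI: "f \<in> Arr C \<Longrightarrow> Dom C f = X \<Longrightarrow> Cod C f = Y \<Longrightarrow> f \<in> Hom C X Y"
  by (simp add: Hom_def)

lemma HomD:
  assumes "f \<in> Hom C X Y"
  shows "f \<in> Arr C" "Dom C f = X" "Cod C f = Y"
  using assms by (auto simp: Hom_def)

context category
begin

lemma Dom_Obj [simp]: "f \<in> Arr C \<Longrightarrow> Dom C f \<in> Obj C"
  and Cod_Obj [simp]: "f \<in> Arr C \<Longrightarrow> Cod C f \<in> Obj C"
  by (simp_all add: Dom_in_Obj Cod_in_Obj)

lemma Id_simps [simp]:
  assumes "X \<in> Obj C"
  shows "Id C X \<in> Arr C" "Dom C (Id C X) = X" "Cod C (Id C X) = X"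
  using HomD[OF Id_in_Hom[OF assms]] by auto

lemma Comp_simps [simp]:
  assumes "f \<in> Arr C" "g \<in> Arr C" "Cod C f = Dom C g"
  shows "Comp C f g \<in> Arr C" "Dom C (Comp C f g) = Dom C f" "Cod C (Comp C f g) = Cod C g"
proof -
  have "f \<in> Hom C (Dom C f) (Cod C f)" "g \<in> Hom C (Cod C f) (Cod C g)"
    using assms by (auto intro: HomI)
  from HomD[OF Comp_in_Hom[OF this]]
  show "Comp C f g \<in> Arr C" "Dom C (Comp C f g) = Dom C f" "Cod C (Comp C f g) = Cod C g" by auto
qed

lemma Id_left [simp]: "f \<in> Arr C \<Longrightarrow> Dom C f = X \<Longrightarrow> Comp C (Id C X) f = f"
  by (rule Id_Comp[of f X "Cod C f"]) (simp add: Hom_def)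

lemma Id_right [simp]: "f \<in> Arr C \<Longrightarrow> Cod C f = X \<Longrightarrow> Comp C f (Id C X) = f"
  by (rule Comp_Id[of f "Dom C f" X]) (simp add: Hom_def)

lemma Comp_assoc_simp [simp]:
  "f \<in> Arr C \<Longrightarrow> g \<in> Arr C \<Longrightarrow> h \<in> Arr C \<Longrightarrow> Cod C f = Dom C g \<Longrightarrow> Cod C g = Dom C h \<Longrightarrow>
    Comp C (Comp C f g) h = Comp C f (Comp C g h)"
  by (rule Comp_assoc[of f "Dom C f" "Cod C f" g "Cod C g" h "Cod C h"]) (simp_all add: Hom_def)

text \<open>Composites are kept nested to the right, so an equation between two-arrow composites
  does not match inside a longer one; this form rewrites the leading pair in front of any
  \<open>h\<close>.\<close>

lemma Comp_eq_extend:
  assumes "Comp C f g = Comp C f' g'" and "f \<in> Arr C" "g \<in> Arr C" "f' \<in> Arr C" "g' \<in> Arr C" "h \<in> Arr C"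
    and "Cod C f = Dom C g" "Cod C f' = Dom C g'" "Cod C g = Dom C h" "Cod C g' = Dom C h"
  shows "Comp C f (Comp C g h) = Comp C f' (Comp C g' h)"
  using assms by (metis Comp_assoc_simp)

lemma inverse_arrows_Id: "X \<in> Obj C \<Longrightarrow> inverse_arrows C (Id C X) (Id C X)"
  by (simp add: inverse_arrows_def Hom_def)

lemma is_iso_Id: "X \<in> Obj C \<Longrightarrow> is_iso C (Id C X)"
  unfolding is_iso_def by (rule exI, rule inverse_arrows_Id)

lemma inverse_arrows_unique:
  assumes "inverse_arrows C f g" "inverse_arrows C f h"
  shows "g = h"
proof -
  from assms have *: "f \<in> Arr C" "g \<in> Arr C" "h \<in> Arr C" "Dom C g = Cod C f" "Cod C g = Dom C f"
      "Dom C h = Cod C f" "Cod C h = Dom C f"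
      "Comp C f g = Id C (Dom C f)" "Comp C g f = Id C (Cod C f)"
      "Comp C f h = Id C (Dom C f)" "Comp C h f = Id C (Cod C f)"
    by (auto simp: inverse_arrows_def Hom_def)
  have "g = Comp C g (Comp C f h)" unfolding *(10) using * by simp
  also have "\<dots> = Comp C (Comp C g f) h" by (rule Comp_assoc_simp[symmetric]) (simp_all only: *)
  also have "\<dots> = h" unfolding *(9) using * by simp
  finally show ?thesis .
qed

lemma inv_of_eq: "inverse_arrows C f g \<Longrightarrow> inv_of C f = g"
  unfolding inv_of_def by (rule the_equality) (auto intro: inverse_arrows_unique)

lemma inv_of_Id [simp]: "X \<in> Obj C \<Longrightarrow> inv_of C (Id C X) = Id C X"
  by (rule inv_of_eq[OF inverse_arrows_Id])

text \<open>This is how strictness becomes usable: \<open>is_identity\<close> only says that the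
  arrow is the identity of some object, and comparison with its known type forces the two ends to be
  the same object.\<close>

lemma is_identityD: "is_identity C f \<Longrightarrow> f \<in> Hom C X Y \<Longrightarrow> f = Id C Y" "is_identity C f \<Longrightarrow> f \<in> Hom C X Y \<Longrightarrow> X = Y"
  by (auto simp: is_identity_def Hom_def)

lemma is_identity_Id: "X \<in> Obj C \<Longrightarrow> is_identity C (Id C X)"
  by (auto simp: is_identity_def)

end

text \<open>The content of strictness as equations, free of the coherence families. It serves in
  both directions: \<open>symmetric_monoidalI\<close> builds a strict symmetric monoidal category
  from it, and \<open>strict_smc\<close> recovers it from the official axioms.\<close>

locale strict_monoidal = category C + monoidal_syntax C M
  for C :: "('o, 'a) cat" and M :: "('o, 'a) tensor" +
  assumes tob_Obj [simp]: "X \<in> Obj C \<Longrightarrow> Y \<in> Obj C \<Longrightarrow> X \<odot> Y \<in> Obj C"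
    and I_Obj [simp]: "I \<in> Obj C"
    and tar_Hom: "f \<in> Hom C X X' \<Longrightarrow> g \<in> Hom C Y Y' \<Longrightarrow> f \<odot>\<^sub>a g \<in> Hom C (X \<odot> Y) (X' \<odot> Y')"
    and tar_Id [simp]: "X \<in> Obj C \<Longrightarrow> Y \<in> Obj C \<Longrightarrow> \<iota> X \<odot>\<^sub>a \<iota> Y = \<iota> (X \<odot> Y)"
    and tar_interchange: "f \<in> Hom C X X' \<Longrightarrow> f' \<in> Hom C X' X'' \<Longrightarrow> g \<in> Hom C Y Y' \<Longrightarrow> g' \<in> Hom C Y' Y'' \<Longrightarrow>
      (f \<Zsemi> f') \<odot>\<^sub>a (g \<Zsemi> g') = (f \<odot>\<^sub>a g) \<Zsemi> (f' \<odot>\<^sub>a g')"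
    and tob_assoc [simp]: "X \<in> Obj C \<Longrightarrow> Y \<in> Obj C \<Longrightarrow> Z \<in> Obj C \<Longrightarrow> (X \<odot> Y) \<odot> Z = X \<odot> (Y \<odot> Z)"
    and I_tob [simp]: "X \<in> Obj C \<Longrightarrow> I \<odot> X = X"
    and tob_I [simp]: "X \<in> Obj C \<Longrightarrow> X \<odot> I = X"
    and tar_assoc [simp]: "f \<in> Arr C \<Longrightarrow> g \<in> Arr C \<Longrightarrow> h \<in> Arr C \<Longrightarrow> (f \<odot>\<^sub>a g) \<odot>\<^sub>a h = f \<odot>\<^sub>a (g \<odot>\<^sub>a h)"
    and I_tar [simp]: "f \<in> Arr C \<Longrightarrow> \<iota> I \<odot>\<^sub>a f = f"
    and tar_I [simp]: "f \<in> Arr C \<Longrightarrow> f \<odot>\<^sub>a \<iota> I = f"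
begin

lemma tar_simps [simp]:
  assumes "f \<in> Arr C" "g \<in> Arr C"
  shows "f \<odot>\<^sub>a g \<in> Arr C" "Dom C (f \<odot>\<^sub>a g) = Dom C f \<odot> Dom C g" "Cod C (f \<odot>\<^sub>a g) = Cod C f \<odot> Cod C g"
proof -
  have "f \<in> Hom C (Dom C f) (Cod C f)" "g \<in> Hom C (Dom C g) (Cod C g)"
    using assms by (auto intro: HomI)
  from HomD[OF tar_Hom[OF this]]
  show "f \<odot>\<^sub>a g \<in> Arr C" "Dom C (f \<odot>\<^sub>a g) = Dom C f \<odot> Dom C g" "Cod C (f \<odot>\<^sub>a g) = Cod C f \<odot> Cod C g" by auto
qed

text \<open>Interchange is oriented so that the simplifier merges composites inside the product.
  Where a product has to be split into whiskered factors instead, \<open>tar_fuse\<close> and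
  \<open>tar_fuse_assoc\<close> are removed from the simpset and \<open>whisk_left\<close>,
  \<open>whisk_right\<close> are used.\<close>

lemma tar_fuse [simp]:
  "f \<in> Arr C \<Longrightarrow> f' \<in> Arr C \<Longrightarrow> g \<in> Arr C \<Longrightarrow> g' \<in> Arr C \<Longrightarrow> Cod C f = Dom C f' \<Longrightarrow> Cod C g = Dom C g' \<Longrightarrow>
    (f \<odot>\<^sub>a g) \<Zsemi> (f' \<odot>\<^sub>a g') = (f \<Zsemi> f') \<odot>\<^sub>a (g \<Zsemi> g')"
  by (rule tar_interchange[symmetric]) (auto simp: Hom_def)

lemma tar_fuse_assoc [simp]:
  assumes "f \<in> Arr C" "f' \<in> Arr C" "g \<in> Arr C" "g' \<in> Arr C" "h \<in> Arr C" "Cod C f = Dom C f'" "Cod C g = Dom C g'"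
    "Cod C f' \<odot> Cod C g' = Dom C h"
  shows "(f \<odot>\<^sub>a g) \<Zsemi> ((f' \<odot>\<^sub>a g') \<Zsemi> h) = ((f \<Zsemi> f') \<odot>\<^sub>a (g \<Zsemi> g')) \<Zsemi> h"
proof -
  have "(f \<odot>\<^sub>a g) \<Zsemi> ((f' \<odot>\<^sub>a g') \<Zsemi> h) = ((f \<odot>\<^sub>a g) \<Zsemi> (f' \<odot>\<^sub>a g')) \<Zsemi> h"
    by (rule Comp_assoc_simp[symmetric]) (use assms in auto)
  then show ?thesis using assms by simp
qed

lemma whisk_right:
  "f \<in> Arr C \<Longrightarrow> g \<in> Arr C \<Longrightarrow> Cod C f = Dom C g \<Longrightarrow> X \<in> Obj C \<Longrightarrow> (f \<Zsemi> g) \<odot>\<^sub>a \<iota> X = (f \<odot>\<^sub>a \<iota> X) \<Zsemi> (g \<odot>\<^sub>a \<iota> X)"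
  by simp

lemma whisk_left:
  "f \<in> Arr C \<Longrightarrow> g \<in> Arr C \<Longrightarrow> Cod C f = Dom C g \<Longrightarrow> X \<in> Obj C \<Longrightarrow> \<iota> X \<odot>\<^sub>a (f \<Zsemi> g) = (\<iota> X \<odot>\<^sub>a f) \<Zsemi> (\<iota> X \<odot>\<^sub>a g)"
  by simp

text \<open>With all coherence arrows identities, pentagon, triangle and the naturality of units
  collapse; what remains of the symmetric structure is naturality, involutivity and one
  hexagon.\<close>

lemma symmetric_monoidalI:
  assumes "\<And>X Y Z. X \<in> Obj C \<Longrightarrow> Y \<in> Obj C \<Longrightarrow> Z \<in> Obj C \<Longrightarrow> assoc M X Y Z = \<iota> (X \<odot> (Y \<odot> Z))"
    and "\<And>X. X \<in> Obj C \<Longrightarrow> lunit M X = \<iota> X"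
    and "\<And>X. X \<in> Obj C \<Longrightarrow> runit M X = \<iota> X"
    and "\<And>X Y. X \<in> Obj C \<Longrightarrow> Y \<in> Obj C \<Longrightarrow> symm M X Y \<in> Hom C (X \<odot> Y) (Y \<odot> X)"
    and "\<And>f g. f \<in> Arr C \<Longrightarrow> g \<in> Arr C \<Longrightarrow>
      (f \<odot>\<^sub>a g) \<Zsemi> symm M (Cod C f) (Cod C g) = symm M (Dom C f) (Dom C g) \<Zsemi> (g \<odot>\<^sub>a f)"
    and "\<And>X Y. X \<in> Obj C \<Longrightarrow> Y \<in> Obj C \<Longrightarrow> symm M X Y \<Zsemi> symm M Y X = \<iota> (X \<odot> Y)"
    and "\<And>X Y Z. X \<in> Obj C \<Longrightarrow> Y \<in> Obj C \<Longrightarrow> Z \<in> Obj C \<Longrightarrow>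
      symm M X (Y \<odot> Z) = (symm M X Y \<odot>\<^sub>a \<iota> Z) \<Zsemi> (\<iota> Y \<odot>\<^sub>a symm M X Z)"
  shows "symmetric_monoidal C M" "strict_tensor C M"
proof -
  note [simp] = assms(1-3) HomD[OF assms(4)]
  show "symmetric_monoidal C M"
  proof unfold_locales
    fix f g X X' Y Y' assume "f \<in> Hom C X X'" "g \<in> Hom C Y Y'"
    then show "(f \<odot>\<^sub>a g) \<Zsemi> symm M X' Y' = symm M X Y \<Zsemi> (g \<odot>\<^sub>a f)"
      using assms(5)[of f g] by (auto simp: Hom_def)
  next
    fix X Y assume "X \<in> Obj C" "Y \<in> Obj C"
    then show "symm M X Y \<Zsemi> symm M Y X = \<iota> (X \<odot> Y)" by (rule assms(6))
  next
    fix X Y Z assume "X \<in> Obj C" "Y \<in> Obj C" "Z \<in> Obj C"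
    then show "assoc M X Y Z \<Zsemi> symm M X (Y \<odot> Z) \<Zsemi> assoc M Y Z X =
      (symm M X Y \<odot>\<^sub>a \<iota> Z) \<Zsemi> assoc M Y X Z \<Zsemi> (\<iota> Y \<odot>\<^sub>a symm M X Z)"
      using assms(7)[of X Y Z] by simp
  qed (auto simp: is_iso_Id Hom_def)
  show "strict_tensor C M"
    by (auto simp: strict_tensor_def intro!: is_identity_Id)
qed

end

text \<open>Circuits (letters are sorts) and tapes (letters are monomials) build their symmetries by
  the same recursion from letter swaps: \<open>s1\<close> moves one letter past a word,
  \<open>symm\<close> moves a word. Naturality is an axiom of both congruences, whereas involutivity
  and the hexagon are proved here.\<close>

locale word_sym = strict_monoidal C M
  for C :: "('l list, 'a) cat" and M :: "('l list, 'a) tensor" +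
  fixes L :: "'l set" and sw :: "'l \<Rightarrow> 'l \<Rightarrow> 'a" and s1 :: "'l \<Rightarrow> 'l list \<Rightarrow> 'a"
  assumes Obj_words [simp]: "Obj C = lists L"
    and tob_append [simp]: "tob M = (@)"
    and tunit_Nil [simp]: "tunit M = []"
    and assoc_Id: "X \<in> lists L \<Longrightarrow> Y \<in> lists L \<Longrightarrow> Z \<in> lists L \<Longrightarrow> assoc M X Y Z = Id C (X @ Y @ Z)"
    and lunit_Id: "X \<in> lists L \<Longrightarrow> lunit M X = Id C X"
    and runit_Id: "X \<in> lists L \<Longrightarrow> runit M X = Id C X"
    and sw_Hom: "u \<in> L \<Longrightarrow> v \<in> L \<Longrightarrow> sw u v \<in> Hom C [u, v] [v, u]"
    and sw_sw: "u \<in> L \<Longrightarrow> v \<in> L \<Longrightarrow> sw u v \<Zsemi> sw v u = \<iota> [u, v]"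
    and s1_Nil [simp]: "u \<in> L \<Longrightarrow> s1 u [] = \<iota> [u]"
    and s1_Cons: "u \<in> L \<Longrightarrow> v \<in> L \<Longrightarrow> Q \<in> lists L \<Longrightarrow>
      s1 u (v # Q) = (sw u v \<odot>\<^sub>a \<iota> Q) \<Zsemi> (\<iota> [v] \<odot>\<^sub>a s1 u Q)"
    and sy_Nil [simp]: "Q \<in> lists L \<Longrightarrow> symm M [] Q = \<iota> Q"
    and sy_Cons: "u \<in> L \<Longrightarrow> P \<in> lists L \<Longrightarrow> Q \<in> lists L \<Longrightarrow>
      symm M (u # P) Q = (\<iota> [u] \<odot>\<^sub>a symm M P Q) \<Zsemi> (s1 u Q \<odot>\<^sub>a \<iota> P)"
    and sy_natural: "f \<in> Arr C \<Longrightarrow> g \<in> Arr C \<Longrightarrow>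
      (f \<odot>\<^sub>a g) \<Zsemi> symm M (Cod C f) (Cod C g) = symm M (Dom C f) (Dom C g) \<Zsemi> (g \<odot>\<^sub>a f)"
begin

abbreviation "sy \<equiv> symm M"

lemma sw_simps [simp]:
  "u \<in> L \<Longrightarrow> v \<in> L \<Longrightarrow> sw u v \<in> Arr C" "u \<in> L \<Longrightarrow> v \<in> L \<Longrightarrow> Dom C (sw u v) = [u, v]"
  "u \<in> L \<Longrightarrow> v \<in> L \<Longrightarrow> Cod C (sw u v) = [v, u]"
  using HomD[OF sw_Hom] by auto

lemma s1_simps [simp]:
  assumes "u \<in> L" "Q \<in> lists L"
  shows "s1 u Q \<in> Arr C" "Dom C (s1 u Q) = u # Q" "Cod C (s1 u Q) = Q @ [u]"
proof -
  have "s1 u Q \<in> Arr C \<and> Dom C (s1 u Q) = u # Q \<and> Cod C (s1 u Q) = Q @ [u]"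
    using assms(2) by induction (auto simp: s1_Cons assms(1))
  then show "s1 u Q \<in> Arr C" "Dom C (s1 u Q) = u # Q" "Cod C (s1 u Q) = Q @ [u]" by auto
qed

lemma sy_simps [simp]:
  assumes "P \<in> lists L" "Q \<in> lists L"
  shows "sy P Q \<in> Arr C" "Dom C (sy P Q) = P @ Q" "Cod C (sy P Q) = Q @ P"
proof -
  have "sy P Q \<in> Arr C \<and> Dom C (sy P Q) = P @ Q \<and> Cod C (sy P Q) = Q @ P"
    using assms by induction (auto simp: sy_Cons)
  then show "sy P Q \<in> Arr C" "Dom C (sy P Q) = P @ Q" "Cod C (sy P Q) = Q @ P" by auto
qed

lemma Id_append: "P \<in> lists L \<Longrightarrow> Q \<in> lists L \<Longrightarrow> \<iota> (P @ Q) = \<iota> P \<odot>\<^sub>a \<iota> Q"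
  by simp

lemma Id_Cons: "u \<in> L \<Longrightarrow> Q \<in> lists L \<Longrightarrow> \<iota> (u # Q) = \<iota> [u] \<odot>\<^sub>a \<iota> Q"
  by simp

lemma Nil_tar [simp]: "f \<in> Arr C \<Longrightarrow> \<iota> [] \<odot>\<^sub>a f = f"
  using I_tar by simp

lemma tar_Nil [simp]: "f \<in> Arr C \<Longrightarrow> f \<odot>\<^sub>a \<iota> [] = f"
  using tar_I by simp

lemma s1_append:
  assumes "u \<in> L" "Q \<in> lists L" "R \<in> lists L"
  shows "s1 u (Q @ R) = (s1 u Q \<odot>\<^sub>a \<iota> R) \<Zsemi> (\<iota> Q \<odot>\<^sub>a s1 u R)"
  using assms(2)
proof induction
  case Nil
  then show ?case using assms by simp
next
  case (Cons v Q)
  have "s1 u ((v # Q) @ R) = (sw u v \<odot>\<^sub>a \<iota> Q \<odot>\<^sub>a \<iota> R) \<Zsemi> (\<iota> [v] \<odot>\<^sub>a s1 u Q \<odot>\<^sub>a \<iota> R) \<Zsemi> (\<iota> [v] \<odot>\<^sub>a \<iota> Q \<odot>\<^sub>a s1 u R)"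
    using Cons assms by (simp add: s1_Cons)
  also have "\<dots> = (s1 u (v # Q) \<odot>\<^sub>a \<iota> R) \<Zsemi> (\<iota> (v # Q) \<odot>\<^sub>a s1 u R)"
    using Cons assms
    by (simp add: s1_Cons whisk_right Id_Cons[of v Q] del: tar_Id tar_fuse tar_fuse_assoc)
  finally show ?case .
qed

text \<open>The hexagon. The recursion is on the left word, so splitting the right word takes an
  induction in which \<open>u\<close> is moved past \<open>Q\<close> and then past
  \<open>R\<close>.\<close>

lemma sy_append_right:
  assumes "P \<in> lists L" "Q \<in> lists L" "R \<in> lists L"
  shows "sy P (Q @ R) = (sy P Q \<odot>\<^sub>a \<iota> R) \<Zsemi> (\<iota> Q \<odot>\<^sub>a sy P R)"
  using assms(1)
proof induction
  case Nil
  then show ?case using assms by simp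
next
  case (Cons u P)
  note [simp] = assms Cons.hyps
  have "sy (u # P) (Q @ R) = (\<iota> [u] \<odot>\<^sub>a sy P (Q @ R)) \<Zsemi> (s1 u (Q @ R) \<odot>\<^sub>a \<iota> P)"
    by (simp add: sy_Cons)
  also have "\<dots> = ((\<iota> [u] \<odot>\<^sub>a sy P Q \<odot>\<^sub>a \<iota> R) \<Zsemi> (\<iota> ([u] @ Q) \<odot>\<^sub>a sy P R)) \<Zsemi>
      ((s1 u Q \<odot>\<^sub>a \<iota> (R @ P)) \<Zsemi> (\<iota> Q \<odot>\<^sub>a s1 u R \<odot>\<^sub>a \<iota> P))"
    unfolding Cons.IH Id_append[of "[u]" Q, simplified] Id_append[of R P, simplified] s1_append[OF \<open>u \<in> L\<close> assms(2,3)]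
    by (simp add: whisk_right whisk_left Id_append Id_Cons[of u Q] del: tar_Id tar_fuse tar_fuse_assoc)
  also have "\<dots> = (\<iota> [u] \<odot>\<^sub>a sy P Q \<odot>\<^sub>a \<iota> R) \<Zsemi> (((\<iota> ([u] @ Q) \<odot>\<^sub>a sy P R) \<Zsemi> (s1 u Q \<odot>\<^sub>a \<iota> (R @ P))) \<Zsemi>
      (\<iota> Q \<odot>\<^sub>a s1 u R \<odot>\<^sub>a \<iota> P))"
    by (simp del: tar_fuse tar_fuse_assoc)
  \<comment> \<open>The only step that is not regrouping: \<open>sy P R\<close> and
    \<open>s1 u Q\<close> act on disjoint blocks, so interchange lets them trade places.\<close>
  also have "(\<iota> ([u] @ Q) \<odot>\<^sub>a sy P R) \<Zsemi> (s1 u Q \<odot>\<^sub>a \<iota> (R @ P)) =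
       (s1 u Q \<odot>\<^sub>a \<iota> (P @ R)) \<Zsemi> (\<iota> (Q @ [u]) \<odot>\<^sub>a sy P R)"
    by simp
  also have "(\<iota> [u] \<odot>\<^sub>a sy P Q \<odot>\<^sub>a \<iota> R) \<Zsemi> (((s1 u Q \<odot>\<^sub>a \<iota> (P @ R)) \<Zsemi> (\<iota> (Q @ [u]) \<odot>\<^sub>a sy P R)) \<Zsemi>
      (\<iota> Q \<odot>\<^sub>a s1 u R \<odot>\<^sub>a \<iota> P)) = (sy (u # P) Q \<odot>\<^sub>a \<iota> R) \<Zsemi> (\<iota> Q \<odot>\<^sub>a sy (u # P) R)"
    by (simp add: sy_Cons whisk_right whisk_left Id_append del: tar_Id tar_fuse tar_fuse_assoc)
  finally show ?case .
qed

lemma sy_right_Nil [simp]: "P \<in> lists L \<Longrightarrow> sy P [] = \<iota> P"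
  by (induction P) (auto simp: sy_Cons)

lemma sw_eq_sy: "u \<in> L \<Longrightarrow> v \<in> L \<Longrightarrow> sw u v = sy [u] [v]"
  by (simp add: sy_Cons s1_Cons)

lemma s1_sy:
  assumes "u \<in> L" "Q \<in> lists L"
  shows "s1 u Q \<Zsemi> sy Q [u] = \<iota> (u # Q)"
  using assms(2)
proof induction
  case Nil
  then show ?case using assms by simp
next
  case (Cons v Q)
  note [simp] = assms(1) Cons.hyps
  have "s1 u (v # Q) \<Zsemi> sy (v # Q) [u] =
    (sw u v \<odot>\<^sub>a \<iota> Q) \<Zsemi> ((\<iota> [v] \<odot>\<^sub>a (s1 u Q \<Zsemi> sy Q [u])) \<Zsemi> (sw v u \<odot>\<^sub>a \<iota> Q))"
    by (simp add: s1_Cons sy_Cons whisk_left del: tar_fuse tar_fuse_assoc)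
  also have "\<dots> = \<iota> (u # v # Q)"
    unfolding Cons.IH by (simp add: sw_sw)
  finally show ?case .
qed

text \<open>In the second factor the hexagon splits off the letter \<open>u\<close>;
  \<open>s1_sy\<close> cancels it and the induction hypothesis cancels the rest.\<close>

lemma sy_sy:
  assumes "P \<in> lists L" "Q \<in> lists L"
  shows "sy P Q \<Zsemi> sy Q P = \<iota> (P @ Q)"
  using assms(1)
proof induction
  case Nil
  then show ?case using assms by simp
next
  case (Cons u P)
  note [simp] = assms(2) Cons.hyps
  have "sy (u # P) Q \<Zsemi> sy Q (u # P) =
    (\<iota> [u] \<odot>\<^sub>a sy P Q) \<Zsemi> (((s1 u Q \<Zsemi> sy Q [u]) \<odot>\<^sub>a \<iota> P) \<Zsemi> (\<iota> [u] \<odot>\<^sub>a sy Q P))"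
    using sy_append_right[of Q "[u]" P] by (simp add: sy_Cons[of u P Q] whisk_right del: tar_fuse tar_fuse_assoc)
  also have "\<dots> = \<iota> ((u # P) @ Q)"
    unfolding s1_sy[OF Cons.hyps(1) assms(2)] using Cons.IH by simp
  finally show ?case .
qed

lemma is_symmetric_monoidal: "symmetric_monoidal C M" and is_strict: "strict_tensor C M"
  by (rule symmetric_monoidalI; simp add: assoc_Id lunit_Id runit_Id sy_natural sy_sy sy_append_right Hom_def)+

end

locale strict_smc = symmetric_monoidal C M
  for C :: "('o, 'a) cat" and M :: "('o, 'a) tensor" +
  assumes strict: "strict_tensor C M"
begin

lemma assoc_Id_raw:
  assumes "X \<in> Obj C" "Y \<in> Obj C" "Z \<in> Obj C"
  shows "assoc M X Y Z = \<iota> (X \<odot> (Y \<odot> Z))" "(X \<odot> Y) \<odot> Z = X \<odot> (Y \<odot> Z)"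
proof -
  have i: "is_identity C (assoc M X Y Z)" using strict assms by (simp add: strict_tensor_def)
  show "assoc M X Y Z = \<iota> (X \<odot> (Y \<odot> Z))" "(X \<odot> Y) \<odot> Z = X \<odot> (Y \<odot> Z)"
    by (rule is_identityD[OF i assoc_in_Hom[OF assms]])+
qed

lemma unit_Id_raw:
  assumes "X \<in> Obj C"
  shows "lunit M X = \<iota> X" "I \<odot> X = X" "runit M X = \<iota> X" "X \<odot> I = X"
proof -
  have i: "is_identity C (lunit M X)" "is_identity C (runit M X)"
    using strict assms by (simp_all add: strict_tensor_def)
  show "lunit M X = \<iota> X" "I \<odot> X = X" by (rule is_identityD[OF i(1) lunit_in_Hom[OF assms]])+
  show "runit M X = \<iota> X" "X \<odot> I = X" by (rule is_identityD[OF i(2) runit_in_Hom[OF assms]])+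
qed

text \<open>Object equations come from the types of the coherence arrows; the arrow equations
  \<open>tar_assoc\<close>, \<open>I_tar\<close> and \<open>tar_I\<close> come from their
  naturality, in which the coherence arrows have become identities.\<close>

sublocale strict_monoidal C M
proof unfold_locales
  fix f g h assume *: "f \<in> Arr C" "g \<in> Arr C" "h \<in> Arr C"
  have **: "(f \<odot>\<^sub>a g) \<odot>\<^sub>a h \<in> Hom C ((Dom C f \<odot> Dom C g) \<odot> Dom C h) ((Cod C f \<odot> Cod C g) \<odot> Cod C h)"
     "f \<odot>\<^sub>a (g \<odot>\<^sub>a h) \<in> Hom C (Dom C f \<odot> (Dom C g \<odot> Dom C h)) (Cod C f \<odot> (Cod C g \<odot> Cod C h))"
    using * by (auto intro!: tensor_in_Hom HomI)
  have "((f \<odot>\<^sub>a g) \<odot>\<^sub>a h) \<Zsemi> assoc M (Cod C f) (Cod C g) (Cod C h) =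
      assoc M (Dom C f) (Dom C g) (Dom C h) \<Zsemi> (f \<odot>\<^sub>a (g \<odot>\<^sub>a h))"
    using * by (auto intro!: assoc_natural HomI)
  then show "(f \<odot>\<^sub>a g) \<odot>\<^sub>a h = f \<odot>\<^sub>a (g \<odot>\<^sub>a h)"
    using * HomD[OF **(1)] HomD[OF **(2)] by (simp add: assoc_Id_raw)
next
  fix f assume *: "f \<in> Arr C"
  have **: "\<iota> I \<odot>\<^sub>a f \<in> Hom C (I \<odot> Dom C f) (I \<odot> Cod C f)" "f \<odot>\<^sub>a \<iota> I \<in> Hom C (Dom C f \<odot> I) (Cod C f \<odot> I)"
    using * unit_in_Obj by (auto intro!: tensor_in_Hom HomI)
  have "(\<iota> I \<odot>\<^sub>a f) \<Zsemi> lunit M (Cod C f) = lunit M (Dom C f) \<Zsemi> f" "(f \<odot>\<^sub>a \<iota> I) \<Zsemi> runit M (Cod C f) = runit M (Dom C f) \<Zsemi> f"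
    using * by (auto intro!: lunit_natural runit_natural HomI)
  then show "\<iota> I \<odot>\<^sub>a f = f" "f \<odot>\<^sub>a \<iota> I = f"
    using * HomD[OF **(1)] HomD[OF **(2)] by (simp_all add: unit_Id_raw)
qed (simp_all add: tensor_in_Obj unit_in_Obj tensor_in_Hom tensor_Id interchange assoc_Id_raw unit_Id_raw)

lemma assoc_Id [simp]: "X \<in> Obj C \<Longrightarrow> Y \<in> Obj C \<Longrightarrow> Z \<in> Obj C \<Longrightarrow> assoc M X Y Z = \<iota> (X \<odot> (Y \<odot> Z))"
  and lunit_Id [simp]: "X \<in> Obj C \<Longrightarrow> lunit M X = \<iota> X"
  and runit_Id [simp]: "X \<in> Obj C \<Longrightarrow> runit M X = \<iota> X"
  by (simp_all add: assoc_Id_raw unit_Id_raw)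

lemma symm_simps [simp]:
  assumes "X \<in> Obj C" "Y \<in> Obj C"
  shows "symm M X Y \<in> Arr C" "Dom C (symm M X Y) = X \<odot> Y" "Cod C (symm M X Y) = Y \<odot> X"
  using HomD[OF symm_in_Hom[OF assms]] by auto

lemma symm_nat:
  "f \<in> Arr C \<Longrightarrow> g \<in> Arr C \<Longrightarrow> Cod C f = X \<Longrightarrow> Cod C g = Y \<Longrightarrow>
    (f \<odot>\<^sub>a g) \<Zsemi> symm M X Y = symm M (Dom C f) (Dom C g) \<Zsemi> (g \<odot>\<^sub>a f)"
  by (rule symm_natural) (auto simp: Hom_def)

lemma symm_inv [simp]: "X \<in> Obj C \<Longrightarrow> Y \<in> Obj C \<Longrightarrow> symm M X Y \<Zsemi> symm M Y X = \<iota> (X \<odot> Y)"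
  by (rule symm_symm)

lemma symm_inv_assoc [simp]:
  assumes "X \<in> Obj C" "Y \<in> Obj C" "f \<in> Arr C" "Dom C f = X \<odot> Y"
  shows "symm M X Y \<Zsemi> (symm M Y X \<Zsemi> f) = f"
  using assms Comp_assoc_simp[of "symm M X Y" "symm M Y X" f] by simp

lemma symm_tob_right:
  "X \<in> Obj C \<Longrightarrow> Y \<in> Obj C \<Longrightarrow> Z \<in> Obj C \<Longrightarrow>
    symm M X (Y \<odot> Z) = (symm M X Y \<odot>\<^sub>a \<iota> Z) \<Zsemi> (\<iota> Y \<odot>\<^sub>a symm M X Z)"
  using hexagon[of X Y Z] by simp

lemma iso_inj:
  assumes "Comp C s t = \<iota> X" "f \<in> Arr C" "g \<in> Arr C" "s \<in> Arr C" "t \<in> Arr C" "Cod C s = Dom C t"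
    "Dom C s = X" "Cod C t = X" "Cod C f = X" "Cod C g = X" "f \<Zsemi> s = g \<Zsemi> s"
  shows "f = g"
proof -
  have "f = (f \<Zsemi> s) \<Zsemi> t" using assms(1-10) by simp
  also have "\<dots> = (g \<Zsemi> s) \<Zsemi> t" by (simp only: assms(11))
  also have "\<dots> = g" using assms(1-10) by simp
  finally show ?thesis .
qed

text \<open>The official axioms contain the hexagon for a product on the right only; the mirror form
  follows by cancelling the invertible \<open>symm M Z (X \<odot> Y)\<close>.\<close>

lemma symm_tob_left:
  assumes [simp]: "X \<in> Obj C" "Y \<in> Obj C" "Z \<in> Obj C"
  shows "symm M (X \<odot> Y) Z = (\<iota> X \<odot>\<^sub>a symm M Y Z) \<Zsemi> (symm M X Z \<odot>\<^sub>a \<iota> Y)" (is "?l = ?r")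
proof (rule iso_inj[where s = "symm M Z (X \<odot> Y)" and t = "symm M (X \<odot> Y) Z" and X = "Z \<odot> (X \<odot> Y)"])
  have "?r \<Zsemi> symm M Z (X \<odot> Y) = (\<iota> X \<odot>\<^sub>a symm M Y Z) \<Zsemi> (((symm M X Z \<odot>\<^sub>a \<iota> Y) \<Zsemi> (symm M Z X \<odot>\<^sub>a \<iota> Y)) \<Zsemi> (\<iota> X \<odot>\<^sub>a symm M Z Y))"
    by (simp add: symm_tob_right del: tar_fuse tar_fuse_assoc)
  also have "\<dots> = \<iota> (X \<odot> (Y \<odot> Z))" by simp
  finally show "?l \<Zsemi> symm M Z (X \<odot> Y) = ?r \<Zsemi> symm M Z (X \<odot> Y)" by simp
qed simp_all

text \<open>The hexagon at \<open>Y = Z = I\<close> makes \<open>symm M X I\<close> idempotent, and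
  an invertible idempotent is an identity.\<close>

lemma symm_I [simp]:
  assumes [simp]: "X \<in> Obj C"
  shows "symm M I X = \<iota> X" "symm M X I = \<iota> X"
proof -
  have s: "symm M X I = symm M X I \<Zsemi> symm M X I"
    using symm_tob_right[of X I I] by simp
  have "symm M X I = symm M X I \<Zsemi> (symm M X I \<Zsemi> symm M I X)" by simp
  also have "\<dots> = (symm M X I \<Zsemi> symm M X I) \<Zsemi> symm M I X" by (rule Comp_assoc_simp[symmetric]) simp_all
  also have "\<dots> = \<iota> X" by (subst s[symmetric]) simp
  finally show XI: "symm M X I = \<iota> X" .
  show "symm M I X = \<iota> X"
    using symm_inv[of I X] unfolding XI by simp
qed

lemma mid4_strict [simp]:
  "W \<in> Obj C \<Longrightarrow> X \<in> Obj C \<Longrightarrow> Y \<in> Obj C \<Longrightarrow> Z \<in> Obj C \<Longrightarrow> mid4 W X Y Z = \<iota> W \<odot>\<^sub>a symm M X Y \<odot>\<^sub>a \<iota> Z"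
  unfolding mid4_def by simp

end

sublocale word_sym \<subseteq> smc: strict_smc C M
  by (rule strict_smc.intro[OF is_symmetric_monoidal]) (simp add: strict_smc_axioms_def is_strict)

section \<open>Strict categories with finite coproducts\<close>

text \<open>A strict form of \<open>fc_category\<close>, cut down to what makes the sum a coproduct:
  naturality of the monoids, their unit laws and their compatibility with the sum. Associativity and
  commutativity of \<open>nab\<close> are recovered from the coproduct property in
  \<open>is_fc_category\<close>.\<close>

locale strict_cocart = strict_smc C M
  for C :: "('o, 'a) cat" and M :: "('o, 'a) tensor" +
  fixes nab :: "'o \<Rightarrow> 'a" and cob :: "'o \<Rightarrow> 'a"
  assumes nab_Hom: "X \<in> Obj C \<Longrightarrow> nab X \<in> Hom C (X \<odot> X) X"
    and cob_Hom: "X \<in> Obj C \<Longrightarrow> cob X \<in> Hom C I X"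
    and nab_unit_left: "X \<in> Obj C \<Longrightarrow> (cob X \<odot>\<^sub>a \<iota> X) \<Zsemi> nab X = \<iota> X"
    and nab_unit_right: "X \<in> Obj C \<Longrightarrow> (\<iota> X \<odot>\<^sub>a cob X) \<Zsemi> nab X = \<iota> X"
    and nab_nat: "f \<in> Arr C \<Longrightarrow> nab (Dom C f) \<Zsemi> f = (f \<odot>\<^sub>a f) \<Zsemi> nab (Cod C f)"
    and cob_nat: "f \<in> Arr C \<Longrightarrow> cob (Dom C f) \<Zsemi> f = cob (Cod C f)"
    and nab_tob: "X \<in> Obj C \<Longrightarrow> Y \<in> Obj C \<Longrightarrow> nab (X \<odot> Y) = (\<iota> X \<odot>\<^sub>a symm M Y X \<odot>\<^sub>a \<iota> Y) \<Zsemi> (nab X \<odot>\<^sub>a nab Y)"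
    and nab_I: "nab I = \<iota> I"
    and cob_tob: "X \<in> Obj C \<Longrightarrow> Y \<in> Obj C \<Longrightarrow> cob (X \<odot> Y) = cob X \<odot>\<^sub>a cob Y"
    and cob_I [simp]: "cob I = \<iota> I"
begin

definition in1 :: "'o \<Rightarrow> 'o \<Rightarrow> 'a" where "in1 X Y = \<iota> X \<odot>\<^sub>a cob Y"
definition in2 :: "'o \<Rightarrow> 'o \<Rightarrow> 'a" where "in2 X Y = cob X \<odot>\<^sub>a \<iota> Y"

lemma nab_cob_simps [simp]:
  assumes "X \<in> Obj C"
  shows "nab X \<in> Arr C" "Dom C (nab X) = X \<odot> X" "Cod C (nab X) = X"
    "cob X \<in> Arr C" "Dom C (cob X) = I" "Cod C (cob X) = X"
  using HomD[OF nab_Hom[OF assms]] HomD[OF cob_Hom[OF assms]] by auto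

lemma in_simps [simp]:
  assumes "X \<in> Obj C" "Y \<in> Obj C"
  shows "in1 X Y \<in> Arr C" "Dom C (in1 X Y) = X" "Cod C (in1 X Y) = X \<odot> Y"
    "in2 X Y \<in> Arr C" "Dom C (in2 X Y) = Y" "Cod C (in2 X Y) = X \<odot> Y"
  using assms by (simp_all add: in1_def in2_def)

lemma cob_Comp [simp]: "f \<in> Arr C \<Longrightarrow> Dom C f = X \<Longrightarrow> cob X \<Zsemi> f = cob (Cod C f)"
  using cob_nat by blast

lemma initial: "f \<in> Arr C \<Longrightarrow> Dom C f = I \<Longrightarrow> f = cob (Cod C f)"
  using cob_nat[of f] by simp

lemma in_nab [simp]: "X \<in> Obj C \<Longrightarrow> in1 X X \<Zsemi> nab X = \<iota> X" "X \<in> Obj C \<Longrightarrow> in2 X X \<Zsemi> nab X = \<iota> X"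
  by (simp_all add: in1_def in2_def nab_unit_left nab_unit_right)

lemma in_tar [simp]:
  assumes "f \<in> Arr C" "g \<in> Arr C" "Dom C f = X" "Dom C g = Y"
  shows "in1 X Y \<Zsemi> (f \<odot>\<^sub>a g) = f \<Zsemi> in1 (Cod C f) (Cod C g)"
    "in2 X Y \<Zsemi> (f \<odot>\<^sub>a g) = g \<Zsemi> in2 (Cod C f) (Cod C g)"
proof -
  have [simp]: "X \<in> Obj C" "Y \<in> Obj C" using assms by auto
  have "f \<odot>\<^sub>a cob (Cod C g) = (f \<odot>\<^sub>a \<iota> I) \<Zsemi> (\<iota> (Cod C f) \<odot>\<^sub>a cob (Cod C g))"
    using assms by (simp del: tar_I)
  then show "in1 X Y \<Zsemi> (f \<odot>\<^sub>a g) = f \<Zsemi> in1 (Cod C f) (Cod C g)"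
    using assms by (simp add: in1_def)
  have "cob (Cod C f) \<odot>\<^sub>a g = (\<iota> I \<odot>\<^sub>a g) \<Zsemi> (cob (Cod C f) \<odot>\<^sub>a \<iota> (Cod C g))"
    using assms by (simp del: I_tar)
  then show "in2 X Y \<Zsemi> (f \<odot>\<^sub>a g) = g \<Zsemi> in2 (Cod C f) (Cod C g)"
    using assms by (simp add: in2_def)
qed

lemma in_symm [simp]:
  assumes "X \<in> Obj C" "Y \<in> Obj C"
  shows "in1 X Y \<Zsemi> symm M X Y = in2 Y X" "in2 X Y \<Zsemi> symm M X Y = in1 Y X"
  using assms by (simp_all add: in1_def in2_def symm_nat)

text \<open>Normal forms for injections into a threefold sum: a single injection for a summand at
  either end, and \<open>in2\<close> followed by \<open>in1\<close> for the middle one.\<close>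

lemma in_in:
  assumes "X \<in> Obj C" "Y \<in> Obj C" "Z \<in> Obj C"
  shows in1_in1: "W = X \<odot> Y \<Longrightarrow> in1 X Y \<Zsemi> in1 W Z = in1 X (Y \<odot> Z)"
    and in2_in2: "W = Y \<odot> Z \<Longrightarrow> in2 Y Z \<Zsemi> in2 X W = in2 (X \<odot> Y) Z"
    and in1_in2: "W = Y \<odot> Z \<Longrightarrow> in1 Y Z \<Zsemi> in2 X W = in2 X Y \<Zsemi> in1 (X \<odot> Y) Z"
proof -
  show "W = X \<odot> Y \<Longrightarrow> in1 X Y \<Zsemi> in1 W Z = in1 X (Y \<odot> Z)"
    using assms by (simp add: in1_def[of X] in1_def[of "X \<odot> Y"] cob_tob tar_Id[symmetric] del: tar_Id)
  show "W = Y \<odot> Z \<Longrightarrow> in2 Y Z \<Zsemi> in2 X W = in2 (X \<odot> Y) Z"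
    using assms in_tar(2)[of "cob X" "in2 Y Z" I Z] by (simp add: in2_def cob_tob)
  show "W = Y \<odot> Z \<Longrightarrow> in1 Y Z \<Zsemi> in2 X W = in2 X Y \<Zsemi> in1 (X \<odot> Y) Z"
    using assms in_tar(2)[of "cob X" "in1 Y Z" I Y] in_tar(1)[of "in2 X Y" "cob Z" Y I]
    by (simp add: in1_def in2_def)
qed

lemma in_I [simp]: "X \<in> Obj C \<Longrightarrow> in1 X I = \<iota> X" "X \<in> Obj C \<Longrightarrow> in2 I X = \<iota> X"
    "X \<in> Obj C \<Longrightarrow> in1 I X = cob X" "X \<in> Obj C \<Longrightarrow> in2 X I = cob X"
  by (simp_all add: in1_def in2_def)

lemma in_tar_assoc [simp]:
  assumes "f \<in> Arr C" "g \<in> Arr C" "Dom C f = X" "Dom C g = Y" "h \<in> Arr C" "Dom C h = Cod C f \<odot> Cod C g"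
  shows "in1 X Y \<Zsemi> ((f \<odot>\<^sub>a g) \<Zsemi> h) = f \<Zsemi> (in1 (Cod C f) (Cod C g) \<Zsemi> h)"
    "in2 X Y \<Zsemi> ((f \<odot>\<^sub>a g) \<Zsemi> h) = g \<Zsemi> (in2 (Cod C f) (Cod C g) \<Zsemi> h)"
  by (rule Comp_eq_extend; use assms in auto)+

lemma in_symm_assoc [simp]:
  assumes "X \<in> Obj C" "Y \<in> Obj C" "h \<in> Arr C" "Dom C h = Y \<odot> X"
  shows "in1 X Y \<Zsemi> (symm M X Y \<Zsemi> h) = in2 Y X \<Zsemi> h" "in2 X Y \<Zsemi> (symm M X Y \<Zsemi> h) = in1 Y X \<Zsemi> h"
  using assms Comp_assoc_simp[of "in1 X Y" "symm M X Y" h] Comp_assoc_simp[of "in2 X Y" "symm M X Y" h] by simp_all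

lemma in_nab_assoc [simp]:
  assumes "X \<in> Obj C" "h \<in> Arr C" "Dom C h = X"
  shows "in1 X X \<Zsemi> (nab X \<Zsemi> h) = h" "in2 X X \<Zsemi> (nab X \<Zsemi> h) = h"
  using assms Comp_assoc_simp[of "in1 X X" "nab X" h] Comp_assoc_simp[of "in2 X X" "nab X" h] by simp_all

lemma in_in_assoc:
  assumes "X \<in> Obj C" "Y \<in> Obj C" "Z \<in> Obj C" "h \<in> Arr C" "Dom C h = X \<odot> (Y \<odot> Z)"
  shows in1_in1_assoc: "W = X \<odot> Y \<Longrightarrow> in1 X Y \<Zsemi> (in1 W Z \<Zsemi> h) = in1 X (Y \<odot> Z) \<Zsemi> h"
    and in2_in2_assoc: "W = Y \<odot> Z \<Longrightarrow> in2 Y Z \<Zsemi> (in2 X W \<Zsemi> h) = in2 (X \<odot> Y) Z \<Zsemi> h"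
    and in1_in2_assoc: "W = Y \<odot> Z \<Longrightarrow> in1 Y Z \<Zsemi> (in2 X W \<Zsemi> h) = in2 X Y \<Zsemi> (in1 (X \<odot> Y) Z \<Zsemi> h)"
  using assms in_in[OF assms(1-3)]
    Comp_assoc_simp[of "in1 X Y" "in1 (X \<odot> Y) Z" h] Comp_assoc_simp[of "in2 Y Z" "in2 X (Y \<odot> Z)" h]
    Comp_assoc_simp[of "in1 Y Z" "in2 X (Y \<odot> Z)" h] Comp_assoc_simp[of "in2 X Y" "in1 (X \<odot> Y) Z" h]
  by (simp_all del: Comp_assoc_simp)

lemma in_tar3 [simp]:
  assumes "f \<in> Arr C" "g \<in> Arr C" "h \<in> Arr C" "W = Dom C f \<odot> Dom C g" "Dom C h = Z"
  shows "in1 W Z \<Zsemi> (f \<odot>\<^sub>a (g \<odot>\<^sub>a h)) = (f \<odot>\<^sub>a g) \<Zsemi> in1 (Cod C f \<odot> Cod C g) (Cod C h)"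
    "in2 W Z \<Zsemi> (f \<odot>\<^sub>a (g \<odot>\<^sub>a h)) = h \<Zsemi> in2 (Cod C f \<odot> Cod C g) (Cod C h)"
  using assms in_tar[of "f \<odot>\<^sub>a g" h] by auto

text \<open>Together with naturality of \<open>nab\<close> this is the whole coproduct property.
  After splitting \<open>nab (X \<odot> Y)\<close> by \<open>nab_tob\<close>, the middle swap only
  exchanges two initial arrows, and the unit laws at \<open>X\<close> and \<open>Y\<close>
  remain.\<close>

lemma in_in_nab:
  assumes [simp]: "X \<in> Obj C" "Y \<in> Obj C"
  shows "(in1 X Y \<odot>\<^sub>a in2 X Y) \<Zsemi> nab (X \<odot> Y) = \<iota> (X \<odot> Y)"
proof -
  have "(in1 X Y \<odot>\<^sub>a in2 X Y) \<Zsemi> nab (X \<odot> Y) = ((\<iota> X \<odot>\<^sub>a cob X) \<odot>\<^sub>a (cob Y \<odot>\<^sub>a \<iota> Y)) \<Zsemi> (nab X \<odot>\<^sub>a nab Y)"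
  proof -
    have "((cob Y \<odot>\<^sub>a cob X) \<odot>\<^sub>a \<iota> Y) \<Zsemi> (symm M Y X \<odot>\<^sub>a \<iota> Y) = cob X \<odot>\<^sub>a cob Y \<odot>\<^sub>a \<iota> Y"
      using symm_nat[of "cob Y" "cob X" Y X] by (subst tar_fuse) simp_all
    then show ?thesis by (simp add: nab_tob in1_def in2_def)
  qed
  also have "\<dots> = ((\<iota> X \<odot>\<^sub>a cob X) \<Zsemi> nab X) \<odot>\<^sub>a ((cob Y \<odot>\<^sub>a \<iota> Y) \<Zsemi> nab Y)"
    by (rule tar_fuse) simp_all
  finally show ?thesis by (simp add: nab_unit_left nab_unit_right)
qed

lemma coprod_eta:
  assumes "f \<in> Arr C" "Dom C f = X \<odot> Y" "X \<in> Obj C" "Y \<in> Obj C"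
  shows "f = ((in1 X Y \<Zsemi> f) \<odot>\<^sub>a (in2 X Y \<Zsemi> f)) \<Zsemi> nab (Cod C f)"
proof -
  have "((in1 X Y \<Zsemi> f) \<odot>\<^sub>a (in2 X Y \<Zsemi> f)) \<Zsemi> nab (Cod C f) = (in1 X Y \<odot>\<^sub>a in2 X Y) \<Zsemi> ((f \<odot>\<^sub>a f) \<Zsemi> nab (Cod C f))"
    using assms by simp
  also have "\<dots> = ((in1 X Y \<odot>\<^sub>a in2 X Y) \<Zsemi> nab (X \<odot> Y)) \<Zsemi> f"
    using assms nab_nat[of f] by simp
  also have "\<dots> = f" unfolding in_in_nab[OF assms(3,4)] using assms by simp
  finally show ?thesis by simp
qed

text \<open>The main instrument of the development: by \<open>coprod_eta\<close> each arrow is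
  rebuilt from its composites with the injections.\<close>

lemma coprod_ext:
  assumes "in1 X Y \<Zsemi> f = in1 X Y \<Zsemi> g" "in2 X Y \<Zsemi> f = in2 X Y \<Zsemi> g" "f \<in> Arr C" "g \<in> Arr C"
    "Dom C f = X \<odot> Y" "Dom C g = X \<odot> Y" "Cod C f = Cod C g" "X \<in> Obj C" "Y \<in> Obj C"
  shows "f = g"
  using coprod_eta[of f X Y] coprod_eta[of g X Y] assms by simp

lemma initial_ext: "f \<in> Arr C \<Longrightarrow> g \<in> Arr C \<Longrightarrow> Dom C f = I \<Longrightarrow> Dom C g = I \<Longrightarrow> Cod C f = Cod C g \<Longrightarrow> f = g"
  using initial[of f] initial[of g] by simp

lemma is_fc_category: "fc_category C M nab cob"
proof unfold_locales
  fix X assume [simp]: "X \<in> Obj C"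
  \<comment> \<open>Both sides start at a threefold sum, so associativity is tested on three
    injections, each of which yields the identity of \<open>X\<close>.\<close>
  have "(nab X \<odot>\<^sub>a \<iota> X) \<Zsemi> nab X = (\<iota> X \<odot>\<^sub>a nab X) \<Zsemi> nab X"
  proof (rule coprod_ext[of "X \<odot> X" X])
    let ?r = "(\<iota> X \<odot>\<^sub>a nab X) \<Zsemi> nab X"
    have 2: "in2 X X \<Zsemi> (in1 (X \<odot> X) X \<Zsemi> ?r) = \<iota> X"
      using in1_in2_assoc[of X X X ?r "X \<odot> X"] by simp
    have 1: "in1 X X \<Zsemi> (in1 (X \<odot> X) X \<Zsemi> ?r) = \<iota> X"
      using in1_in1_assoc[of X X X ?r "X \<odot> X"] by simp
    have "in1 (X \<odot> X) X \<Zsemi> ?r = nab X"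
      by (rule coprod_ext[of X X]) (simp_all only: 1 2, simp_all)
    then show "in1 (X \<odot> X) X \<Zsemi> ((nab X \<odot>\<^sub>a \<iota> X) \<Zsemi> nab X) = in1 (X \<odot> X) X \<Zsemi> ?r"
      by simp
    show "in2 (X \<odot> X) X \<Zsemi> ((nab X \<odot>\<^sub>a \<iota> X) \<Zsemi> nab X) = in2 (X \<odot> X) X \<Zsemi> ?r"
      using in2_in2_assoc[of X X X ?r "X \<odot> X"] by simp
  qed simp_all
  then show "(nab X \<odot>\<^sub>a \<iota> X) \<Zsemi> nab X = assoc M X X X \<Zsemi> (\<iota> X \<odot>\<^sub>a nab X) \<Zsemi> nab X" by simp
  show "symm M X X \<Zsemi> nab X = nab X"
    by (rule coprod_ext[of X X]) simp_all
next
  fix f X Y assume "f \<in> Hom C X Y"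
  then show "nab X \<Zsemi> f = (f \<odot>\<^sub>a f) \<Zsemi> nab Y" "cob X \<Zsemi> f = cob Y"
    using nab_nat by (auto simp: Hom_def)
next
  fix X Y assume "X \<in> Obj C" "Y \<in> Obj C"
  then show "nab (X \<odot> Y) = mid4 X Y X Y \<Zsemi> (nab X \<odot>\<^sub>a nab Y)" by (simp add: nab_tob)
qed (simp_all add: nab_Hom cob_Hom nab_unit_left nab_unit_right nab_I cob_tob)

end

lemma strict_cocartI:
  assumes "fc_category C M nab cob" "strict_tensor C M"
  shows "strict_cocart C M nab cob"
proof -
  interpret fc_category C M nab cob by fact
  interpret strict_smc C M by unfold_locales fact
  show ?thesis
  proof unfold_locales
    fix f assume "f \<in> Arr C"
    then have "f \<in> Hom C (Dom C f) (Cod C f)" by (simp add: Hom_def)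
    from nabla_natural[OF this] cobang_natural[OF this]
    show "nab (Dom C f) \<Zsemi> f = (f \<odot>\<^sub>a f) \<Zsemi> nab (Cod C f)" "cob (Dom C f) \<Zsemi> f = cob (Cod C f)" .
  next
    fix X Y assume "X \<in> Obj C" "Y \<in> Obj C"
    then show "nab (X \<odot> Y) = (\<iota> X \<odot>\<^sub>a symm M Y X \<odot>\<^sub>a \<iota> Y) \<Zsemi> (nab X \<odot>\<^sub>a nab Y)"
      "cob (X \<odot> Y) = cob X \<odot>\<^sub>a cob Y"
      using nabla_sum[of X Y] cobang_sum[of X Y] HomD[OF cobang_in_Hom[of X]] HomD[OF cobang_in_Hom[of Y]] by simp_all
  qed (use nabla_lunit nabla_runit nabla_zero in \<open>simp_all add: nabla_in_Hom cobang_in_Hom cobang_zero\<close>)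
qed

section \<open>Finite copowers, their injections and copairings\<close>

context strict_cocart
begin

abbreviation npow :: "'o \<Rightarrow> nat \<Rightarrow> 'o" where "npow X n \<equiv> canonical_fc.nsum M X n"

primrec nin :: "'o \<Rightarrow> nat \<Rightarrow> nat \<Rightarrow> 'a" where
  "nin X 0 k = undefined"
| "nin X (Suc n) k = (case k of 0 \<Rightarrow> in1 X (npow X n) | Suc j \<Rightarrow> nin X n j \<Zsemi> in2 X (npow X n))"

definition nsumar :: "'a list \<Rightarrow> 'a" where "nsumar fs = foldr (tar M) fs (\<iota> I)"

text \<open>Folding with codiagonals keeps the shape of the syntax: a sum of tapes followed by
  \<open>tnabla_n\<close>, and the arrows of \<open>canonical_fc.copair\<close>, become
  instances.\<close>

definition ncopair :: "'o \<Rightarrow> 'a list \<Rightarrow> 'a" where "ncopair Z fs = foldr (\<lambda>f g. (f \<odot>\<^sub>a g) \<Zsemi> nab Z) fs (cob Z)"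

lemma nsumar_simps [simp]: "nsumar [] = \<iota> I" "nsumar (f # fs) = f \<odot>\<^sub>a nsumar fs"
  by (simp_all add: nsumar_def)

lemma ncopair_simps [simp]: "ncopair Z [] = cob Z" "ncopair Z (f # fs) = (f \<odot>\<^sub>a ncopair Z fs) \<Zsemi> nab Z"
  by (simp_all add: ncopair_def)

lemma npow_simps [simp]: "npow X 0 = I" "npow X (Suc n) = X \<odot> npow X n"
  by (simp_all add: canonical_fc.nsum.simps)

lemma npow_Obj [simp]: "X \<in> Obj C \<Longrightarrow> npow X n \<in> Obj C"
  by (induction n) auto

lemma npow_add: "X \<in> Obj C \<Longrightarrow> npow X (m + n) = npow X m \<odot> npow X n"
  by (induction m) auto

lemma nin_simps [simp]:
  assumes "X \<in> Obj C" "k < n"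
  shows "nin X n k \<in> Arr C" "Dom C (nin X n k) = X" "Cod C (nin X n k) = npow X n"
proof -
  have "nin X n k \<in> Arr C \<and> Dom C (nin X n k) = X \<and> Cod C (nin X n k) = npow X n"
    using assms by (induction n arbitrary: k) (auto split: nat.split)
  then show "nin X n k \<in> Arr C" "Dom C (nin X n k) = X" "Cod C (nin X n k) = npow X n" by auto
qed

lemma npow_ext:
  assumes "\<And>k. k < n \<Longrightarrow> nin X n k \<Zsemi> f = nin X n k \<Zsemi> g" "f \<in> Arr C" "g \<in> Arr C"
    "Dom C f = npow X n" "Dom C g = npow X n" "Cod C f = Cod C g" "X \<in> Obj C"
  shows "f = g"
  using assms
proof (induction n arbitrary: f g)
  case 0
  then show ?case by (auto intro: initial_ext)
next
  case (Suc n)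
  show ?case
  proof (rule coprod_ext[of X "npow X n"])
    show "in1 X (npow X n) \<Zsemi> f = in1 X (npow X n) \<Zsemi> g" using Suc.prems(1)[of 0] by simp
    show "in2 X (npow X n) \<Zsemi> f = in2 X (npow X n) \<Zsemi> g"
    proof (rule Suc.IH)
      fix k assume "k < n"
      then show "nin X n k \<Zsemi> (in2 X (npow X n) \<Zsemi> f) = nin X n k \<Zsemi> (in2 X (npow X n) \<Zsemi> g)"
        using Suc.prems(1)[of "Suc k"] Suc.prems by simp
    qed (use Suc.prems in simp_all)
  qed (use Suc.prems in simp_all)
qed

lemma ncopair_props:
  assumes "set fs \<subseteq> Hom C X Z" "X \<in> Obj C" "Z \<in> Obj C"
  shows "ncopair Z fs \<in> Arr C" "Dom C (ncopair Z fs) = npow X (length fs)" "Cod C (ncopair Z fs) = Z"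
proof -
  have "ncopair Z fs \<in> Arr C \<and> Dom C (ncopair Z fs) = npow X (length fs) \<and> Cod C (ncopair Z fs) = Z"
    using assms by (induction fs) (auto simp: Hom_def)
  then show "ncopair Z fs \<in> Arr C" "Dom C (ncopair Z fs) = npow X (length fs)" "Cod C (ncopair Z fs) = Z" by auto
qed

lemma nsumar_props:
  assumes "set fs \<subseteq> Hom C X Z" "X \<in> Obj C" "Z \<in> Obj C"
  shows "nsumar fs \<in> Arr C" "Dom C (nsumar fs) = npow X (length fs)" "Cod C (nsumar fs) = npow Z (length fs)"
proof -
  have "nsumar fs \<in> Arr C \<and> Dom C (nsumar fs) = npow X (length fs) \<and> Cod C (nsumar fs) = npow Z (length fs)"
    using assms by (induction fs) (auto simp: Hom_def)
  then show "nsumar fs \<in> Arr C" "Dom C (nsumar fs) = npow X (length fs)" "Cod C (nsumar fs) = npow Z (length fs)" by auto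
qed

lemma nin_ncopair:
  assumes "set fs \<subseteq> Hom C X Z" "X \<in> Obj C" "Z \<in> Obj C" "k < length fs" "n = length fs"
  shows "nin X n k \<Zsemi> ncopair Z fs = fs ! k"
  unfolding assms(5) using assms(1-4)
proof (induction fs arbitrary: k)
  case (Cons f fs)
  have f: "f \<in> Arr C" "Dom C f = X" "Cod C f = Z" using Cons.prems(1) by (auto simp: Hom_def)
  have [simp]: "ncopair Z fs \<in> Arr C" "Dom C (ncopair Z fs) = npow X (length fs)" "Cod C (ncopair Z fs) = Z"
    using ncopair_props[of fs X Z] Cons.prems by auto
  show ?case
  proof (cases k)
    case 0
    then show ?thesis using f Cons.prems by simp
  next
    case (Suc j)
    then have "nin X (length fs) j \<Zsemi> ncopair Z fs = fs ! j" using Cons by simp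
    then show ?thesis using f Cons.prems Suc by simp
  qed
qed simp

lemma ncopair_Comp:
  assumes "set fs \<subseteq> Hom C X Z" "X \<in> Obj C" "Z \<in> Obj C" "h \<in> Arr C" "Dom C h = Z"
  shows "ncopair Z fs \<Zsemi> h = ncopair (Cod C h) (map (\<lambda>f. f \<Zsemi> h) fs)"
proof (rule npow_ext[of "length fs" X])
  have *: "set (map (\<lambda>f. f \<Zsemi> h) fs) \<subseteq> Hom C X (Cod C h)"
    using assms by (auto simp: Hom_def subset_iff)
  have hO: "Cod C h \<in> Obj C" using assms by simp
  note p = ncopair_props[OF assms(1-3)] ncopair_props[OF * assms(2) hO]
  show "ncopair Z fs \<Zsemi> h \<in> Arr C" "ncopair (Cod C h) (map (\<lambda>f. f \<Zsemi> h) fs) \<in> Arr C"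
    "Dom C (ncopair Z fs \<Zsemi> h) = npow X (length fs)"
    "Dom C (ncopair (Cod C h) (map (\<lambda>f. f \<Zsemi> h) fs)) = npow X (length fs)"
    "Cod C (ncopair Z fs \<Zsemi> h) = Cod C (ncopair (Cod C h) (map (\<lambda>f. f \<Zsemi> h) fs))"
    using p assms by simp_all
  fix k assume k: "k < length fs"
  have "nin X (length fs) k \<Zsemi> (ncopair Z fs \<Zsemi> h) = (nin X (length fs) k \<Zsemi> ncopair Z fs) \<Zsemi> h"
    using p assms k by simp
  also have "\<dots> = fs ! k \<Zsemi> h" using nin_ncopair[OF assms(1-3) k] by simp
  also have "\<dots> = map (\<lambda>f. f \<Zsemi> h) fs ! k" using k by simp
  also have "\<dots> = nin X (length fs) k \<Zsemi> ncopair (Cod C h) (map (\<lambda>f. f \<Zsemi> h) fs)"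
    by (rule nin_ncopair[OF * assms(2) hO, symmetric]) (use k in simp_all)
  finally show "nin X (length fs) k \<Zsemi> (ncopair Z fs \<Zsemi> h) = nin X (length fs) k \<Zsemi> ncopair (Cod C h) (map (\<lambda>f. f \<Zsemi> h) fs)" .
qed (use assms in auto)

lemma nsumar_ncopair:
  assumes "set fs \<subseteq> Hom C X Y" "set gs \<subseteq> Hom C Y Z"
    "X \<in> Obj C" "Y \<in> Obj C" "Z \<in> Obj C" "length fs = length gs"
  shows "nsumar fs \<Zsemi> ncopair Z gs = ncopair Z (map2 (\<Zsemi>) fs gs)"
  using assms(6,1,2)
proof (induction fs gs rule: list_induct2)
  case Nil
  then show ?case using assms by simp
next
  case (Cons f fs g gs)
  have f: "f \<in> Arr C" "Dom C f = X" "Cod C f = Y" "g \<in> Arr C" "Dom C g = Y" "Cod C g = Z"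
    using Cons.prems by (auto simp: Hom_def)
  have [simp]: "nsumar fs \<in> Arr C" "Dom C (nsumar fs) = npow X (length fs)" "Cod C (nsumar fs) = npow Y (length fs)"
    "ncopair Z gs \<in> Arr C" "Dom C (ncopair Z gs) = npow Y (length gs)" "Cod C (ncopair Z gs) = Z"
    using nsumar_props[of fs X Y] ncopair_props[of gs Y Z] Cons.prems assms by auto
  have "nsumar (f # fs) \<Zsemi> ncopair Z (g # gs) = ((f \<Zsemi> g) \<odot>\<^sub>a (nsumar fs \<Zsemi> ncopair Z gs)) \<Zsemi> nab Z"
    using f Cons.hyps assms by simp
  then show ?case using Cons by simp
qed

lemma ncopair_nin: "X \<in> Obj C \<Longrightarrow> ncopair (npow X n) (map (nin X n) [0..<n]) = \<iota> (npow X n)"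
proof (rule npow_ext[of n X])
  assume X: "X \<in> Obj C"
  have *: "set (map (nin X n) [0..<n]) \<subseteq> Hom C X (npow X n)"
    using X by (auto simp: Hom_def)
  show "ncopair (npow X n) (map (nin X n) [0..<n]) \<in> Arr C" "Dom C (ncopair (npow X n) (map (nin X n) [0..<n])) = npow X n"
    "Cod C (ncopair (npow X n) (map (nin X n) [0..<n])) = Cod C (\<iota> (npow X n))"
    using ncopair_props[OF * X] X by simp_all
  show "nin X n k \<Zsemi> ncopair (npow X n) (map (nin X n) [0..<n]) = nin X n k \<Zsemi> \<iota> (npow X n)" if "k < n" for k
    using nin_ncopair[OF * X, of k n] X that by simp
qed simp_all

lemma nin_add:
  assumes "X \<in> Obj C"
  shows "k < m \<Longrightarrow> nin X (m + n) k = nin X m k \<Zsemi> in1 (npow X m) (npow X n)"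
    and "k < n \<Longrightarrow> nin X (m + n) (m + k) = nin X n k \<Zsemi> in2 (npow X m) (npow X n)"
proof -
  show "k < m \<Longrightarrow> nin X (m + n) k = nin X m k \<Zsemi> in1 (npow X m) (npow X n)"
  proof (induction m arbitrary: k)
    case (Suc m)
    show ?case
    proof (cases k)
      case 0
      then show ?thesis using assms by (simp add: npow_add in1_in1)
    next
      case (Suc j)
      then have "nin X (m + n) j = nin X m j \<Zsemi> in1 (npow X m) (npow X n)" "j < m" using Suc.IH Suc.prems by auto
      then show ?thesis using assms Suc by (simp add: npow_add in1_in2)
    qed
  qed simp
  show "k < n \<Longrightarrow> nin X (m + n) (m + k) = nin X n k \<Zsemi> in2 (npow X m) (npow X n)"
    by (induction m) (use assms in \<open>simp_all add: npow_add in2_in2\<close>)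
qed

end

context strict_cocart
begin

text \<open>The middle interchange regroups a sum of sums, so it carries the outer injections to
  sums of injections. Laplaza 9 uses this directly, the recursion of \<open>tdistl\<close> through
  the inverse form \<open>mid4_out\<close>.\<close>

lemma mid4_in:
  assumes [simp]: "A \<in> Obj C" "B \<in> Obj C" "D \<in> Obj C" "E \<in> Obj C"
  shows "in1 (A \<odot> B) (D \<odot> E) \<Zsemi> (\<iota> A \<odot>\<^sub>a symm M B D \<odot>\<^sub>a \<iota> E) = in1 A D \<odot>\<^sub>a in1 B E"
    and "in2 (A \<odot> B) (D \<odot> E) \<Zsemi> (\<iota> A \<odot>\<^sub>a symm M B D \<odot>\<^sub>a \<iota> E) = in2 A D \<odot>\<^sub>a in2 B E"
proof -
  let ?m = "\<iota> A \<odot>\<^sub>a symm M B D \<odot>\<^sub>a \<iota> E"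
  note in_in [simp] in_in_assoc [simp]
  have "in1 B (D \<odot> E) \<Zsemi> (symm M B D \<odot>\<^sub>a \<iota> E) = in1 B D \<Zsemi> (in1 (B \<odot> D) E \<Zsemi> (symm M B D \<odot>\<^sub>a \<iota> E))"
    by (rule in1_in1_assoc[symmetric]) simp_all
  also have "\<dots> = in2 D B \<Zsemi> in1 (D \<odot> B) E"
    by (simp del: in_in in_in_assoc)
  finally have a: "in1 B (D \<odot> E) \<Zsemi> (symm M B D \<odot>\<^sub>a \<iota> E) = in2 D B \<Zsemi> in1 (D \<odot> B) E" .
  have "in1 B (D \<odot> E) \<Zsemi> (in2 A (B \<odot> (D \<odot> E)) \<Zsemi> ?m) = (in1 B (D \<odot> E) \<Zsemi> (symm M B D \<odot>\<^sub>a \<iota> E)) \<Zsemi> in2 A (D \<odot> (B \<odot> E))"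
    by (simp del: in_in in_in_assoc)
  then have 2: "in2 A B \<Zsemi> (in1 (A \<odot> B) (D \<odot> E) \<Zsemi> ?m) = in2 A B \<Zsemi> (in1 A D \<odot>\<^sub>a in1 B E)"
    unfolding a using in1_in2_assoc[of A B "D \<odot> E" ?m "B \<odot> (D \<odot> E)"] by simp
  show "in1 (A \<odot> B) (D \<odot> E) \<Zsemi> ?m = in1 A D \<odot>\<^sub>a in1 B E"
    by (rule coprod_ext[of A B]) (simp_all only: 2, simp_all)
  have b: "in1 D E \<Zsemi> (in2 B (D \<odot> E) \<Zsemi> (symm M B D \<odot>\<^sub>a \<iota> E)) = in1 D (B \<odot> E)"
    by simp
  have b': "in2 D E \<Zsemi> (in2 B (D \<odot> E) \<Zsemi> (symm M B D \<odot>\<^sub>a \<iota> E)) = in2 (D \<odot> B) E"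
    by simp
  have c: "in2 (A \<odot> B) (D \<odot> E) \<Zsemi> ?m = (in2 B (D \<odot> E) \<Zsemi> (symm M B D \<odot>\<^sub>a \<iota> E)) \<Zsemi> in2 A (D \<odot> (B \<odot> E))"
  proof -
    have "in2 (A \<odot> B) (D \<odot> E) \<Zsemi> ?m = in2 B (D \<odot> E) \<Zsemi> (in2 A (B \<odot> (D \<odot> E)) \<Zsemi> ?m)"
      by (simp only: in2_in2_assoc[of A B "D \<odot> E" ?m "B \<odot> (D \<odot> E)"] assms tar_simps tob_Obj Id_simps symm_simps tob_assoc refl)
    then show ?thesis by (simp del: in_in in_in_assoc)
  qed
  show "in2 (A \<odot> B) (D \<odot> E) \<Zsemi> ?m = in2 A D \<odot>\<^sub>a in2 B E"
  proof (rule coprod_ext[of D E])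
    have "in1 D E \<Zsemi> (in2 (A \<odot> B) (D \<odot> E) \<Zsemi> ?m) = (in1 D E \<Zsemi> (in2 B (D \<odot> E) \<Zsemi> (symm M B D \<odot>\<^sub>a \<iota> E))) \<Zsemi> in2 A (D \<odot> (B \<odot> E))"
      unfolding c by (simp del: in_in in_in_assoc)
    then show "in1 D E \<Zsemi> (in2 (A \<odot> B) (D \<odot> E) \<Zsemi> ?m) = in1 D E \<Zsemi> (in2 A D \<odot>\<^sub>a in2 B E)"
      unfolding b by simp
    have "in2 D E \<Zsemi> (in2 (A \<odot> B) (D \<odot> E) \<Zsemi> ?m) = (in2 D E \<Zsemi> (in2 B (D \<odot> E) \<Zsemi> (symm M B D \<odot>\<^sub>a \<iota> E))) \<Zsemi> in2 A (D \<odot> (B \<odot> E))"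
      unfolding c by (simp del: in_in in_in_assoc)
    then show "in2 D E \<Zsemi> (in2 (A \<odot> B) (D \<odot> E) \<Zsemi> ?m) = in2 D E \<Zsemi> (in2 A D \<odot>\<^sub>a in2 B E)"
      unfolding b' by simp
  qed simp_all
qed

end

section \<open>Distributive categories are rig categories\<close>

text \<open>The inverse distributor is a parameter because the syntax names it, as \<open>tdistl_inv\<close>.\<close>

locale dist_rig = rig_syntax R + S: strict_cocart "rcat R" "rsum R" "rnabla R" "rcobang R" + P: strict_smc "rcat R" "rprod R"
  for R :: "('o, 'a, 'z) fc_rig_scheme" +
  fixes dli :: "'o \<Rightarrow> 'o \<Rightarrow> 'o \<Rightarrow> 'a"
  assumes distr_ob [simp]: "X \<in> Ob \<Longrightarrow> Y \<in> Ob \<Longrightarrow> Z \<in> Ob \<Longrightarrow> (X \<oplus> Y) \<otimes> Z = (X \<otimes> Z) \<oplus> (Y \<otimes> Z)"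
    and annl_ob [simp]: "X \<in> Ob \<Longrightarrow> \<zero> \<otimes> X = \<zero>"
    and annr_ob [simp]: "X \<in> Ob \<Longrightarrow> X \<otimes> \<zero> = \<zero>"
    and distr_Id [simp]: "X \<in> Ob \<Longrightarrow> Y \<in> Ob \<Longrightarrow> Z \<in> Ob \<Longrightarrow> \<delta>\<^sub>r X Y Z = \<iota> ((X \<otimes> Z) \<oplus> (Y \<otimes> Z))"
    and annl_Id [simp]: "X \<in> Ob \<Longrightarrow> l\<^sub>0 X = \<iota> \<zero>"
    and annr_Id [simp]: "X \<in> Ob \<Longrightarrow> r\<^sub>0 X = \<iota> \<zero>"
    and in_prod: "X \<in> Ob \<Longrightarrow> Y \<in> Ob \<Longrightarrow> Z \<in> Ob \<Longrightarrow> S.in1 X Y \<otimes>\<^sub>a \<iota> Z = S.in1 (X \<otimes> Z) (Y \<otimes> Z)"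
      "X \<in> Ob \<Longrightarrow> Y \<in> Ob \<Longrightarrow> Z \<in> Ob \<Longrightarrow> S.in2 X Y \<otimes>\<^sub>a \<iota> Z = S.in2 (X \<otimes> Z) (Y \<otimes> Z)"
    and dl_Hom: "X \<in> Ob \<Longrightarrow> Y \<in> Ob \<Longrightarrow> Z \<in> Ob \<Longrightarrow> \<delta>\<^sub>l X Y Z \<in> hom (X \<otimes> (Y \<oplus> Z)) ((X \<otimes> Y) \<oplus> (X \<otimes> Z))"
    and dli_Hom: "X \<in> Ob \<Longrightarrow> Y \<in> Ob \<Longrightarrow> Z \<in> Ob \<Longrightarrow> dli X Y Z \<in> hom ((X \<otimes> Y) \<oplus> (X \<otimes> Z)) (X \<otimes> (Y \<oplus> Z))"
    and dl_dli: "X \<in> Ob \<Longrightarrow> Y \<in> Ob \<Longrightarrow> Z \<in> Ob \<Longrightarrow> \<delta>\<^sub>l X Y Z \<Zsemi> dli X Y Z = \<iota> (X \<otimes> (Y \<oplus> Z))"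
    and dli_dl: "X \<in> Ob \<Longrightarrow> Y \<in> Ob \<Longrightarrow> Z \<in> Ob \<Longrightarrow> dli X Y Z \<Zsemi> \<delta>\<^sub>l X Y Z = \<iota> ((X \<otimes> Y) \<oplus> (X \<otimes> Z))"
    and prod_in_dl: "X \<in> Ob \<Longrightarrow> Y \<in> Ob \<Longrightarrow> Z \<in> Ob \<Longrightarrow> (\<iota> X \<otimes>\<^sub>a S.in1 Y Z) \<Zsemi> \<delta>\<^sub>l X Y Z = S.in1 (X \<otimes> Y) (X \<otimes> Z)"
       "X \<in> Ob \<Longrightarrow> Y \<in> Ob \<Longrightarrow> Z \<in> Ob \<Longrightarrow> (\<iota> X \<otimes>\<^sub>a S.in2 Y Z) \<Zsemi> \<delta>\<^sub>l X Y Z = S.in2 (X \<otimes> Y) (X \<otimes> Z)"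
begin

lemma dl_simps [simp]:
  assumes "X \<in> Ob" "Y \<in> Ob" "Z \<in> Ob"
  shows "\<delta>\<^sub>l X Y Z \<in> Arr (rcat R)" "Dom (rcat R) (\<delta>\<^sub>l X Y Z) = X \<otimes> (Y \<oplus> Z)" "Cod (rcat R) (\<delta>\<^sub>l X Y Z) = (X \<otimes> Y) \<oplus> (X \<otimes> Z)"
    "dli X Y Z \<in> Arr (rcat R)" "Cod (rcat R) (dli X Y Z) = X \<otimes> (Y \<oplus> Z)" "Dom (rcat R) (dli X Y Z) = (X \<otimes> Y) \<oplus> (X \<otimes> Z)"
  using HomD[OF dl_Hom[OF assms]] HomD[OF dli_Hom[OF assms]] by auto

lemma in_dli:
  assumes [simp]: "X \<in> Ob" "Y \<in> Ob" "Z \<in> Ob"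
  shows "S.in1 (X \<otimes> Y) (X \<otimes> Z) \<Zsemi> dli X Y Z = \<iota> X \<otimes>\<^sub>a S.in1 Y Z"
    "S.in2 (X \<otimes> Y) (X \<otimes> Z) \<Zsemi> dli X Y Z = \<iota> X \<otimes>\<^sub>a S.in2 Y Z"
  unfolding prod_in_dl[OF assms, symmetric] by (simp_all add: dl_dli)

text \<open>The whiskered injections are the coproduct injections followed by the isomorphism
  \<open>dli X Y Z\<close> (\<open>in_dli\<close>), hence jointly epic. Most conditions on the left
  distributor are tested with this rule.\<close>

lemma dl_ext:
  assumes "(\<iota> X \<otimes>\<^sub>a S.in1 Y Z) \<Zsemi> f = (\<iota> X \<otimes>\<^sub>a S.in1 Y Z) \<Zsemi> g" "(\<iota> X \<otimes>\<^sub>a S.in2 Y Z) \<Zsemi> f = (\<iota> X \<otimes>\<^sub>a S.in2 Y Z) \<Zsemi> g"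
    and [simp]: "f \<in> Arr (rcat R)" "g \<in> Arr (rcat R)" "X \<in> Ob" "Y \<in> Ob" "Z \<in> Ob"
    and D [simp]: "Dom (rcat R) f = X \<otimes> (Y \<oplus> Z)" "Dom (rcat R) g = X \<otimes> (Y \<oplus> Z)" and E: "Cod (rcat R) f = Cod (rcat R) g"
  shows "f = g"
proof -
  have *: "S.in1 (X \<otimes> Y) (X \<otimes> Z) \<Zsemi> (dli X Y Z \<Zsemi> h) = (\<iota> X \<otimes>\<^sub>a S.in1 Y Z) \<Zsemi> h"
    "S.in2 (X \<otimes> Y) (X \<otimes> Z) \<Zsemi> (dli X Y Z \<Zsemi> h) = (\<iota> X \<otimes>\<^sub>a S.in2 Y Z) \<Zsemi> h"
    if "h \<in> Arr (rcat R)" "Dom (rcat R) h = X \<otimes> (Y \<oplus> Z)" for h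
    unfolding in_dli[OF assms(5-7), symmetric] using that by simp_all
  have "dli X Y Z \<Zsemi> f = dli X Y Z \<Zsemi> g"
    by (rule S.coprod_ext[of "X \<otimes> Y" "X \<otimes> Z"]) (simp_all add: * assms(1,2) E)
  then have "\<delta>\<^sub>l X Y Z \<Zsemi> (dli X Y Z \<Zsemi> f) = \<delta>\<^sub>l X Y Z \<Zsemi> (dli X Y Z \<Zsemi> g)" by simp
  moreover have "\<delta>\<^sub>l X Y Z \<Zsemi> (dli X Y Z \<Zsemi> h) = h"
    if "h \<in> Arr (rcat R)" "Dom (rcat R) h = X \<otimes> (Y \<oplus> Z)" for h
    using that dl_dli[of X Y Z] S.Comp_assoc_simp[of "\<delta>\<^sub>l X Y Z" "dli X Y Z" h] by simp
  ultimately show ?thesis by simp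
qed

lemma prod_in_dl_gen:
  assumes "X \<in> Ob" "Y \<in> Ob" "Z \<in> Ob" "f \<in> Arr (rcat R)" "Cod (rcat R) f = X"
  shows "(f \<otimes>\<^sub>a S.in1 Y Z) \<Zsemi> \<delta>\<^sub>l X Y Z = (f \<otimes>\<^sub>a \<iota> Y) \<Zsemi> S.in1 (X \<otimes> Y) (X \<otimes> Z)"
    "(f \<otimes>\<^sub>a S.in2 Y Z) \<Zsemi> \<delta>\<^sub>l X Y Z = (f \<otimes>\<^sub>a \<iota> Z) \<Zsemi> S.in2 (X \<otimes> Y) (X \<otimes> Z)"
  using assms by (simp_all add: prod_in_dl[symmetric])

lemma in_prod_Comp:
  assumes "X \<in> Ob" "Y \<in> Ob" "f \<in> Arr (rcat R)" "Dom (rcat R) f = X \<oplus> Y" "g \<in> Arr (rcat R)" "Dom (rcat R) g = Z"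
  shows "S.in1 (X \<otimes> Z) (Y \<otimes> Z) \<Zsemi> (f \<otimes>\<^sub>a g) = (S.in1 X Y \<Zsemi> f) \<otimes>\<^sub>a g"
    "S.in2 (X \<otimes> Z) (Y \<otimes> Z) \<Zsemi> (f \<otimes>\<^sub>a g) = (S.in2 X Y \<Zsemi> f) \<otimes>\<^sub>a g"
proof -
  have "Z \<in> Ob" using assms by auto
  then show "S.in1 (X \<otimes> Z) (Y \<otimes> Z) \<Zsemi> (f \<otimes>\<^sub>a g) = (S.in1 X Y \<Zsemi> f) \<otimes>\<^sub>a g"
    "S.in2 (X \<otimes> Z) (Y \<otimes> Z) \<Zsemi> (f \<otimes>\<^sub>a g) = (S.in2 X Y \<Zsemi> f) \<otimes>\<^sub>a g"
    unfolding in_prod[OF assms(1,2) \<open>Z \<in> Ob\<close>, symmetric] using assms by simp_all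
qed

text \<open>This is naturality of the right distributor, which is an identity here. It holds because
  right whiskering preserves injections (\<open>in_prod\<close>), and it is tested on them.\<close>

lemma sum_prod:
  assumes [simp]: "f \<in> Arr (rcat R)" "g \<in> Arr (rcat R)" "h \<in> Arr (rcat R)"
  shows "(f \<oplus>\<^sub>a g) \<otimes>\<^sub>a h = (f \<otimes>\<^sub>a h) \<oplus>\<^sub>a (g \<otimes>\<^sub>a h)"
proof -
  let ?X = "Dom (rcat R) f" let ?Y = "Dom (rcat R) g" let ?Z = "Dom (rcat R) h"
  have k: "(k \<Zsemi> S.in1 (Cod (rcat R) f) (Cod (rcat R) g)) \<otimes>\<^sub>a h = (k \<otimes>\<^sub>a h) \<Zsemi> S.in1 (Cod (rcat R) f \<otimes> Cod (rcat R) h) (Cod (rcat R) g \<otimes> Cod (rcat R) h)"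
    if "k \<in> Arr (rcat R)" "Cod (rcat R) k = Cod (rcat R) f" for k
    using that by (simp add: in_prod[symmetric])
  have k': "(k \<Zsemi> S.in2 (Cod (rcat R) f) (Cod (rcat R) g)) \<otimes>\<^sub>a h = (k \<otimes>\<^sub>a h) \<Zsemi> S.in2 (Cod (rcat R) f \<otimes> Cod (rcat R) h) (Cod (rcat R) g \<otimes> Cod (rcat R) h)"
    if "k \<in> Arr (rcat R)" "Cod (rcat R) k = Cod (rcat R) g" for k
    using that by (simp add: in_prod[symmetric])
  show ?thesis
    by (rule S.coprod_ext[of "?X \<otimes> ?Z" "?Y \<otimes> ?Z"]) (simp_all add: in_prod_Comp k k')
qed

text \<open>By \<open>prod_in_dl\<close> the distributor turns whiskered injections into injections;
  along each of them both sides become \<open>f\<close> tensored with one component, followed by an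
  injection.\<close>

lemma dl_nat:
  assumes [simp]: "f \<in> Arr (rcat R)" "g \<in> Arr (rcat R)" "h \<in> Arr (rcat R)"
  shows "(f \<otimes>\<^sub>a (g \<oplus>\<^sub>a h)) \<Zsemi> \<delta>\<^sub>l (Cod (rcat R) f) (Cod (rcat R) g) (Cod (rcat R) h) =
    \<delta>\<^sub>l (Dom (rcat R) f) (Dom (rcat R) g) (Dom (rcat R) h) \<Zsemi> ((f \<otimes>\<^sub>a g) \<oplus>\<^sub>a (f \<otimes>\<^sub>a h))"
proof -
  have "(f \<otimes>\<^sub>a (g \<Zsemi> S.in1 (Cod (rcat R) g) (Cod (rcat R) h))) \<Zsemi> \<delta>\<^sub>l (Cod (rcat R) f) (Cod (rcat R) g) (Cod (rcat R) h) =
    ((f \<otimes>\<^sub>a g) \<Zsemi> (\<iota> (Cod (rcat R) f) \<otimes>\<^sub>a S.in1 (Cod (rcat R) g) (Cod (rcat R) h))) \<Zsemi> \<delta>\<^sub>l (Cod (rcat R) f) (Cod (rcat R) g) (Cod (rcat R) h)" by simp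
  also have "\<dots> = (f \<otimes>\<^sub>a g) \<Zsemi> S.in1 (Cod (rcat R) f \<otimes> Cod (rcat R) g) (Cod (rcat R) f \<otimes> Cod (rcat R) h)"
    by (simp add: prod_in_dl del: P.tar_fuse P.tar_fuse_assoc)
  finally have 1: "(f \<otimes>\<^sub>a (g \<Zsemi> S.in1 (Cod (rcat R) g) (Cod (rcat R) h))) \<Zsemi> \<delta>\<^sub>l (Cod (rcat R) f) (Cod (rcat R) g) (Cod (rcat R) h) =
    (f \<otimes>\<^sub>a g) \<Zsemi> S.in1 (Cod (rcat R) f \<otimes> Cod (rcat R) g) (Cod (rcat R) f \<otimes> Cod (rcat R) h)" .
  have "(f \<otimes>\<^sub>a (h \<Zsemi> S.in2 (Cod (rcat R) g) (Cod (rcat R) h))) \<Zsemi> \<delta>\<^sub>l (Cod (rcat R) f) (Cod (rcat R) g) (Cod (rcat R) h) =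
    ((f \<otimes>\<^sub>a h) \<Zsemi> (\<iota> (Cod (rcat R) f) \<otimes>\<^sub>a S.in2 (Cod (rcat R) g) (Cod (rcat R) h))) \<Zsemi> \<delta>\<^sub>l (Cod (rcat R) f) (Cod (rcat R) g) (Cod (rcat R) h)" by simp
  also have "\<dots> = (f \<otimes>\<^sub>a h) \<Zsemi> S.in2 (Cod (rcat R) f \<otimes> Cod (rcat R) g) (Cod (rcat R) f \<otimes> Cod (rcat R) h)"
    by (simp add: prod_in_dl del: P.tar_fuse P.tar_fuse_assoc)
  finally have 2: "(f \<otimes>\<^sub>a (h \<Zsemi> S.in2 (Cod (rcat R) g) (Cod (rcat R) h))) \<Zsemi> \<delta>\<^sub>l (Cod (rcat R) f) (Cod (rcat R) g) (Cod (rcat R) h) =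
    (f \<otimes>\<^sub>a h) \<Zsemi> S.in2 (Cod (rcat R) f \<otimes> Cod (rcat R) g) (Cod (rcat R) f \<otimes> Cod (rcat R) h)" .
  have a: "(\<iota> (Dom (rcat R) f) \<otimes>\<^sub>a k) \<Zsemi> (\<delta>\<^sub>l (Dom (rcat R) f) (Dom (rcat R) g) (Dom (rcat R) h) \<Zsemi> ((f \<otimes>\<^sub>a g) \<oplus>\<^sub>a (f \<otimes>\<^sub>a h))) =
    ((\<iota> (Dom (rcat R) f) \<otimes>\<^sub>a k) \<Zsemi> \<delta>\<^sub>l (Dom (rcat R) f) (Dom (rcat R) g) (Dom (rcat R) h)) \<Zsemi> ((f \<otimes>\<^sub>a g) \<oplus>\<^sub>a (f \<otimes>\<^sub>a h))"
    if "k \<in> Arr (rcat R)" "Cod (rcat R) k = Dom (rcat R) g \<oplus> Dom (rcat R) h" for k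
    using that by simp
  show ?thesis
    by (rule dl_ext[of "Dom (rcat R) f" "Dom (rcat R) g" "Dom (rcat R) h"]) (simp_all add: a prod_in_dl 1 2)
qed

section \<open>Laplaza's conditions, tested on injections\<close>

lemma in_symm_prod:
  assumes [simp]: "X \<in> Ob" "Y \<in> Ob" "Z \<in> Ob"
  shows "S.in1 (X \<otimes> Z) (Y \<otimes> Z) \<Zsemi> \<sigma>\<^sub>p (X \<oplus> Y) Z = \<sigma>\<^sub>p X Z \<Zsemi> (\<iota> Z \<otimes>\<^sub>a S.in1 X Y)"
    "S.in2 (X \<otimes> Z) (Y \<otimes> Z) \<Zsemi> \<sigma>\<^sub>p (X \<oplus> Y) Z = \<sigma>\<^sub>p Y Z \<Zsemi> (\<iota> Z \<otimes>\<^sub>a S.in2 X Y)"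
  unfolding in_prod[OF assms, symmetric] by (simp_all add: P.symm_nat)

lemma prod_in_dl_Comp:
  assumes "X \<in> Ob" "Y \<in> Ob" "Z \<in> Ob" "h \<in> Arr (rcat R)" "Dom (rcat R) h = (X \<otimes> Y) \<oplus> (X \<otimes> Z)"
  shows "(\<iota> X \<otimes>\<^sub>a S.in1 Y Z) \<Zsemi> (\<delta>\<^sub>l X Y Z \<Zsemi> h) = S.in1 (X \<otimes> Y) (X \<otimes> Z) \<Zsemi> h"
    "(\<iota> X \<otimes>\<^sub>a S.in2 Y Z) \<Zsemi> (\<delta>\<^sub>l X Y Z \<Zsemi> h) = S.in2 (X \<otimes> Y) (X \<otimes> Z) \<Zsemi> h"
  unfolding prod_in_dl[OF assms(1-3), symmetric] using assms by simp_all

text \<open>The numbers in these names are those of \<open>laplaza_1\<close> to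
  \<open>laplaza_24\<close>. Condition 2 ties the left distributor to the symmetry; it is used again
  to compute symmetries in \<open>symm_npow\<close> and \<open>ti_tsym_prod\<close>.\<close>

lemma lap2:
  assumes [simp]: "X \<in> Ob" "Y \<in> Ob" "Z \<in> Ob"
  shows "\<sigma>\<^sub>p (X \<oplus> Y) Z \<Zsemi> \<delta>\<^sub>l Z X Y = \<sigma>\<^sub>p X Z \<oplus>\<^sub>a \<sigma>\<^sub>p Y Z"
proof (rule S.coprod_ext[of "X \<otimes> Z" "Y \<otimes> Z"])
  show "S.in1 (X \<otimes> Z) (Y \<otimes> Z) \<Zsemi> (\<sigma>\<^sub>p (X \<oplus> Y) Z \<Zsemi> \<delta>\<^sub>l Z X Y) = S.in1 (X \<otimes> Z) (Y \<otimes> Z) \<Zsemi> (\<sigma>\<^sub>p X Z \<oplus>\<^sub>a \<sigma>\<^sub>p Y Z)"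
    using S.Comp_eq_extend[OF in_symm_prod(1)[OF assms], of "\<delta>\<^sub>l Z X Y"] by (simp add: prod_in_dl)
  show "S.in2 (X \<otimes> Z) (Y \<otimes> Z) \<Zsemi> (\<sigma>\<^sub>p (X \<oplus> Y) Z \<Zsemi> \<delta>\<^sub>l Z X Y) = S.in2 (X \<otimes> Z) (Y \<otimes> Z) \<Zsemi> (\<sigma>\<^sub>p X Z \<oplus>\<^sub>a \<sigma>\<^sub>p Y Z)"
    using S.Comp_eq_extend[OF in_symm_prod(2)[OF assms], of "\<delta>\<^sub>l Z X Y"] by (simp add: prod_in_dl)
qed simp_all

lemma lap1:
  assumes [simp]: "X \<in> Ob" "Y \<in> Ob" "Z \<in> Ob"
  shows "(\<iota> X \<otimes>\<^sub>a \<sigma>\<^sub>s Y Z) \<Zsemi> \<delta>\<^sub>l X Z Y = \<delta>\<^sub>l X Y Z \<Zsemi> \<sigma>\<^sub>s (X \<otimes> Y) (X \<otimes> Z)"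
  by (rule dl_ext[of X Y Z]) (simp_all add: prod_in_dl prod_in_dl_Comp)

lemma lap3:
  assumes [simp]: "X \<in> Ob" "Y \<in> Ob" "Z \<in> Ob"
  shows "\<sigma>\<^sub>s X Y \<otimes>\<^sub>a \<iota> Z = \<sigma>\<^sub>s (X \<otimes> Z) (Y \<otimes> Z)"
  by (rule S.coprod_ext[of "X \<otimes> Z" "Y \<otimes> Z"]) (simp_all add: in_prod_Comp in_prod)

text \<open>The domain is a product with a threefold sum, so the second whiskered injection still
  leaves a product with a sum of two, to which \<open>dl_ext\<close> is applied once more.\<close>

lemma lap5:
  assumes [simp]: "W \<in> Ob" "X \<in> Ob" "Y \<in> Ob" "Z \<in> Ob"
  shows "\<delta>\<^sub>l W X (Y \<oplus> Z) \<Zsemi> (\<iota> (W \<otimes> X) \<oplus>\<^sub>a \<delta>\<^sub>l W Y Z) = \<delta>\<^sub>l W (X \<oplus> Y) Z \<Zsemi> (\<delta>\<^sub>l W X Y \<oplus>\<^sub>a \<iota> (W \<otimes> Z))"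
    (is "?l = ?r")
proof (rule dl_ext[of W X "Y \<oplus> Z"])
  have w: "(\<iota> W \<otimes>\<^sub>a (f \<Zsemi> g)) \<Zsemi> h = (\<iota> W \<otimes>\<^sub>a f) \<Zsemi> ((\<iota> W \<otimes>\<^sub>a g) \<Zsemi> h)"
    if "f \<in> Arr (rcat R)" "g \<in> Arr (rcat R)" "h \<in> Arr (rcat R)" "Cod (rcat R) f = Dom (rcat R) g" "Dom (rcat R) h = W \<otimes> Cod (rcat R) g" for f g h
    using that by simp
  have "(\<iota> W \<otimes>\<^sub>a (S.in1 X Y \<Zsemi> S.in1 (X \<oplus> Y) Z)) \<Zsemi> ?r = S.in1 (W \<otimes> X) ((W \<otimes> Y) \<oplus> (W \<otimes> Z))"
    by (subst w) (simp_all add: prod_in_dl prod_in_dl_Comp S.in1_in1 del: P.tar_fuse P.tar_fuse_assoc)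
  then show "(\<iota> W \<otimes>\<^sub>a S.in1 X (Y \<oplus> Z)) \<Zsemi> ?l = (\<iota> W \<otimes>\<^sub>a S.in1 X (Y \<oplus> Z)) \<Zsemi> ?r"
    by (simp add: prod_in_dl prod_in_dl_Comp S.in1_in1)
  have l: "(\<iota> W \<otimes>\<^sub>a S.in2 X (Y \<oplus> Z)) \<Zsemi> ?l = \<delta>\<^sub>l W Y Z \<Zsemi> S.in2 (W \<otimes> X) ((W \<otimes> Y) \<oplus> (W \<otimes> Z))"
    by (simp add: prod_in_dl prod_in_dl_Comp S.in1_in1)
  have "(\<iota> W \<otimes>\<^sub>a S.in2 X (Y \<oplus> Z)) \<Zsemi> ?r = \<delta>\<^sub>l W Y Z \<Zsemi> S.in2 (W \<otimes> X) ((W \<otimes> Y) \<oplus> (W \<otimes> Z))"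
  proof (rule dl_ext[of W Y Z])
    have "(\<iota> W \<otimes>\<^sub>a (S.in2 X Y \<Zsemi> S.in1 (X \<oplus> Y) Z)) \<Zsemi> ?r = S.in2 (W \<otimes> X) (W \<otimes> Y) \<Zsemi> S.in1 ((W \<otimes> X) \<oplus> (W \<otimes> Y)) (W \<otimes> Z)"
      by (subst w) (simp_all add: prod_in_dl prod_in_dl_Comp del: P.tar_fuse P.tar_fuse_assoc)
    then show "(\<iota> W \<otimes>\<^sub>a S.in1 Y Z) \<Zsemi> ((\<iota> W \<otimes>\<^sub>a S.in2 X (Y \<oplus> Z)) \<Zsemi> ?r) = (\<iota> W \<otimes>\<^sub>a S.in1 Y Z) \<Zsemi> (\<delta>\<^sub>l W Y Z \<Zsemi> S.in2 (W \<otimes> X) ((W \<otimes> Y) \<oplus> (W \<otimes> Z)))"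
      by (simp add: prod_in_dl_Comp S.in1_in2)
    show "(\<iota> W \<otimes>\<^sub>a S.in2 Y Z) \<Zsemi> ((\<iota> W \<otimes>\<^sub>a S.in2 X (Y \<oplus> Z)) \<Zsemi> ?r) = (\<iota> W \<otimes>\<^sub>a S.in2 Y Z) \<Zsemi> (\<delta>\<^sub>l W Y Z \<Zsemi> S.in2 (W \<otimes> X) ((W \<otimes> Y) \<oplus> (W \<otimes> Z)))"
      by (simp add: prod_in_dl_Comp S.in2_in2)
  qed simp_all
  then show "(\<iota> W \<otimes>\<^sub>a S.in2 X (Y \<oplus> Z)) \<Zsemi> ?l = (\<iota> W \<otimes>\<^sub>a S.in2 X (Y \<oplus> Z)) \<Zsemi> ?r"
    unfolding l by simp
qed simp_all

lemma lap6:
  assumes [simp]: "W \<in> Ob" "X \<in> Ob" "Y \<in> Ob" "Z \<in> Ob"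
  shows "(\<iota> W \<otimes>\<^sub>a \<delta>\<^sub>l X Y Z) \<Zsemi> \<delta>\<^sub>l W (X \<otimes> Y) (X \<otimes> Z) = \<delta>\<^sub>l (W \<otimes> X) Y Z"
proof (rule dl_ext[of "W \<otimes> X" Y Z])
  have i: "\<iota> (W \<otimes> X) \<otimes>\<^sub>a k = \<iota> W \<otimes>\<^sub>a (\<iota> X \<otimes>\<^sub>a k)" if "k \<in> Arr (rcat R)" for k
    using that P.tar_assoc[of "\<iota> W" "\<iota> X" k] by simp
  show "(\<iota> (W \<otimes> X) \<otimes>\<^sub>a S.in1 Y Z) \<Zsemi> ((\<iota> W \<otimes>\<^sub>a \<delta>\<^sub>l X Y Z) \<Zsemi> \<delta>\<^sub>l W (X \<otimes> Y) (X \<otimes> Z)) = (\<iota> (W \<otimes> X) \<otimes>\<^sub>a S.in1 Y Z) \<Zsemi> \<delta>\<^sub>l (W \<otimes> X) Y Z"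
    unfolding prod_in_dl(1)[of "W \<otimes> X" Y Z, simplified] by (simp add: i prod_in_dl)
  show "(\<iota> (W \<otimes> X) \<otimes>\<^sub>a S.in2 Y Z) \<Zsemi> ((\<iota> W \<otimes>\<^sub>a \<delta>\<^sub>l X Y Z) \<Zsemi> \<delta>\<^sub>l W (X \<otimes> Y) (X \<otimes> Z)) = (\<iota> (W \<otimes> X) \<otimes>\<^sub>a S.in2 Y Z) \<Zsemi> \<delta>\<^sub>l (W \<otimes> X) Y Z"
    unfolding prod_in_dl(2)[of "W \<otimes> X" Y Z, simplified] by (simp add: i prod_in_dl)
qed simp_all

lemma lap8:
  assumes [simp]: "W \<in> Ob" "X \<in> Ob" "Y \<in> Ob" "Z \<in> Ob"
  shows "\<delta>\<^sub>l W (X \<otimes> Z) (Y \<otimes> Z) = \<delta>\<^sub>l W X Y \<otimes>\<^sub>a \<iota> Z"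
proof (rule dl_ext[of W "X \<otimes> Z" "Y \<otimes> Z"])
  have "(\<iota> W \<otimes>\<^sub>a S.in1 (X \<otimes> Z) (Y \<otimes> Z)) \<Zsemi> (\<delta>\<^sub>l W X Y \<otimes>\<^sub>a \<iota> Z) = ((\<iota> W \<otimes>\<^sub>a S.in1 X Y) \<otimes>\<^sub>a \<iota> Z) \<Zsemi> (\<delta>\<^sub>l W X Y \<otimes>\<^sub>a \<iota> Z)"
    by (simp add: in_prod)
  also have "\<dots> = ((\<iota> W \<otimes>\<^sub>a S.in1 X Y) \<Zsemi> \<delta>\<^sub>l W X Y) \<otimes>\<^sub>a \<iota> Z" by (subst P.tar_fuse) simp_all
  finally show "(\<iota> W \<otimes>\<^sub>a S.in1 (X \<otimes> Z) (Y \<otimes> Z)) \<Zsemi> \<delta>\<^sub>l W (X \<otimes> Z) (Y \<otimes> Z) = (\<iota> W \<otimes>\<^sub>a S.in1 (X \<otimes> Z) (Y \<otimes> Z)) \<Zsemi> (\<delta>\<^sub>l W X Y \<otimes>\<^sub>a \<iota> Z)"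
    by (simp add: prod_in_dl in_prod)
  have "(\<iota> W \<otimes>\<^sub>a S.in2 (X \<otimes> Z) (Y \<otimes> Z)) \<Zsemi> (\<delta>\<^sub>l W X Y \<otimes>\<^sub>a \<iota> Z) = ((\<iota> W \<otimes>\<^sub>a S.in2 X Y) \<otimes>\<^sub>a \<iota> Z) \<Zsemi> (\<delta>\<^sub>l W X Y \<otimes>\<^sub>a \<iota> Z)"
    by (simp add: in_prod)
  also have "\<dots> = ((\<iota> W \<otimes>\<^sub>a S.in2 X Y) \<Zsemi> \<delta>\<^sub>l W X Y) \<otimes>\<^sub>a \<iota> Z" by (subst P.tar_fuse) simp_all
  finally show "(\<iota> W \<otimes>\<^sub>a S.in2 (X \<otimes> Z) (Y \<otimes> Z)) \<Zsemi> \<delta>\<^sub>l W (X \<otimes> Z) (Y \<otimes> Z) = (\<iota> W \<otimes>\<^sub>a S.in2 (X \<otimes> Z) (Y \<otimes> Z)) \<Zsemi> (\<delta>\<^sub>l W X Y \<otimes>\<^sub>a \<iota> Z)"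
    by (simp add: prod_in_dl in_prod)
qed simp_all

text \<open>The distributor turns whiskered injections into outer injections, and
  \<open>mid4_in\<close> splits these into sums of injections, which is what the right side gives
  summand by summand.\<close>

lemma lap9:
  assumes [simp]: "W \<in> Ob" "X \<in> Ob" "Y \<in> Ob" "Z \<in> Ob"
  shows "\<delta>\<^sub>l (W \<oplus> X) Y Z \<Zsemi> (\<iota> (W \<otimes> Y) \<oplus>\<^sub>a \<sigma>\<^sub>s (X \<otimes> Y) (W \<otimes> Z) \<oplus>\<^sub>a \<iota> (X \<otimes> Z)) = \<delta>\<^sub>l W Y Z \<oplus>\<^sub>a \<delta>\<^sub>l X Y Z"
proof (rule dl_ext[of "W \<oplus> X" Y Z])
  have i: "\<iota> (W \<oplus> X) \<otimes>\<^sub>a k = (\<iota> W \<otimes>\<^sub>a k) \<oplus>\<^sub>a (\<iota> X \<otimes>\<^sub>a k)" if "k \<in> Arr (rcat R)" for k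
    using that sum_prod[of "\<iota> W" "\<iota> X" k] by simp
  let ?m = "\<iota> (W \<otimes> Y) \<oplus>\<^sub>a \<sigma>\<^sub>s (X \<otimes> Y) (W \<otimes> Z) \<oplus>\<^sub>a \<iota> (X \<otimes> Z)"
  have "(\<iota> (W \<oplus> X) \<otimes>\<^sub>a S.in1 Y Z) \<Zsemi> (\<delta>\<^sub>l (W \<oplus> X) Y Z \<Zsemi> ?m) = S.in1 (W \<otimes> Y) (W \<otimes> Z) \<oplus>\<^sub>a S.in1 (X \<otimes> Y) (X \<otimes> Z)"
    using S.mid4_in(1)[of "W \<otimes> Y" "X \<otimes> Y" "W \<otimes> Z" "X \<otimes> Z"] by (subst prod_in_dl_Comp) simp_all
  also have "\<dots> = (\<iota> (W \<oplus> X) \<otimes>\<^sub>a S.in1 Y Z) \<Zsemi> (\<delta>\<^sub>l W Y Z \<oplus>\<^sub>a \<delta>\<^sub>l X Y Z)"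
    by (simp add: i prod_in_dl)
  finally show "(\<iota> (W \<oplus> X) \<otimes>\<^sub>a S.in1 Y Z) \<Zsemi> (\<delta>\<^sub>l (W \<oplus> X) Y Z \<Zsemi> ?m) = (\<iota> (W \<oplus> X) \<otimes>\<^sub>a S.in1 Y Z) \<Zsemi> (\<delta>\<^sub>l W Y Z \<oplus>\<^sub>a \<delta>\<^sub>l X Y Z)" .
  have "(\<iota> (W \<oplus> X) \<otimes>\<^sub>a S.in2 Y Z) \<Zsemi> (\<delta>\<^sub>l (W \<oplus> X) Y Z \<Zsemi> ?m) = S.in2 (W \<otimes> Y) (W \<otimes> Z) \<oplus>\<^sub>a S.in2 (X \<otimes> Y) (X \<otimes> Z)"
    using S.mid4_in(2)[of "W \<otimes> Y" "X \<otimes> Y" "W \<otimes> Z" "X \<otimes> Z"] by (subst prod_in_dl_Comp) simp_all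
  also have "\<dots> = (\<iota> (W \<oplus> X) \<otimes>\<^sub>a S.in2 Y Z) \<Zsemi> (\<delta>\<^sub>l W Y Z \<oplus>\<^sub>a \<delta>\<^sub>l X Y Z)"
    by (simp add: i prod_in_dl)
  finally show "(\<iota> (W \<oplus> X) \<otimes>\<^sub>a S.in2 Y Z) \<Zsemi> (\<delta>\<^sub>l (W \<oplus> X) Y Z \<Zsemi> ?m) = (\<iota> (W \<oplus> X) \<otimes>\<^sub>a S.in2 Y Z) \<Zsemi> (\<delta>\<^sub>l W Y Z \<oplus>\<^sub>a \<delta>\<^sub>l X Y Z)" .
qed simp_all

lemma lap23:
  assumes [simp]: "X \<in> Ob" "Y \<in> Ob"
  shows "\<delta>\<^sub>l \<one> X Y = \<iota> (X \<oplus> Y)"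
proof -
  have "S.in1 X Y \<Zsemi> \<delta>\<^sub>l \<one> X Y = S.in1 X Y" "S.in2 X Y \<Zsemi> \<delta>\<^sub>l \<one> X Y = S.in2 X Y"
    using prod_in_dl[of \<one> X Y] by simp_all
  note i = this
  show ?thesis by (rule S.coprod_ext[of X Y]) (simp_all only: i, simp_all)
qed

text \<open>When one summand is zero the injection of the other is an identity, so
  \<open>prod_in_dl\<close> itself reads off the distributor.\<close>

lemma lap19:
  assumes [simp]: "X \<in> Ob" "Y \<in> Ob"
  shows "\<delta>\<^sub>l X \<zero> Y = \<iota> (X \<otimes> Y)" "\<delta>\<^sub>l X Y \<zero> = \<iota> (X \<otimes> Y)"
  using prod_in_dl(2)[of X \<zero> Y] prod_in_dl(1)[of X Y \<zero>] by simp_all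

lemma is_rig_category: "rig_category R"
proof -
  have iso: "is_iso (rcat R) (\<delta>\<^sub>l X Y Z)" if "X \<in> Ob" "Y \<in> Ob" "Z \<in> Ob" for X Y Z
    using that by (auto simp: is_iso_def inverse_arrows_def Hom_def dl_dli dli_dl intro!: exI[of _ "dli X Y Z"])
  \<comment> \<open>Zero is initial and so has a single endomorphism; this settles several of the
    conditions about annihilators.\<close>
  have z: "f = \<iota> \<zero>" if "f \<in> Arr (rcat R)" "Dom (rcat R) f = \<zero>" "Cod (rcat R) f = \<zero>" for f
    by (rule S.initial_ext) (simp_all add: that)
  show ?thesis
  proof unfold_locales
    fix f g h X X' Y Y' Z Z' assume "f \<in> hom X X'" "g \<in> hom Y Y'" "h \<in> hom Z Z'"
    then show "(f \<otimes>\<^sub>a (g \<oplus>\<^sub>a h)) \<Zsemi> \<delta>\<^sub>l X' Y' Z' = \<delta>\<^sub>l X Y Z \<Zsemi> ((f \<otimes>\<^sub>a g) \<oplus>\<^sub>a (f \<otimes>\<^sub>a h))"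
      "((f \<oplus>\<^sub>a g) \<otimes>\<^sub>a h) \<Zsemi> \<delta>\<^sub>r X' Y' Z' = \<delta>\<^sub>r X Y Z \<Zsemi> ((f \<otimes>\<^sub>a h) \<oplus>\<^sub>a (g \<otimes>\<^sub>a h))"
      using dl_nat[of f g h] sum_prod[of f g h] by (auto simp: Hom_def)
  next
    fix W X Y Z assume [simp]: "W \<in> Ob" "X \<in> Ob" "Y \<in> Ob" "Z \<in> Ob"
    show "(\<iota> W \<otimes>\<^sub>a \<alpha>\<^sub>s X Y Z) \<Zsemi> \<delta>\<^sub>l W X (Y \<oplus> Z) \<Zsemi> (\<iota> (W \<otimes> X) \<oplus>\<^sub>a \<delta>\<^sub>l W Y Z) =
      \<delta>\<^sub>l W (X \<oplus> Y) Z \<Zsemi> (\<delta>\<^sub>l W X Y \<oplus>\<^sub>a \<iota> (W \<otimes> Z)) \<Zsemi> \<alpha>\<^sub>s (W \<otimes> X) (W \<otimes> Y) (W \<otimes> Z)"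
      using lap5[of W X Y Z] by simp
    show "\<alpha>\<^sub>p W X (Y \<oplus> Z) \<Zsemi> (\<iota> W \<otimes>\<^sub>a \<delta>\<^sub>l X Y Z) \<Zsemi> \<delta>\<^sub>l W (X \<otimes> Y) (X \<otimes> Z) =
      \<delta>\<^sub>l (W \<otimes> X) Y Z \<Zsemi> (\<alpha>\<^sub>p W X Y \<oplus>\<^sub>a \<alpha>\<^sub>p W X Z)"
      using lap6[of W X Y Z] by simp
    show "\<alpha>\<^sub>p W (X \<oplus> Y) Z \<Zsemi> (\<iota> W \<otimes>\<^sub>a \<delta>\<^sub>r X Y Z) \<Zsemi> \<delta>\<^sub>l W (X \<otimes> Z) (Y \<otimes> Z) =
      (\<delta>\<^sub>l W X Y \<otimes>\<^sub>a \<iota> Z) \<Zsemi> \<delta>\<^sub>r (W \<otimes> X) (W \<otimes> Y) Z \<Zsemi> (\<alpha>\<^sub>p W X Z \<oplus>\<^sub>a \<alpha>\<^sub>p W Y Z)"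
      using lap8[of W X Y Z] by simp
    show "\<delta>\<^sub>l (W \<oplus> X) Y Z \<Zsemi> (\<delta>\<^sub>r W X Y \<oplus>\<^sub>a \<delta>\<^sub>r W X Z) \<Zsemi> mid4\<^sub>s (W \<otimes> Y) (X \<otimes> Y) (W \<otimes> Z) (X \<otimes> Z) =
      \<delta>\<^sub>r W X (Y \<oplus> Z) \<Zsemi> (\<delta>\<^sub>l W Y Z \<oplus>\<^sub>a \<delta>\<^sub>l X Y Z)"
      using lap9[of W X Y Z] by simp
  next
    fix X Y Z assume [simp]: "X \<in> Ob" "Y \<in> Ob" "Z \<in> Ob"
    show "(\<iota> X \<otimes>\<^sub>a \<sigma>\<^sub>s Y Z) \<Zsemi> \<delta>\<^sub>l X Z Y = \<delta>\<^sub>l X Y Z \<Zsemi> \<sigma>\<^sub>s (X \<otimes> Y) (X \<otimes> Z)" by (simp add: lap1)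
    show "\<sigma>\<^sub>p (X \<oplus> Y) Z \<Zsemi> \<delta>\<^sub>l Z X Y = \<delta>\<^sub>r X Y Z \<Zsemi> (\<sigma>\<^sub>p X Z \<oplus>\<^sub>a \<sigma>\<^sub>p Y Z)" by (simp add: lap2)
    show "(\<sigma>\<^sub>s X Y \<otimes>\<^sub>a \<iota> Z) \<Zsemi> \<delta>\<^sub>r Y X Z = \<delta>\<^sub>r X Y Z \<Zsemi> \<sigma>\<^sub>s (X \<otimes> Z) (Y \<otimes> Z)" by (simp add: lap3)
    show "\<delta>\<^sub>l X Y Z \<in> hom (X \<otimes> (Y \<oplus> Z)) ((X \<otimes> Y) \<oplus> (X \<otimes> Z))" by (simp add: dl_Hom)
    show "is_iso (rcat R) (\<delta>\<^sub>l X Y Z)" by (simp add: iso)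
    show "\<delta>\<^sub>r X Y Z \<in> hom ((X \<oplus> Y) \<otimes> Z) ((X \<otimes> Z) \<oplus> (Y \<otimes> Z))" by (simp add: Hom_def)
    show "is_iso (rcat R) (\<delta>\<^sub>r X Y Z)" by (simp add: S.is_iso_Id)
  next
    fix X Y assume [simp]: "X \<in> Ob" "Y \<in> Ob"
    show "\<delta>\<^sub>l \<zero> X Y \<Zsemi> (l\<^sub>0 X \<oplus>\<^sub>a l\<^sub>0 Y) \<Zsemi> l\<^sub>s \<zero> = l\<^sub>0 (X \<oplus> Y)" by (simp add: z)
    show "\<delta>\<^sub>l X \<zero> Y \<Zsemi> (r\<^sub>0 X \<oplus>\<^sub>a \<iota> (X \<otimes> Y)) \<Zsemi> l\<^sub>s (X \<otimes> Y) = \<iota> X \<otimes>\<^sub>a l\<^sub>s Y" by (simp add: lap19)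
    show "\<delta>\<^sub>l X Y \<zero> \<Zsemi> (\<iota> (X \<otimes> Y) \<oplus>\<^sub>a r\<^sub>0 X) \<Zsemi> r\<^sub>s (X \<otimes> Y) = \<iota> X \<otimes>\<^sub>a r\<^sub>s Y" by (simp add: lap19)
    show "\<delta>\<^sub>l \<one> X Y \<Zsemi> (l\<^sub>p X \<oplus>\<^sub>a l\<^sub>p Y) = l\<^sub>p (X \<oplus> Y)" by (simp add: lap23)
  next
    fix f X X' assume "f \<in> hom X X'"
    then have [simp]: "f \<in> Arr (rcat R)" "Dom (rcat R) f = X" "Cod (rcat R) f = X'" "X \<in> Ob" "X' \<in> Ob" by (auto simp: Hom_def)
    have "\<iota> \<zero> \<otimes>\<^sub>a f = \<iota> \<zero>" "f \<otimes>\<^sub>a \<iota> \<zero> = \<iota> \<zero>" by (simp_all add: z)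
    then show "(\<iota> \<zero> \<otimes>\<^sub>a f) \<Zsemi> l\<^sub>0 X' = l\<^sub>0 X" "(f \<otimes>\<^sub>a \<iota> \<zero>) \<Zsemi> r\<^sub>0 X' = r\<^sub>0 X" by simp_all
  next
    show "\<sigma>\<^sub>p X \<zero> \<Zsemi> l\<^sub>0 X = r\<^sub>0 X" if "X \<in> Ob" for X using that by (simp add: z)
  qed (simp_all add: Hom_def S.is_iso_Id S.symmetric_monoidal_axioms P.symmetric_monoidal_axioms)
qed

end

section \<open>Quotients of syntax\<close>

text \<open>\<open>cls\<close> is written as a comprehension so that it can be exchanged for
  \<open>tape_class\<close> by rewriting when the locale is instantiated with tapes.\<close>

locale quot =
  fixes wt :: "'t \<Rightarrow> bool" and eqv :: "'t \<Rightarrow> 't \<Rightarrow> bool"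
  assumes eqv_refl: "wt t \<Longrightarrow> eqv t t"
    and eqv_sym: "eqv t u \<Longrightarrow> eqv u t"
    and eqv_trans: "eqv t u \<Longrightarrow> eqv u v \<Longrightarrow> eqv t v"
    and eqv_wt: "eqv t u \<Longrightarrow> wt t"
begin

abbreviation cls :: "'t \<Rightarrow> 't set" where "cls t \<equiv> {u. eqv t u}"

lemma cls_cong: "eqv t u \<Longrightarrow> cls t = cls u"
  by (auto intro: eqv_sym eqv_trans)

lemma eqv_rep: "wt t \<Longrightarrow> eqv t (rep (cls t))"
  using someI[of "\<lambda>x. x \<in> cls t" t] eqv_refl by (simp add: rep_def)

lemma cls_eqD: "wt t \<Longrightarrow> cls t = cls u \<Longrightarrow> eqv t u"
  using eqv_refl eqv_sym by blast

lemma cls_rep: "wt t \<Longrightarrow> cls (rep (cls t)) = cls t"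
  using cls_cong[OF eqv_rep] by simp

lemma wt_rep: "wt t \<Longrightarrow> wt (rep (cls t))"
  using eqv_wt[OF eqv_sym[OF eqv_rep]] .

end

text \<open>The axioms that \<open>circ_eq\<close> and \<open>tape_eq\<close> share. Single letters
  appear as \<open>idn [x]\<close>, although the recursive definitions of the symmetries use the
  generators \<open>CId\<close> and \<open>TId\<close>; the two differ by a unit law, which each
  instance discharges.\<close>

locale syntactic_smc = quot wt eqv
  for wt :: "'t \<Rightarrow> bool" and eqv :: "'t \<Rightarrow> 't \<Rightarrow> bool" +
  fixes L :: "'l set" and dm cd :: "'t \<Rightarrow> 'l list" and sq pr :: "'t \<Rightarrow> 't \<Rightarrow> 't" and idn :: "'l list \<Rightarrow> 't"
    and swp :: "'l \<Rightarrow> 'l \<Rightarrow> 't" and sym1 :: "'l \<Rightarrow> 'l list \<Rightarrow> 't" and symw :: "'l list \<Rightarrow> 'l list \<Rightarrow> 't"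
  assumes eqv_dm: "eqv t u \<Longrightarrow> dm t = dm u" "eqv t u \<Longrightarrow> cd t = cd u"
    and wt_dm: "wt t \<Longrightarrow> dm t \<in> lists L" "wt t \<Longrightarrow> cd t \<in> lists L"
    and sq_simps [simp]: "wt (sq t u) \<longleftrightarrow> wt t \<and> wt u \<and> cd t = dm u" "dm (sq t u) = dm t" "cd (sq t u) = cd u"
    and pr_simps [simp]: "wt (pr t u) \<longleftrightarrow> wt t \<and> wt u" "dm (pr t u) = dm t @ dm u" "cd (pr t u) = cd t @ cd u"
    and idn_simps [simp]: "P \<in> lists L \<Longrightarrow> wt (idn P)" "dm (idn P) = P" "cd (idn P) = P"
    and swp_simps [simp]: "x \<in> L \<Longrightarrow> y \<in> L \<Longrightarrow> wt (swp x y)" "dm (swp x y) = [x, y]" "cd (swp x y) = [y, x]"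
    and sym1_simps [simp]: "x \<in> L \<Longrightarrow> P \<in> lists L \<Longrightarrow> wt (sym1 x P)" "dm (sym1 x P) = x # P" "cd (sym1 x P) = P @ [x]"
    and symw_simps [simp]: "P \<in> lists L \<Longrightarrow> Q \<in> lists L \<Longrightarrow> wt (symw P Q)" "dm (symw P Q) = P @ Q" "cd (symw P Q) = Q @ P"
    and sq_cong: "eqv t t' \<Longrightarrow> eqv u u' \<Longrightarrow> cd t = dm u \<Longrightarrow> eqv (sq t u) (sq t' u')"
    and pr_cong: "eqv t t' \<Longrightarrow> eqv u u' \<Longrightarrow> eqv (pr t u) (pr t' u')"
    and sq_assoc: "wt (sq (sq t u) v) \<Longrightarrow> eqv (sq (sq t u) v) (sq t (sq u v))"
    and idn_sq: "wt t \<Longrightarrow> eqv (sq (idn (dm t)) t) t"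
    and sq_idn: "wt t \<Longrightarrow> eqv (sq t (idn (cd t))) t"
    and pr_assoc: "wt t \<Longrightarrow> wt u \<Longrightarrow> wt v \<Longrightarrow> eqv (pr (pr t u) v) (pr t (pr u v))"
    and idn_pr: "wt t \<Longrightarrow> eqv (pr (idn []) t) t"
    and pr_idn: "wt t \<Longrightarrow> eqv (pr t (idn [])) t"
    and pr_idn_idn: "P \<in> lists L \<Longrightarrow> Q \<in> lists L \<Longrightarrow> eqv (pr (idn P) (idn Q)) (idn (P @ Q))"
    and sq_pr: "wt (sq t u) \<Longrightarrow> wt (sq t' u') \<Longrightarrow> eqv (sq (pr t t') (pr u u')) (pr (sq t u) (sq t' u'))"
    and swp_swp: "x \<in> L \<Longrightarrow> y \<in> L \<Longrightarrow> eqv (sq (swp x y) (swp y x)) (idn [x, y])"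
    and sym1_Nil: "x \<in> L \<Longrightarrow> eqv (sym1 x []) (idn [x])"
    and sym1_Cons: "x \<in> L \<Longrightarrow> y \<in> L \<Longrightarrow> Q \<in> lists L \<Longrightarrow>
      eqv (sym1 x (y # Q)) (sq (pr (swp x y) (idn Q)) (pr (idn [y]) (sym1 x Q)))"
    and symw_Nil: "Q \<in> lists L \<Longrightarrow> eqv (symw [] Q) (idn Q)"
    and symw_Cons: "x \<in> L \<Longrightarrow> P \<in> lists L \<Longrightarrow> Q \<in> lists L \<Longrightarrow>
      eqv (symw (x # P) Q) (sq (pr (idn [x]) (symw P Q)) (pr (sym1 x Q) (idn P)))"
    and symw_nat: "wt t \<Longrightarrow> wt u \<Longrightarrow> eqv (sq (pr t u) (symw (cd t) (cd u))) (sq (symw (dm t) (dm u)) (pr u t))"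
begin

text \<open>Copies the shape of \<open>tape_cat\<close>, as \<open>quot_tensor\<close> copies
  \<open>tape_sum\<close>, so that for tapes they coincide literally (\<open>quot_cat_tape\<close>,
  \<open>quot_tensor_tape\<close>) and the results are about the official structures.\<close>

definition quot_cat :: "('l list, 't set) cat" where
  "quot_cat = \<lparr>Obj = lists L, Arr = {cls t | t. wt t}, Dom = \<lambda>a. dm (rep a), Cod = \<lambda>a. cd (rep a),
     Id = \<lambda>P. cls (idn P), Comp = \<lambda>a b. cls (sq (rep a) (rep b))\<rparr>"

definition quot_tensor :: "('l list, 't set) tensor" where
  "quot_tensor = \<lparr>tob = (@), tar = \<lambda>a b. cls (pr (rep a) (rep b)), tunit = [],
     assoc = \<lambda>P Q R. cls (idn (P @ Q @ R)), lunit = \<lambda>P. cls (idn P), runit = \<lambda>P. cls (idn P),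
     symm = \<lambda>P Q. cls (symw P Q)\<rparr>"

lemma cls_Arr [simp]: "wt t \<Longrightarrow> cls t \<in> Arr quot_cat"
  by (auto simp: quot_cat_def)

lemma cls_Dom [simp]: "wt t \<Longrightarrow> Dom quot_cat (cls t) = dm t"
  and cls_Cod [simp]: "wt t \<Longrightarrow> Cod quot_cat (cls t) = cd t"
  using eqv_dm[OF eqv_rep[of t]] by (simp_all add: quot_cat_def)

text \<open>\<open>Comp\<close> acts on chosen representatives; the congruence rule makes the choice
  irrelevant.\<close>

lemma cls_Comp: "wt t \<Longrightarrow> wt u \<Longrightarrow> cd t = dm u \<Longrightarrow> Comp quot_cat (cls t) (cls u) = cls (sq t u)"
  unfolding quot_cat_def by simp (metis (no_types, lifting) cls_cong sq_cong eqv_rep)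

lemma cls_tar: "wt t \<Longrightarrow> wt u \<Longrightarrow> tar quot_tensor (cls t) (cls u) = cls (pr t u)"
  unfolding quot_tensor_def by simp (metis (no_types, lifting) cls_cong pr_cong eqv_rep)

lemma cls_Id: "Id quot_cat P = cls (idn P)"
  by (simp add: quot_cat_def)

lemma HomE:
  assumes "f \<in> Hom quot_cat P Q"
  obtains t where "wt t" "f = cls t" "dm t = P" "cd t = Q"
  using assms cls_Dom cls_Cod by (auto simp: Hom_def) (auto simp: quot_cat_def)

lemma ArrE:
  assumes "f \<in> Arr quot_cat"
  obtains t where "wt t" "f = cls t"
  using assms by (auto simp: quot_cat_def)

lemma cls_Hom: "wt t \<Longrightarrow> cls t \<in> Hom quot_cat (dm t) (cd t)"
  by (simp add: Hom_def)

lemma Obj_quot [simp]: "Obj quot_cat = lists L"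
  by (simp add: quot_cat_def)

lemma quot_tensor_simps [simp]:
  "tob quot_tensor = (@)" "tunit quot_tensor = []"
  "assoc quot_tensor P Q R = cls (idn (P @ Q @ R))" "lunit quot_tensor P = cls (idn P)" "runit quot_tensor P = cls (idn P)"
  by (simp_all add: quot_tensor_def)

lemma symm_quot_tensor: "symm quot_tensor P Q = cls (symw P Q)"
  by (simp add: quot_tensor_def)

sublocale word_sym quot_cat quot_tensor L "\<lambda>u v. cls (swp u v)" "\<lambda>u Q. cls (sym1 u Q)"
proof unfold_locales
  note [simp] = cls_Comp cls_tar symm_quot_tensor
  show "f \<in> Arr quot_cat \<Longrightarrow> Dom quot_cat f \<in> Obj quot_cat" for f
    by (erule ArrE) (simp add: wt_dm)
  show "f \<in> Arr quot_cat \<Longrightarrow> Cod quot_cat f \<in> Obj quot_cat" for f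
    by (erule ArrE) (simp add: wt_dm)
  show "X \<in> Obj quot_cat \<Longrightarrow> Id quot_cat X \<in> Hom quot_cat X X" for X
    using cls_Hom[of "idn X"] by (simp add: cls_Id)
  show "f \<in> Hom quot_cat X Y \<Longrightarrow> g \<in> Hom quot_cat Y Z \<Longrightarrow> Comp quot_cat f g \<in> Hom quot_cat X Z" for f g X Y Z
    by (elim HomE) (simp add: Hom_def)
  show "f \<in> Hom quot_cat X Y \<Longrightarrow> Comp quot_cat (Id quot_cat X) f = f" for f X Y
    by (elim HomE, hypsubst) (simp add: cls_Id wt_dm cls_cong[OF idn_sq])
  show "f \<in> Hom quot_cat X Y \<Longrightarrow> Comp quot_cat f (Id quot_cat Y) = f" for f X Y
    by (elim HomE, hypsubst) (simp add: cls_Id wt_dm cls_cong[OF sq_idn])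
  show "f \<in> Hom quot_cat W X \<Longrightarrow> g \<in> Hom quot_cat X Y \<Longrightarrow> h \<in> Hom quot_cat Y Z \<Longrightarrow>
       Comp quot_cat (Comp quot_cat f g) h = Comp quot_cat f (Comp quot_cat g h)" for f g h W X Y Z
    by (elim HomE) (simp add: cls_cong[OF sq_assoc])
  show "f \<in> Hom quot_cat X X' \<Longrightarrow> g \<in> Hom quot_cat Y Y' \<Longrightarrow>
       tar quot_tensor f g \<in> Hom quot_cat (tob quot_tensor X Y) (tob quot_tensor X' Y')" for f g X X' Y Y'
    by (elim HomE) (simp add: Hom_def)
  show "X \<in> Obj quot_cat \<Longrightarrow> Y \<in> Obj quot_cat \<Longrightarrow> tar quot_tensor (Id quot_cat X) (Id quot_cat Y) =
       Id quot_cat (tob quot_tensor X Y)" for X Y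
    by (simp add: cls_Id cls_cong[OF pr_idn_idn])
  show "f \<in> Hom quot_cat X X' \<Longrightarrow> f' \<in> Hom quot_cat X' X'' \<Longrightarrow> g \<in> Hom quot_cat Y Y' \<Longrightarrow> g' \<in> Hom quot_cat Y' Y'' \<Longrightarrow>
       tar quot_tensor (Comp quot_cat f f') (Comp quot_cat g g') =
       Comp quot_cat (tar quot_tensor f g) (tar quot_tensor f' g')" for f f' g g' X X' X'' Y Y' Y''
    by (elim HomE) (simp add: cls_cong[OF sq_pr])
  show "f \<in> Arr quot_cat \<Longrightarrow> g \<in> Arr quot_cat \<Longrightarrow> h \<in> Arr quot_cat \<Longrightarrow>
       tar quot_tensor (tar quot_tensor f g) h = tar quot_tensor f (tar quot_tensor g h)" for f g h
    by (elim ArrE) (simp add: cls_cong[OF pr_assoc])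
  show "f \<in> Arr quot_cat \<Longrightarrow> tar quot_tensor (Id quot_cat (tunit quot_tensor)) f = f" for f
    by (erule ArrE) (simp add: cls_Id cls_cong[OF idn_pr])
  show "f \<in> Arr quot_cat \<Longrightarrow> tar quot_tensor f (Id quot_cat (tunit quot_tensor)) = f" for f
    by (erule ArrE) (simp add: cls_Id cls_cong[OF pr_idn])
  show "u \<in> L \<Longrightarrow> v \<in> L \<Longrightarrow> cls (swp u v) \<in> Hom quot_cat [u, v] [v, u]" for u v
    using cls_Hom[of "swp u v"] by simp
  show "u \<in> L \<Longrightarrow> v \<in> L \<Longrightarrow> Comp quot_cat (cls (swp u v)) (cls (swp v u)) = Id quot_cat [u, v]" for u v
    by (simp add: cls_Id cls_cong[OF swp_swp])
  show "u \<in> L \<Longrightarrow> cls (sym1 u []) = Id quot_cat [u]" for u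
    by (simp add: cls_Id cls_cong[OF sym1_Nil])
  show "u \<in> L \<Longrightarrow> v \<in> L \<Longrightarrow> Q \<in> lists L \<Longrightarrow> cls (sym1 u (v # Q)) =
       Comp quot_cat (tar quot_tensor (cls (swp u v)) (Id quot_cat Q)) (tar quot_tensor (Id quot_cat [v]) (cls (sym1 u Q)))" for u v Q
    by (simp add: cls_Id cls_cong[OF sym1_Cons])
  show "Q \<in> lists L \<Longrightarrow> symm quot_tensor [] Q = Id quot_cat Q" for Q
    by (simp add: cls_Id cls_cong[OF symw_Nil])
  show "u \<in> L \<Longrightarrow> P \<in> lists L \<Longrightarrow> Q \<in> lists L \<Longrightarrow> symm quot_tensor (u # P) Q =
       Comp quot_cat (tar quot_tensor (Id quot_cat [u]) (symm quot_tensor P Q)) (tar quot_tensor (cls (sym1 u Q)) (Id quot_cat P))" for u P Q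
    by (simp add: cls_Id cls_cong[OF symw_Cons])
  show "f \<in> Arr quot_cat \<Longrightarrow> g \<in> Arr quot_cat \<Longrightarrow>
       Comp quot_cat (tar quot_tensor f g) (symm quot_tensor (Cod quot_cat f) (Cod quot_cat g)) =
       Comp quot_cat (symm quot_tensor (Dom quot_cat f) (Dom quot_cat g)) (tar quot_tensor g f)" for f g
    by (elim ArrE) (simp add: wt_dm cls_cong[OF symw_nat])
qed (simp_all add: cls_Id)

end

section \<open>Typing of derived tapes\<close>

lemma poly_prod_simps [simp]:
  "poly_prod [] Q = []" "poly_prod (U # P) Q = map ((@) U) Q @ poly_prod P Q"
  by (simp_all add: poly_prod_def)

lemma poly_prod_Nil [simp]: "poly_prod P [] = []"
  by (induction P) auto

lemma poly_prod_append [simp]: "poly_prod (P @ P') Q = poly_prod P Q @ poly_prod P' Q"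
  by (induction P) auto

lemma poly_prod_sing: "poly_prod P [V] = map (\<lambda>U. U @ V) P"
  by (induction P) auto

lemma poly_prod_lists [simp]:
  assumes "P \<in> lists (lists S)" "Q \<in> lists (lists S)"
  shows "poly_prod P Q \<in> lists (lists S)"
  using assms by (induction P) (auto simp: in_lists_conv_set)

lemma map_append_lists [simp]:
  assumes "U \<in> lists S" "Q \<in> lists (lists S)"
  shows "map ((@) U) Q \<in> lists (lists S)" "map (\<lambda>V. V @ U) Q \<in> lists (lists S)"
  using assms by (auto simp: in_lists_conv_set)

lemma poly_prod_map: "poly_prod (map ((@) U) P) Q = map ((@) U) (poly_prod P Q)"
  by (induction P) auto

lemma poly_prod_assoc [simp]: "poly_prod (poly_prod P Q) R = poly_prod P (poly_prod Q R)"
  by (induction P) (auto simp: poly_prod_map)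

lemma poly_prod_one [simp]: "poly_prod P [[]] = P"
  by (induction P) auto

lemma replicate_lists [simp]: "U \<in> S \<Longrightarrow> replicate n U \<in> lists S"
  by (auto simp: in_lists_conv_set)

lemma map_append_Nil [simp]: "map ((@) []) Q = Q"
  by (simp add: map_idI)

lemma poly_prod_replicate: "poly_prod (replicate n []) Q = concat (replicate n Q)"
  by (induction n) auto

locale signature =
  fixes T :: "'f alg_theory" and \<Gamma> :: "('s, 'g) monsig"
  assumes sig: "monoidal_signature \<Gamma>"
begin

abbreviation "Wd \<equiv> lists (sorts \<Gamma>)"
abbreviation "Pl \<equiv> lists (lists (sorts \<Gamma>))"
abbreviation "td \<equiv> tdom T \<Gamma> :: ('s, 'g, 'f) tape \<Rightarrow> 's list list"
abbreviation "tc \<equiv> tcod T \<Gamma> :: ('s, 'g, 'f) tape \<Rightarrow> 's list list"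
abbreviation "wt \<equiv> wt_tape T \<Gamma> :: ('s, 'g, 'f) tape \<Rightarrow> bool"
abbreviation eqt (infix "\<approx>" 50) where "t \<approx> u \<equiv> tape_eq T \<Gamma> (t :: ('s, 'g, 'f) tape) u"
abbreviation ceq (infix "\<approx>\<^sub>c" 50) where "c \<approx>\<^sub>c d \<equiv> circ_eq \<Gamma> c d"

lemma cid_simps [simp]: "cid [] = CUnit" "cid (A # U) = CPar (CId A) (cid U)"
  by (simp_all add: cid_def)

lemma cid_typing [simp]: "cdom \<Gamma> (cid U) = U" "ccod \<Gamma> (cid U) = U" "wt_circ \<Gamma> (cid U) \<longleftrightarrow> U \<in> Wd"
  by (induction U) auto

lemma csym1_typing [simp]: "cdom \<Gamma> (csym1 A V) = A # V" "ccod \<Gamma> (csym1 A V) = V @ [A]"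
  "wt_circ \<Gamma> (csym1 A V) \<longleftrightarrow> A \<in> sorts \<Gamma> \<and> V \<in> Wd"
  by (induction V) auto

lemma csym_typing [simp]: "cdom \<Gamma> (csym U V) = U @ V" "ccod \<Gamma> (csym U V) = V @ U"
  "U \<in> Wd \<Longrightarrow> V \<in> Wd \<Longrightarrow> wt_circ \<Gamma> (csym U V)"
  by (induction U) auto

lemma wt_circ_words: "wt_circ \<Gamma> c \<Longrightarrow> cdom \<Gamma> c \<in> Wd" "wt_circ \<Gamma> c \<Longrightarrow> ccod \<Gamma> c \<in> Wd"
  using sig by (induction c) (auto simp: monoidal_signature_def)

lemma circ_eq_typing:
  "c \<approx>\<^sub>c d \<Longrightarrow> wt_circ \<Gamma> c \<and> wt_circ \<Gamma> d \<and> cdom \<Gamma> c = cdom \<Gamma> d \<and> ccod \<Gamma> c = ccod \<Gamma> d"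
  by (induction rule: circ_eq.induct) (auto simp: wt_circ_words)

lemma tid_typing [simp]: "td (tid P) = P" "tc (tid P) = P" "wt (tid P) \<longleftrightarrow> P \<in> Pl"
  by (induction P) auto

lemma tcobang_typing [simp]: "td (tcobang P) = []" "tc (tcobang P) = P" "wt (tcobang P) \<longleftrightarrow> P \<in> Pl"
  by (induction P) auto

lemma tsym1_typing [simp]: "td (tsym1 U Q) = U # Q" "tc (tsym1 U Q) = Q @ [U]" "wt (tsym1 U Q) \<longleftrightarrow> U \<in> Wd \<and> Q \<in> Pl"
  by (induction Q) auto

lemma tsym_typing [simp]: "td (tsym P Q) = P @ Q" "tc (tsym P Q) = Q @ P" "P \<in> Pl \<Longrightarrow> Q \<in> Pl \<Longrightarrow> wt (tsym P Q)"
  by (induction P) auto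

lemma tnabla_typing [simp]: "td (tnabla P) = P @ P" "tc (tnabla P) = P" "P \<in> Pl \<Longrightarrow> wt (tnabla P)"
  by (induction P) auto

lemma tdistl_typing [simp]: "td (tdistl P Q R) = poly_prod P (Q @ R)" "tc (tdistl P Q R) = poly_prod P Q @ poly_prod P R"
  "P \<in> Pl \<Longrightarrow> Q \<in> Pl \<Longrightarrow> R \<in> Pl \<Longrightarrow> wt (tdistl P Q R)"
  by (induction P) auto

lemma tdistl_inv_typing [simp]: "tc (tdistl_inv P Q R) = poly_prod P (Q @ R)" "td (tdistl_inv P Q R) = poly_prod P Q @ poly_prod P R"
  "P \<in> Pl \<Longrightarrow> Q \<in> Pl \<Longrightarrow> R \<in> Pl \<Longrightarrow> wt (tdistl_inv P Q R)"
  by (induction P) auto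

lemma tops_typing [simp]: "td (tops T f P) = P" "tc (tops T f P) = poly_prod (replicate (arity T f) []) P"
  "f \<in> ops T \<Longrightarrow> P \<in> Pl \<Longrightarrow> wt (tops T f P)"
  by (induction P) (auto simp: poly_prod_replicate)

lemma tsum_simps [simp]: "tsum [] = TZero" "tsum (t # ts) = TPar t (tsum ts)"
  by (simp_all add: tsum_def)

lemma tsum_typing [simp]: "td (tsum ts) = concat (map td ts)" "tc (tsum ts) = concat (map tc ts)"
  "wt (tsum ts) \<longleftrightarrow> (\<forall>t \<in> set ts. wt t)"
  by (induction ts) auto

lemma tnabla_n_typing [simp]: "td (tnabla_n n P) = concat (replicate n P)" "tc (tnabla_n n P) = P"
  "P \<in> Pl \<Longrightarrow> wt (tnabla_n n P)"
  by (induction n) auto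

lemma trm_tape_typing [simp]:
  assumes "wf_trm T n t"
  shows "td (trm_tape n U t) = [U]" "tc (trm_tape n U t) = replicate n U" "U \<in> Wd \<Longrightarrow> wt (trm_tape n U t)"
proof -
  have "td (trm_tape n U t) = [U] \<and> tc (trm_tape n U t) = replicate n U \<and> (U \<in> Wd \<longrightarrow> wt (trm_tape n U t))"
    using assms
  proof induction
    case (1 i)
    then have "replicate i U @ U # replicate (n - Suc i) U = replicate n U"
      using replicate_add[of i "Suc (n - Suc i)" U] by simp
    then show ?case by simp
  next
    case (2 f ts)
    then have "map (\<lambda>t. td (trm_tape n U t)) ts = replicate (arity T f) [U]"
      "map (\<lambda>t. tc (trm_tape n U t)) ts = replicate (arity T f) (replicate n U)"
      by (auto simp: map_replicate_const cong: map_cong)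
    with 2 show ?case by (auto simp: o_def)
  qed
  then show "td (trm_tape n U t) = [U]" "tc (trm_tape n U t) = replicate n U" "U \<in> Wd \<Longrightarrow> wt (trm_tape n U t)" by auto
qed

lemma wt_poly: "wt t \<Longrightarrow> td t \<in> Pl" "wt t \<Longrightarrow> tc t \<in> Pl"
  by (induction t) (auto simp: wt_circ_words)

lemma lwhisk1_typing [simp]: "td (lwhisk1 U t) = map ((@) U) (td t)" "tc (lwhisk1 U t) = map ((@) U) (tc t)"
  "U \<in> Wd \<Longrightarrow> wt t \<Longrightarrow> wt (lwhisk1 U t)"
  by (induction t) auto

lemma rwhisk1_typing [simp]: "td (rwhisk1 U t) = map (\<lambda>V. V @ U) (td t)" "tc (rwhisk1 U t) = map (\<lambda>V. V @ U) (tc t)"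
  "U \<in> Wd \<Longrightarrow> wt t \<Longrightarrow> wt (rwhisk1 U t)"
  by (induction t) auto

lemma lwhisk_typing [simp]: "td (lwhisk P t) = poly_prod P (td t)" "tc (lwhisk P t) = poly_prod P (tc t)"
  "P \<in> Pl \<Longrightarrow> wt t \<Longrightarrow> wt (lwhisk P t)"
  by (induction P) auto

lemma rwhisk_typing [simp]: "td (rwhisk T \<Gamma> P t) = poly_prod (td t) P" "tc (rwhisk T \<Gamma> P t) = poly_prod (tc t) P"
  "P \<in> Pl \<Longrightarrow> wt t \<Longrightarrow> wt (rwhisk T \<Gamma> P t)"
  by (induction P) (auto simp: poly_prod_sing wt_poly)

lemma tprod_typing [simp]: "td (tprod T \<Gamma> t u) = poly_prod (td t) (td u)" "tc (tprod T \<Gamma> t u) = poly_prod (tc t) (tc u)"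
  "wt t \<Longrightarrow> wt u \<Longrightarrow> wt (tprod T \<Gamma> t u)"
  by (simp_all add: tprod_def wt_poly)

lemma tsym_prod_typing [simp]: "td (tsym_prod P Q) = poly_prod P Q" "tc (tsym_prod P Q) = poly_prod Q P"
  "P \<in> Pl \<Longrightarrow> Q \<in> Pl \<Longrightarrow> wt (tsym_prod P Q)"
proof (induction Q)
  case (Cons V Q)
  have *: "concat (map (\<lambda>U. [f U]) P) = map f P" for f :: "'s list \<Rightarrow> 's list" by (induction P) auto
  { case 1 then show ?case using Cons by (simp add: o_def * poly_prod_sing) }
  { case 2 then show ?case using Cons by (simp add: o_def * poly_prod_sing) }
  { case 3
    then have "wt_circ \<Gamma> (csym U V)" if "U \<in> set P" for U
      using that by (intro csym_typing) auto
    with 3 show ?case using Cons by (simp add: o_def * poly_prod_sing) }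
qed auto

text \<open>Makes \<open>Dom\<close> and \<open>Cod\<close>, which are read off a representative,
  well defined on classes.\<close>

lemma tape_eq_typing:
  "t \<approx> u \<Longrightarrow> wt t \<and> wt u \<and> td t = td u \<and> tc t = tc u"
proof (induction rule: tape_eq.induct)
  case (circ c d)
  then show ?case using circ_eq_typing by auto
qed (auto simp: wt_poly wt_circ_words poly_prod_replicate dest: trm_tape_typing)

end

context strict_smc
begin

text \<open>Both composites rearrange \<open>U P Q U P Q\<close> into \<open>U U P P Q Q\<close>.
  This is what allows the recursive \<open>tnabla\<close> to be split at an arbitrary
  concatenation.\<close>

lemma mid4_assoc:
  assumes [simp]: "U \<in> Obj C" "P \<in> Obj C" "Q \<in> Obj C"
  shows "(\<iota> U \<odot>\<^sub>a symm M (P \<odot> Q) U \<odot>\<^sub>a \<iota> (P \<odot> Q)) \<Zsemi> (\<iota> (U \<odot> U) \<odot>\<^sub>a \<iota> P \<odot>\<^sub>a symm M Q P \<odot>\<^sub>a \<iota> Q) =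
    (\<iota> (U \<odot> P) \<odot>\<^sub>a symm M Q (U \<odot> P) \<odot>\<^sub>a \<iota> Q) \<Zsemi> (\<iota> U \<odot>\<^sub>a symm M P U \<odot>\<^sub>a \<iota> P \<odot>\<^sub>a \<iota> (Q \<odot> Q))"
    (is "?l = ?r")
proof -
  have s: "(symm M P U \<odot>\<^sub>a \<iota> (Q \<odot> P)) \<Zsemi> (\<iota> (U \<odot> P) \<odot>\<^sub>a symm M Q P) = (\<iota> (P \<odot> U) \<odot>\<^sub>a symm M Q P) \<Zsemi> (symm M P U \<odot>\<^sub>a \<iota> (P \<odot> Q))"
    by simp
  have "((\<iota> P \<odot>\<^sub>a symm M Q U) \<Zsemi> (symm M P U \<odot>\<^sub>a \<iota> Q)) \<odot>\<^sub>a \<iota> P = (\<iota> P \<odot>\<^sub>a symm M Q U \<odot>\<^sub>a \<iota> P) \<Zsemi> (symm M P U \<odot>\<^sub>a \<iota> (Q \<odot> P))"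
    by (simp add: tar_Id[symmetric] whisk_right del: tar_Id tar_fuse tar_fuse_assoc)
  then have l: "(symm M (P \<odot> Q) U \<odot>\<^sub>a \<iota> P) \<Zsemi> (\<iota> (U \<odot> P) \<odot>\<^sub>a symm M Q P) =
     (\<iota> P \<odot>\<^sub>a symm M Q U \<odot>\<^sub>a \<iota> P) \<Zsemi> ((symm M P U \<odot>\<^sub>a \<iota> (Q \<odot> P)) \<Zsemi> (\<iota> (U \<odot> P) \<odot>\<^sub>a symm M Q P))"
    by (simp add: symm_tob_left del: tar_fuse tar_fuse_assoc)
  have "\<iota> P \<odot>\<^sub>a ((symm M Q U \<odot>\<^sub>a \<iota> P) \<Zsemi> (\<iota> U \<odot>\<^sub>a symm M Q P)) = (\<iota> P \<odot>\<^sub>a symm M Q U \<odot>\<^sub>a \<iota> P) \<Zsemi> (\<iota> (P \<odot> U) \<odot>\<^sub>a symm M Q P)"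
    by (simp add: tar_Id[symmetric] whisk_left del: tar_Id tar_fuse tar_fuse_assoc)
  then have r: "(\<iota> P \<odot>\<^sub>a symm M Q (U \<odot> P)) \<Zsemi> (symm M P U \<odot>\<^sub>a \<iota> (P \<odot> Q)) =
     (\<iota> P \<odot>\<^sub>a symm M Q U \<odot>\<^sub>a \<iota> P) \<Zsemi> ((\<iota> (P \<odot> U) \<odot>\<^sub>a symm M Q P) \<Zsemi> (symm M P U \<odot>\<^sub>a \<iota> (P \<odot> Q)))"
    by (simp add: symm_tob_right del: tar_fuse tar_fuse_assoc)
  have e: "(symm M (P \<odot> Q) U \<odot>\<^sub>a \<iota> P) \<Zsemi> (\<iota> (U \<odot> P) \<odot>\<^sub>a symm M Q P) = (\<iota> P \<odot>\<^sub>a symm M Q (U \<odot> P)) \<Zsemi> (symm M P U \<odot>\<^sub>a \<iota> (P \<odot> Q))"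
    unfolding l r s ..
  have "?l = \<iota> U \<odot>\<^sub>a (((symm M (P \<odot> Q) U \<odot>\<^sub>a \<iota> P) \<Zsemi> (\<iota> (U \<odot> P) \<odot>\<^sub>a symm M Q P)) \<odot>\<^sub>a \<iota> Q)"
    by (simp add: tar_Id[symmetric] whisk_left whisk_right del: tar_Id tar_fuse tar_fuse_assoc)
  also have "\<dots> = ?r"
    unfolding e by (simp add: tar_Id[symmetric] whisk_left whisk_right del: tar_Id tar_fuse tar_fuse_assoc)
  finally show ?thesis .
qed

text \<open>Both composites take \<open>U V U V\<close> to \<open>V V U U\<close>; this gives
  naturality of the codiagonal at a symmetry.\<close>

lemma mid4_symm:
  assumes [simp]: "U \<in> Obj C" "V \<in> Obj C"
  shows "(\<iota> U \<odot>\<^sub>a symm M V U \<odot>\<^sub>a \<iota> V) \<Zsemi> symm M (U \<odot> U) (V \<odot> V) =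
    (symm M U V \<odot>\<^sub>a symm M U V) \<Zsemi> (\<iota> V \<odot>\<^sub>a symm M U V \<odot>\<^sub>a \<iota> U)"
proof -
  let ?s = "symm M U V"
  have "symm M (U \<odot> U) (V \<odot> V) = (\<iota> U \<odot>\<^sub>a symm M U (V \<odot> V)) \<Zsemi> (symm M U (V \<odot> V) \<odot>\<^sub>a \<iota> U)"
    by (simp add: symm_tob_left)
  also have "\<iota> U \<odot>\<^sub>a symm M U (V \<odot> V) = (\<iota> U \<odot>\<^sub>a ?s \<odot>\<^sub>a \<iota> V) \<Zsemi> (\<iota> U \<odot>\<^sub>a \<iota> V \<odot>\<^sub>a ?s)"
    by (simp add: symm_tob_right whisk_left del: tar_fuse tar_fuse_assoc tar_Id)
  also have "symm M U (V \<odot> V) \<odot>\<^sub>a \<iota> U = (?s \<odot>\<^sub>a \<iota> V \<odot>\<^sub>a \<iota> U) \<Zsemi> (\<iota> V \<odot>\<^sub>a ?s \<odot>\<^sub>a \<iota> U)"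
    by (simp add: symm_tob_right whisk_right del: tar_fuse tar_fuse_assoc tar_Id)
  finally have "(\<iota> U \<odot>\<^sub>a symm M V U \<odot>\<^sub>a \<iota> V) \<Zsemi> symm M (U \<odot> U) (V \<odot> V) =
    ((\<iota> U \<odot>\<^sub>a symm M V U \<odot>\<^sub>a \<iota> V) \<Zsemi> (\<iota> U \<odot>\<^sub>a ?s \<odot>\<^sub>a \<iota> V)) \<Zsemi> (((\<iota> (U \<odot> V) \<odot>\<^sub>a ?s) \<Zsemi> (?s \<odot>\<^sub>a \<iota> (V \<odot> U))) \<Zsemi> (\<iota> V \<odot>\<^sub>a ?s \<odot>\<^sub>a \<iota> U))"
    by (simp add: tar_Id[symmetric] del: tar_fuse tar_fuse_assoc tar_Id)
  also have "\<dots> = (?s \<odot>\<^sub>a ?s) \<Zsemi> (\<iota> V \<odot>\<^sub>a ?s \<odot>\<^sub>a \<iota> U)" by simp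
  finally show ?thesis .
qed

end

section \<open>Circuits and tapes as strict symmetric monoidal categories\<close>

context signature
begin

sublocale circ: syntactic_smc "wt_circ \<Gamma>" "circ_eq \<Gamma>" "sorts \<Gamma>" "cdom \<Gamma>" "ccod \<Gamma>" CSeq CPar cid CSym csym1 csym
proof unfold_locales
  have [simp]: "wt_circ \<Gamma> c \<Longrightarrow> c \<approx>\<^sub>c c" for c by (rule circ_eq.refl)
  show "P \<in> Wd \<Longrightarrow> Q \<in> Wd \<Longrightarrow> CPar (cid P) (cid Q) \<approx>\<^sub>c cid (P @ Q)" for P Q
  proof (induction P rule: lists.induct)
    case Nil
    then show ?case by (simp add: circ_eq.unit_par)
  next
    case (Cons A P)
    then have "CPar (CPar (CId A) (cid P)) (cid Q) \<approx>\<^sub>c CPar (CId A) (CPar (cid P) (cid Q))"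
      by (intro circ_eq.par_assoc) auto
    moreover have "CPar (CId A) (CPar (cid P) (cid Q)) \<approx>\<^sub>c CPar (CId A) (cid (P @ Q))"
      using Cons by (intro circ_eq.par_cong) auto
    ultimately show ?case by (simp add: circ_eq.trans[of \<Gamma>])
  qed
  have c1: "cid [A] \<approx>\<^sub>c CId A" if "A \<in> sorts \<Gamma>" for A using that by (simp add: circ_eq.par_unit)
  show "u \<in> sorts \<Gamma> \<Longrightarrow> csym1 u [] \<approx>\<^sub>c cid [u]" for u
    using circ_eq.sym[OF c1] by simp
  show "x \<in> sorts \<Gamma> \<Longrightarrow> y \<in> sorts \<Gamma> \<Longrightarrow> Q \<in> Wd \<Longrightarrow>
       csym1 x (y # Q) \<approx>\<^sub>c CSeq (CPar (CSym x y) (cid Q)) (CPar (cid [y]) (csym1 x Q))" for x y Q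
    unfolding csym1.simps by (intro circ_eq.seq_cong circ_eq.par_cong circ_eq.sym[OF c1]) simp_all
  show "u \<in> sorts \<Gamma> \<Longrightarrow> P \<in> Wd \<Longrightarrow> Q \<in> Wd \<Longrightarrow>
       csym (u # P) Q \<approx>\<^sub>c CSeq (CPar (cid [u]) (csym P Q)) (CPar (csym1 u Q) (cid P))" for u P Q
    unfolding csym.simps by (intro circ_eq.seq_cong circ_eq.par_cong circ_eq.sym[OF c1]) simp_all
qed (simp_all add: circ_eq.refl circ_eq.unit_par[simplified] circ_eq_typing wt_circ_words
  circ_eq.seq_cong circ_eq.par_cong circ_eq.seq_assoc circ_eq.id_seq circ_eq.seq_id circ_eq.par_assoc circ_eq.par_unit
  circ_eq.interchange circ_eq.sym_sym[simplified] circ_eq.sym_natural, (blast intro: circ_eq.sym circ_eq.trans dest: circ_eq_typing)+)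

lemma tape_class_Collect: "{u. tape_eq T \<Gamma> t u} = tape_class T \<Gamma> t"
  by (simp add: tape_class_def)

lemma tid_append: "P \<in> Pl \<Longrightarrow> Q \<in> Pl \<Longrightarrow> TPar (tid P) (tid Q) \<approx> tid (P @ Q)"
proof (induction P rule: lists.induct)
  case Nil
  then show ?case by (simp add: tape_eq.zero_sum)
next
  case (Cons A P)
  then have "TPar (TPar (TId A) (tid P)) (tid Q) \<approx> TPar (TId A) (TPar (tid P) (tid Q))"
    by (intro tape_eq.sum_assoc) auto
  moreover have "TPar (TId A) (TPar (tid P) (tid Q)) \<approx> TPar (TId A) (tid (P @ Q))"
    using Cons by (intro tape_eq.sum_cong tape_eq.refl) auto
  ultimately show ?case by (simp add: tape_eq.trans[of T \<Gamma>])
qed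

lemma syntactic_smc_tape: "syntactic_smc wt eqt Wd td tc TSeq TPar tid TSym tsym1 tsym"
proof unfold_locales
  have [simp]: "wt c \<Longrightarrow> c \<approx> c" for c by (rule tape_eq.refl)
  have c1: "tid [A] \<approx> TId A" if "A \<in> Wd" for A using that by (simp add: tape_eq.sum_zero)
  show "u \<in> Wd \<Longrightarrow> tsym1 u [] \<approx> tid [u]" for u
    using tape_eq.sym[OF c1] by simp
  show "x \<in> Wd \<Longrightarrow> y \<in> Wd \<Longrightarrow> Q \<in> Pl \<Longrightarrow>
       tsym1 x (y # Q) \<approx> TSeq (TPar (TSym x y) (tid Q)) (TPar (tid [y]) (tsym1 x Q))" for x y Q
    unfolding tsym1.simps by (intro tape_eq.seq_cong tape_eq.sum_cong tape_eq.sym[OF c1]) simp_all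
  show "u \<in> Wd \<Longrightarrow> P \<in> Pl \<Longrightarrow> Q \<in> Pl \<Longrightarrow>
       tsym (u # P) Q \<approx> TSeq (TPar (tid [u]) (tsym P Q)) (TPar (tsym1 u Q) (tid P))" for u P Q
    unfolding tsym.simps by (intro tape_eq.seq_cong tape_eq.sum_cong tape_eq.sym[OF c1]) simp_all
qed (simp_all add: tape_eq.refl tape_eq.zero_sum tape_eq_typing wt_poly tid_append
  tape_eq.seq_cong tape_eq.sum_cong tape_eq.seq_assoc tape_eq.id_seq tape_eq.seq_id tape_eq.sum_assoc tape_eq.sum_zero
  tape_eq.interchange tape_eq.sym_sym[simplified] tape_eq.sym_natural, (blast intro: tape_eq.sym tape_eq.trans dest: tape_eq_typing)+)

lemma quot_cat_tape: "syntactic_smc.quot_cat wt eqt Wd td tc TSeq tid = tape_cat T \<Gamma>"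
  unfolding syntactic_smc.quot_cat_def[OF syntactic_smc_tape] tape_cat_def tape_class_Collect ..

lemma quot_tensor_tape: "syntactic_smc.quot_tensor eqt TPar tid tsym = tape_sum T \<Gamma>"
  unfolding syntactic_smc.quot_tensor_def[OF syntactic_smc_tape] tape_sum_def tape_class_Collect ..

text \<open>The rewrites replace the generic quotient by \<open>tape_cat\<close>,
  \<open>tape_sum\<close> and \<open>tape_class\<close> in every inherited fact.\<close>

sublocale tape: syntactic_smc wt eqt Wd td tc TSeq TPar tid TSym tsym1 tsym
  rewrites "\<And>t. {u. tape_eq T \<Gamma> t u} = tape_class T \<Gamma> t"
    and "syntactic_smc.quot_cat wt eqt Wd td tc TSeq tid = tape_cat T \<Gamma>"
    and "syntactic_smc.quot_tensor eqt TPar tid tsym = tape_sum T \<Gamma>"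
  by (rule syntactic_smc_tape tape_class_Collect quot_cat_tape quot_tensor_tape)+

end

section \<open>Tapes form a category with finite coproducts\<close>

locale tapes = signature T \<Gamma>
  for T :: "'f alg_theory" and \<Gamma> :: "('s, 'g) monsig"
begin

abbreviation TC :: "('s list list, ('s, 'g, 'f) tape set) cat" where "TC \<equiv> tape_cat T \<Gamma>"
abbreviation TS :: "('s list list, ('s, 'g, 'f) tape set) tensor" where "TS \<equiv> tape_sum T \<Gamma>"
abbreviation cl :: "('s, 'g, 'f) tape \<Rightarrow> ('s, 'g, 'f) tape set" where "cl t \<equiv> tape_class T \<Gamma> t"
abbreviation tseq (infixl "\<Zsemi>" 55) where "a \<Zsemi> b \<equiv> Comp TC a b"
abbreviation tplus (infixr "\<boxplus>" 70) where "a \<boxplus> b \<equiv> tar TS a b"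
abbreviation tident ("\<iota>") where "\<iota> P \<equiv> Id TC P"
abbreviation tsy ("\<sigma>") where "\<sigma> P Q \<equiv> symm TS P Q"

lemma Dom_Pl [simp]: "f \<in> Arr TC \<Longrightarrow> Dom TC f \<in> Pl"
  and Cod_Pl [simp]: "f \<in> Arr TC \<Longrightarrow> Cod TC f \<in> Pl"
  using tape.Dom_Obj tape.Cod_Obj by (simp_all only: tape.Obj_words)

lemma cl_TSeq [simp]: "wt t \<Longrightarrow> wt u \<Longrightarrow> tc t = td u \<Longrightarrow> cl (TSeq t u) = cl t \<Zsemi> cl u"
  by (simp add: tape.cls_Comp)

lemma cl_TPar [simp]: "wt t \<Longrightarrow> wt u \<Longrightarrow> cl (TPar t u) = cl t \<boxplus> cl u"
  by (simp add: tape.cls_tar)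

lemma cl_tid [simp]: "cl (tid P) = \<iota> P"
  by (simp add: tape.cls_Id)

lemma cl_TZero [simp]: "cl TZero = \<iota> []"
  using cl_tid[of "[]"] by simp

lemma eq_cl: "t \<approx> u \<Longrightarrow> cl t = cl u"
  by (rule tape.cls_cong)

lemma cl_TId [simp]: "U \<in> Wd \<Longrightarrow> cl (TId U) = \<iota> [U]"
  using eq_cl[OF tape_eq.sum_zero[of T \<Gamma> "TId U"]] cl_tid[of "[U]"] by simp

lemma cl_tsym [simp]: "cl (tsym P Q) = \<sigma> P Q"
  by (simp add: tape.symm_quot_tensor)

lemma cl_TSym [simp]: "U \<in> Wd \<Longrightarrow> V \<in> Wd \<Longrightarrow> cl (TSym U V) = \<sigma> [U] [V]"
  using tape.sw_eq_sy by simp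

lemma wt_rep [simp]: "f \<in> Arr TC \<Longrightarrow> wt (rep f)"
  by (elim tape.ArrE) (simp add: tape.wt_rep)

lemma cl_rep [simp]: "f \<in> Arr TC \<Longrightarrow> cl (rep f) = f"
  by (elim tape.ArrE) (simp add: tape.cls_rep)

lemma td_rep [simp]: "f \<in> Arr TC \<Longrightarrow> td (rep f) = Dom TC f" "f \<in> Arr TC \<Longrightarrow> tc (rep f) = Cod TC f"
  using tape.cls_Dom[of "rep f"] tape.cls_Cod[of "rep f"] by simp_all

definition tN :: "'s list list \<Rightarrow> ('s, 'g, 'f) tape set" where "tN P = cl (tnabla P)"
definition tB :: "'s list list \<Rightarrow> ('s, 'g, 'f) tape set" where "tB P = cl (tcobang P)"

lemma tN_simps [simp]: "P \<in> Pl \<Longrightarrow> tN P \<in> Arr TC" "P \<in> Pl \<Longrightarrow> Dom TC (tN P) = P @ P" "P \<in> Pl \<Longrightarrow> Cod TC (tN P) = P"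
  by (simp_all add: tN_def)

lemma tB_simps [simp]: "P \<in> Pl \<Longrightarrow> tB P \<in> Arr TC" "P \<in> Pl \<Longrightarrow> Dom TC (tB P) = []" "P \<in> Pl \<Longrightarrow> Cod TC (tB P) = P"
  by (simp_all add: tB_def)

lemma tN_Nil [simp]: "tN [] = \<iota> []" by (simp add: tN_def)
lemma tB_Nil [simp]: "tB [] = \<iota> []" by (simp add: tB_def)

lemma cl_tnabla [simp]: "cl (tnabla P) = tN P" by (simp add: tN_def)
lemma cl_tcobang [simp]: "cl (tcobang P) = tB P" by (simp add: tB_def)

lemma cl_TCobang [simp]: "U \<in> Wd \<Longrightarrow> cl (TCobang U) = tB [U]"
  using eq_cl[OF tape_eq.sum_zero[of T \<Gamma> "TCobang U"]] by (simp add: tB_def)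

lemma cl_TNabla [simp]: "U \<in> Wd \<Longrightarrow> cl (TNabla U) = tN [U]"
  unfolding tN_def by simp

lemma tN_Cons: "U \<in> Wd \<Longrightarrow> P \<in> Pl \<Longrightarrow> tN (U # P) = (\<iota> [U] \<boxplus> \<sigma> P [U] \<boxplus> \<iota> P) \<Zsemi> (tN [U] \<boxplus> tN P)"
  unfolding tN_def[of "U # P"] by simp

lemma tB_Cons: "U \<in> Wd \<Longrightarrow> P \<in> Pl \<Longrightarrow> tB (U # P) = tB [U] \<boxplus> tB P"
  unfolding tB_def[of "U # P"] by simp

lemma tB_append: "P \<in> Pl \<Longrightarrow> Q \<in> Pl \<Longrightarrow> tB (P @ Q) = tB P \<boxplus> tB Q"
proof (induction P rule: lists.induct)
  case (Cons U P)
  then show ?case using tB_Cons[of U P] tB_Cons[of U "P @ Q"] by simp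
qed simp

text \<open>The recursion of \<open>tnabla\<close> splits off one monomial, whereas
  \<open>strict_cocart\<close> asks for a splitting at any concatenation; \<open>mid4_assoc\<close>
  moves the boundary.\<close>

lemma tN_append:
  assumes "P \<in> Pl" "Q \<in> Pl"
  shows "tN (P @ Q) = (\<iota> P \<boxplus> \<sigma> Q P \<boxplus> \<iota> Q) \<Zsemi> (tN P \<boxplus> tN Q)"
  using assms(1)
proof (induction P)
  case Nil
  then show ?case using assms by simp
next
  case (Cons U P)
  note [simp] = Cons.hyps assms(2)
  let ?M = "\<iota> P \<boxplus> \<sigma> Q P \<boxplus> \<iota> Q"
  have "tN ((U # P) @ Q) = (\<iota> [U] \<boxplus> \<sigma> (P @ Q) [U] \<boxplus> \<iota> (P @ Q)) \<Zsemi> (tN [U] \<boxplus> (?M \<Zsemi> (tN P \<boxplus> tN Q)))"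
    using Cons.IH tN_Cons[of U "P @ Q"] by simp
  also have "tN [U] \<boxplus> (?M \<Zsemi> (tN P \<boxplus> tN Q)) = (\<iota> ([U] @ [U]) \<boxplus> ?M) \<Zsemi> (tN [U] \<boxplus> tN P \<boxplus> tN Q)"
    by (subst tape.tar_fuse) simp_all
  also have "(\<iota> [U] \<boxplus> \<sigma> (P @ Q) [U] \<boxplus> \<iota> (P @ Q)) \<Zsemi> ((\<iota> ([U] @ [U]) \<boxplus> ?M) \<Zsemi> (tN [U] \<boxplus> tN P \<boxplus> tN Q)) =
     ((\<iota> [U] \<boxplus> \<sigma> (P @ Q) [U] \<boxplus> \<iota> (P @ Q)) \<Zsemi> (\<iota> ([U] @ [U]) \<boxplus> ?M)) \<Zsemi> (tN [U] \<boxplus> tN P \<boxplus> tN Q)"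
    by (simp del: tape.tar_fuse tape.tar_fuse_assoc)
  also have "(\<iota> [U] \<boxplus> \<sigma> (P @ Q) [U] \<boxplus> \<iota> (P @ Q)) \<Zsemi> (\<iota> ([U] @ [U]) \<boxplus> ?M) =
     (\<iota> ([U] @ P) \<boxplus> \<sigma> Q ([U] @ P) \<boxplus> \<iota> Q) \<Zsemi> (\<iota> [U] \<boxplus> \<sigma> P [U] \<boxplus> \<iota> P \<boxplus> \<iota> (Q @ Q))"
    using tape.smc.mid4_assoc[of "[U]" P Q] by (simp only: tape.Obj_words tape.tob_append) simp
  also have "\<dots> \<Zsemi> (tN [U] \<boxplus> tN P \<boxplus> tN Q) = (\<iota> (U # P) \<boxplus> \<sigma> Q (U # P) \<boxplus> \<iota> Q) \<Zsemi>
     (((\<iota> [U] \<boxplus> \<sigma> P [U] \<boxplus> \<iota> P) \<boxplus> \<iota> (Q @ Q)) \<Zsemi> ((tN [U] \<boxplus> tN P) \<boxplus> tN Q))"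
    by (simp del: tape.tar_fuse tape.tar_fuse_assoc)
  also have "((\<iota> [U] \<boxplus> \<sigma> P [U] \<boxplus> \<iota> P) \<boxplus> \<iota> (Q @ Q)) \<Zsemi> ((tN [U] \<boxplus> tN P) \<boxplus> tN Q) = tN (U # P) \<boxplus> tN Q"
    by (subst tape.tar_fuse) (simp_all add: tN_Cons[of U P])
  finally show ?case .
qed

text \<open>The congruence postulates this for circuits and operations; symmetries follow from
  naturality of the symmetry and codiagonals from the unit law.\<close>

lemma tB_natural: "wt t \<Longrightarrow> tB (td t) \<Zsemi> cl t = tB (tc t)"
proof (induction t)
  case (TCirc c)
  then show ?case using eq_cl[OF tape_eq.cobang_circ[of \<Gamma> c T]] by (simp add: wt_circ_words)
next
  case (TSym U V)
  then show ?case using tape.smc.symm_nat[of "tB [U]" "tB [V]" "[U]" "[V]"]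
    by (simp add: tB_Cons[of _ "[_]"])
next
  case (TSeq t u)
  from TSeq.prems have "tB (td t) \<Zsemi> cl (TSeq t u) = (tB (td t) \<Zsemi> cl t) \<Zsemi> cl u" by (simp add: wt_poly)
  also have "tB (td t) \<Zsemi> cl t = tB (td u)" using TSeq by simp
  also have "\<dots> \<Zsemi> cl u = tB (tc u)" using TSeq by simp
  finally show ?case by simp
next
  case (TPar t u)
  then show ?case by (simp add: tB_append wt_poly)
next
  case (TNabla U)
  then have [simp]: "U \<in> Wd" by simp
  have "tB [U, U] = tB [U] \<Zsemi> (tB [U] \<boxplus> \<iota> [U])"
    using tape.tar_fuse[of "\<iota> []" "tB [U]" "tB [U]" "\<iota> [U]"] by (simp add: tB_Cons[of _ "[_]"])
  moreover have "(tB [U] \<boxplus> \<iota> [U]) \<Zsemi> tN [U] = \<iota> [U]"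
    using eq_cl[OF tape_eq.nabla_unit[of U \<Gamma> T]] by simp
  ultimately show ?case by simp
next
  case (TOp f U)
  then show ?case using eq_cl[OF tape_eq.cobang_op[of f T U \<Gamma>]] by simp
qed (auto simp: )

lemma tN_comm: "U \<in> Wd \<Longrightarrow> \<sigma> [U] [U] \<Zsemi> tN [U] = tN [U]"
  using eq_cl[OF tape_eq.nabla_comm[of U \<Gamma> T]] by simp

lemma tN_assoc: "U \<in> Wd \<Longrightarrow> (tN [U] \<boxplus> \<iota> [U]) \<Zsemi> tN [U] = (\<iota> [U] \<boxplus> tN [U]) \<Zsemi> tN [U]"
  using eq_cl[OF tape_eq.nabla_assoc[of U \<Gamma> T]] by simp

lemma tN_unit1: "U \<in> Wd \<Longrightarrow> (tB [U] \<boxplus> \<iota> [U]) \<Zsemi> tN [U] = \<iota> [U]"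
  using eq_cl[OF tape_eq.nabla_unit[of U \<Gamma> T]] by simp

text \<open>Brackets the fourfold codiagonal so that the two middle inputs meet first. There
  commutativity absorbs the middle swap, which gives naturality of the codiagonal at itself in
  \<open>tN_natural\<close>.\<close>

lemma tN_four:
  assumes [simp]: "U \<in> Wd"
  shows "(tN [U] \<boxplus> tN [U]) \<Zsemi> tN [U] = (\<iota> [U] \<boxplus> tN [U] \<boxplus> \<iota> [U]) \<Zsemi> ((\<iota> [U] \<boxplus> tN [U]) \<Zsemi> tN [U])"
proof -
  have "(tN [U] \<boxplus> tN [U]) \<Zsemi> tN [U] = (\<iota> ([U] @ [U]) \<boxplus> tN [U]) \<Zsemi> ((tN [U] \<boxplus> \<iota> [U]) \<Zsemi> tN [U])"
    by simp
  also have "\<dots> = ((\<iota> [U] \<boxplus> \<iota> [U] \<boxplus> tN [U]) \<Zsemi> (\<iota> [U] \<boxplus> tN [U])) \<Zsemi> tN [U]"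
    unfolding tN_assoc[OF assms] using tape.tar_assoc[of "\<iota> [U]" "\<iota> [U]" "tN [U]"]
    by (simp del: tape.tar_fuse tape.tar_fuse_assoc)
  also have "(\<iota> [U] \<boxplus> \<iota> [U] \<boxplus> tN [U]) \<Zsemi> (\<iota> [U] \<boxplus> tN [U]) = \<iota> [U] \<boxplus> ((tN [U] \<boxplus> \<iota> [U]) \<Zsemi> tN [U])"
    unfolding tN_assoc[OF assms] by (subst tape.tar_fuse) (simp_all del: tape.tar_fuse)
  also have "\<dots> = (\<iota> [U] \<boxplus> tN [U] \<boxplus> \<iota> [U]) \<Zsemi> (\<iota> [U] \<boxplus> tN [U])"
    by (simp add: tape.whisk_left del: tape.tar_fuse tape.tar_fuse_assoc)
  also have "\<dots> \<Zsemi> tN [U] = (\<iota> [U] \<boxplus> tN [U] \<boxplus> \<iota> [U]) \<Zsemi> ((\<iota> [U] \<boxplus> tN [U]) \<Zsemi> tN [U])"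
    by (simp del: tape.tar_fuse tape.tar_fuse_assoc)
  finally show ?thesis .
qed

text \<open>Axioms cover circuits and operations. At a symmetry it is \<open>mid4_symm\<close>, at a
  sum the swap is carried past the two tapes, at a codiagonal it is associativity with
  commutativity, and at a cobang the unit law.\<close>

lemma tN_natural: "wt t \<Longrightarrow> tN (td t) \<Zsemi> cl t = (cl t \<boxplus> cl t) \<Zsemi> tN (tc t)"
proof (induction t)
  case (TCirc c)
  then show ?case using eq_cl[OF tape_eq.nabla_circ[of \<Gamma> c T]] by (simp add: wt_circ_words)
next
  case (TSym U V)
  then have [simp]: "U \<in> Wd" "V \<in> Wd" by auto
  have "tN [U, V] \<Zsemi> \<sigma> [U] [V] = (\<iota> [U] \<boxplus> \<sigma> [V] [U] \<boxplus> \<iota> [V]) \<Zsemi> ((tN [U] \<boxplus> tN [V]) \<Zsemi> \<sigma> [U] [V])"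
    by (simp add: tN_Cons[of U "[V]"])
  also have "(tN [U] \<boxplus> tN [V]) \<Zsemi> \<sigma> [U] [V] = \<sigma> ([U] @ [U]) ([V] @ [V]) \<Zsemi> (tN [V] \<boxplus> tN [U])"
    by (simp add: tape.smc.symm_nat)
  also have "(\<iota> [U] \<boxplus> \<sigma> [V] [U] \<boxplus> \<iota> [V]) \<Zsemi> (\<sigma> ([U] @ [U]) ([V] @ [V]) \<Zsemi> (tN [V] \<boxplus> tN [U])) =
     ((\<iota> [U] \<boxplus> \<sigma> [V] [U] \<boxplus> \<iota> [V]) \<Zsemi> \<sigma> ([U] @ [U]) ([V] @ [V])) \<Zsemi> (tN [V] \<boxplus> tN [U])"
    by simp
  also have "(\<iota> [U] \<boxplus> \<sigma> [V] [U] \<boxplus> \<iota> [V]) \<Zsemi> \<sigma> ([U] @ [U]) ([V] @ [V]) = (\<sigma> [U] [V] \<boxplus> \<sigma> [U] [V]) \<Zsemi> (\<iota> [V] \<boxplus> \<sigma> [U] [V] \<boxplus> \<iota> [U])"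
    using tape.smc.mid4_symm[of "[U]" "[V]"] by (simp only: tape.Obj_words tape.tob_append) simp
  also have "\<dots> \<Zsemi> (tN [V] \<boxplus> tN [U]) = (\<sigma> [U] [V] \<boxplus> \<sigma> [U] [V]) \<Zsemi> tN [V, U]"
    by (simp add: tN_Cons[of V "[U]"] del: tape.tar_fuse tape.tar_fuse_assoc)
  finally show ?case by simp
next
  case (TSeq t u)
  have "tN (td t) \<Zsemi> cl (TSeq t u) = (tN (td t) \<Zsemi> cl t) \<Zsemi> cl u" using TSeq.prems by (simp add: wt_poly)
  also have "tN (td t) \<Zsemi> cl t = (cl t \<boxplus> cl t) \<Zsemi> tN (td u)" using TSeq by simp
  also have "\<dots> \<Zsemi> cl u = (cl t \<boxplus> cl t) \<Zsemi> (tN (td u) \<Zsemi> cl u)" using TSeq.prems by (simp add: wt_poly)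
  also have "tN (td u) \<Zsemi> cl u = (cl u \<boxplus> cl u) \<Zsemi> tN (tc u)" using TSeq by simp
  also have "(cl t \<boxplus> cl t) \<Zsemi> ((cl u \<boxplus> cl u) \<Zsemi> tN (tc u)) = (cl (TSeq t u) \<boxplus> cl (TSeq t u)) \<Zsemi> tN (tc u)"
    using TSeq.prems by (simp add: wt_poly)
  finally show ?case by simp
next
  case (TPar t u)
  note [simp] = wt_poly
  from TPar.prems have [simp]: "wt t" "wt u" by auto
  have s: "\<sigma> (td u) (td t) \<Zsemi> (cl t \<boxplus> cl u) = (cl u \<boxplus> cl t) \<Zsemi> \<sigma> (tc u) (tc t)"
    by (simp add: tape.smc.symm_nat)
  have "tN (td (TPar t u)) \<Zsemi> cl (TPar t u) = (\<iota> (td t) \<boxplus> \<sigma> (td u) (td t) \<boxplus> \<iota> (td u)) \<Zsemi> ((tN (td t) \<Zsemi> cl t) \<boxplus> (tN (td u) \<Zsemi> cl u))"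
    by (simp add: tN_append)
  also have "\<dots> = (\<iota> (td t) \<boxplus> \<sigma> (td u) (td t) \<boxplus> \<iota> (td u)) \<Zsemi> ((cl t \<boxplus> (cl t \<boxplus> cl u) \<boxplus> cl u) \<Zsemi> (tN (tc t) \<boxplus> tN (tc u)))"
    unfolding TPar.IH(1)[OF \<open>wt t\<close>] TPar.IH(2)[OF \<open>wt u\<close>]
    using tape.tar_fuse[of "cl t \<boxplus> cl t" "tN (tc t)" "cl u \<boxplus> cl u" "tN (tc u)"] by (simp del: tape.tar_fuse tape.tar_fuse_assoc)
  also have "\<dots> = (cl t \<boxplus> (\<sigma> (td u) (td t) \<Zsemi> (cl t \<boxplus> cl u)) \<boxplus> cl u) \<Zsemi> (tN (tc t) \<boxplus> tN (tc u))"
  proof -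
    have "(\<iota> (td t) \<boxplus> \<sigma> (td u) (td t) \<boxplus> \<iota> (td u)) \<Zsemi> (cl t \<boxplus> ((cl t \<boxplus> cl u) \<boxplus> cl u)) = cl t \<boxplus> ((\<sigma> (td u) (td t) \<Zsemi> (cl t \<boxplus> cl u)) \<boxplus> cl u)"
      by (subst tape.tar_fuse, simp_all del: tape.tar_fuse tape.tar_assoc, subst tape.tar_fuse, simp_all del: tape.tar_assoc)
    then show ?thesis
      using tape.Comp_assoc_simp[of "\<iota> (td t) \<boxplus> \<sigma> (td u) (td t) \<boxplus> \<iota> (td u)" "cl t \<boxplus> ((cl t \<boxplus> cl u) \<boxplus> cl u)" "tN (tc t) \<boxplus> tN (tc u)"]
      by (simp del: tape.tar_fuse tape.tar_fuse_assoc tape.Comp_assoc_simp)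
  qed
  also have "\<dots> = (cl t \<boxplus> ((cl u \<boxplus> cl t) \<Zsemi> \<sigma> (tc u) (tc t)) \<boxplus> cl u) \<Zsemi> (tN (tc t) \<boxplus> tN (tc u))"
    unfolding s ..
  also have "cl t \<boxplus> ((cl u \<boxplus> cl t) \<Zsemi> \<sigma> (tc u) (tc t)) \<boxplus> cl u = (cl t \<boxplus> ((cl u \<boxplus> cl t) \<boxplus> cl u)) \<Zsemi> (\<iota> (tc t) \<boxplus> \<sigma> (tc u) (tc t) \<boxplus> \<iota> (tc u))"
      by (subst tape.tar_fuse, simp_all del: tape.tar_fuse tape.tar_assoc, subst tape.tar_fuse, simp_all del: tape.tar_assoc)
  also have "\<dots> \<Zsemi> (tN (tc t) \<boxplus> tN (tc u)) = (cl (TPar t u) \<boxplus> cl (TPar t u)) \<Zsemi> tN (tc (TPar t u))"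
    by (simp add: tN_append del: tape.tar_fuse tape.tar_fuse_assoc)
  finally show ?case .
next
  case (TNabla U)
  then have [simp]: "U \<in> Wd" by simp
  have "tN [U, U] \<Zsemi> tN [U] = (\<iota> [U] \<boxplus> \<sigma> [U] [U] \<boxplus> \<iota> [U]) \<Zsemi> ((tN [U] \<boxplus> tN [U]) \<Zsemi> tN [U])"
    by (simp add: tN_Cons[of U "[U]"])
  also have "\<dots> = (\<iota> [U] \<boxplus> (\<sigma> [U] [U] \<Zsemi> tN [U]) \<boxplus> \<iota> [U]) \<Zsemi> ((\<iota> [U] \<boxplus> tN [U]) \<Zsemi> tN [U])"
    unfolding tN_four[OF \<open>U \<in> Wd\<close>] by (simp add: tape.whisk_left tape.whisk_right del: tape.tar_fuse tape.tar_fuse_assoc)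
  also have "\<dots> = (tN [U] \<boxplus> tN [U]) \<Zsemi> tN [U]"
    by (simp only: tN_comm[OF \<open>U \<in> Wd\<close>] tN_four[OF \<open>U \<in> Wd\<close>])
  finally show ?case by simp
next
  case (TCobang U)
  then have [simp]: "U \<in> Wd" by simp
  have "tB [U] \<boxplus> tB [U] = tB [U] \<Zsemi> (tB [U] \<boxplus> \<iota> [U])"
    using tape.tar_fuse[of "\<iota> []" "tB [U]" "tB [U]" "\<iota> [U]"] by simp
  then show ?case by (simp add: tN_unit1)
next
  case (TOp f U)
  then show ?case using eq_cl[OF tape_eq.nabla_op[of f T U \<Gamma>]] by simp
qed auto

lemma tN_unit2:
  assumes [simp]: "U \<in> Wd"
  shows "(\<iota> [U] \<boxplus> tB [U]) \<Zsemi> tN [U] = \<iota> [U]"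
proof -
  have "(\<iota> [U] \<boxplus> tB [U]) \<Zsemi> (\<sigma> [U] [U] \<Zsemi> tN [U]) = (tB [U] \<boxplus> \<iota> [U]) \<Zsemi> tN [U]"
    using tape.smc.symm_nat[of "\<iota> [U]" "tB [U]" "[U]" "[U]"]
      tape.Comp_assoc_simp[of "\<iota> [U] \<boxplus> tB [U]" "\<sigma> [U] [U]" "tN [U]"] by simp
  then show ?thesis by (simp add: tN_comm tN_unit1)
qed

lemma tN_unit:
  assumes "P \<in> Pl"
  shows "(tB P \<boxplus> \<iota> P) \<Zsemi> tN P = \<iota> P" "(\<iota> P \<boxplus> tB P) \<Zsemi> tN P = \<iota> P"
  using assms
proof (induction P)
  case (Cons U P)
  note [simp] = Cons.hyps
  have a: "(tB P \<boxplus> \<iota> [U]) \<Zsemi> \<sigma> P [U] = \<iota> [U] \<boxplus> tB P" "(\<iota> P \<boxplus> tB [U]) \<Zsemi> \<sigma> P [U] = tB [U] \<boxplus> \<iota> P"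
    by (simp_all add: tape.smc.symm_nat)
  { case 1
    have "(tB (U # P) \<boxplus> \<iota> (U # P)) \<Zsemi> tN (U # P) = (tB [U] \<boxplus> (tB P \<boxplus> \<iota> [U]) \<boxplus> \<iota> P) \<Zsemi> tN (U # P)" by (simp add: tB_Cons[of U P])
    also have "\<dots> = (tB [U] \<boxplus> ((tB P \<boxplus> \<iota> [U]) \<Zsemi> \<sigma> P [U]) \<boxplus> \<iota> P) \<Zsemi> (tN [U] \<boxplus> tN P)"
    proof -
      have "(tB [U] \<boxplus> ((tB P \<boxplus> \<iota> [U]) \<boxplus> \<iota> P)) \<Zsemi> (\<iota> [U] \<boxplus> \<sigma> P [U] \<boxplus> \<iota> P) = tB [U] \<boxplus> ((tB P \<boxplus> \<iota> [U]) \<Zsemi> \<sigma> P [U]) \<boxplus> \<iota> P"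
        by (subst tape.tar_fuse, simp_all del: tape.tar_fuse tape.tar_assoc, subst tape.tar_fuse, simp_all del: tape.tar_assoc)
      then show ?thesis unfolding tN_Cons[OF Cons.hyps]
        by (subst tape.Comp_assoc_simp[symmetric]) (simp_all del: tape.tar_fuse tape.tar_fuse_assoc tape.Comp_assoc_simp)
    qed
    also have "\<dots> = ((tB [U] \<boxplus> \<iota> [U]) \<boxplus> (tB P \<boxplus> \<iota> P)) \<Zsemi> (tN [U] \<boxplus> tN P)"
      unfolding a by simp
    also have "\<dots> = \<iota> [U] \<boxplus> \<iota> P" using Cons.IH by (subst tape.tar_fuse) (simp_all add: tN_unit1)
    finally show ?case by simp }
  { case 2
    have "(\<iota> (U # P) \<boxplus> tB (U # P)) \<Zsemi> tN (U # P) = (\<iota> [U] \<boxplus> (\<iota> P \<boxplus> tB [U]) \<boxplus> tB P) \<Zsemi> tN (U # P)" by (simp add: tB_Cons[of U P] tape.Id_Cons[of U P] del: tape.tar_Id)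
    also have "\<dots> = (\<iota> [U] \<boxplus> ((\<iota> P \<boxplus> tB [U]) \<Zsemi> \<sigma> P [U]) \<boxplus> tB P) \<Zsemi> (tN [U] \<boxplus> tN P)"
    proof -
      have "(\<iota> [U] \<boxplus> ((\<iota> P \<boxplus> tB [U]) \<boxplus> tB P)) \<Zsemi> (\<iota> [U] \<boxplus> \<sigma> P [U] \<boxplus> \<iota> P) = \<iota> [U] \<boxplus> ((\<iota> P \<boxplus> tB [U]) \<Zsemi> \<sigma> P [U]) \<boxplus> tB P"
        by (subst tape.tar_fuse, simp_all del: tape.tar_fuse tape.tar_assoc, subst tape.tar_fuse, simp_all del: tape.tar_assoc)
      then show ?thesis unfolding tN_Cons[OF Cons.hyps]
        by (subst tape.Comp_assoc_simp[symmetric]) (simp_all del: tape.tar_fuse tape.tar_fuse_assoc tape.Comp_assoc_simp)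
    qed
    also have "\<dots> = ((\<iota> [U] \<boxplus> tB [U]) \<boxplus> (\<iota> P \<boxplus> tB P)) \<Zsemi> (tN [U] \<boxplus> tN P)"
      unfolding a by simp
    also have "\<dots> = \<iota> [U] \<boxplus> \<iota> P" using Cons.IH by (subst tape.tar_fuse) (simp_all add: tN_unit2)
    finally show ?case by simp }
qed simp_all

text \<open>From here on equations between tapes out of a sum may be tested on injections.\<close>

sublocale tsum: strict_cocart TC TS tN tB
proof unfold_locales
  fix f assume "f \<in> Arr TC"
  then obtain t where t: "wt t" "f = cl t" by (rule tape.ArrE)
  show "tN (Dom TC f) \<Zsemi> f = (f \<boxplus> f) \<Zsemi> tN (Cod TC f)" "tB (Dom TC f) \<Zsemi> f = tB (Cod TC f)"
    unfolding t(2) using t(1) tN_natural[of t] tB_natural[of t] by simp_all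
qed (simp_all add: Hom_def tN_unit tN_append tB_append tape.is_strict)

end

section \<open>Whiskerings\<close>

context tapes
begin

definition DL :: "'s list list \<Rightarrow> 's list list \<Rightarrow> 's list list \<Rightarrow> ('s, 'g, 'f) tape set" where "DL P Q R = cl (tdistl P Q R)"
definition DLI :: "'s list list \<Rightarrow> 's list list \<Rightarrow> 's list list \<Rightarrow> ('s, 'g, 'f) tape set" where "DLI P Q R = cl (tdistl_inv P Q R)"

lemma in_Nil [simp]: "X \<in> Pl \<Longrightarrow> tsum.in1 X [] = \<iota> X" "X \<in> Pl \<Longrightarrow> tsum.in2 [] X = \<iota> X"
    "X \<in> Pl \<Longrightarrow> tsum.in1 [] X = tB X" "X \<in> Pl \<Longrightarrow> tsum.in2 X [] = tB X"
  using tsum.in_I[of X] by simp_all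

abbreviation pp (infixr "\<star>" 75) where "P \<star> Q \<equiv> poly_prod P Q"

lemma cl_tdistl [simp]: "cl (tdistl P Q R) = DL P Q R" and cl_tdistl_inv [simp]: "cl (tdistl_inv P Q R) = DLI P Q R"
  by (simp_all add: DL_def DLI_def)

lemma DL_simps [simp]:
  assumes "P \<in> Pl" "Q \<in> Pl" "R \<in> Pl"
  shows "DL P Q R \<in> Arr TC" "Dom TC (DL P Q R) = P \<star> (Q @ R)" "Cod TC (DL P Q R) = P \<star> Q @ P \<star> R"
   "DLI P Q R \<in> Arr TC" "Cod TC (DLI P Q R) = P \<star> (Q @ R)" "Dom TC (DLI P Q R) = P \<star> Q @ P \<star> R"
  using assms by (simp_all add: DL_def DLI_def del: cl_tdistl cl_tdistl_inv)

lemma DL_Nil [simp]: "DL [] Q R = \<iota> []" "DLI [] Q R = \<iota> []"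
  by (simp_all add: DL_def DLI_def)

lemma DL_Cons:
  "U \<in> Wd \<Longrightarrow> P \<in> Pl \<Longrightarrow> Q \<in> Pl \<Longrightarrow> R \<in> Pl \<Longrightarrow> DL (U # P) Q R =
    (\<iota> ([U] \<star> (Q @ R)) \<boxplus> DL P Q R) \<Zsemi> (\<iota> ([U] \<star> Q) \<boxplus> \<sigma> ([U] \<star> R) (P \<star> Q) \<boxplus> \<iota> (P \<star> R))"
  "U \<in> Wd \<Longrightarrow> P \<in> Pl \<Longrightarrow> Q \<in> Pl \<Longrightarrow> R \<in> Pl \<Longrightarrow> DLI (U # P) Q R =
    (\<iota> ([U] \<star> Q) \<boxplus> \<sigma> (P \<star> Q) ([U] \<star> R) \<boxplus> \<iota> (P \<star> R)) \<Zsemi> (\<iota> ([U] \<star> (Q @ R)) \<boxplus> DLI P Q R)"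
  unfolding DL_def[of "U # P"] DLI_def[of "U # P"] by simp_all

lemma DL_sing [simp]:
  "U \<in> Wd \<Longrightarrow> Q \<in> Pl \<Longrightarrow> R \<in> Pl \<Longrightarrow> DL [U] Q R = \<iota> ([U] \<star> (Q @ R))"
  "U \<in> Wd \<Longrightarrow> Q \<in> Pl \<Longrightarrow> R \<in> Pl \<Longrightarrow> DLI [U] Q R = \<iota> ([U] \<star> (Q @ R))"
  by (simp_all add: DL_Cons[of U "[]"])

lemma DL_zero [simp]:
  assumes "P \<in> Pl" "Q \<in> Pl"
  shows "DL P Q [] = \<iota> (P \<star> Q)" "DLI P Q [] = \<iota> (P \<star> Q)" "DL P [] Q = \<iota> (P \<star> Q)" "DLI P [] Q = \<iota> (P \<star> Q)"
  using assms by (induction P) (simp_all add: DL_Cons)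

lemma DL_DLI:
  assumes "P \<in> Pl" "Q \<in> Pl" "R \<in> Pl"
  shows "DL P Q R \<Zsemi> DLI P Q R = \<iota> (P \<star> (Q @ R))" "DLI P Q R \<Zsemi> DL P Q R = \<iota> (P \<star> Q @ P \<star> R)"
  using assms(1)
proof (induction P)
  case (Cons U P)
  note [simp] = assms Cons.hyps
  { case 1
    have "DL (U # P) Q R \<Zsemi> DLI (U # P) Q R = (\<iota> ([U] \<star> (Q @ R)) \<boxplus> DL P Q R) \<Zsemi>
     (((\<iota> ([U] \<star> Q) \<boxplus> \<sigma> ([U] \<star> R) (P \<star> Q) \<boxplus> \<iota> (P \<star> R)) \<Zsemi> (\<iota> ([U] \<star> Q) \<boxplus> \<sigma> (P \<star> Q) ([U] \<star> R) \<boxplus> \<iota> (P \<star> R))) \<Zsemi>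
     (\<iota> ([U] \<star> (Q @ R)) \<boxplus> DLI P Q R))"
      by (simp add: DL_Cons del: tape.tar_fuse tape.tar_fuse_assoc)
    then show ?case using Cons.IH by simp }
  { case 2
    have "DLI (U # P) Q R \<Zsemi> DL (U # P) Q R = (\<iota> ([U] \<star> Q) \<boxplus> \<sigma> (P \<star> Q) ([U] \<star> R) \<boxplus> \<iota> (P \<star> R)) \<Zsemi>
     (((\<iota> ([U] \<star> (Q @ R)) \<boxplus> DLI P Q R) \<Zsemi> (\<iota> ([U] \<star> (Q @ R)) \<boxplus> DL P Q R)) \<Zsemi>
     (\<iota> ([U] \<star> Q) \<boxplus> \<sigma> ([U] \<star> R) (P \<star> Q) \<boxplus> \<iota> (P \<star> R)))"
      by (simp add: DL_Cons del: tape.tar_fuse tape.tar_fuse_assoc)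
    then show ?case using Cons.IH by simp }
qed simp_all

lemma cl_whisk1_tid [simp]:
  "U \<in> Wd \<Longrightarrow> P \<in> Pl \<Longrightarrow> cl (lwhisk1 U (tid P)) = \<iota> ([U] \<star> P)"
  "U \<in> Wd \<Longrightarrow> P \<in> Pl \<Longrightarrow> cl (rwhisk1 U (tid P)) = \<iota> (P \<star> [U])"
  by (induction P) (auto simp: poly_prod_sing)

lemma cl_lwhisk_tid: "Q \<in> Pl \<Longrightarrow> P \<in> Pl \<Longrightarrow> cl (lwhisk Q (tid P)) = \<iota> (Q \<star> P)"
  by (induction Q rule: lists.induct) simp_all

lemma cl_rwhisk_tid: "Q \<in> Pl \<Longrightarrow> P \<in> Pl \<Longrightarrow> cl (rwhisk T \<Gamma> Q (tid P)) = \<iota> (P \<star> Q)"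
proof (induction Q rule: lists.induct)
  case (Cons W Q)
  then show ?case using DL_DLI[of P "[W]" Q] by (simp add: poly_prod_sing)
qed simp

text \<open>Tensoring with \<open>tid P\<close> is whiskering by \<open>P\<close>, since the other
  whiskering then acts on an identity; so \<open>prod_cong\<close> gives the congruence property,
  here and in \<open>rwhisk_cong\<close>.\<close>

lemma lwhisk_cong:
  assumes "P \<in> Pl" "t \<approx> u"
  shows "cl (lwhisk P t) = cl (lwhisk P u)"
proof -
  have t: "wt t" "wt u" "td t = td u" "tc t = tc u" using tape_eq_typing[OF assms(2)] by auto
  have "cl (tprod T \<Gamma> (tid P) t) = cl (tprod T \<Gamma> (tid P) u)"
    using assms by (intro eq_cl tape_eq.prod_cong tape_eq.refl) auto
  then show ?thesis using t assms(1) by (simp add: tprod_def cl_rwhisk_tid wt_poly)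
qed

lemma rwhisk_cong:
  assumes "P \<in> Pl" "t \<approx> u"
  shows "cl (rwhisk T \<Gamma> P t) = cl (rwhisk T \<Gamma> P u)"
proof -
  have t: "wt t" "wt u" "td t = td u" "tc t = tc u" using tape_eq_typing[OF assms(2)] by auto
  have "cl (tprod T \<Gamma> t (tid P)) = cl (tprod T \<Gamma> u (tid P))"
    using assms by (intro eq_cl tape_eq.prod_cong tape_eq.refl) auto
  moreover have "td u \<in> Pl" using t by (simp add: wt_poly)
  ultimately show ?thesis using t assms(1) by (simp add: tprod_def cl_lwhisk_tid)
qed

definition LW :: "'s list list \<Rightarrow> ('s, 'g, 'f) tape set \<Rightarrow> ('s, 'g, 'f) tape set" where "LW P a = cl (lwhisk P (rep a))"
definition RW :: "'s list list \<Rightarrow> ('s, 'g, 'f) tape set \<Rightarrow> ('s, 'g, 'f) tape set" where "RW P a = cl (rwhisk T \<Gamma> P (rep a))"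

lemma LW_cl: "P \<in> Pl \<Longrightarrow> wt t \<Longrightarrow> LW P (cl t) = cl (lwhisk P t)"
  unfolding LW_def by (rule lwhisk_cong[OF _ tape_eq.sym[OF tape.eqv_rep]])

lemma RW_cl: "P \<in> Pl \<Longrightarrow> wt t \<Longrightarrow> RW P (cl t) = cl (rwhisk T \<Gamma> P t)"
  unfolding RW_def by (rule rwhisk_cong[OF _ tape_eq.sym[OF tape.eqv_rep]])

lemma LW_simps [simp]:
  assumes "P \<in> Pl" "a \<in> Arr TC"
  shows "LW P a \<in> Arr TC" "Dom TC (LW P a) = P \<star> Dom TC a" "Cod TC (LW P a) = P \<star> Cod TC a"
  using assms by (simp_all add: LW_def)

lemma RW_simps [simp]:
  assumes "P \<in> Pl" "a \<in> Arr TC"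
  shows "RW P a \<in> Arr TC" "Dom TC (RW P a) = Dom TC a \<star> P" "Cod TC (RW P a) = Cod TC a \<star> P"
  using assms by (simp_all add: RW_def)

lemma LW_sing_cl: "U \<in> Wd \<Longrightarrow> wt t \<Longrightarrow> LW [U] (cl t) = cl (lwhisk1 U t)"
  by (simp add: LW_cl)

lemma RW_sing_cl: "U \<in> Wd \<Longrightarrow> wt t \<Longrightarrow> RW [U] (cl t) = cl (rwhisk1 U t)"
  by (simp add: RW_cl wt_poly poly_prod_sing)

lemma LW_Nil [simp]: "a \<in> Arr TC \<Longrightarrow> LW [] a = \<iota> []"
  by (simp add: LW_def)

lemma LW_Cons: "U \<in> Wd \<Longrightarrow> P \<in> Pl \<Longrightarrow> a \<in> Arr TC \<Longrightarrow> LW (U # P) a = LW [U] a \<boxplus> LW P a"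
  by (simp add: LW_def)

lemma LW_append: "P \<in> Pl \<Longrightarrow> Q \<in> Pl \<Longrightarrow> a \<in> Arr TC \<Longrightarrow> LW (P @ Q) a = LW P a \<boxplus> LW Q a"
proof (induction P rule: lists.induct)
  case (Cons U P)
  then show ?case using LW_Cons[of U P a] LW_Cons[of U "P @ Q" a] by simp
qed simp

lemma LW_Id [simp]: "P \<in> Pl \<Longrightarrow> Q \<in> Pl \<Longrightarrow> LW P (\<iota> Q) = \<iota> (P \<star> Q)"
  using LW_cl[of P "tid Q"] cl_lwhisk_tid[of P Q] by simp

lemma RW_Id [simp]: "P \<in> Pl \<Longrightarrow> Q \<in> Pl \<Longrightarrow> RW P (\<iota> Q) = \<iota> (Q \<star> P)"
  using RW_cl[of P "tid Q"] cl_rwhisk_tid[of P Q] by simp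

lemma LW_Comp:
  assumes "P \<in> Pl" "a \<in> Arr TC" "b \<in> Arr TC" "Cod TC a = Dom TC b"
  shows "LW P (a \<Zsemi> b) = LW P a \<Zsemi> LW P b"
proof -
  obtain t u where t: "wt t" "wt u" "a = cl t" "b = cl u" using assms by (elim tape.ArrE)
  have 1: "LW [U] (cl (TSeq t u)) = LW [U] (cl t) \<Zsemi> LW [U] (cl u)" if "U \<in> Wd" for U
    using that t assms(4) LW_sing_cl[of U "TSeq t u"] LW_sing_cl[of U t] LW_sing_cl[of U u] by simp
  show ?thesis using assms(1)
  proof (induction P)
    case (Cons U P)
    then show ?case using 1[of U] t assms(4) LW_Cons[of U P] by simp
  qed (use assms in simp)
qed

text \<open>Whiskering by a single monomial acts generator by generator and so preserves sums on the
  nose. On the left, a general polynomial does so only up to the distributor.\<close>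

lemma LW_sing_tar:
  assumes "U \<in> Wd" "a \<in> Arr TC" "b \<in> Arr TC"
  shows "LW [U] (a \<boxplus> b) = LW [U] a \<boxplus> LW [U] b"
proof -
  obtain t u where t: "wt t" "wt u" "a = cl t" "b = cl u" using assms by (elim tape.ArrE)
  then show ?thesis using assms(1) LW_sing_cl[of U "TPar t u"] LW_sing_cl[of U t] LW_sing_cl[of U u] by simp
qed

lemma RW_sing_tar:
  assumes "U \<in> Wd" "a \<in> Arr TC" "b \<in> Arr TC"
  shows "RW [U] (a \<boxplus> b) = RW [U] a \<boxplus> RW [U] b"
proof -
  obtain t u where t: "wt t" "wt u" "a = cl t" "b = cl u" using assms by (elim tape.ArrE)
  then show ?thesis using assms(1) RW_sing_cl[of U "TPar t u"] RW_sing_cl[of U t] RW_sing_cl[of U u] by simp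
qed

lemma LW_tB [simp]:
  assumes "P \<in> Pl" "Q \<in> Pl"
  shows "LW P (tB Q) = tB (P \<star> Q)"
  by (rule tsum.initial_ext) (simp_all add: assms)

lemma LW_sing_in [simp]:
  assumes "U \<in> Wd" "P \<in> Pl" "Q \<in> Pl"
  shows "LW [U] (tsum.in1 P Q) = tsum.in1 (map ((@) U) P) (map ((@) U) Q)"
     "LW [U] (tsum.in2 P Q) = tsum.in2 (map ((@) U) P) (map ((@) U) Q)"
  using assms by (simp_all add: tsum.in1_def tsum.in2_def LW_sing_tar)

lemma RW_tB [simp]:
  assumes "P \<in> Pl" "Q \<in> Pl"
  shows "RW P (tB Q) = tB (Q \<star> P)"
  by (rule tsum.initial_ext) (simp_all add: assms)

lemma RW_sing_in:
  assumes "U \<in> Wd" "P \<in> Pl" "Q \<in> Pl"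
  shows "RW [U] (tsum.in1 P Q) = tsum.in1 (P \<star> [U]) (Q \<star> [U])"
     "RW [U] (tsum.in2 P Q) = tsum.in2 (P \<star> [U]) (Q \<star> [U])"
  using assms by (simp_all add: tsum.in1_def tsum.in2_def RW_sing_tar)

text \<open>Composes \<open>mid4_in\<close> with the opposite swap.\<close>

lemma mid4_out:
  assumes [simp]: "A \<in> Pl" "B \<in> Pl" "D \<in> Pl" "E \<in> Pl"
  shows "(tsum.in1 A D \<boxplus> tsum.in1 B E) \<Zsemi> (\<iota> A \<boxplus> \<sigma> D B \<boxplus> \<iota> E) = tsum.in1 (A @ B) (D @ E)"
    "(tsum.in2 A D \<boxplus> tsum.in2 B E) \<Zsemi> (\<iota> A \<boxplus> \<sigma> D B \<boxplus> \<iota> E) = tsum.in2 (A @ B) (D @ E)"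
proof -
  have m: "(\<iota> A \<boxplus> \<sigma> B D \<boxplus> \<iota> E) \<Zsemi> (\<iota> A \<boxplus> \<sigma> D B \<boxplus> \<iota> E) = \<iota> (A @ B @ D @ E)" by simp
  have "(tsum.in1 A D \<boxplus> tsum.in1 B E) \<Zsemi> (\<iota> A \<boxplus> \<sigma> D B \<boxplus> \<iota> E) =
     (tsum.in1 (A @ B) (D @ E) \<Zsemi> (\<iota> A \<boxplus> \<sigma> B D \<boxplus> \<iota> E)) \<Zsemi> (\<iota> A \<boxplus> \<sigma> D B \<boxplus> \<iota> E)"
    using tsum.mid4_in(1)[of A B D E] by (simp only: tape.Obj_words tape.tob_append assms)
  also have "\<dots> = tsum.in1 (A @ B) (D @ E) \<Zsemi> ((\<iota> A \<boxplus> \<sigma> B D \<boxplus> \<iota> E) \<Zsemi> (\<iota> A \<boxplus> \<sigma> D B \<boxplus> \<iota> E))"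
    by (rule tape.Comp_assoc_simp) simp_all
  also have "\<dots> = tsum.in1 (A @ B) (D @ E)" unfolding m by simp
  finally show "(tsum.in1 A D \<boxplus> tsum.in1 B E) \<Zsemi> (\<iota> A \<boxplus> \<sigma> D B \<boxplus> \<iota> E) = tsum.in1 (A @ B) (D @ E)" .
  have "(tsum.in2 A D \<boxplus> tsum.in2 B E) \<Zsemi> (\<iota> A \<boxplus> \<sigma> D B \<boxplus> \<iota> E) =
     (tsum.in2 (A @ B) (D @ E) \<Zsemi> (\<iota> A \<boxplus> \<sigma> B D \<boxplus> \<iota> E)) \<Zsemi> (\<iota> A \<boxplus> \<sigma> D B \<boxplus> \<iota> E)"
    using tsum.mid4_in(2)[of A B D E] by (simp only: tape.Obj_words tape.tob_append assms)
  also have "\<dots> = tsum.in2 (A @ B) (D @ E) \<Zsemi> ((\<iota> A \<boxplus> \<sigma> B D \<boxplus> \<iota> E) \<Zsemi> (\<iota> A \<boxplus> \<sigma> D B \<boxplus> \<iota> E))"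
    by (rule tape.Comp_assoc_simp) simp_all
  also have "\<dots> = tsum.in2 (A @ B) (D @ E)" unfolding m by simp
  finally show "(tsum.in2 A D \<boxplus> tsum.in2 B E) \<Zsemi> (\<iota> A \<boxplus> \<sigma> D B \<boxplus> \<iota> E) = tsum.in2 (A @ B) (D @ E)" .
qed

text \<open>Identifies the recursively defined distributor by its effect on injections, the main
  form in which it is used below. In the induction step \<open>mid4_out\<close> absorbs the swap in
  the recursion of \<open>tdistl\<close>.\<close>

lemma LW_in_DL:
  assumes "P \<in> Pl" "Q \<in> Pl" "R \<in> Pl"
  shows "LW P (tsum.in1 Q R) \<Zsemi> DL P Q R = tsum.in1 (P \<star> Q) (P \<star> R)"
    "LW P (tsum.in2 Q R) \<Zsemi> DL P Q R = tsum.in2 (P \<star> Q) (P \<star> R)"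
  using assms(1)
proof (induction P)
  case (Cons U P)
  note [simp] = assms Cons.hyps
  let ?m = "\<iota> ([U] \<star> Q) \<boxplus> \<sigma> ([U] \<star> R) (P \<star> Q) \<boxplus> \<iota> (P \<star> R)"
  { case 1
    have L: "LW (U # P) (tsum.in1 Q R) = LW [U] (tsum.in1 Q R) \<boxplus> LW P (tsum.in1 Q R)" by (rule LW_Cons) simp_all
    have "LW (U # P) (tsum.in1 Q R) \<Zsemi> DL (U # P) Q R = ((LW [U] (tsum.in1 Q R) \<boxplus> LW P (tsum.in1 Q R)) \<Zsemi> (\<iota> ([U] \<star> (Q @ R)) \<boxplus> DL P Q R)) \<Zsemi> ?m"
      unfolding DL_Cons[OF Cons.hyps assms(2,3)] L by (rule tape.Comp_assoc_simp[symmetric]) simp_all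
    also have "\<dots> = (tsum.in1 ([U] \<star> Q) ([U] \<star> R) \<boxplus> tsum.in1 (P \<star> Q) (P \<star> R)) \<Zsemi> ?m"
      using Cons.IH by simp
    also have "\<dots> = tsum.in1 ([U] \<star> Q @ P \<star> Q) ([U] \<star> R @ P \<star> R)" by (rule mid4_out) simp_all
    finally show ?case by simp }
  { case 2
    have L: "LW (U # P) (tsum.in2 Q R) = LW [U] (tsum.in2 Q R) \<boxplus> LW P (tsum.in2 Q R)" by (rule LW_Cons) simp_all
    have "LW (U # P) (tsum.in2 Q R) \<Zsemi> DL (U # P) Q R = ((LW [U] (tsum.in2 Q R) \<boxplus> LW P (tsum.in2 Q R)) \<Zsemi> (\<iota> ([U] \<star> (Q @ R)) \<boxplus> DL P Q R)) \<Zsemi> ?m"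
      unfolding DL_Cons[OF Cons.hyps assms(2,3)] L by (rule tape.Comp_assoc_simp[symmetric]) simp_all
    also have "\<dots> = (tsum.in2 ([U] \<star> Q) ([U] \<star> R) \<boxplus> tsum.in2 (P \<star> Q) (P \<star> R)) \<Zsemi> ?m"
      using Cons.IH by simp
    also have "\<dots> = tsum.in2 ([U] \<star> Q @ P \<star> Q) ([U] \<star> R @ P \<star> R)" by (rule mid4_out) simp_all
    finally show ?case by simp }
qed (use assms in simp_all)

lemma in_DLI:
  assumes [simp]: "P \<in> Pl" "Q \<in> Pl" "R \<in> Pl"
  shows "tsum.in1 (P \<star> Q) (P \<star> R) \<Zsemi> DLI P Q R = LW P (tsum.in1 Q R)"
    "tsum.in2 (P \<star> Q) (P \<star> R) \<Zsemi> DLI P Q R = LW P (tsum.in2 Q R)"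
  unfolding LW_in_DL[OF assms, symmetric] by (simp_all add: DL_DLI)

text \<open>The analogue of \<open>dl_ext\<close>, available before the product of tapes is known to
  be functorial.\<close>

lemma LW_ext:
  assumes "LW P (tsum.in1 Q R) \<Zsemi> f = LW P (tsum.in1 Q R) \<Zsemi> g" "LW P (tsum.in2 Q R) \<Zsemi> f = LW P (tsum.in2 Q R) \<Zsemi> g"
    and [simp]: "f \<in> Arr TC" "g \<in> Arr TC" "P \<in> Pl" "Q \<in> Pl" "R \<in> Pl"
    and D [simp]: "Dom TC f = P \<star> (Q @ R)" "Dom TC g = P \<star> (Q @ R)" and E: "Cod TC f = Cod TC g"
  shows "f = g"
proof -
  have *: "tsum.in1 (P \<star> Q) (P \<star> R) \<Zsemi> (DLI P Q R \<Zsemi> h) = LW P (tsum.in1 Q R) \<Zsemi> h"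
    "tsum.in2 (P \<star> Q) (P \<star> R) \<Zsemi> (DLI P Q R \<Zsemi> h) = LW P (tsum.in2 Q R) \<Zsemi> h"
    if "h \<in> Arr TC" "Dom TC h = P \<star> (Q @ R)" for h
    unfolding in_DLI[OF assms(5-7), symmetric] using that by simp_all
  have "DLI P Q R \<Zsemi> f = DLI P Q R \<Zsemi> g"
    by (rule tsum.coprod_ext[of "P \<star> Q" "P \<star> R"]) (simp_all add: * assms(1,2) E)
  then have "DL P Q R \<Zsemi> (DLI P Q R \<Zsemi> f) = DL P Q R \<Zsemi> (DLI P Q R \<Zsemi> g)" by simp
  moreover have "DL P Q R \<Zsemi> (DLI P Q R \<Zsemi> h) = h"
    if "h \<in> Arr TC" "Dom TC h = P \<star> (Q @ R)" for h
    using that DL_DLI(1)[of P Q R] tape.Comp_assoc_simp[of "DL P Q R" "DLI P Q R" h] by simp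
  ultimately show ?thesis by simp
qed

lemma RW_Nil [simp]: "a \<in> Arr TC \<Longrightarrow> RW [] a = \<iota> []"
  by (simp add: RW_def)

lemma RW_Cons:
  "W \<in> Wd \<Longrightarrow> S \<in> Pl \<Longrightarrow> a \<in> Arr TC \<Longrightarrow> RW (W # S) a = DL (Dom TC a) [W] S \<Zsemi> ((RW [W] a \<boxplus> RW S a) \<Zsemi> DLI (Cod TC a) [W] S)"
  using RW_sing_cl[of W "rep a"] by (simp add: RW_def[of "W # S"] RW_def[of S] poly_prod_sing)

text \<open>Right whiskering by a polynomial is defined by conjugation with distributors. On
  whiskered injections the distributors disappear, and one monomial can be treated at a
  time.\<close>

lemma LW_in_RW_Cons:
  assumes [simp]: "W \<in> Wd" "S \<in> Pl" "a \<in> Arr TC"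
  shows "LW (Dom TC a) (tsum.in1 [W] S) \<Zsemi> RW (W # S) a = RW [W] a \<Zsemi> LW (Cod TC a) (tsum.in1 [W] S)"
    "LW (Dom TC a) (tsum.in2 [W] S) \<Zsemi> RW (W # S) a = RW S a \<Zsemi> LW (Cod TC a) (tsum.in2 [W] S)"
proof -
  let ?P = "Dom TC a" let ?Q = "Cod TC a"
  have "LW ?P (tsum.in1 [W] S) \<Zsemi> RW (W # S) a = (LW ?P (tsum.in1 [W] S) \<Zsemi> DL ?P [W] S) \<Zsemi> ((RW [W] a \<boxplus> RW S a) \<Zsemi> DLI ?Q [W] S)"
    unfolding RW_Cons[OF assms] by (rule tape.Comp_assoc_simp[symmetric]) simp_all
  also have "\<dots> = RW [W] a \<Zsemi> (tsum.in1 (?Q \<star> [W]) (?Q \<star> S) \<Zsemi> DLI ?Q [W] S)"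
    by (subst LW_in_DL) simp_all
  finally show "LW (Dom TC a) (tsum.in1 [W] S) \<Zsemi> RW (W # S) a = RW [W] a \<Zsemi> LW (Cod TC a) (tsum.in1 [W] S)"
    by (simp add: in_DLI)
  have "LW ?P (tsum.in2 [W] S) \<Zsemi> RW (W # S) a = (LW ?P (tsum.in2 [W] S) \<Zsemi> DL ?P [W] S) \<Zsemi> ((RW [W] a \<boxplus> RW S a) \<Zsemi> DLI ?Q [W] S)"
    unfolding RW_Cons[OF assms] by (rule tape.Comp_assoc_simp[symmetric]) simp_all
  also have "\<dots> = RW S a \<Zsemi> (tsum.in2 (?Q \<star> [W]) (?Q \<star> S) \<Zsemi> DLI ?Q [W] S)"
    by (subst LW_in_DL) simp_all
  finally show "LW (Dom TC a) (tsum.in2 [W] S) \<Zsemi> RW (W # S) a = RW S a \<Zsemi> LW (Cod TC a) (tsum.in2 [W] S)"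
    by (simp add: in_DLI)
qed

text \<open>Syntactic for one monomial; for a polynomial both sides are tested on whiskered
  injections with \<open>LW_in_RW_Cons\<close>.\<close>

lemma RW_Comp:
  assumes "P \<in> Pl" and [simp]: "a \<in> Arr TC" "b \<in> Arr TC" "Cod TC a = Dom TC b"
  shows "RW P (a \<Zsemi> b) = RW P a \<Zsemi> RW P b"
proof -
  obtain t u where t: "wt t" "wt u" "a = cl t" "b = cl u" using assms by (elim tape.ArrE)
  have 1: "RW [U] (a \<Zsemi> b) = RW [U] a \<Zsemi> RW [U] b" if "U \<in> Wd" for U
    using that t assms(4) RW_sing_cl[of U "TSeq t u"] RW_sing_cl[of U t] RW_sing_cl[of U u] by simp
  show ?thesis using assms(1)
  proof (induction P)
    case (Cons W P)
    note [simp] = Cons.hyps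
    note w = LW_in_RW_Cons[OF Cons.hyps, of "a \<Zsemi> b", simplified] LW_in_RW_Cons[OF Cons.hyps, of a, simplified] LW_in_RW_Cons[OF Cons.hyps, of b, simplified]
    have w': "LW (Dom TC a) (tsum.in1 [W] P) \<Zsemi> (RW (W # P) a \<Zsemi> RW (W # P) b) = RW [W] a \<Zsemi> (LW (Dom TC b) (tsum.in1 [W] P) \<Zsemi> RW (W # P) b)"
      "LW (Dom TC a) (tsum.in2 [W] P) \<Zsemi> (RW (W # P) a \<Zsemi> RW (W # P) b) = RW P a \<Zsemi> (LW (Dom TC b) (tsum.in2 [W] P) \<Zsemi> RW (W # P) b)"
      by (rule tape.Comp_eq_extend; simp add: w)+
    show ?case
    proof (rule LW_ext[of "Dom TC a" "[W]" P])
      show "LW (Dom TC a) (tsum.in1 [W] P) \<Zsemi> RW (W # P) (a \<Zsemi> b) = LW (Dom TC a) (tsum.in1 [W] P) \<Zsemi> (RW (W # P) a \<Zsemi> RW (W # P) b)"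
        unfolding w w' by (simp add: 1)
      show "LW (Dom TC a) (tsum.in2 [W] P) \<Zsemi> RW (W # P) (a \<Zsemi> b) = LW (Dom TC a) (tsum.in2 [W] P) \<Zsemi> (RW (W # P) a \<Zsemi> RW (W # P) b)"
        unfolding w w' by (simp add: Cons.IH)
    qed simp_all
  qed simp
qed

lemma LW_LW_in:
  assumes "P \<in> Pl" "a \<in> Arr TC" "b \<in> Arr TC" "Cod TC a = Dom TC b" "h \<in> Arr TC" "Dom TC h = P \<star> Cod TC b"
  shows "LW P a \<Zsemi> (LW P b \<Zsemi> h) = LW P (a \<Zsemi> b) \<Zsemi> h"
  using assms by (simp add: LW_Comp)

lemma LW_in_RW:
  assumes "Q \<in> Pl" and [simp]: "R \<in> Pl" "a \<in> Arr TC"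
  shows "LW (Dom TC a) (tsum.in1 Q R) \<Zsemi> RW (Q @ R) a = RW Q a \<Zsemi> LW (Cod TC a) (tsum.in1 Q R)"
    "LW (Dom TC a) (tsum.in2 Q R) \<Zsemi> RW (Q @ R) a = RW R a \<Zsemi> LW (Cod TC a) (tsum.in2 Q R)"
  using assms(1)
proof (induction Q)
  case Nil
  { case 1 show ?case by (rule tsum.initial_ext) simp_all }
  { case 2 show ?case by simp }
next
  case (Cons W Q)
  note [simp] = Cons.hyps
  let ?P = "Dom TC a" let ?P' = "Cod TC a"
  have i: "tsum.in1 [W] Q \<Zsemi> tsum.in1 (W # Q) R = tsum.in1 [W] (Q @ R)"
    "tsum.in2 [W] Q \<Zsemi> tsum.in1 (W # Q) R = tsum.in1 Q R \<Zsemi> tsum.in2 [W] (Q @ R)"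
    "tsum.in2 (W # Q) R = tsum.in2 Q R \<Zsemi> tsum.in2 [W] (Q @ R)"
    by (simp_all add: tsum.in1_in1 tsum.in1_in2 tsum.in2_in2)
  note w = LW_in_RW_Cons[of W "Q @ R" a, simplified] LW_in_RW_Cons[of W Q a, simplified]
  have a1: "LW ?P f \<Zsemi> (LW ?P (tsum.in2 [W] (Q @ R)) \<Zsemi> RW (W # Q @ R) a) = (LW ?P f \<Zsemi> RW (Q @ R) a) \<Zsemi> LW ?P' (tsum.in2 [W] (Q @ R))"
    if "f \<in> Arr TC" "Cod TC f = Q @ R" for f
    unfolding w(2) using that by simp
  have a2: "LW ?P (tsum.in1 [W] Q) \<Zsemi> (RW (W # Q) a \<Zsemi> h) = RW [W] a \<Zsemi> (LW ?P' (tsum.in1 [W] Q) \<Zsemi> h)"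
    "LW ?P (tsum.in2 [W] Q) \<Zsemi> (RW (W # Q) a \<Zsemi> h) = RW Q a \<Zsemi> (LW ?P' (tsum.in2 [W] Q) \<Zsemi> h)"
    if "h \<in> Arr TC" "Dom TC h = ?P' \<star> (W # Q)" for h
    using that by (rule_tac tape.Comp_eq_extend; simp add: w)+
  { case 1
    have 2: "LW ?P (tsum.in1 Q R \<Zsemi> tsum.in2 [W] (Q @ R)) \<Zsemi> RW (W # Q @ R) a = RW Q a \<Zsemi> LW ?P' (tsum.in1 Q R \<Zsemi> tsum.in2 [W] (Q @ R))"
      using a1[of "tsum.in1 Q R"] Cons.IH(1) by (simp add: LW_Comp)
    show ?case
      by (rule LW_ext[of ?P "[W]" Q]) (simp_all add: LW_LW_in a2 i w 2 LW_Comp[symmetric]) }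
  { case 2
    show ?case unfolding i using a1[of "tsum.in2 Q R"] Cons.IH(2) by (simp add: LW_Comp) }
qed

text \<open>Right strictness at the level of arrows: right whiskering keeps injections without any
  distributor. \<open>RW_tar\<close> follows by testing on them.\<close>

lemma RW_in:
  assumes "S \<in> Pl" and [simp]: "P \<in> Pl" "R \<in> Pl"
  shows "RW S (tsum.in1 P R) = tsum.in1 (P \<star> S) (R \<star> S)" "RW S (tsum.in2 P R) = tsum.in2 (P \<star> S) (R \<star> S)"
  using assms(1)
proof (induction S)
  case Nil
  { case 1 show ?case by simp }
  { case 2 show ?case by simp }
next
  case (Cons W S)
  note [simp] = Cons.hyps
  { case 1
    have "RW (W # S) (tsum.in1 P R) = tsum.in1 (P \<star> (W # S)) (R \<star> (W # S))"
    proof (rule LW_ext[of P "[W]" S])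
      show "LW P (tsum.in1 [W] S) \<Zsemi> RW (W # S) (tsum.in1 P R) = LW P (tsum.in1 [W] S) \<Zsemi> tsum.in1 (P \<star> (W # S)) (R \<star> (W # S))"
        using LW_in_RW_Cons(1)[of W S "tsum.in1 P R"] RW_sing_in(1)[of W P R] by (simp add: LW_append)
      show "LW P (tsum.in2 [W] S) \<Zsemi> RW (W # S) (tsum.in1 P R) = LW P (tsum.in2 [W] S) \<Zsemi> tsum.in1 (P \<star> (W # S)) (R \<star> (W # S))"
        using LW_in_RW_Cons(2)[of W S "tsum.in1 P R"] Cons.IH(1) by (simp add: LW_append)
    qed simp_all
    then show ?case . }
  { case 2
    have "RW (W # S) (tsum.in2 P R) = tsum.in2 (P \<star> (W # S)) (R \<star> (W # S))"
    proof (rule LW_ext[of R "[W]" S])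
      show "LW R (tsum.in1 [W] S) \<Zsemi> RW (W # S) (tsum.in2 P R) = LW R (tsum.in1 [W] S) \<Zsemi> tsum.in2 (P \<star> (W # S)) (R \<star> (W # S))"
        using LW_in_RW_Cons(1)[of W S "tsum.in2 P R"] RW_sing_in(2)[of W P R] by (simp add: LW_append)
      show "LW R (tsum.in2 [W] S) \<Zsemi> RW (W # S) (tsum.in2 P R) = LW R (tsum.in2 [W] S) \<Zsemi> tsum.in2 (P \<star> (W # S)) (R \<star> (W # S))"
        using LW_in_RW_Cons(2)[of W S "tsum.in2 P R"] Cons.IH(2) by (simp add: LW_append)
    qed simp_all
    then show ?case . }
qed

lemma RW_tar:
  assumes [simp]: "S \<in> Pl" "a \<in> Arr TC" "b \<in> Arr TC"
  shows "RW S (a \<boxplus> b) = RW S a \<boxplus> RW S b"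
proof (rule tsum.coprod_ext[of "Dom TC a \<star> S" "Dom TC b \<star> S"])
  have "tsum.in1 (Dom TC a \<star> S) (Dom TC b \<star> S) \<Zsemi> RW S (a \<boxplus> b) = RW S (tsum.in1 (Dom TC a) (Dom TC b) \<Zsemi> (a \<boxplus> b))"
  proof -
    have "RW S (tsum.in1 (Dom TC a) (Dom TC b) \<Zsemi> (a \<boxplus> b)) = RW S (tsum.in1 (Dom TC a) (Dom TC b)) \<Zsemi> RW S (a \<boxplus> b)"
      by (rule RW_Comp) simp_all
    then show ?thesis unfolding RW_in[OF assms(1) Dom_Pl[OF assms(2)] Dom_Pl[OF assms(3)]] ..
  qed
  also have "\<dots> = RW S (a \<Zsemi> tsum.in1 (Cod TC a) (Cod TC b))" by simp
  also have "\<dots> = RW S a \<Zsemi> tsum.in1 (Cod TC a \<star> S) (Cod TC b \<star> S)" by (simp add: RW_Comp RW_in)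
  finally show "tsum.in1 (Dom TC a \<star> S) (Dom TC b \<star> S) \<Zsemi> RW S (a \<boxplus> b) = tsum.in1 (Dom TC a \<star> S) (Dom TC b \<star> S) \<Zsemi> (RW S a \<boxplus> RW S b)"
    by simp
  have "tsum.in2 (Dom TC a \<star> S) (Dom TC b \<star> S) \<Zsemi> RW S (a \<boxplus> b) = RW S (tsum.in2 (Dom TC a) (Dom TC b) \<Zsemi> (a \<boxplus> b))"
  proof -
    have "RW S (tsum.in2 (Dom TC a) (Dom TC b) \<Zsemi> (a \<boxplus> b)) = RW S (tsum.in2 (Dom TC a) (Dom TC b)) \<Zsemi> RW S (a \<boxplus> b)"
      by (rule RW_Comp) simp_all
    then show ?thesis unfolding RW_in[OF assms(1) Dom_Pl[OF assms(2)] Dom_Pl[OF assms(3)]] ..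
  qed
  also have "\<dots> = RW S (b \<Zsemi> tsum.in2 (Cod TC a) (Cod TC b))" by simp
  also have "\<dots> = RW S b \<Zsemi> tsum.in2 (Cod TC a \<star> S) (Cod TC b \<star> S)" by (simp add: RW_Comp RW_in)
  finally show "tsum.in2 (Dom TC a \<star> S) (Dom TC b \<star> S) \<Zsemi> RW S (a \<boxplus> b) = tsum.in2 (Dom TC a \<star> S) (Dom TC b \<star> S) \<Zsemi> (RW S a \<boxplus> RW S b)"
    by simp
qed simp_all

end

section \<open>Compatibility of the whiskerings and the slide law\<close>

context tapes
begin

lemma cl_TCirc_cong: "c \<approx>\<^sub>c d \<Longrightarrow> cl (TCirc c) = cl (TCirc d)"
  by (rule eq_cl[OF tape_eq.circ])

lemma cl_TCirc_CSeq [simp]: "wt_circ \<Gamma> c \<Longrightarrow> wt_circ \<Gamma> d \<Longrightarrow> ccod \<Gamma> c = cdom \<Gamma> d \<Longrightarrow> cl (TCirc (CSeq c d)) = cl (TCirc c) \<Zsemi> cl (TCirc d)"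
  using eq_cl[OF tape_eq.circ_seq[of \<Gamma> c d T]] wt_circ_words by simp

lemma cl_TCirc_cid [simp]: "U \<in> Wd \<Longrightarrow> cl (TCirc (cid U)) = \<iota> [U]"
  using eq_cl[OF tape_eq.circ_id[of U \<Gamma> T]] by simp

text \<open>With \<open>cl_TCirc_CPar2\<close>: both orders of whiskering two circuits give their
  product, which is the slide law for circuits.\<close>

lemma cl_TCirc_CPar1:
  assumes "wt_circ \<Gamma> c" "wt_circ \<Gamma> d"
  shows "cl (TCirc (CPar (cid (cdom \<Gamma> c)) d)) \<Zsemi> cl (TCirc (CPar c (cid (ccod \<Gamma> d)))) = cl (TCirc (CPar c d))"
proof -
  have "CSeq (CPar (cid (cdom \<Gamma> c)) d) (CPar c (cid (ccod \<Gamma> d))) \<approx>\<^sub>c CPar c d"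
    using assms by (intro circ_eq.trans[OF circ_eq.interchange] circ_eq.par_cong circ_eq.id_seq circ_eq.seq_id) (auto simp: wt_circ_words)
  from cl_TCirc_cong[OF this] show ?thesis using assms by (simp add: wt_circ_words)
qed

lemma cl_TCirc_CPar2:
  assumes "wt_circ \<Gamma> c" "wt_circ \<Gamma> d"
  shows "cl (TCirc (CPar c (cid (cdom \<Gamma> d)))) \<Zsemi> cl (TCirc (CPar (cid (ccod \<Gamma> c)) d)) = cl (TCirc (CPar c d))"
proof -
  have "CSeq (CPar c (cid (cdom \<Gamma> d))) (CPar (cid (ccod \<Gamma> c)) d) \<approx>\<^sub>c CPar c d"
    using assms by (intro circ_eq.trans[OF circ_eq.interchange] circ_eq.par_cong circ_eq.id_seq circ_eq.seq_id) (auto simp: wt_circ_words)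
  from cl_TCirc_cong[OF this] show ?thesis using assms by (simp add: wt_circ_words)
qed

text \<open>Syntactic except at circuits, where the identities have to be regrouped by the axioms of
  circuits.\<close>

lemma cl_lwhisk1_append:
  assumes "U \<in> Wd" "V \<in> Wd" "wt t"
  shows "cl (lwhisk1 (U @ V) t) = cl (lwhisk1 U (lwhisk1 V t))"
  using assms(3)
proof (induction t)
  case (TCirc c)
  have "CPar (cid (U @ V)) c \<approx>\<^sub>c CPar (CPar (cid U) (cid V)) c"
    using assms TCirc by (intro circ_eq.par_cong circ_eq.sym[OF circ.pr_idn_idn] circ_eq.refl) auto
  moreover have "CPar (CPar (cid U) (cid V)) c \<approx>\<^sub>c CPar (cid U) (CPar (cid V) c)"
    using assms TCirc by (intro circ_eq.par_assoc) auto
  ultimately have "CPar (cid (U @ V)) c \<approx>\<^sub>c CPar (cid U) (CPar (cid V) c)" by (rule circ_eq.trans)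
  then show ?case by (simp add: cl_TCirc_cong)
qed (use assms in simp_all)

lemma cl_rwhisk1_append:
  assumes "U \<in> Wd" "V \<in> Wd" "wt t"
  shows "cl (rwhisk1 (U @ V) t) = cl (rwhisk1 V (rwhisk1 U t))"
  using assms(3)
proof (induction t)
  case (TCirc c)
  have "CPar c (cid (U @ V)) \<approx>\<^sub>c CPar c (CPar (cid U) (cid V))"
    using assms TCirc by (intro circ_eq.par_cong circ_eq.sym[OF circ.pr_idn_idn] circ_eq.refl) auto
  moreover have "CPar c (CPar (cid U) (cid V)) \<approx>\<^sub>c CPar (CPar c (cid U)) (cid V)"
    using assms TCirc by (intro circ_eq.sym[OF circ_eq.par_assoc]) auto
  ultimately have "CPar c (cid (U @ V)) \<approx>\<^sub>c CPar (CPar c (cid U)) (cid V)" by (rule circ_eq.trans)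
  then show ?case by (simp add: cl_TCirc_cong)
qed (use assms in simp_all)

lemma cl_lrwhisk1:
  assumes "U \<in> Wd" "V \<in> Wd" "wt t"
  shows "cl (lwhisk1 U (rwhisk1 V t)) = cl (rwhisk1 V (lwhisk1 U t))"
  using assms(3)
proof (induction t)
  case (TCirc c)
  have "CPar (CPar (cid U) c) (cid V) \<approx>\<^sub>c CPar (cid U) (CPar c (cid V))"
    using assms TCirc by (intro circ_eq.par_assoc) auto
  then show ?case by (simp add: cl_TCirc_cong)
qed (use assms in simp_all)

lemma cl_whisk1_Nil:
  assumes "wt t"
  shows "cl (lwhisk1 [] t) = cl t" "cl (rwhisk1 [] t) = cl t"
  using assms
proof (induction t)
  case (TCirc c)
  { case 1 then show ?case using cl_TCirc_cong[OF circ_eq.unit_par[of \<Gamma> c]] by simp }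
  { case 2 then show ?case using cl_TCirc_cong[OF circ_eq.par_unit[of \<Gamma> c]] by simp }
qed simp_all

lemma LW_one [simp]: "a \<in> Arr TC \<Longrightarrow> LW [[]] a = a" and RW_one [simp]: "a \<in> Arr TC \<Longrightarrow> RW [[]] a = a"
proof -
  assume "a \<in> Arr TC"
  then obtain t where t: "wt t" "a = cl t" by (rule tape.ArrE)
  show "LW [[]] a = a" "RW [[]] a = a"
    unfolding t(2) using t(1) by (simp_all add: LW_sing_cl RW_sing_cl cl_whisk1_Nil)
qed

lemma LW_sing_append:
  assumes "U \<in> Wd" "V \<in> Wd" "a \<in> Arr TC"
  shows "LW [U @ V] a = LW [U] (LW [V] a)"
proof -
  obtain t where t: "wt t" "a = cl t" using assms(3) by (rule tape.ArrE)
  show ?thesis unfolding t(2) using t(1) assms(1,2) by (simp add: LW_sing_cl cl_lwhisk1_append)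
qed

lemma RW_sing_append:
  assumes "U \<in> Wd" "V \<in> Wd" "a \<in> Arr TC"
  shows "RW [U @ V] a = RW [V] (RW [U] a)"
proof -
  obtain t where t: "wt t" "a = cl t" using assms(3) by (rule tape.ArrE)
  show ?thesis unfolding t(2) using t(1) assms(1,2) by (simp add: RW_sing_cl cl_rwhisk1_append)
qed

lemma RW_LW_sing:
  assumes "U \<in> Wd" "V \<in> Wd" "a \<in> Arr TC"
  shows "RW [V] (LW [U] a) = LW [U] (RW [V] a)"
proof -
  obtain t where t: "wt t" "a = cl t" using assms(3) by (rule tape.ArrE)
  show ?thesis unfolding t(2) using t(1) assms(1,2) by (simp add: LW_sing_cl RW_sing_cl cl_lrwhisk1)
qed

lemma LW_LW:
  assumes "P \<in> Pl" "Q \<in> Pl" and [simp]: "a \<in> Arr TC"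
  shows "LW (P \<star> Q) a = LW P (LW Q a)"
proof -
  have 1: "LW (map ((@) U) Q) a = LW [U] (LW Q a)" if "U \<in> Wd" for U
    using assms(2)
  proof (induction Q)
    case (Cons V Q)
    have "LW (map ((@) U) (V # Q)) a = LW [U @ V] a \<boxplus> LW (map ((@) U) Q) a"
      using LW_Cons[of "U @ V" "map ((@) U) Q" a] Cons.hyps that by simp
    also have "\<dots> = LW [U] (LW [V] a \<boxplus> LW Q a)"
      using Cons that LW_sing_append[of U V a] by (simp add: LW_sing_tar)
    finally show ?case using LW_Cons[of V Q a] Cons.hyps by simp
  qed (use that in simp)
  show ?thesis using assms(1)
  proof (induction P)
    case (Cons U P)
    then show ?case using 1[of U] assms(2) LW_Cons[of U P "LW Q a"] LW_append[of "map ((@) U) Q" "P \<star> Q" a] by simp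
  qed (use assms(2) in simp)
qed

text \<open>For monomials this is associativity of the product of circuits. It extends to a
  polynomial \<open>R\<close> by \<open>LW_ext\<close>, and then to a polynomial \<open>P\<close>
  because right whiskering preserves sums.\<close>

lemma RW_LW:
  assumes "P \<in> Pl" "R \<in> Pl" and [simp]: "a \<in> Arr TC"
  shows "RW R (LW P a) = LW P (RW R a)"
proof -
  have 1: "RW R (LW [U] a) = LW [U] (RW R a)" if "U \<in> Wd" for U
    using assms(2)
  proof (induction R)
    case (Cons W R)
    note [simp] = that Cons.hyps
    let ?D = "Dom TC a" let ?C = "Cod TC a"
    have l: "LW ([U] \<star> ?D) b = LW [U] (LW ?D b)" "LW ([U] \<star> ?C) b = LW [U] (LW ?C b)" if "b \<in> Arr TC" for b
      using that LW_LW[of "[U]" ?D b] LW_LW[of "[U]" ?C b] by simp_all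
    note w = LW_in_RW_Cons[OF Cons.hyps, of "LW [U] a"] LW_in_RW_Cons[OF Cons.hyps, of a]
    show ?case
    proof (rule LW_ext[of "[U] \<star> ?D" "[W]" R])
      have "LW ([U] \<star> ?D) (tsum.in1 [W] R) \<Zsemi> LW [U] (RW (W # R) a) = LW [U] (RW [W] a \<Zsemi> LW ?C (tsum.in1 [W] R))"
        by (simp add: l LW_Comp[symmetric] w del: poly_prod_simps)
      also have "\<dots> = RW [W] (LW [U] a) \<Zsemi> LW ([U] \<star> ?C) (tsum.in1 [W] R)"
        by (simp add: l LW_Comp RW_LW_sing del: poly_prod_simps)
      finally show "LW ([U] \<star> ?D) (tsum.in1 [W] R) \<Zsemi> RW (W # R) (LW [U] a) = LW ([U] \<star> ?D) (tsum.in1 [W] R) \<Zsemi> LW [U] (RW (W # R) a)"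
        using w(1) by simp
      have "LW ([U] \<star> ?D) (tsum.in2 [W] R) \<Zsemi> LW [U] (RW (W # R) a) = LW [U] (RW R a \<Zsemi> LW ?C (tsum.in2 [W] R))"
        by (simp add: l LW_Comp[symmetric] w del: poly_prod_simps)
      also have "\<dots> = RW R (LW [U] a) \<Zsemi> LW ([U] \<star> ?C) (tsum.in2 [W] R)"
        by (simp add: l LW_Comp Cons.IH del: poly_prod_simps)
      finally show "LW ([U] \<star> ?D) (tsum.in2 [W] R) \<Zsemi> RW (W # R) (LW [U] a) = LW ([U] \<star> ?D) (tsum.in2 [W] R) \<Zsemi> LW [U] (RW (W # R) a)"
        using w(2) by simp
    qed (simp_all add: poly_prod_map)
  qed (use that in simp)
  show ?thesis using assms(1)
  proof (induction P)
    case (Cons U P)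
    then show ?case using 1[of U] assms(2) LW_Cons[of U P "RW R a"] LW_Cons[of U P a] by (simp add: RW_tar)
  qed (use assms(2) in simp)
qed

section \<open>Operations at polynomials\<close>

abbreviation opN :: "'f \<Rightarrow> 's list list" where "opN f \<equiv> replicate (arity T f) []"

definition OP :: "'f \<Rightarrow> 's list list \<Rightarrow> ('s, 'g, 'f) tape set" where "OP f P = cl (tops T f P)"

lemma OP_simps [simp]:
  assumes "f \<in> ops T" "P \<in> Pl"
  shows "OP f P \<in> Arr TC" "Dom TC (OP f P) = P" "Cod TC (OP f P) = opN f \<star> P"
  using assms by (simp_all add: OP_def)

lemma opN_sing [simp]: "replicate n [] \<star> [U] = replicate n U"
  by (simp add: poly_prod_replicate)

lemma OP_sing: "f \<in> ops T \<Longrightarrow> U \<in> Wd \<Longrightarrow> cl (TOp f U) = OP f [U]"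
  by (simp add: OP_def)

text \<open>A repeated sum of \<open>t\<close> is a left whiskering by a sum of units; this turns
  the axiom \<open>op_natural\<close> into a statement about \<open>LW\<close>, namely
  \<open>OP_natural\<close>.\<close>

lemma cl_tsum_replicate: "wt t \<Longrightarrow> cl (tsum (replicate n t)) = LW (replicate n []) (cl t)"
proof (induction n)
  case (Suc n)
  then show ?case using LW_Cons[of "[]" "replicate n []" "cl t"] by simp
qed simp

lemma OP_natural:
  assumes "f \<in> ops T" "a \<in> Arr TC"
  shows "a \<Zsemi> OP f (Cod TC a) = OP f (Dom TC a) \<Zsemi> LW (opN f) a"
proof -
  obtain t where t: "wt t" "a = cl t" using assms(2) by (rule tape.ArrE)
  have c: "cl (tops T f P) = OP f P" for P by (simp add: OP_def)
  have "concat (replicate (arity T f) (td t)) = opN f \<star> td t" by (simp add: poly_prod_replicate)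
  then show ?thesis unfolding t(2) using t(1) assms(1) eq_cl[OF tape_eq.op_natural[OF t(1) assms(1)]]
    by (simp add: cl_tsum_replicate c wt_poly)
qed

text \<open>At monomials it is the definition of \<open>rwhisk1\<close>. Naturality of operations
  along injections carries it first to a polynomial \<open>P\<close> and then to a polynomial
  \<open>S\<close>.\<close>

lemma RW_OP:
  assumes [simp]: "f \<in> ops T" "P \<in> Pl" "S \<in> Pl"
  shows "RW S (OP f P) = OP f (P \<star> S)"
proof -
  have 0: "RW [W] (OP f [U]) = OP f [U @ W]" if "W \<in> Wd" "U \<in> Wd" for W U
    using that RW_sing_cl[of W "TOp f U"] by (simp add: OP_sing[symmetric])
  have 1: "RW [W] (OP f P) = OP f (P \<star> [W])" if [simp]: "W \<in> Wd" for W
    using assms(2)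
  proof (induction P)
    case Nil
    show ?case by (rule tsum.initial_ext) simp_all
  next
    case (Cons U P)
    note [simp] = Cons.hyps
    show ?case
    proof (rule tsum.coprod_ext[of "[U] \<star> [W]" "P \<star> [W]"])
      have "tsum.in1 ([U] \<star> [W]) (P \<star> [W]) \<Zsemi> RW [W] (OP f (U # P)) = RW [W] (tsum.in1 [U] P \<Zsemi> OP f (U # P))"
        using RW_in[of "[W]" "[U]" P] by (simp add: RW_Comp)
      also have "\<dots> = RW [W] (OP f [U] \<Zsemi> LW (opN f) (tsum.in1 [U] P))"
        using OP_natural[of f "tsum.in1 [U] P"] by simp
      also have "\<dots> = OP f ([U] \<star> [W]) \<Zsemi> LW (opN f) (tsum.in1 ([U] \<star> [W]) (P \<star> [W]))"
        using RW_in[of "[W]" "[U]" P] by (simp add: RW_Comp 0 RW_LW)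
      also have "\<dots> = tsum.in1 ([U] \<star> [W]) (P \<star> [W]) \<Zsemi> OP f ((U # P) \<star> [W])"
        using OP_natural[of f "tsum.in1 ([U] \<star> [W]) (P \<star> [W])"] by simp
      finally show "tsum.in1 ([U] \<star> [W]) (P \<star> [W]) \<Zsemi> RW [W] (OP f (U # P)) = tsum.in1 ([U] \<star> [W]) (P \<star> [W]) \<Zsemi> OP f ((U # P) \<star> [W])" .
      have "tsum.in2 ([U] \<star> [W]) (P \<star> [W]) \<Zsemi> RW [W] (OP f (U # P)) = RW [W] (tsum.in2 [U] P \<Zsemi> OP f (U # P))"
        using RW_in[of "[W]" "[U]" P] by (simp add: RW_Comp)
      also have "\<dots> = RW [W] (OP f P \<Zsemi> LW (opN f) (tsum.in2 [U] P))"
        using OP_natural[of f "tsum.in2 [U] P"] by simp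
      also have "\<dots> = OP f (P \<star> [W]) \<Zsemi> LW (opN f) (tsum.in2 ([U] \<star> [W]) (P \<star> [W]))"
        using RW_in[of "[W]" "[U]" P] by (simp add: RW_Comp Cons.IH RW_LW)
      also have "\<dots> = tsum.in2 ([U] \<star> [W]) (P \<star> [W]) \<Zsemi> OP f ((U # P) \<star> [W])"
        using OP_natural[of f "tsum.in2 ([U] \<star> [W]) (P \<star> [W])"] by simp
      finally show "tsum.in2 ([U] \<star> [W]) (P \<star> [W]) \<Zsemi> RW [W] (OP f (U # P)) = tsum.in2 ([U] \<star> [W]) (P \<star> [W]) \<Zsemi> OP f ((U # P) \<star> [W])" .
    qed simp_all
  qed
  show ?thesis using assms(3)
  proof (induction S)
    case Nil
    then show ?case by (intro tsum.initial_ext) simp_all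
  next
    case (Cons W S)
    note [simp] = Cons.hyps
    have l: "LW (opN f) (LW P b) = LW (opN f \<star> P) b" if "b \<in> Arr TC" for b
      using that by (simp add: LW_LW)
    show ?case
    proof (rule LW_ext[of P "[W]" S])
      have "LW P (tsum.in1 [W] S) \<Zsemi> RW (W # S) (OP f P) = OP f (P \<star> [W]) \<Zsemi> LW (opN f \<star> P) (tsum.in1 [W] S)"
        using LW_in_RW_Cons(1)[of W S "OP f P"] by (simp add: 1)
      then show "LW P (tsum.in1 [W] S) \<Zsemi> RW (W # S) (OP f P) = LW P (tsum.in1 [W] S) \<Zsemi> OP f (P \<star> (W # S))"
        using OP_natural[of f "LW P (tsum.in1 [W] S)"] by (simp add: l)
      have "LW P (tsum.in2 [W] S) \<Zsemi> RW (W # S) (OP f P) = OP f (P \<star> S) \<Zsemi> LW (opN f \<star> P) (tsum.in2 [W] S)"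
        using LW_in_RW_Cons(2)[of W S "OP f P"] by (simp add: Cons.IH)
      then show "LW P (tsum.in2 [W] S) \<Zsemi> RW (W # S) (OP f P) = LW P (tsum.in2 [W] S) \<Zsemi> OP f (P \<star> (W # S))"
        using OP_natural[of f "LW P (tsum.in2 [W] S)"] by (simp add: l)
    qed simp_all
  qed
qed

text \<open>This is what makes \<open>tprod\<close> functorial. For an operation on either side it is the axiom
  \<open>op_natural\<close>.\<close>

definition slides :: "('s, 'g, 'f) tape set \<Rightarrow> ('s, 'g, 'f) tape set \<Rightarrow> bool" where
  "slides a b \<longleftrightarrow> LW (Dom TC a) b \<Zsemi> RW (Cod TC b) a = RW (Dom TC b) a \<Zsemi> LW (Cod TC a) b"

lemma slides_Comp_right:
  assumes "slides a b" "slides a c" "a \<in> Arr TC" "b \<in> Arr TC" "c \<in> Arr TC" "Cod TC b = Dom TC c"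
  shows "slides a (b \<Zsemi> c)"
proof -
  have "LW (Dom TC a) (b \<Zsemi> c) \<Zsemi> RW (Cod TC c) a = LW (Dom TC a) b \<Zsemi> (LW (Dom TC a) c \<Zsemi> RW (Cod TC c) a)"
    using assms by (simp add: LW_Comp)
  also have "\<dots> = (LW (Dom TC a) b \<Zsemi> RW (Cod TC b) a) \<Zsemi> LW (Cod TC a) c"
    using assms(2-) unfolding slides_def by simp
  also have "\<dots> = RW (Dom TC b) a \<Zsemi> (LW (Cod TC a) b \<Zsemi> LW (Cod TC a) c)"
    using assms(1,3-) unfolding slides_def by simp
  finally show ?thesis using assms by (simp add: slides_def LW_Comp)
qed

lemma slides_Comp_left:
  assumes "slides a c" "slides b c" "a \<in> Arr TC" "b \<in> Arr TC" "c \<in> Arr TC" "Cod TC a = Dom TC b"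
  shows "slides (a \<Zsemi> b) c"
proof -
  have "LW (Dom TC a) c \<Zsemi> RW (Cod TC c) (a \<Zsemi> b) = (LW (Dom TC a) c \<Zsemi> RW (Cod TC c) a) \<Zsemi> RW (Cod TC c) b"
    using assms by (simp add: RW_Comp)
  also have "\<dots> = RW (Dom TC c) a \<Zsemi> (LW (Dom TC b) c \<Zsemi> RW (Cod TC c) b)"
    using assms(1,3-) unfolding slides_def by simp
  also have "\<dots> = RW (Dom TC c) a \<Zsemi> (RW (Dom TC c) b \<Zsemi> LW (Cod TC b) c)"
    using assms(2-) unfolding slides_def by simp
  finally show ?thesis using assms by (simp add: slides_def RW_Comp)
qed

lemma slides_in_right:
  assumes "Q \<in> Pl" "R \<in> Pl" "a \<in> Arr TC"
  shows "slides a (tsum.in1 Q R)" "slides a (tsum.in2 Q R)"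
  using assms LW_in_RW[OF assms] by (simp_all add: slides_def)

lemma slides_in_left:
  assumes [simp]: "Q \<in> Pl" "R \<in> Pl" "a \<in> Arr TC"
  shows "slides (tsum.in1 Q R) a" "slides (tsum.in2 Q R) a"
  by (simp_all add: slides_def RW_in LW_append)

text \<open>In the right argument the test arrows are whiskered injections, which move past
  \<open>a\<close> by \<open>LW_in_RW\<close>; in the left argument, in
  \<open>slides_copair_left\<close>, they are plain injections, by \<open>RW_in\<close>.\<close>

lemma slides_copair_right:
  assumes "slides a (tsum.in1 Q R \<Zsemi> b)" "slides a (tsum.in2 Q R \<Zsemi> b)"
    and [simp]: "a \<in> Arr TC" "b \<in> Arr TC" "Dom TC b = Q @ R" "Q \<in> Pl" "R \<in> Pl"
  shows "slides a b"
  unfolding slides_def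
proof (rule LW_ext[of "Dom TC a" Q R])
  show "LW (Dom TC a) (tsum.in1 Q R) \<Zsemi> (LW (Dom TC a) b \<Zsemi> RW (Cod TC b) a) = LW (Dom TC a) (tsum.in1 Q R) \<Zsemi> (RW (Dom TC b) a \<Zsemi> LW (Cod TC a) b)"
    using assms(1) tape.Comp_eq_extend[OF LW_in_RW(1)[of Q R a], of "LW (Cod TC a) b"] unfolding slides_def by (simp add: LW_Comp)
  show "LW (Dom TC a) (tsum.in2 Q R) \<Zsemi> (LW (Dom TC a) b \<Zsemi> RW (Cod TC b) a) = LW (Dom TC a) (tsum.in2 Q R) \<Zsemi> (RW (Dom TC b) a \<Zsemi> LW (Cod TC a) b)"
    using assms(2) tape.Comp_eq_extend[OF LW_in_RW(2)[of Q R a], of "LW (Cod TC a) b"] unfolding slides_def by (simp add: LW_Comp)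
qed simp_all

lemma slides_copair_left:
  assumes "slides (tsum.in1 Q R \<Zsemi> a) b" "slides (tsum.in2 Q R \<Zsemi> a) b"
    and [simp]: "a \<in> Arr TC" "b \<in> Arr TC" "Dom TC a = Q @ R" "Q \<in> Pl" "R \<in> Pl"
  shows "slides a b"
  unfolding slides_def
proof (rule tsum.coprod_ext[of "Q \<star> Dom TC b" "R \<star> Dom TC b"])
  have "LW Q b \<Zsemi> RW (Cod TC b) (tsum.in1 Q R \<Zsemi> a) = RW (Dom TC b) (tsum.in1 Q R \<Zsemi> a) \<Zsemi> LW (Cod TC a) b"
    using assms(1) unfolding slides_def by simp
  then show "tsum.in1 (Q \<star> Dom TC b) (R \<star> Dom TC b) \<Zsemi> (LW (Dom TC a) b \<Zsemi> RW (Cod TC b) a) = tsum.in1 (Q \<star> Dom TC b) (R \<star> Dom TC b) \<Zsemi> (RW (Dom TC b) a \<Zsemi> LW (Cod TC a) b)"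
    by (simp add: LW_append RW_Comp RW_in)
  have "LW R b \<Zsemi> RW (Cod TC b) (tsum.in2 Q R \<Zsemi> a) = RW (Dom TC b) (tsum.in2 Q R \<Zsemi> a) \<Zsemi> LW (Cod TC a) b"
    using assms(2) unfolding slides_def by simp
  then show "tsum.in2 (Q \<star> Dom TC b) (R \<star> Dom TC b) \<Zsemi> (LW (Dom TC a) b \<Zsemi> RW (Cod TC b) a) = tsum.in2 (Q \<star> Dom TC b) (R \<star> Dom TC b) \<Zsemi> (RW (Dom TC b) a \<Zsemi> LW (Cod TC a) b)"
    by (simp add: LW_append RW_Comp RW_in)
qed simp_all

lemma slides_initial:
  assumes [simp]: "a \<in> Arr TC" "b \<in> Arr TC"
  shows "Dom TC b = [] \<Longrightarrow> slides a b" "Dom TC a = [] \<Longrightarrow> slides a b"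
  unfolding slides_def by (rule tsum.initial_ext; simp)+

lemma slides_Id [simp]: "a \<in> Arr TC \<Longrightarrow> P \<in> Pl \<Longrightarrow> slides a (\<iota> P)" "a \<in> Arr TC \<Longrightarrow> P \<in> Pl \<Longrightarrow> slides (\<iota> P) a"
  by (simp_all add: slides_def)

text \<open>Symmetries, codiagonals and sums are copairings of composites with injections, so up to
  the congruence every tape arises from circuits and operations by composition and copairing. The
  cases follow the coproduct structure rather than the syntax.\<close>

lemma tape_copair_induct [consumes 1, case_names circ op Comp in1 in2 copair initial]:
  assumes "wt t"
    and circ: "\<And>c. wt_circ \<Gamma> c \<Longrightarrow> Q (cl (TCirc c))"
    and op: "\<And>f U. f \<in> ops T \<Longrightarrow> U \<in> Wd \<Longrightarrow> Q (OP f [U])"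
    and Comp: "\<And>a b. Q a \<Longrightarrow> Q b \<Longrightarrow> a \<in> Arr TC \<Longrightarrow> b \<in> Arr TC \<Longrightarrow> Cod TC a = Dom TC b \<Longrightarrow> Q (a \<Zsemi> b)"
    and in1: "\<And>P R. P \<in> Pl \<Longrightarrow> R \<in> Pl \<Longrightarrow> Q (tsum.in1 P R)"
    and in2: "\<And>P R. P \<in> Pl \<Longrightarrow> R \<in> Pl \<Longrightarrow> Q (tsum.in2 P R)"
    and copair: "\<And>P R a. Q (tsum.in1 P R \<Zsemi> a) \<Longrightarrow> Q (tsum.in2 P R \<Zsemi> a) \<Longrightarrow> a \<in> Arr TC \<Longrightarrow> Dom TC a = P @ R \<Longrightarrow>
       P \<in> Pl \<Longrightarrow> R \<in> Pl \<Longrightarrow> Q a"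
    and initial: "\<And>a. a \<in> Arr TC \<Longrightarrow> Dom TC a = [] \<Longrightarrow> Q a"
  shows "Q (cl t)"
proof -
  \<comment> \<open>An identity is the first injection into a sum with the empty polynomial.\<close>
  have Id: "Q (\<iota> P)" if "P \<in> Pl" for P
    using in1[of P "[]"] that by simp
  show ?thesis using assms(1)
  proof (induction t)
    case (TSym U V)
    then show ?case using copair[of "[U]" "[V]" "\<sigma> [U] [V]"] in1[of "[V]" "[U]"] in2[of "[V]" "[U]"] by simp
  next
    case (TSeq t u)
    then show ?case by (simp add: Comp)
  next
    case (TPar t u)
    then have a: "Q (cl t \<Zsemi> tsum.in1 (tc t) (tc u))" "Q (cl u \<Zsemi> tsum.in2 (tc t) (tc u))"
      by (simp_all add: Comp in1 in2 wt_poly)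
    show ?case using TPar.prems a copair[of "td t" "td u" "cl t \<boxplus> cl u"] by (simp add: wt_poly)
  next
    case (TNabla U)
    then show ?case using copair[of "[U]" "[U]" "tN [U]"] Id[of "[U]"] by simp
  qed (use circ op Id initial in \<open>simp_all add: OP_sing\<close>)
qed

text \<open>The left argument varies by \<open>tape_copair_induct\<close>. Two circuits slide by
  interchange of circuits; an operation slides by \<open>OP_natural\<close> at the whiskered
  circuit, with \<open>RW_OP\<close> identifying the operations at both ends.\<close>

lemma slides_circ:
  assumes "a \<in> Arr TC" and d: "wt_circ \<Gamma> d"
  shows "slides a (cl (TCirc d))"
proof -
  note d [simp]
  obtain t where t: "wt t" "a = cl t" using assms(1) by (rule tape.ArrE)
  show ?thesis unfolding t(2) using t(1)
  proof (induction rule: tape_copair_induct)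
    case (circ c)
    then show ?case using d cl_TCirc_CPar1[of c d] cl_TCirc_CPar2[of c d]
      by (simp add: slides_def LW_sing_cl RW_sing_cl wt_circ_words)
  next
    case (op f U)
    have "LW [U] (cl (TCirc d)) \<Zsemi> OP f (Cod TC (LW [U] (cl (TCirc d)))) = OP f (Dom TC (LW [U] (cl (TCirc d)))) \<Zsemi> LW (opN f) (LW [U] (cl (TCirc d)))"
      using op by (intro OP_natural) simp_all
    then show ?case using op d LW_LW[of "opN f" "[U]" "cl (TCirc d)"] RW_OP[of f "[U]" "[cdom \<Gamma> d]"] RW_OP[of f "[U]" "[ccod \<Gamma> d]"]
      by (simp add: slides_def wt_circ_words)
  next
    case (initial a) then show ?case by (simp add: slides_initial)
  next
    case (copair P R a)
    then show ?case by (intro slides_copair_left[of P R a]) simp_all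
  qed (simp_all add: slides_Comp_left slides_in_left)
qed

lemma npow_eq [simp]: "tsum.npow P n = replicate n [] \<star> P"
  by (induction n) simp_all

lemma LW_replicate: "a \<in> Arr TC \<Longrightarrow> LW (replicate n []) a = tsum.nsumar (replicate n a)"
proof (induction n)
  case (Suc n)
  then show ?case using LW_Cons[of "[]" "replicate n []" a] by simp
qed simp

lemma map2_replicate: "length fs = n \<Longrightarrow> map2 h (replicate n x) fs = map (h x) fs"
  by (induction fs arbitrary: n) auto

lemma LW_ncopair:
  assumes "a \<in> Hom TC P Q" "set fs \<subseteq> Hom TC Q R" "length fs = n" "P \<in> Pl" "Q \<in> Pl" "R \<in> Pl"
  shows "LW (replicate n []) a \<Zsemi> tsum.ncopair R fs = tsum.ncopair R (map (\<lambda>f. a \<Zsemi> f) fs)"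
proof -
  have a: "a \<in> Arr TC" using assms(1) by (simp add: Hom_def)
  have "tsum.nsumar (replicate n a) \<Zsemi> tsum.ncopair R fs = tsum.ncopair R (map2 (\<Zsemi>) (replicate n a) fs)"
    by (rule tsum.nsumar_ncopair[of _ P Q]) (use assms in auto)
  then show ?thesis using assms(3) a by (simp add: LW_replicate map2_replicate)
qed

lemma ncopair_upt_cong: "(\<And>j. j < n \<Longrightarrow> f j = h j) \<Longrightarrow> tsum.ncopair Z (map f [0..<n]) = tsum.ncopair Z (map h [0..<n])"
  by (intro arg_cong[of _ _ "tsum.ncopair Z"] map_cong) simp_all

text \<open>Sends the \<open>j\<close>-th copy of \<open>P \<star> [V]\<close> to \<open>P\<close>
  times the \<open>j\<close>-th copy of \<open>V\<close>: a permutation of summands, written as a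
  copairing so that it can be tested on injections. It is the discrepancy between an operation at
  \<open>P \<star> [V]\<close> and the whiskering by \<open>P\<close> of the operation at
  \<open>V\<close>.\<close>

definition shuffle :: "nat \<Rightarrow> 's list \<Rightarrow> 's list list \<Rightarrow> ('s, 'g, 'f) tape set" where
  "shuffle n V P = tsum.ncopair (P \<star> replicate n V) (map (\<lambda>j. LW P (tsum.nin [V] n j)) [0..<n])"

lemma nin_replicate [simp]:
  assumes "V \<in> Wd" "j < n"
  shows "tsum.nin [V] n j \<in> Arr TC" "Dom TC (tsum.nin [V] n j) = [V]" "Cod TC (tsum.nin [V] n j) = replicate n V"
  using tsum.nin_simps[of "[V]" j n] assms by simp_all

lemma shuffle_Hom: "V \<in> Wd \<Longrightarrow> P \<in> Pl \<Longrightarrow> set (map (\<lambda>j. LW P (tsum.nin [V] n j)) [0..<n]) \<subseteq> Hom TC (P \<star> [V]) (P \<star> replicate n V)"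
  by (simp add: Hom_def image_subset_iff)

lemma in_LW_Cons:
  assumes [simp]: "U \<in> Wd" "P \<in> Pl" "a \<in> Arr TC" and D: "Dom TC a = A" "Cod TC a = B"
  shows "tsum.in1 ([U] \<star> A) (P \<star> A) \<Zsemi> LW (U # P) a = LW [U] a \<Zsemi> tsum.in1 ([U] \<star> B) (P \<star> B)"
    "tsum.in2 ([U] \<star> A) (P \<star> A) \<Zsemi> LW (U # P) a = LW P a \<Zsemi> tsum.in2 ([U] \<star> B) (P \<star> B)"
  unfolding D[symmetric] LW_Cons[OF assms(1-3)] by (simp_all del: poly_prod_simps)

lemma shuffle_simps [simp]:
  assumes [simp]: "V \<in> Wd" "P \<in> Pl"
  shows "shuffle n V P \<in> Arr TC" "Dom TC (shuffle n V P) = replicate n [] \<star> (P \<star> [V])" "Cod TC (shuffle n V P) = P \<star> replicate n V"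
  using tsum.ncopair_props[OF shuffle_Hom[OF assms, of n]] by (simp_all add: shuffle_def)

lemma LW_shuffle:
  assumes "a \<in> Hom TC Q (P \<star> [V])" and [simp]: "V \<in> Wd" "P \<in> Pl" "Q \<in> Pl"
  shows "LW (replicate n []) a \<Zsemi> shuffle n V P = tsum.ncopair (P \<star> replicate n V) (map (\<lambda>j. a \<Zsemi> LW P (tsum.nin [V] n j)) [0..<n])"
  unfolding shuffle_def using LW_ncopair[OF assms(1) shuffle_Hom[of V P n]] by (simp add: o_def)

lemma shuffle_Comp:
  assumes "h \<in> Hom TC (P \<star> replicate n V) Q" and [simp]: "V \<in> Wd" "P \<in> Pl" "Q \<in> Pl"
  shows "shuffle n V P \<Zsemi> h = tsum.ncopair Q (map (\<lambda>j. LW P (tsum.nin [V] n j) \<Zsemi> h) [0..<n])"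
  unfolding shuffle_def using tsum.ncopair_Comp[OF shuffle_Hom[of V P n], of h] HomD[OF assms(1)] by (simp add: o_def)

lemma LW_nin [simp]:
  assumes [simp]: "U \<in> Wd" "V \<in> Wd"
  shows "j < n \<Longrightarrow> LW [U] (tsum.nin [V] n j) = tsum.nin [U @ V] n j"
proof (induction n arbitrary: j)
  case (Suc n)
  then show ?case by (cases j) (simp_all add: LW_Comp)
qed simp

lemma shuffle_sing: "U \<in> Wd \<Longrightarrow> V \<in> Wd \<Longrightarrow> shuffle n V [U] = \<iota> (replicate n (U @ V))"
  using tsum.ncopair_nin[of "[U @ V]" n]
  by (simp add: shuffle_def) (metis (no_types, lifting) LW_nin atLeastLessThan_iff map_cong set_upt)

text \<open>By induction on \<open>P\<close>, tested on injections: \<open>OP_natural\<close> moves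
  an injection past the operation, where it meets the copairing. At a monomial the permutation is
  trivial and left whiskering rewrites the operation tape directly.\<close>

lemma OP_shuffle:
  assumes g: "g \<in> ops T" and [simp]: "V \<in> Wd" "P \<in> Pl"
  shows "OP g (P \<star> [V]) \<Zsemi> shuffle (arity T g) V P = LW P (OP g [V])"
  using assms(3)
proof (induction P)
  case Nil
  then show ?case using g by (intro tsum.initial_ext) simp_all
next
  case (Cons U P)
  note [simp] = Cons.hyps g
  let ?n = "arity T g"
  note L = in_LW_Cons[OF Cons.hyps, of "OP g [V]" "[V]" "replicate ?n V", simplified opN_sing]
  have s: "tsum.in1 ([U] \<star> [V]) (P \<star> [V]) \<Zsemi> LW (U # P) (tsum.nin [V] ?n j) = LW [U] (tsum.nin [V] ?n j) \<Zsemi> tsum.in1 ([U] \<star> replicate ?n V) (P \<star> replicate ?n V)"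
    "tsum.in2 ([U] \<star> [V]) (P \<star> [V]) \<Zsemi> LW (U # P) (tsum.nin [V] ?n j) = LW P (tsum.nin [V] ?n j) \<Zsemi> tsum.in2 ([U] \<star> replicate ?n V) (P \<star> replicate ?n V)"
    if "j < ?n" for j
    using in_LW_Cons[OF Cons.hyps, of "tsum.nin [V] ?n j" "[V]" "replicate ?n V"] that by (simp_all del: poly_prod_simps LW_nin)
  have Q: "[U] \<star> [V] @ P \<star> [V] = (U # P) \<star> [V]" "[U] \<star> replicate ?n V @ P \<star> replicate ?n V = (U # P) \<star> replicate ?n V" by simp_all
  show ?case
  proof (rule tsum.coprod_ext[of "[U] \<star> [V]" "P \<star> [V]"])
    have "tsum.in1 ([U] \<star> [V]) (P \<star> [V]) \<Zsemi> (OP g ((U # P) \<star> [V]) \<Zsemi> shuffle ?n V (U # P)) =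
       OP g ([U] \<star> [V]) \<Zsemi> (LW (opN g) (tsum.in1 ([U] \<star> [V]) (P \<star> [V])) \<Zsemi> shuffle ?n V (U # P))"
      using OP_natural[of g "tsum.in1 ([U] \<star> [V]) (P \<star> [V])"] by (intro tape.Comp_eq_extend) simp_all
    also have "LW (opN g) (tsum.in1 ([U] \<star> [V]) (P \<star> [V])) \<Zsemi> shuffle ?n V (U # P) =
       shuffle ?n V [U] \<Zsemi> tsum.in1 ([U] \<star> replicate ?n V) (P \<star> replicate ?n V)"
    proof -
      have "tsum.in1 ([U] \<star> [V]) (P \<star> [V]) \<in> Hom TC ([U] \<star> [V]) ((U # P) \<star> [V])"
        "tsum.in1 ([U] \<star> replicate ?n V) (P \<star> replicate ?n V) \<in> Hom TC ([U] \<star> replicate ?n V) ((U # P) \<star> replicate ?n V)"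
        unfolding Q[symmetric] by (simp_all add: Hom_def del: poly_prod_simps)
      from LW_shuffle[OF this(1), of ?n] shuffle_Comp[OF this(2)] show ?thesis
        using ncopair_upt_cong[OF s(1)] by simp
    qed
    also have "OP g ([U] \<star> [V]) \<Zsemi> (shuffle ?n V [U] \<Zsemi> tsum.in1 ([U] \<star> replicate ?n V) (P \<star> replicate ?n V)) =
       LW [U] (OP g [V]) \<Zsemi> tsum.in1 ([U] \<star> replicate ?n V) (P \<star> replicate ?n V)"
      using LW_sing_cl[of U "TOp g V"] by (simp add: shuffle_sing OP_sing[symmetric])
    also have "\<dots> = tsum.in1 ([U] \<star> [V]) (P \<star> [V]) \<Zsemi> LW (U # P) (OP g [V])"
      by (rule L(1)[symmetric]) simp_all
    finally show "tsum.in1 ([U] \<star> [V]) (P \<star> [V]) \<Zsemi> (OP g ((U # P) \<star> [V]) \<Zsemi> shuffle ?n V (U # P)) = tsum.in1 ([U] \<star> [V]) (P \<star> [V]) \<Zsemi> LW (U # P) (OP g [V])" .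
    have "tsum.in2 ([U] \<star> [V]) (P \<star> [V]) \<Zsemi> (OP g ((U # P) \<star> [V]) \<Zsemi> shuffle ?n V (U # P)) =
       OP g (P \<star> [V]) \<Zsemi> (LW (opN g) (tsum.in2 ([U] \<star> [V]) (P \<star> [V])) \<Zsemi> shuffle ?n V (U # P))"
      using OP_natural[of g "tsum.in2 ([U] \<star> [V]) (P \<star> [V])"] by (intro tape.Comp_eq_extend) simp_all
    also have "LW (opN g) (tsum.in2 ([U] \<star> [V]) (P \<star> [V])) \<Zsemi> shuffle ?n V (U # P) =
       shuffle ?n V P \<Zsemi> tsum.in2 ([U] \<star> replicate ?n V) (P \<star> replicate ?n V)"
    proof -
      have "tsum.in2 ([U] \<star> [V]) (P \<star> [V]) \<in> Hom TC (P \<star> [V]) ((U # P) \<star> [V])"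
        "tsum.in2 ([U] \<star> replicate ?n V) (P \<star> replicate ?n V) \<in> Hom TC (P \<star> replicate ?n V) ((U # P) \<star> replicate ?n V)"
        unfolding Q[symmetric] by (simp_all add: Hom_def del: poly_prod_simps)
      from LW_shuffle[OF this(1), of ?n] shuffle_Comp[OF this(2)] show ?thesis
        using ncopair_upt_cong[OF s(2)] by simp
    qed
    also have "OP g (P \<star> [V]) \<Zsemi> (shuffle ?n V P \<Zsemi> tsum.in2 ([U] \<star> replicate ?n V) (P \<star> replicate ?n V)) =
       (OP g (P \<star> [V]) \<Zsemi> shuffle ?n V P) \<Zsemi> tsum.in2 ([U] \<star> replicate ?n V) (P \<star> replicate ?n V)"
      by (rule tape.Comp_assoc_simp[symmetric]) simp_all
    also have "\<dots> = tsum.in2 ([U] \<star> [V]) (P \<star> [V]) \<Zsemi> LW (U # P) (OP g [V])"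
      unfolding Cons.IH by (rule L(2)[symmetric]) simp_all
    finally show "tsum.in2 ([U] \<star> [V]) (P \<star> [V]) \<Zsemi> (OP g ((U # P) \<star> [V]) \<Zsemi> shuffle ?n V (U # P)) = tsum.in2 ([U] \<star> [V]) (P \<star> [V]) \<Zsemi> LW (U # P) (OP g [V])" .
  qed simp_all
qed

lemma slides_nin: "a \<in> Arr TC \<Longrightarrow> V \<in> Wd \<Longrightarrow> j < n \<Longrightarrow> slides a (tsum.nin [V] n j)"
proof (induction n arbitrary: j)
  case (Suc n)
  show ?case
  proof (cases j)
    case 0
    then show ?thesis using Suc.prems by (simp add: slides_in_right)
  next
    case (Suc k)
    then show ?thesis using Suc.IH[of k] Suc.prems by (simp add: slides_Comp_right slides_in_right)
  qed
qed simp

text \<open>\<open>OP_natural\<close> at \<open>RW [V] a\<close> moves \<open>a\<close> past the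
  operation into as many copies as the arity. \<open>shuffle\<close> then carries these copies to
  the right whiskering of \<open>a\<close> by the replicated \<open>V\<close>, because
  \<open>a\<close> slides past each injection \<open>nin\<close>.\<close>

lemma slides_op:
  assumes [simp]: "a \<in> Arr TC" "g \<in> ops T" "V \<in> Wd"
  shows "slides a (OP g [V])"
proof -
  let ?n = "arity T g" let ?P = "Dom TC a" let ?Q = "Cod TC a"
  have "RW [V] a \<Zsemi> LW (Cod TC a) (OP g [V]) = RW [V] a \<Zsemi> (OP g (?Q \<star> [V]) \<Zsemi> shuffle ?n V ?Q)"
    by (simp add: OP_shuffle)
  also have "\<dots> = OP g (?P \<star> [V]) \<Zsemi> (LW (opN g) (RW [V] a) \<Zsemi> shuffle ?n V ?Q)"
    using OP_natural[of g "RW [V] a"] by (intro tape.Comp_eq_extend) simp_all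
  also have "LW (opN g) (RW [V] a) \<Zsemi> shuffle ?n V ?Q = shuffle ?n V ?P \<Zsemi> RW (replicate ?n V) a"
  proof -
    have "RW [V] a \<Zsemi> LW ?Q (tsum.nin [V] ?n j) = LW ?P (tsum.nin [V] ?n j) \<Zsemi> RW (replicate ?n V) a" if "j < ?n" for j
      using slides_nin[of a V j ?n] that by (simp add: slides_def)
    from ncopair_upt_cong[OF this] show ?thesis
      using LW_shuffle[of "RW [V] a" "?P \<star> [V]" ?Q V ?n] shuffle_Comp[of "RW (replicate ?n V) a" ?P ?n V "?Q \<star> replicate ?n V"]
      by (simp add: Hom_def)
  qed
  also have "OP g (?P \<star> [V]) \<Zsemi> (shuffle ?n V ?P \<Zsemi> RW (replicate ?n V) a) = (OP g (?P \<star> [V]) \<Zsemi> shuffle ?n V ?P) \<Zsemi> RW (replicate ?n V) a"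
    by (rule tape.Comp_assoc_simp[symmetric]) simp_all
  finally show ?thesis by (simp add: slides_def OP_shuffle)
qed

lemma slides_all:
  assumes [simp]: "a \<in> Arr TC" and b: "b \<in> Arr TC"
  shows "slides a b"
proof -
  obtain t where t: "wt t" "b = cl t" using b by (rule tape.ArrE)
  show ?thesis unfolding t(2) using t(1)
  proof (induction rule: tape_copair_induct)
    case (initial a) then show ?case by (simp add: slides_initial)
  next
    case (copair P R b)
    then show ?case by (intro slides_copair_right[of a P R b]) simp_all
  qed (simp_all add: slides_Comp_right slides_in_right slides_circ slides_op)
qed

lemma slide:
  "a \<in> Arr TC \<Longrightarrow> b \<in> Arr TC \<Longrightarrow> Dom TC a = P \<Longrightarrow> Cod TC a = P' \<Longrightarrow> Dom TC b = Q \<Longrightarrow> Cod TC b = Q' \<Longrightarrow>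
    LW P b \<Zsemi> RW Q' a = RW Q a \<Zsemi> LW P' b"
  using slides_all[of a b] by (auto simp: slides_def)

text \<open>In contrast to \<open>LW_LW\<close> this rests on the slide law: for polynomial
  \<open>R\<close> the test injections come whiskered by \<open>Q\<close>, and \<open>a\<close> has
  to be moved past such arrows, which are not injections themselves.\<close>

lemma RW_RW:
  assumes "Q \<in> Pl" "R \<in> Pl" and a [simp]: "a \<in> Arr TC"
  shows "RW (Q \<star> R) a = RW R (RW Q a)"
proof -
  let ?P = "Dom TC a" let ?P' = "Cod TC a"
  have 1: "RW (Q \<star> [W]) a = RW [W] (RW Q a)" if [simp]: "W \<in> Wd" for W
    using assms(1)
  proof (induction Q)
    case (Cons V Q)
    note [simp] = Cons.hyps
    have i: "tsum.in1 [V @ W] (Q \<star> [W]) = RW [W] (tsum.in1 [V] Q)" "tsum.in2 [V @ W] (Q \<star> [W]) = RW [W] (tsum.in2 [V] Q)"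
      using RW_in[of "[W]" "[V]" Q] by simp_all
    note w = LW_in_RW_Cons[of "V @ W" "Q \<star> [W]" a] LW_in_RW_Cons[of V Q a]
    show ?case
    proof (rule LW_ext[of ?P "[V @ W]" "Q \<star> [W]"])
      have "LW ?P (tsum.in1 [V @ W] (Q \<star> [W])) \<Zsemi> RW [W] (RW (V # Q) a) = RW [W] (LW ?P (tsum.in1 [V] Q) \<Zsemi> RW (V # Q) a)"
        by (simp add: i RW_Comp RW_LW)
      also have "\<dots> = RW [V @ W] a \<Zsemi> LW ?P' (tsum.in1 [V @ W] (Q \<star> [W]))"
        unfolding w(3)[OF Cons.hyps a] by (simp add: i RW_Comp RW_LW RW_sing_append)
      finally show "LW ?P (tsum.in1 [V @ W] (Q \<star> [W])) \<Zsemi> RW ((V # Q) \<star> [W]) a = LW ?P (tsum.in1 [V @ W] (Q \<star> [W])) \<Zsemi> RW [W] (RW (V # Q) a)"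
        using w(1) by simp
      have "LW ?P (tsum.in2 [V @ W] (Q \<star> [W])) \<Zsemi> RW [W] (RW (V # Q) a) = RW [W] (LW ?P (tsum.in2 [V] Q) \<Zsemi> RW (V # Q) a)"
        by (simp add: i RW_Comp RW_LW)
      also have "\<dots> = RW (Q \<star> [W]) a \<Zsemi> LW ?P' (tsum.in2 [V @ W] (Q \<star> [W]))"
        unfolding w(4)[OF Cons.hyps a] by (simp add: i RW_Comp RW_LW Cons.IH)
      finally show "LW ?P (tsum.in2 [V @ W] (Q \<star> [W])) \<Zsemi> RW ((V # Q) \<star> [W]) a = LW ?P (tsum.in2 [V @ W] (Q \<star> [W])) \<Zsemi> RW [W] (RW (V # Q) a)"
        using w(2) by simp
    qed simp_all
  qed simp
  show ?thesis using assms(2)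
  proof (induction R)
    case Nil
    then show ?case using assms by (intro tsum.initial_ext) simp_all
  next
    case (Cons W R)
    note [simp] = Cons.hyps assms(1)
    note w = LW_in_RW_Cons[of W R "RW Q a"]
    have l: "LW (?P \<star> Q) b = LW ?P (LW Q b)" "LW (?P' \<star> Q) b = LW ?P' (LW Q b)" if "b \<in> Arr TC" for b
      using that by (simp_all add: LW_LW)
    show ?case
    proof (rule LW_ext[of "?P \<star> Q" "[W]" R])
      show "LW (?P \<star> Q) (tsum.in1 [W] R) \<Zsemi> RW (Q \<star> (W # R)) a = LW (?P \<star> Q) (tsum.in1 [W] R) \<Zsemi> RW (W # R) (RW Q a)"
        using w(1) slide[of a "LW Q (tsum.in1 [W] R)", OF _ _ HOL.refl HOL.refl HOL.refl HOL.refl] by (simp add: l 1)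
      show "LW (?P \<star> Q) (tsum.in2 [W] R) \<Zsemi> RW (Q \<star> (W # R)) a = LW (?P \<star> Q) (tsum.in2 [W] R) \<Zsemi> RW (W # R) (RW Q a)"
        using w(2) slide[of a "LW Q (tsum.in2 [W] R)", OF _ _ HOL.refl HOL.refl HOL.refl HOL.refl] by (simp add: l Cons.IH)
    qed simp_all
  qed
qed

end

section \<open>The product of tapes\<close>

context tapes
begin

section \<open>The symmetry of the product\<close>

lemma csym_csym:
  assumes "U \<in> Wd" "V \<in> Wd"
  shows "CSeq (csym U V) (csym V U) \<approx>\<^sub>c cid (U @ V)"
  using circ.sy_sy[OF assms] assms by (intro circ.cls_eqD) (simp_all add: circ.symm_quot_tensor circ.cls_Comp circ.cls_Id)

lemma csym_append:
  assumes "U \<in> Wd" "V \<in> Wd" "W \<in> Wd"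
  shows "csym U (V @ W) \<approx>\<^sub>c CSeq (CPar (csym U V) (cid W)) (CPar (cid V) (csym U W))"
  using circ.sy_append_right[OF assms] assms
  by (intro circ.cls_eqD) (simp_all add: circ.symm_quot_tensor circ.cls_Comp circ.cls_tar circ.cls_Id)

definition SG :: "'s list list \<Rightarrow> 's list list \<Rightarrow> ('s, 'g, 'f) tape set" where "SG P Q = cl (tsym_prod P Q)"

lemma SG_simps [simp]:
  assumes "P \<in> Pl" "Q \<in> Pl"
  shows "SG P Q \<in> Arr TC" "Dom TC (SG P Q) = P \<star> Q" "Cod TC (SG P Q) = Q \<star> P"
  using assms by (simp_all add: SG_def)

lemma wt_map_csym: "P \<in> Pl \<Longrightarrow> V \<in> Wd \<Longrightarrow> \<forall>U \<in> set P. wt_circ \<Gamma> (csym U V)"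
  by (auto intro!: csym_typing)

lemma SG_Nil [simp]: "SG P [] = \<iota> []"
  by (simp add: SG_def)

lemma SG_Nil_left [simp]: "Q \<in> Pl \<Longrightarrow> SG [] Q = \<iota> []"
  by (rule tsum.initial_ext) simp_all

lemma SG_sing_eq: "P \<in> Pl \<Longrightarrow> V \<in> Wd \<Longrightarrow> SG P [V] = cl (tsum (map (\<lambda>U. TCirc (csym U V)) P))"
  using wt_map_csym[of P V] by (simp add: SG_def o_def poly_prod_sing)

lemma SG_Cons: "P \<in> Pl \<Longrightarrow> V \<in> Wd \<Longrightarrow> Q \<in> Pl \<Longrightarrow> SG P (V # Q) = DL P [V] Q \<Zsemi> (SG P [V] \<boxplus> SG P Q)"
  unfolding SG_sing_eq
  using wt_map_csym[of P V] by (simp add: SG_def o_def poly_prod_sing)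

lemma SG_sing_sing: "U \<in> Wd \<Longrightarrow> V \<in> Wd \<Longrightarrow> SG [U] [V] = cl (TCirc (csym U V))"
  by (simp add: SG_sing_eq wt_circ_words)

lemma SG_Cons_sing: "U \<in> Wd \<Longrightarrow> V \<in> Wd \<Longrightarrow> P \<in> Pl \<Longrightarrow> SG (U # P) [V] = SG [U] [V] \<boxplus> SG P [V]"
  using wt_map_csym[of P V] by (simp add: SG_sing_eq wt_circ_words)

lemma SG_append_sing: "P \<in> Pl \<Longrightarrow> P' \<in> Pl \<Longrightarrow> V \<in> Wd \<Longrightarrow> SG (P @ P') [V] = SG P [V] \<boxplus> SG P' [V]"
proof (induction P rule: lists.induct)
  case (Cons U P)
  then show ?case using SG_Cons_sing[of U V "P @ P'"] SG_Cons_sing[of U V P] by simp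
qed simp

text \<open>As with right whiskering, the distributor in the recursion disappears on whiskered
  injections and leaves one monomial of the right factor.\<close>

lemma LW_in_SG_Cons:
  assumes [simp]: "P \<in> Pl" "V \<in> Wd" "Q \<in> Pl"
  shows "LW P (tsum.in1 [V] Q) \<Zsemi> SG P (V # Q) = SG P [V] \<Zsemi> tsum.in1 ([V] \<star> P) (Q \<star> P)"
    "LW P (tsum.in2 [V] Q) \<Zsemi> SG P (V # Q) = SG P Q \<Zsemi> tsum.in2 ([V] \<star> P) (Q \<star> P)"
proof -
  have "LW P (tsum.in1 [V] Q) \<Zsemi> SG P (V # Q) = (LW P (tsum.in1 [V] Q) \<Zsemi> DL P [V] Q) \<Zsemi> (SG P [V] \<boxplus> SG P Q)"
    unfolding SG_Cons[OF assms] by (rule tape.Comp_assoc_simp[symmetric]) simp_all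
  then show "LW P (tsum.in1 [V] Q) \<Zsemi> SG P (V # Q) = SG P [V] \<Zsemi> tsum.in1 ([V] \<star> P) (Q \<star> P)"
    by (simp add: LW_in_DL)
  have "LW P (tsum.in2 [V] Q) \<Zsemi> SG P (V # Q) = (LW P (tsum.in2 [V] Q) \<Zsemi> DL P [V] Q) \<Zsemi> (SG P [V] \<boxplus> SG P Q)"
    unfolding SG_Cons[OF assms] by (rule tape.Comp_assoc_simp[symmetric]) simp_all
  then show "LW P (tsum.in2 [V] Q) \<Zsemi> SG P (V # Q) = SG P Q \<Zsemi> tsum.in2 ([V] \<star> P) (Q \<star> P)"
    by (simp add: LW_in_DL)
qed

lemma LW_in_SG:
  assumes [simp]: "P \<in> Pl" "R \<in> Pl" and "Q \<in> Pl"
  shows "LW P (tsum.in1 Q R) \<Zsemi> SG P (Q @ R) = SG P Q \<Zsemi> tsum.in1 (Q \<star> P) (R \<star> P)"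
    "LW P (tsum.in2 Q R) \<Zsemi> SG P (Q @ R) = SG P R \<Zsemi> tsum.in2 (Q \<star> P) (R \<star> P)"
  using assms(3)
proof (induction Q)
  case Nil
  { case 1 show ?case by (rule tsum.initial_ext) simp_all }
  { case 2 show ?case by simp }
next
  case (Cons V Q)
  note [simp] = Cons.hyps
  have i: "tsum.in1 [V] Q \<Zsemi> tsum.in1 (V # Q) R = tsum.in1 [V] (Q @ R)"
    "tsum.in2 [V] Q \<Zsemi> tsum.in1 (V # Q) R = tsum.in1 Q R \<Zsemi> tsum.in2 [V] (Q @ R)"
    "tsum.in2 (V # Q) R = tsum.in2 Q R \<Zsemi> tsum.in2 [V] (Q @ R)"
    by (simp_all add: tsum.in1_in1 tsum.in1_in2 tsum.in2_in2)
  have j: "tsum.in1 ([V] \<star> P) (Q \<star> P) \<Zsemi> tsum.in1 ((V # Q) \<star> P) (R \<star> P) = tsum.in1 ([V] \<star> P) ((Q @ R) \<star> P)"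
    "tsum.in2 ([V] \<star> P) (Q \<star> P) \<Zsemi> tsum.in1 ((V # Q) \<star> P) (R \<star> P) = tsum.in1 (Q \<star> P) (R \<star> P) \<Zsemi> tsum.in2 ([V] \<star> P) ((Q @ R) \<star> P)"
    "tsum.in2 ((V # Q) \<star> P) (R \<star> P) = tsum.in2 (Q \<star> P) (R \<star> P) \<Zsemi> tsum.in2 ([V] \<star> P) ((Q @ R) \<star> P)"
    by (simp_all add: tsum.in1_in1 tsum.in1_in2 tsum.in2_in2)
  note w = LW_in_SG_Cons[of P V "Q @ R", simplified] LW_in_SG_Cons[of P V Q, simplified]
  have a1: "LW P f \<Zsemi> (LW P (tsum.in2 [V] (Q @ R)) \<Zsemi> SG P (V # Q @ R)) = (LW P f \<Zsemi> SG P (Q @ R)) \<Zsemi> tsum.in2 ([V] \<star> P) ((Q @ R) \<star> P)"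
    if "f \<in> Arr TC" "Cod TC f = Q @ R" for f
    using that unfolding w(2) by simp
  have a2: "LW P (tsum.in1 [V] Q) \<Zsemi> (SG P (V # Q) \<Zsemi> h) = SG P [V] \<Zsemi> (tsum.in1 ([V] \<star> P) (Q \<star> P) \<Zsemi> h)"
    "LW P (tsum.in2 [V] Q) \<Zsemi> (SG P (V # Q) \<Zsemi> h) = SG P Q \<Zsemi> (tsum.in2 ([V] \<star> P) (Q \<star> P) \<Zsemi> h)"
    if "h \<in> Arr TC" "Dom TC h = (V # Q) \<star> P" for h
    using that by (rule_tac tape.Comp_eq_extend; simp add: w)+
  { case 1
    have 2: "LW P (tsum.in1 Q R \<Zsemi> tsum.in2 [V] (Q @ R)) \<Zsemi> SG P (V # Q @ R) = SG P Q \<Zsemi> (tsum.in1 (Q \<star> P) (R \<star> P) \<Zsemi> tsum.in2 ([V] \<star> P) ((Q @ R) \<star> P))"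
      using a1[of "tsum.in1 Q R"] Cons.IH(1) by (simp add: LW_Comp)
    have "LW P (tsum.in1 (V # Q) R) \<Zsemi> SG P (V # Q @ R) = SG P (V # Q) \<Zsemi> tsum.in1 ((V # Q) \<star> P) (R \<star> P)"
    proof (rule LW_ext[of P "[V]" Q])
      have "LW P (tsum.in1 [V] Q) \<Zsemi> (LW P (tsum.in1 (V # Q) R) \<Zsemi> SG P (V # Q @ R)) = LW P (tsum.in1 [V] (Q @ R)) \<Zsemi> SG P (V # Q @ R)"
        by (simp add: LW_LW_in i)
      also have "\<dots> = SG P [V] \<Zsemi> (tsum.in1 ([V] \<star> P) (Q \<star> P) \<Zsemi> tsum.in1 ((V # Q) \<star> P) (R \<star> P))"
        unfolding j using w(1) by simp
      also have "\<dots> = LW P (tsum.in1 [V] Q) \<Zsemi> (SG P (V # Q) \<Zsemi> tsum.in1 ((V # Q) \<star> P) (R \<star> P))"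
        by (rule a2(1)[symmetric]) simp_all
      finally show "LW P (tsum.in1 [V] Q) \<Zsemi> (LW P (tsum.in1 (V # Q) R) \<Zsemi> SG P (V # Q @ R)) = LW P (tsum.in1 [V] Q) \<Zsemi> (SG P (V # Q) \<Zsemi> tsum.in1 ((V # Q) \<star> P) (R \<star> P))" .
      have "LW P (tsum.in2 [V] Q) \<Zsemi> (LW P (tsum.in1 (V # Q) R) \<Zsemi> SG P (V # Q @ R)) = LW P (tsum.in1 Q R \<Zsemi> tsum.in2 [V] (Q @ R)) \<Zsemi> SG P (V # Q @ R)"
        by (simp add: LW_LW_in i)
      also have "\<dots> = SG P Q \<Zsemi> (tsum.in2 ([V] \<star> P) (Q \<star> P) \<Zsemi> tsum.in1 ((V # Q) \<star> P) (R \<star> P))"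
        unfolding j by (rule 2)
      also have "\<dots> = LW P (tsum.in2 [V] Q) \<Zsemi> (SG P (V # Q) \<Zsemi> tsum.in1 ((V # Q) \<star> P) (R \<star> P))"
        by (rule a2(2)[symmetric]) simp_all
      finally show "LW P (tsum.in2 [V] Q) \<Zsemi> (LW P (tsum.in1 (V # Q) R) \<Zsemi> SG P (V # Q @ R)) = LW P (tsum.in2 [V] Q) \<Zsemi> (SG P (V # Q) \<Zsemi> tsum.in1 ((V # Q) \<star> P) (R \<star> P))" .
    qed simp_all
    then show ?case by simp }
  { case 2
    have "LW P (tsum.in2 Q R \<Zsemi> tsum.in2 [V] (Q @ R)) \<Zsemi> SG P (V # Q @ R) = SG P R \<Zsemi> (tsum.in2 (Q \<star> P) (R \<star> P) \<Zsemi> tsum.in2 ([V] \<star> P) ((Q @ R) \<star> P))"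
      using a1[of "tsum.in2 Q R"] Cons.IH(2) by (simp add: LW_Comp)
    then show ?case unfolding i j by simp }
qed

lemma in_LW_append:
  assumes "P \<in> Pl" "P' \<in> Pl" "b \<in> Arr TC" "Dom TC b = A" "Cod TC b = B"
  shows "tsum.in1 (P \<star> A) (P' \<star> A) \<Zsemi> LW (P @ P') b = LW P b \<Zsemi> tsum.in1 (P \<star> B) (P' \<star> B)"
    "tsum.in2 (P \<star> A) (P' \<star> A) \<Zsemi> LW (P @ P') b = LW P' b \<Zsemi> tsum.in2 (P \<star> B) (P' \<star> B)"
  using assms by (simp_all add: LW_append)

text \<open>The recursion of \<open>tsym_prod\<close> is on the right factor; splitting the left one
  takes an induction over \<open>R\<close>, tested on whiskered injections with
  \<open>LW_in_SG_Cons\<close>.\<close>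

lemma in_SG:
  assumes [simp]: "P \<in> Pl" "P' \<in> Pl" and "R \<in> Pl"
  shows "tsum.in1 (P \<star> R) (P' \<star> R) \<Zsemi> SG (P @ P') R = SG P R \<Zsemi> LW R (tsum.in1 P P')"
    "tsum.in2 (P \<star> R) (P' \<star> R) \<Zsemi> SG (P @ P') R = SG P' R \<Zsemi> LW R (tsum.in2 P P')"
  using assms(3)
proof (induction R)
  case Nil
  { case 1 show ?case by (rule tsum.initial_ext) simp_all }
  { case 2 show ?case by (rule tsum.initial_ext) simp_all }
next
  case (Cons W R)
  note [simp] = Cons.hyps
  have w1: "LW P0 f \<Zsemi> (k0 \<Zsemi> SG (P @ P') (W # R)) = k1 \<Zsemi> (LW (P @ P') f \<Zsemi> SG (P @ P') (W # R))"
    if "LW P0 f \<Zsemi> k0 = k1 \<Zsemi> LW (P @ P') f" "P0 \<in> Pl" "f \<in> Arr TC" "k0 \<in> Arr TC" "k1 \<in> Arr TC" "Cod TC f = W # R" "Dom TC k0 = P0 \<star> (W # R)"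
      "Cod TC k0 = (P @ P') \<star> (W # R)" "Cod TC k1 = (P @ P') \<star> Dom TC f"
    for f k0 k1 P0
    using that by (intro tape.Comp_eq_extend) simp_all
  have w2: "LW P0 (tsum.in1 [W] R) \<Zsemi> (SG P0 (W # R) \<Zsemi> LW (W # R) f) = (SG P0 [W] \<Zsemi> LW [W] f) \<Zsemi> tsum.in1 ([W] \<star> (P @ P')) (R \<star> (P @ P'))"
    "LW P0 (tsum.in2 [W] R) \<Zsemi> (SG P0 (W # R) \<Zsemi> LW (W # R) f) = (SG P0 R \<Zsemi> LW R f) \<Zsemi> tsum.in2 ([W] \<star> (P @ P')) (R \<star> (P @ P'))"
    if [simp]: "P0 \<in> Pl" "f \<in> Arr TC" "Dom TC f = P0" "Cod TC f = P @ P'" for f P0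
  proof -
    have "LW P0 (tsum.in1 [W] R) \<Zsemi> (SG P0 (W # R) \<Zsemi> LW (W # R) f) = SG P0 [W] \<Zsemi> (tsum.in1 ([W] \<star> P0) (R \<star> P0) \<Zsemi> LW (W # R) f)"
      by (rule tape.Comp_eq_extend[OF LW_in_SG_Cons(1)]) simp_all
    then show "LW P0 (tsum.in1 [W] R) \<Zsemi> (SG P0 (W # R) \<Zsemi> LW (W # R) f) = (SG P0 [W] \<Zsemi> LW [W] f) \<Zsemi> tsum.in1 ([W] \<star> (P @ P')) (R \<star> (P @ P'))"
      using in_LW_Cons(1)[of W R f P0 "P @ P'"] by simp
    have "LW P0 (tsum.in2 [W] R) \<Zsemi> (SG P0 (W # R) \<Zsemi> LW (W # R) f) = SG P0 R \<Zsemi> (tsum.in2 ([W] \<star> P0) (R \<star> P0) \<Zsemi> LW (W # R) f)"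
      by (rule tape.Comp_eq_extend[OF LW_in_SG_Cons(2)]) simp_all
    then show "LW P0 (tsum.in2 [W] R) \<Zsemi> (SG P0 (W # R) \<Zsemi> LW (W # R) f) = (SG P0 R \<Zsemi> LW R f) \<Zsemi> tsum.in2 ([W] \<star> (P @ P')) (R \<star> (P @ P'))"
      using in_LW_Cons(2)[of W R f P0 "P @ P'"] by simp
  qed
  note c = LW_in_SG_Cons[of "P @ P'" W R]
  note n = in_LW_append[of P P' "tsum.in1 [W] R" "[W]" "W # R", symmetric] in_LW_append[of P P' "tsum.in2 [W] R" R "W # R", symmetric]
  { case 1
    show ?case
    proof (rule LW_ext[of P "[W]" R])
      have "LW P (tsum.in1 [W] R) \<Zsemi> (tsum.in1 (P \<star> (W # R)) (P' \<star> (W # R)) \<Zsemi> SG (P @ P') (W # R)) =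
        tsum.in1 (P \<star> [W]) (P' \<star> [W]) \<Zsemi> (SG (P @ P') [W] \<Zsemi> tsum.in1 ([W] \<star> (P @ P')) (R \<star> (P @ P')))"
        using c(1) n(1) by (subst w1[of P]) simp_all
      also have "\<dots> = (SG P [W] \<Zsemi> LW [W] (tsum.in1 P P')) \<Zsemi> tsum.in1 ([W] \<star> (P @ P')) (R \<star> (P @ P'))"
        by (simp add: SG_append_sing)
      also have "\<dots> = LW P (tsum.in1 [W] R) \<Zsemi> (SG P (W # R) \<Zsemi> LW (W # R) (tsum.in1 P P'))"
        by (rule w2[symmetric]) simp_all
      finally show "LW P (tsum.in1 [W] R) \<Zsemi> (tsum.in1 (P \<star> (W # R)) (P' \<star> (W # R)) \<Zsemi> SG (P @ P') (W # R)) = LW P (tsum.in1 [W] R) \<Zsemi> (SG P (W # R) \<Zsemi> LW (W # R) (tsum.in1 P P'))" .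
      have "LW P (tsum.in2 [W] R) \<Zsemi> (tsum.in1 (P \<star> (W # R)) (P' \<star> (W # R)) \<Zsemi> SG (P @ P') (W # R)) =
        (tsum.in1 (P \<star> R) (P' \<star> R) \<Zsemi> SG (P @ P') R) \<Zsemi> tsum.in2 ([W] \<star> (P @ P')) (R \<star> (P @ P'))"
        using c(2) n(3) by (subst w1[of P]) simp_all
      also have "\<dots> = LW P (tsum.in2 [W] R) \<Zsemi> (SG P (W # R) \<Zsemi> LW (W # R) (tsum.in1 P P'))"
        unfolding Cons.IH by (rule w2[symmetric]) simp_all
      finally show "LW P (tsum.in2 [W] R) \<Zsemi> (tsum.in1 (P \<star> (W # R)) (P' \<star> (W # R)) \<Zsemi> SG (P @ P') (W # R)) = LW P (tsum.in2 [W] R) \<Zsemi> (SG P (W # R) \<Zsemi> LW (W # R) (tsum.in1 P P'))" .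
    qed simp_all }
  { case 2
    show ?case
    proof (rule LW_ext[of P' "[W]" R])
      have "LW P' (tsum.in1 [W] R) \<Zsemi> (tsum.in2 (P \<star> (W # R)) (P' \<star> (W # R)) \<Zsemi> SG (P @ P') (W # R)) =
        tsum.in2 (P \<star> [W]) (P' \<star> [W]) \<Zsemi> (SG (P @ P') [W] \<Zsemi> tsum.in1 ([W] \<star> (P @ P')) (R \<star> (P @ P')))"
        using c(1) n(2) by (subst w1[of P']) simp_all
      also have "\<dots> = (SG P' [W] \<Zsemi> LW [W] (tsum.in2 P P')) \<Zsemi> tsum.in1 ([W] \<star> (P @ P')) (R \<star> (P @ P'))"
        by (simp add: SG_append_sing)
      also have "\<dots> = LW P' (tsum.in1 [W] R) \<Zsemi> (SG P' (W # R) \<Zsemi> LW (W # R) (tsum.in2 P P'))"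
        by (rule w2[symmetric]) simp_all
      finally show "LW P' (tsum.in1 [W] R) \<Zsemi> (tsum.in2 (P \<star> (W # R)) (P' \<star> (W # R)) \<Zsemi> SG (P @ P') (W # R)) = LW P' (tsum.in1 [W] R) \<Zsemi> (SG P' (W # R) \<Zsemi> LW (W # R) (tsum.in2 P P'))" .
      have "LW P' (tsum.in2 [W] R) \<Zsemi> (tsum.in2 (P \<star> (W # R)) (P' \<star> (W # R)) \<Zsemi> SG (P @ P') (W # R)) =
        (tsum.in2 (P \<star> R) (P' \<star> R) \<Zsemi> SG (P @ P') R) \<Zsemi> tsum.in2 ([W] \<star> (P @ P')) (R \<star> (P @ P'))"
        using c(2) n(4) by (subst w1[of P']) simp_all
      also have "\<dots> = LW P' (tsum.in2 [W] R) \<Zsemi> (SG P' (W # R) \<Zsemi> LW (W # R) (tsum.in2 P P'))"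
        unfolding Cons.IH by (rule w2[symmetric]) simp_all
      finally show "LW P' (tsum.in2 [W] R) \<Zsemi> (tsum.in2 (P \<star> (W # R)) (P' \<star> (W # R)) \<Zsemi> SG (P @ P') (W # R)) = LW P' (tsum.in2 [W] R) \<Zsemi> (SG P' (W # R) \<Zsemi> LW (W # R) (tsum.in2 P P'))" .
    qed simp_all }
qed

lemma SG_replicate: "U \<in> Wd \<Longrightarrow> V \<in> Wd \<Longrightarrow> SG [U] (replicate n V) = LW (replicate n []) (SG [U] [V])"
proof (induction n)
  case (Suc n)
  then show ?case using SG_Cons[of "[U]" V "replicate n V"] LW_Cons[of "[]" "replicate n []" "SG [U] [V]"] by simp
qed simp

text \<open>For circuits this is the naturality axiom. For an operation it is
  \<open>OP_natural\<close> at the symmetry of two monomials, because the symmetry at several copies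
  of \<open>V\<close> is the sum of as many symmetries (\<open>SG_replicate\<close>).\<close>

lemma SG_nat_sing:
  assumes [simp]: "U \<in> Wd" and b: "b \<in> Arr TC"
  shows "LW [U] b \<Zsemi> SG [U] (Cod TC b) = SG [U] (Dom TC b) \<Zsemi> RW [U] b"
proof -
  obtain t where t: "wt t" "b = cl t" using b by (rule tape.ArrE)
  show ?thesis unfolding t(2) using t(1)
  proof (induction rule: tape_copair_induct)
    case (circ d)
    then have "CSeq (CPar (cid U) d) (csym U (ccod \<Gamma> d)) \<approx>\<^sub>c CSeq (csym U (cdom \<Gamma> d)) (CPar d (cid U))"
      using circ_eq.sym_natural[of \<Gamma> "cid U" d] by simp
    from cl_TCirc_cong[OF this] show ?case using circ by (simp add: SG_sing_sing LW_sing_cl RW_sing_cl wt_circ_words)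
  next
    case (op g V)
    have "SG [U] [V] \<Zsemi> OP g ([V] \<star> [U]) = OP g ([U] \<star> [V]) \<Zsemi> LW (opN g) (SG [U] [V])"
      using op OP_natural[of g "SG [U] [V]"] by simp
    then show ?case using op LW_sing_cl[of U "TOp g V"] RW_OP[of g "[V]" "[U]"] by (simp add: SG_replicate OP_sing[symmetric])
  next
    case (Comp a b)
    have "LW [U] (a \<Zsemi> b) \<Zsemi> SG [U] (Cod TC b) = LW [U] a \<Zsemi> (LW [U] b \<Zsemi> SG [U] (Cod TC b))" using Comp by (simp add: LW_Comp)
    also have "\<dots> = (LW [U] a \<Zsemi> SG [U] (Dom TC b)) \<Zsemi> RW [U] b" using Comp(2-) by simp
    also have "\<dots> = SG [U] (Dom TC a) \<Zsemi> RW [U] (a \<Zsemi> b)" using Comp(1,3-) by (simp add: RW_Comp)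
    finally show ?case using Comp by simp
  next
    case (in1 P R)
    then show ?case using LW_in_SG(1)[of "[U]" R P] by (simp add: RW_in)
  next
    case (in2 P R)
    then show ?case using LW_in_SG(2)[of "[U]" R P] by (simp add: RW_in)
  next
    case (copair P R a)
    note [simp] = copair(3-)
    have e1: "LW [U] (tsum.in1 P R) \<Zsemi> (SG [U] (P @ R) \<Zsemi> RW [U] a) = SG [U] P \<Zsemi> (tsum.in1 (P \<star> [U]) (R \<star> [U]) \<Zsemi> RW [U] a)"
      by (rule tape.Comp_eq_extend[OF LW_in_SG(1)]) simp_all
    have e2: "LW [U] (tsum.in2 P R) \<Zsemi> (SG [U] (P @ R) \<Zsemi> RW [U] a) = SG [U] R \<Zsemi> (tsum.in2 (P \<star> [U]) (R \<star> [U]) \<Zsemi> RW [U] a)"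
      by (rule tape.Comp_eq_extend[OF LW_in_SG(2)]) simp_all
    show ?case
    proof (rule LW_ext[of "[U]" P R])
      show "LW [U] (tsum.in1 P R) \<Zsemi> (LW [U] a \<Zsemi> SG [U] (Cod TC a)) = LW [U] (tsum.in1 P R) \<Zsemi> (SG [U] (Dom TC a) \<Zsemi> RW [U] a)"
        using copair(1) e1 by (simp add: LW_LW_in RW_Comp RW_in del: LW_sing_in)
      show "LW [U] (tsum.in2 P R) \<Zsemi> (LW [U] a \<Zsemi> SG [U] (Cod TC a)) = LW [U] (tsum.in2 P R) \<Zsemi> (SG [U] (Dom TC a) \<Zsemi> RW [U] a)"
        using copair(2) e2 by (simp add: LW_LW_in RW_Comp RW_in del: LW_sing_in)
    qed simp_all
  next
    case (initial a)
    then show ?case by (intro tsum.initial_ext) simp_all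
  qed
qed

text \<open>Extends the left factor from a monomial to \<open>P\<close> by testing on injections,
  where \<open>in_SG\<close> and \<open>LW_in_RW_Cons\<close> hand over between the two
  whiskerings.\<close>

lemma SG_nat_right:
  assumes "P \<in> Pl" and b [simp]: "b \<in> Arr TC" and D: "Dom TC b = R" "Cod TC b = S"
  shows "LW P b \<Zsemi> SG P S = SG P R \<Zsemi> RW P b"
  unfolding D[symmetric] using assms(1)
proof (induction P)
  case Nil
  then show ?case by (intro tsum.initial_ext) simp_all
next
  case (Cons U P)
  note [simp] = Cons.hyps
  let ?R = "Dom TC b" let ?S = "Cod TC b"
  show ?case
  proof (rule tsum.coprod_ext[of "[U] \<star> ?R" "P \<star> ?R"])
    have "tsum.in1 ([U] \<star> ?R) (P \<star> ?R) \<Zsemi> (LW (U # P) b \<Zsemi> SG (U # P) ?S) = LW [U] b \<Zsemi> (tsum.in1 ([U] \<star> ?S) (P \<star> ?S) \<Zsemi> SG (U # P) ?S)"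
      by (rule tape.Comp_eq_extend[OF in_LW_Cons(1)]) simp_all
    also have "\<dots> = (LW [U] b \<Zsemi> SG [U] ?S) \<Zsemi> LW ?S (tsum.in1 [U] P)"
      using in_SG(1)[of "[U]" P ?S] by simp
    also have "\<dots> = SG [U] ?R \<Zsemi> (RW [U] b \<Zsemi> LW ?S (tsum.in1 [U] P))"
      unfolding SG_nat_sing[OF Cons.hyps(1) b] by simp
    also have "\<dots> = SG [U] ?R \<Zsemi> (LW ?R (tsum.in1 [U] P) \<Zsemi> RW (U # P) b)"
      using LW_in_RW_Cons(1)[of U P b] by simp
    also have "\<dots> = tsum.in1 ([U] \<star> ?R) (P \<star> ?R) \<Zsemi> (SG (U # P) ?R \<Zsemi> RW (U # P) b)"
      using in_SG(1)[of "[U]" P ?R, symmetric] by (intro tape.Comp_eq_extend) simp_all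
    finally show "tsum.in1 ([U] \<star> ?R) (P \<star> ?R) \<Zsemi> (LW (U # P) b \<Zsemi> SG (U # P) ?S) = tsum.in1 ([U] \<star> ?R) (P \<star> ?R) \<Zsemi> (SG (U # P) ?R \<Zsemi> RW (U # P) b)" .
    have "tsum.in2 ([U] \<star> ?R) (P \<star> ?R) \<Zsemi> (LW (U # P) b \<Zsemi> SG (U # P) ?S) = LW P b \<Zsemi> (tsum.in2 ([U] \<star> ?S) (P \<star> ?S) \<Zsemi> SG (U # P) ?S)"
      by (rule tape.Comp_eq_extend[OF in_LW_Cons(2)]) simp_all
    also have "\<dots> = (LW P b \<Zsemi> SG P ?S) \<Zsemi> LW ?S (tsum.in2 [U] P)"
      using in_SG(2)[of "[U]" P ?S] by simp
    also have "\<dots> = SG P ?R \<Zsemi> (RW P b \<Zsemi> LW ?S (tsum.in2 [U] P))"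
      unfolding Cons.IH by simp
    also have "\<dots> = SG P ?R \<Zsemi> (LW ?R (tsum.in2 [U] P) \<Zsemi> RW (U # P) b)"
      using LW_in_RW_Cons(2)[of U P b] by simp
    also have "\<dots> = tsum.in2 ([U] \<star> ?R) (P \<star> ?R) \<Zsemi> (SG (U # P) ?R \<Zsemi> RW (U # P) b)"
      using in_SG(2)[of "[U]" P ?R, symmetric] by (intro tape.Comp_eq_extend) simp_all
    finally show "tsum.in2 ([U] \<star> ?R) (P \<star> ?R) \<Zsemi> (LW (U # P) b \<Zsemi> SG (U # P) ?S) = tsum.in2 ([U] \<star> ?R) (P \<star> ?R) \<Zsemi> (SG (U # P) ?R \<Zsemi> RW (U # P) b)" .
  qed simp_all
qed

lemma SG_SG_sing:
  assumes [simp]: "V \<in> Wd" and "P \<in> Pl"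
  shows "SG P [V] \<Zsemi> SG [V] P = \<iota> (P \<star> [V])"
  using assms(2)
proof (induction P)
  case (Cons U P)
  note [simp] = Cons.hyps
  have 0: "SG [U] [V] \<Zsemi> SG [V] [U] = \<iota> ([U] \<star> [V])"
    using cl_TCirc_cong[OF csym_csym[of U V]] by (simp add: SG_sing_sing)
  show ?case
  proof (rule tsum.coprod_ext[of "[U] \<star> [V]" "P \<star> [V]"])
    have "tsum.in1 ([U] \<star> [V]) (P \<star> [V]) \<Zsemi> (SG (U # P) [V] \<Zsemi> SG [V] (U # P)) = SG [U] [V] \<Zsemi> (LW [V] (tsum.in1 [U] P) \<Zsemi> SG [V] (U # P))"
      using in_SG(1)[of "[U]" P "[V]"] by (intro tape.Comp_eq_extend) simp_all
    also have "\<dots> = (SG [U] [V] \<Zsemi> SG [V] [U]) \<Zsemi> tsum.in1 ([U] \<star> [V]) (P \<star> [V])"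
      unfolding LW_in_SG_Cons[OF Cons_in_lists_iff[THEN iffD2, OF conjI[OF assms(1) lists.Nil]] Cons.hyps] by simp
    finally show "tsum.in1 ([U] \<star> [V]) (P \<star> [V]) \<Zsemi> (SG (U # P) [V] \<Zsemi> SG [V] (U # P)) = tsum.in1 ([U] \<star> [V]) (P \<star> [V]) \<Zsemi> \<iota> ((U # P) \<star> [V])"
      unfolding 0 by simp
    have "tsum.in2 ([U] \<star> [V]) (P \<star> [V]) \<Zsemi> (SG (U # P) [V] \<Zsemi> SG [V] (U # P)) = SG P [V] \<Zsemi> (LW [V] (tsum.in2 [U] P) \<Zsemi> SG [V] (U # P))"
      using in_SG(2)[of "[U]" P "[V]"] by (intro tape.Comp_eq_extend) simp_all
    also have "\<dots> = (SG P [V] \<Zsemi> SG [V] P) \<Zsemi> tsum.in2 ([U] \<star> [V]) (P \<star> [V])"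
      unfolding LW_in_SG_Cons[OF Cons_in_lists_iff[THEN iffD2, OF conjI[OF assms(1) lists.Nil]] Cons.hyps] by simp
    finally show "tsum.in2 ([U] \<star> [V]) (P \<star> [V]) \<Zsemi> (SG (U # P) [V] \<Zsemi> SG [V] (U # P)) = tsum.in2 ([U] \<star> [V]) (P \<star> [V]) \<Zsemi> \<iota> ((U # P) \<star> [V])"
      unfolding Cons.IH by simp
  qed simp_all
qed simp

lemma SG_SG:
  assumes [simp]: "P \<in> Pl" and "Q \<in> Pl"
  shows "SG P Q \<Zsemi> SG Q P = \<iota> (P \<star> Q)"
  using assms(2)
proof (induction Q)
  case (Cons V Q)
  note [simp] = Cons.hyps
  show ?case
  proof (rule LW_ext[of P "[V]" Q])
    have "LW P (tsum.in1 [V] Q) \<Zsemi> (SG P (V # Q) \<Zsemi> SG (V # Q) P) = SG P [V] \<Zsemi> (tsum.in1 ([V] \<star> P) (Q \<star> P) \<Zsemi> SG (V # Q) P)"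
      by (rule tape.Comp_eq_extend[OF LW_in_SG_Cons(1)]) simp_all
    also have "\<dots> = (SG P [V] \<Zsemi> SG [V] P) \<Zsemi> LW P (tsum.in1 [V] Q)"
      using in_SG(1)[of "[V]" Q P] by simp
    finally show "LW P (tsum.in1 [V] Q) \<Zsemi> (SG P (V # Q) \<Zsemi> SG (V # Q) P) = LW P (tsum.in1 [V] Q) \<Zsemi> \<iota> (P \<star> (V # Q))"
      unfolding SG_SG_sing[OF Cons.hyps(1) assms(1)] by simp
    have "LW P (tsum.in2 [V] Q) \<Zsemi> (SG P (V # Q) \<Zsemi> SG (V # Q) P) = SG P Q \<Zsemi> (tsum.in2 ([V] \<star> P) (Q \<star> P) \<Zsemi> SG (V # Q) P)"
      by (rule tape.Comp_eq_extend[OF LW_in_SG_Cons(2)]) simp_all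
    also have "\<dots> = (SG P Q \<Zsemi> SG Q P) \<Zsemi> LW P (tsum.in2 [V] Q)"
      using in_SG(2)[of "[V]" Q P] by simp
    finally show "LW P (tsum.in2 [V] Q) \<Zsemi> (SG P (V # Q) \<Zsemi> SG (V # Q) P) = LW P (tsum.in2 [V] Q) \<Zsemi> \<iota> (P \<star> (V # Q))"
      unfolding Cons.IH by simp
  qed simp_all
qed simp

text \<open>Right naturality conjugated by the involution \<open>SG_SG\<close>.\<close>

lemma SG_nat_left:
  assumes [simp]: "R \<in> Pl" "a \<in> Arr TC" and D [simp]: "Dom TC a = P" "Cod TC a = P'"
  shows "RW R a \<Zsemi> SG P' R = SG P R \<Zsemi> LW R a"
proof -
  have [simp]: "P \<in> Pl" "P' \<in> Pl" using D Dom_Pl Cod_Pl assms(2) by blast+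
  have "SG P R \<Zsemi> LW R a = (SG P R \<Zsemi> LW R a) \<Zsemi> (SG R P' \<Zsemi> SG P' R)"
    by (simp only: SG_SG \<open>P' \<in> Pl\<close> assms(1)) simp
  also have "\<dots> = SG P R \<Zsemi> ((LW R a \<Zsemi> SG R P') \<Zsemi> SG P' R)"
    by simp
  also have "LW R a \<Zsemi> SG R P' = SG R P \<Zsemi> RW R a"
    by (rule SG_nat_right) simp_all
  also have "SG P R \<Zsemi> ((SG R P \<Zsemi> RW R a) \<Zsemi> SG P' R) = (SG P R \<Zsemi> SG R P) \<Zsemi> (RW R a \<Zsemi> SG P' R)"
    by simp
  also have "\<dots> = RW R a \<Zsemi> SG P' R" unfolding SG_SG[OF \<open>P \<in> Pl\<close> assms(1)] by simp
  finally show ?thesis by simp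
qed

text \<open>The hexagon for the product, in whiskered form. The next three lemmas transport it along
  an arrow \<open>x\<close> into one of its arguments; taken at injections they reduce it to
  monomials, where it is the hexagon of circuits.\<close>

definition hexagonal :: "'s list list \<Rightarrow> 's list list \<Rightarrow> 's list list \<Rightarrow> bool" where
  "hexagonal P Q R \<longleftrightarrow> SG P (Q \<star> R) = RW R (SG P Q) \<Zsemi> LW Q (SG P R)"

lemma hexagonal_right:
  assumes [simp]: "P \<in> Pl" "Q \<in> Pl" "x \<in> Arr TC" and D [simp]: "Dom TC x = R'" "Cod TC x = R" and "hexagonal P Q R'"
  shows "LW P (LW Q x) \<Zsemi> SG P (Q \<star> R) = LW P (LW Q x) \<Zsemi> (RW R (SG P Q) \<Zsemi> LW Q (SG P R))"
proof -
  have [simp]: "R \<in> Pl" "R' \<in> Pl" using D Dom_Pl Cod_Pl assms(3) by blast+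
  have "LW P (LW Q x) \<Zsemi> SG P (Q \<star> R) = SG P (Q \<star> R') \<Zsemi> RW P (LW Q x)"
    by (rule SG_nat_right) simp_all
  also have "\<dots> = RW R' (SG P Q) \<Zsemi> LW Q (SG P R' \<Zsemi> RW P x)"
    using assms(6) unfolding hexagonal_def by (simp add: LW_Comp RW_LW)
  also have "SG P R' \<Zsemi> RW P x = LW P x \<Zsemi> SG P R"
    by (rule SG_nat_right[symmetric]) simp_all
  also have "RW R' (SG P Q) \<Zsemi> LW Q (LW P x \<Zsemi> SG P R) = (RW R' (SG P Q) \<Zsemi> LW (Q \<star> P) x) \<Zsemi> LW Q (SG P R)"
    by (simp add: LW_Comp LW_LW)
  also have "RW R' (SG P Q) \<Zsemi> LW (Q \<star> P) x = LW (P \<star> Q) x \<Zsemi> RW R (SG P Q)"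
    by (rule slide[symmetric]) simp_all
  finally show ?thesis by (simp add: LW_LW)
qed

lemma hexagonal_mid:
  assumes [simp]: "P \<in> Pl" "R \<in> Pl" "x \<in> Arr TC" and D [simp]: "Dom TC x = Q'" "Cod TC x = Q" and "hexagonal P Q' R"
  shows "LW P (RW R x) \<Zsemi> SG P (Q \<star> R) = LW P (RW R x) \<Zsemi> (RW R (SG P Q) \<Zsemi> LW Q (SG P R))"
proof -
  have [simp]: "Q \<in> Pl" "Q' \<in> Pl" using D Dom_Pl Cod_Pl assms(3) by blast+
  have "LW P (RW R x) \<Zsemi> SG P (Q \<star> R) = SG P (Q' \<star> R) \<Zsemi> RW P (RW R x)"
    by (rule SG_nat_right) simp_all
  also have "\<dots> = RW R (SG P Q') \<Zsemi> (LW Q' (SG P R) \<Zsemi> RW (R \<star> P) x)"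
    using assms(6) unfolding hexagonal_def by (simp add: RW_RW)
  also have "LW Q' (SG P R) \<Zsemi> RW (R \<star> P) x = RW (P \<star> R) x \<Zsemi> LW Q (SG P R)"
    by (rule slide) simp_all
  also have "RW R (SG P Q') \<Zsemi> (RW (P \<star> R) x \<Zsemi> LW Q (SG P R)) = RW R (SG P Q' \<Zsemi> RW P x) \<Zsemi> LW Q (SG P R)"
    by (simp add: RW_Comp RW_RW)
  also have "SG P Q' \<Zsemi> RW P x = LW P x \<Zsemi> SG P Q"
    by (rule SG_nat_right[symmetric]) simp_all
  finally show ?thesis by (simp add: RW_Comp RW_LW)
qed

lemma hexagonal_left:
  assumes [simp]: "Q \<in> Pl" "R \<in> Pl" "x \<in> Arr TC" and D [simp]: "Dom TC x = P'" "Cod TC x = P" and "hexagonal P' Q R"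
  shows "RW (Q \<star> R) x \<Zsemi> SG P (Q \<star> R) = RW (Q \<star> R) x \<Zsemi> (RW R (SG P Q) \<Zsemi> LW Q (SG P R))"
proof -
  have [simp]: "P \<in> Pl" "P' \<in> Pl" using D Dom_Pl Cod_Pl assms(3) by blast+
  have "RW (Q \<star> R) x \<Zsemi> SG P (Q \<star> R) = SG P' (Q \<star> R) \<Zsemi> LW (Q \<star> R) x"
    by (rule SG_nat_left) simp_all
  also have "\<dots> = RW R (SG P' Q) \<Zsemi> LW Q (SG P' R \<Zsemi> LW R x)"
    using assms(6) unfolding hexagonal_def by (simp add: LW_LW LW_Comp)
  also have "SG P' R \<Zsemi> LW R x = RW R x \<Zsemi> SG P R"
    by (rule SG_nat_left[symmetric]) simp_all
  also have "RW R (SG P' Q) \<Zsemi> LW Q (RW R x \<Zsemi> SG P R) = RW R (SG P' Q \<Zsemi> LW Q x) \<Zsemi> LW Q (SG P R)"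
    by (simp add: RW_Comp LW_Comp RW_LW)
  also have "SG P' Q \<Zsemi> LW Q x = RW Q x \<Zsemi> SG P Q"
    by (rule SG_nat_left[symmetric]) simp_all
  finally show ?thesis by (simp add: RW_Comp RW_RW)
qed

lemma hexagonal_all:
  assumes [simp]: "P \<in> Pl" "Q \<in> Pl" "R \<in> Pl"
  shows "hexagonal P Q R"
proof -
  have 1: "hexagonal [U] [V] [W]" if [simp]: "U \<in> Wd" "V \<in> Wd" "W \<in> Wd" for U V W
    using cl_TCirc_cong[OF csym_append[of U V W]] by (simp add: hexagonal_def SG_sing_sing LW_sing_cl RW_sing_cl)
  have 2: "hexagonal P [V] [W]" if [simp]: "V \<in> Wd" "W \<in> Wd" for V W
    using assms(1)
  proof (induction P)
    case Nil
    then show ?case unfolding hexagonal_def by (intro tsum.initial_ext) simp_all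
  next
    case (Cons U P)
    note [simp] = Cons.hyps
    have r: "RW ([V] \<star> [W]) (tsum.in1 [U] P) = tsum.in1 ([U] \<star> [V] \<star> [W]) (P \<star> [V] \<star> [W])"
      "RW ([V] \<star> [W]) (tsum.in2 [U] P) = tsum.in2 ([U] \<star> [V] \<star> [W]) (P \<star> [V] \<star> [W])"
      by (rule RW_in; simp)+
    have "RW ([V] \<star> [W]) (tsum.in1 [U] P) \<Zsemi> SG (U # P) ([V] \<star> [W]) = RW ([V] \<star> [W]) (tsum.in1 [U] P) \<Zsemi> (RW [W] (SG (U # P) [V]) \<Zsemi> LW [V] (SG (U # P) [W]))"
      by (rule hexagonal_left[of _ _ _ "[U]"]) (simp_all add: 1)
    moreover have "RW ([V] \<star> [W]) (tsum.in2 [U] P) \<Zsemi> SG (U # P) ([V] \<star> [W]) = RW ([V] \<star> [W]) (tsum.in2 [U] P) \<Zsemi> (RW [W] (SG (U # P) [V]) \<Zsemi> LW [V] (SG (U # P) [W]))"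
      by (rule hexagonal_left[of _ _ _ P]) (simp_all add: Cons.IH)
    ultimately show ?case unfolding hexagonal_def r by (rule tsum.coprod_ext) (simp_all add: poly_prod_map)
  qed
  have 3: "hexagonal P Q [W]" if [simp]: "W \<in> Wd" for W
    using assms(2)
  proof (induction Q)
    case Nil
    then show ?case unfolding hexagonal_def by (intro tsum.initial_ext) simp_all
  next
    case (Cons V Q)
    note [simp] = Cons.hyps
    have r: "RW [W] (tsum.in1 [V] Q) = tsum.in1 ([V] \<star> [W]) (Q \<star> [W])" "RW [W] (tsum.in2 [V] Q) = tsum.in2 ([V] \<star> [W]) (Q \<star> [W])"
      by (rule RW_in; simp)+
    have "LW P (RW [W] (tsum.in1 [V] Q)) \<Zsemi> SG P ((V # Q) \<star> [W]) = LW P (RW [W] (tsum.in1 [V] Q)) \<Zsemi> (RW [W] (SG P (V # Q)) \<Zsemi> LW (V # Q) (SG P [W]))"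
      by (rule hexagonal_mid[of _ _ _ "[V]"]) (simp_all add: 2)
    moreover have "LW P (RW [W] (tsum.in2 [V] Q)) \<Zsemi> SG P ((V # Q) \<star> [W]) = LW P (RW [W] (tsum.in2 [V] Q)) \<Zsemi> (RW [W] (SG P (V # Q)) \<Zsemi> LW (V # Q) (SG P [W]))"
      by (rule hexagonal_mid[of _ _ _ Q]) (simp_all add: Cons.IH)
    ultimately show ?case unfolding hexagonal_def r by (rule LW_ext) (simp_all add: poly_prod_map)
  qed
  show ?thesis using assms(3)
  proof (induction R)
    case Nil
    then show ?case unfolding hexagonal_def by (intro tsum.initial_ext) simp_all
  next
    case (Cons W R)
    note [simp] = Cons.hyps
    have r: "LW (P \<star> Q) (tsum.in1 [W] R) = LW P (LW Q (tsum.in1 [W] R))" "LW (P \<star> Q) (tsum.in2 [W] R) = LW P (LW Q (tsum.in2 [W] R))"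
      by (rule LW_LW; simp)+
    show ?case unfolding hexagonal_def
    proof (rule LW_ext[of "P \<star> Q" "[W]" R])
      show "LW (P \<star> Q) (tsum.in1 [W] R) \<Zsemi> SG P (Q \<star> (W # R)) = LW (P \<star> Q) (tsum.in1 [W] R) \<Zsemi> (RW (W # R) (SG P Q) \<Zsemi> LW Q (SG P (W # R)))"
        unfolding r by (rule hexagonal_right[of _ _ _ "[W]"]) (simp_all add: 3)
      show "LW (P \<star> Q) (tsum.in2 [W] R) \<Zsemi> SG P (Q \<star> (W # R)) = LW (P \<star> Q) (tsum.in2 [W] R) \<Zsemi> (RW (W # R) (SG P Q) \<Zsemi> LW Q (SG P (W # R)))"
        unfolding r by (rule hexagonal_right[of _ _ _ R]) (simp_all add: Cons.IH)
    qed simp_all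
  qed
qed

section \<open>The rig category of tapes\<close>

abbreviation TP :: "('s list list, ('s, 'g, 'f) tape set) tensor" where "TP \<equiv> tape_prod T \<Gamma>"

lemma TP_simps [simp]: "tob TP = poly_prod" "tunit TP = [[]]" "symm TP P Q = SG P Q" "assoc TP P Q R = \<iota> (P \<star> Q \<star> R)"
  "lunit TP P = \<iota> P" "runit TP P = \<iota> P"
  using cl_tid by (simp_all add: tape_prod_def SG_def)

lemma tar_TP: "a \<in> Arr TC \<Longrightarrow> b \<in> Arr TC \<Longrightarrow> tar TP a b = LW (Dom TC a) b \<Zsemi> RW (Cod TC b) a"
  by (simp add: tape_prod_def tprod_def LW_def RW_def)

text \<open>Interchange for \<open>tprod\<close> is exactly the slide law; associativity combines
  \<open>LW_LW\<close>, \<open>RW_RW\<close> and \<open>RW_LW\<close>.\<close>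

lemma strict_monoidal_prod: "strict_monoidal TC TP"
proof unfold_locales
  fix f f' g g' X X' X'' Y Y' Y''
  assume "f \<in> Hom TC X X'" "f' \<in> Hom TC X' X''" "g \<in> Hom TC Y Y'" "g' \<in> Hom TC Y' Y''"
  note [simp] = HomD[OF this(1)] HomD[OF this(2)] HomD[OF this(3)] HomD[OF this(4)]
  have [simp]: "X \<in> Pl" "X' \<in> Pl" "Y' \<in> Pl" "Y'' \<in> Pl"
    using Dom_Pl[of f] Dom_Pl[of f'] Cod_Pl[of g] Cod_Pl[of g'] by simp_all
  have "tar TP (f \<Zsemi> f') (g \<Zsemi> g') = LW X g \<Zsemi> ((LW X g' \<Zsemi> RW Y'' f) \<Zsemi> RW Y'' f')"
    by (simp add: tar_TP LW_Comp RW_Comp)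
  also have "LW X g' \<Zsemi> RW Y'' f = RW Y' f \<Zsemi> LW X' g'"
    by (rule slide) simp_all
  also have "LW X g \<Zsemi> ((RW Y' f \<Zsemi> LW X' g') \<Zsemi> RW Y'' f') = tar TP f g \<Zsemi> tar TP f' g'"
    by (simp add: tar_TP)
  finally show "tar TP (f \<Zsemi> f') (g \<Zsemi> g') = tar TP f g \<Zsemi> tar TP f' g'" .
next
  fix f g h assume [simp]: "f \<in> Arr TC" "g \<in> Arr TC" "h \<in> Arr TC"
  show "tar TP (tar TP f g) h = tar TP f (tar TP g h)"
    by (simp add: tar_TP LW_Comp RW_Comp LW_LW RW_RW RW_LW)
qed (auto simp: tar_TP Hom_def)

sublocale tprod: strict_smc TC TP
proof -
  interpret strict_monoidal TC TP by (rule strict_monoidal_prod)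
  have *: "tar TP f g \<Zsemi> symm TP (Cod TC f) (Cod TC g) = symm TP (Dom TC f) (Dom TC g) \<Zsemi> tar TP g f"
    if [simp]: "f \<in> Arr TC" "g \<in> Arr TC" for f g
  proof -
    let ?P = "Dom TC f" let ?P' = "Cod TC f" let ?Q = "Dom TC g" let ?Q' = "Cod TC g"
    have "tar TP f g \<Zsemi> symm TP ?P' ?Q' = LW ?P g \<Zsemi> (RW ?Q' f \<Zsemi> SG ?P' ?Q')" by (simp add: tar_TP)
    also have "RW ?Q' f \<Zsemi> SG ?P' ?Q' = SG ?P ?Q' \<Zsemi> LW ?Q' f" by (rule SG_nat_left) simp_all
    also have "LW ?P g \<Zsemi> (SG ?P ?Q' \<Zsemi> LW ?Q' f) = (LW ?P g \<Zsemi> SG ?P ?Q') \<Zsemi> LW ?Q' f" by simp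
    also have "LW ?P g \<Zsemi> SG ?P ?Q' = SG ?P ?Q \<Zsemi> RW ?P g" by (rule SG_nat_right) simp_all
    also have "(SG ?P ?Q \<Zsemi> RW ?P g) \<Zsemi> LW ?Q' f = SG ?P ?Q \<Zsemi> (RW ?P g \<Zsemi> LW ?Q' f)" by simp
    also have "RW ?P g \<Zsemi> LW ?Q' f = LW ?Q f \<Zsemi> RW ?P' g" by (rule slide[symmetric]) simp_all
    finally show ?thesis by (simp add: tar_TP)
  qed
  have h: "symm TP P (tob TP Q R) = tar TP (symm TP P Q) (\<iota> R) \<Zsemi> tar TP (\<iota> Q) (symm TP P R)"
    if "P \<in> Obj TC" "Q \<in> Obj TC" "R \<in> Obj TC" for P Q R
    using that hexagonal_all[of P Q R] by (simp add: hexagonal_def tar_TP)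
  note s = symmetric_monoidalI[OF _ _ _ _ * _ h]
  show "strict_smc TC TP"
    by (intro strict_smc.intro strict_smc_axioms.intro s) (simp_all add: SG_SG Hom_def)
qed

abbreviation TR :: "('s list list, ('s, 'g, 'f) tape set, 'f) theory_rig" where "TR \<equiv> tape_rig T \<Gamma>"

lemma TR_simps [simp]: "rcat TR = TC" "rsum TR = TS" "rprod TR = TP" "distl TR = DL"
  "distr TR P Q R = \<iota> ((P @ Q) \<star> R)" "annl TR P = \<iota> []" "annr TR P = \<iota> []" "rnabla TR = tN" "rcobang TR = tB" "incl TR = tape_incl T \<Gamma>"
  using cl_tid[of "[]"] by (auto simp: tape_rig_def fun_eq_iff)

text \<open>\<open>RW_in\<close> supplies the behaviour of right whiskering on injections and
  \<open>LW_in_DL\<close> that of the left distributor; all of Laplaza's conditions follow.\<close>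

sublocale trig: dist_rig TR DLI
  rewrites "rcat TR = TC" and "rsum TR = TS" and "rprod TR = TP" and "rnabla TR = tN" and "rcobang TR = tB"
proof -
  show "dist_rig TR DLI"
  proof (intro dist_rig.intro)
    show "strict_cocart (rcat TR) (rsum TR) (rnabla TR) (rcobang TR)" using tsum.strict_cocart_axioms by simp
    show "strict_smc (rcat TR) (rprod TR)" using tprod.strict_smc_axioms by simp
    show "dist_rig_axioms TR DLI"
      by unfold_locales (simp_all add: tar_TP Hom_def DL_DLI LW_in_DL RW_in)
  qed
qed simp_all

lemma tape_right_strict: "right_strict_rig TR"
  unfolding right_strict_rig_def
  using trig.is_rig_category tape.is_strict tprod.strict by (simp add: tape.is_identity_Id)

lemma tape_fc_rig: "fc_rig_category TR"
  unfolding fc_rig_category_def using trig.is_rig_category tsum.is_fc_category by simp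

lemma tape_sesquistrict: "sesquistrict_rig_category (tape_sesqui T \<Gamma>)"
  unfolding sesquistrict_rig_category_def using tape_right_strict
  by (simp add: tape_sesqui_def tape.is_identity_Id)

end

section \<open>Terms\<close>

context strict_cocart
begin

lemma ncopair_append:
  assumes "set fs \<subseteq> Hom C X Z" "set gs \<subseteq> Hom C X Z" and [simp]: "X \<in> Obj C" "Z \<in> Obj C"
  shows "ncopair Z (fs @ gs) = (ncopair Z fs \<odot>\<^sub>a ncopair Z gs) \<Zsemi> nab Z"
  using assms(1)
proof (induction fs)
  case Nil
  have [simp]: "ncopair Z gs \<in> Arr C" "Dom C (ncopair Z gs) = npow X (length gs)" "Cod C (ncopair Z gs) = Z"
    using ncopair_props[OF assms(2-4)] by auto
  have "cob Z \<odot>\<^sub>a ncopair Z gs = ncopair Z gs \<Zsemi> in2 Z Z"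
    using in_tar(2)[of "cob Z" "ncopair Z gs" I "npow X (length gs)"] by simp
  then show ?case by simp
next
  case (Cons f fs)
  have [simp]: "ncopair Z gs \<in> Arr C" "Dom C (ncopair Z gs) = npow X (length gs)" "Cod C (ncopair Z gs) = Z"
    using ncopair_props[OF assms(2-4)] by auto
  from Cons.prems have [simp]: "ncopair Z fs \<in> Arr C" "Dom C (ncopair Z fs) = npow X (length fs)" "Cod C (ncopair Z fs) = Z"
    using ncopair_props[of fs X Z] by auto
  from Cons.prems have [simp]: "f \<in> Arr C" "Cod C f = Z" by (auto simp: Hom_def)
  interpret fc: fc_category C M nab cob by (rule is_fc_category)
  have a: "(nab Z \<odot>\<^sub>a \<iota> Z) \<Zsemi> nab Z = (\<iota> Z \<odot>\<^sub>a nab Z) \<Zsemi> nab Z"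
    using fc.nabla_assoc[of Z] by simp
  have "ncopair Z ((f # fs) @ gs) = (f \<odot>\<^sub>a ((ncopair Z fs \<odot>\<^sub>a ncopair Z gs) \<Zsemi> nab Z)) \<Zsemi> nab Z"
    using Cons by simp
  also have "\<dots> = (f \<odot>\<^sub>a ncopair Z fs \<odot>\<^sub>a ncopair Z gs) \<Zsemi> ((\<iota> Z \<odot>\<^sub>a nab Z) \<Zsemi> nab Z)"
    by simp
  also have "\<dots> = ((f \<odot>\<^sub>a ncopair Z fs) \<odot>\<^sub>a ncopair Z gs) \<Zsemi> ((nab Z \<odot>\<^sub>a \<iota> Z) \<Zsemi> nab Z)"
    unfolding a by simp
  also have "\<dots> = (((f \<odot>\<^sub>a ncopair Z fs) \<Zsemi> nab Z) \<odot>\<^sub>a ncopair Z gs) \<Zsemi> nab Z"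
    by (subst tar_fuse_assoc) simp_all
  finally show ?case by simp
qed

text \<open>The right side is the form in which \<open>trm_tape\<close> writes a variable.\<close>

lemma nin_explicit:
  assumes [simp]: "X \<in> Obj C"
  shows "i < n \<Longrightarrow> nin X n i = cob (npow X i) \<odot>\<^sub>a \<iota> X \<odot>\<^sub>a cob (npow X (n - Suc i))"
proof (induction n arbitrary: i)
  case (Suc n)
  show ?case
  proof (cases i)
    case 0
    then show ?thesis by (simp add: in1_def)
  next
    case (Suc j)
    then have j: "j < n" using Suc.prems by simp
    let ?k = "cob (npow X j) \<odot>\<^sub>a \<iota> X \<odot>\<^sub>a cob (npow X (n - Suc j))"
    have r: "npow X n = npow X j \<odot> X \<odot> npow X (n - Suc j)"
      using j npow_add[of X j "Suc (n - Suc j)"] by simp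
    have "cob X \<odot>\<^sub>a ?k = ?k \<Zsemi> in2 X (npow X n)"
      using in_tar(2)[of "cob X" ?k I X] by (simp add: r)
    then show ?thesis using Suc.IH[OF j] Suc by (simp add: cob_tob)
  qed
qed simp

lemma tar_eq_copair:
  assumes "f \<in> Arr C" "g \<in> Arr C"
  shows "((f \<Zsemi> in1 (Cod C f) (Cod C g)) \<odot>\<^sub>a (g \<Zsemi> in2 (Cod C f) (Cod C g))) \<Zsemi> nab (Cod C f \<odot> Cod C g) = f \<odot>\<^sub>a g"
  by (rule coprod_ext[of "Dom C f" "Dom C g"]) (use assms in simp_all)

lemma inj_eq_nin: "X \<in> Obj C \<Longrightarrow> k < n \<Longrightarrow> canonical_fc.inj C M cob X n k = nin X n k"
proof (induction n arbitrary: k)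
  case (Suc n)
  show ?case
  proof (cases k)
    case 0
    then show ?thesis using Suc.prems by (simp add: canonical_fc.inj.simps in1_def)
  next
    case (Suc j)
    then have j: "j < n" using Suc.prems by simp
    have "cob X \<odot>\<^sub>a nin X n j = (\<iota> I \<odot>\<^sub>a nin X n j) \<Zsemi> (cob X \<odot>\<^sub>a \<iota> (npow X n))"
      using Suc.prems j by (simp del: I_tar)
    then show ?thesis using Suc.prems Suc.IH[of j] Suc j by (simp add: canonical_fc.inj.simps in2_def)
  qed
qed simp

lemma nsum_add_eq [simp]: "X \<in> Obj C \<Longrightarrow> canonical_fc.nsum_add C M X m n = \<iota> (npow X (m + n))"
  by (induction m) (simp_all add: canonical_fc.nsum_add.simps npow_add)

lemma copair_eq: "X \<in> Obj C \<Longrightarrow> \<forall>k \<in> set ks. k < n \<Longrightarrow> canonical_fc.copair C M nab cob X n ks = ncopair (npow X n) (map (nin X n) ks)"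
  by (induction ks) (simp_all add: canonical_fc.copair.simps inj_eq_nin)

end

section \<open>Terms, substitution and the Lawvere category\<close>

inductive_cases wf_Fn: "wf_trm T n (Fn f ts)"

lemma wf_subst: "wf_trm T m t \<Longrightarrow> \<forall>i<m. wf_trm T n (s i) \<Longrightarrow> wf_trm T n (subst s t)"
  by (induction rule: wf_trm.induct) (auto intro!: wf_trm.intros)

lemma subst_Var [simp]: "subst Var t = t"
  by (induction t) (auto intro: map_idI)

lemma trm_eq_wf: "trm_eq T n t u \<Longrightarrow> wf_trm T n t \<and> wf_trm T n u"
proof (induction rule: trm_eq.induct)
  case (cong f ts us)
  then have "length us = length ts" "\<forall>t \<in> set ts. wf_trm T n t" "\<forall>t \<in> set us. wf_trm T n t"
    by (auto simp: list_all2_conv_all_nth in_set_conv_nth)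
  with cong show ?case by (auto intro!: wf_trm.intros)
qed (auto intro: wf_subst)

lemma trm_eq_rep: "wf_trm T n t \<Longrightarrow> trm_eq T n t (rep (trm_class T n t))"
  by (simp add: rep_def trm_class_def) (rule someI, rule trm_eq.refl)

lemma wf_rep: "wf_trm T n t \<Longrightarrow> wf_trm T n (rep (trm_class T n t))"
  by (rule trm_eq_wf[OF trm_eq_rep, THEN conjunct2])

lemma wf_op: "f \<in> ops T \<Longrightarrow> wf_trm T (arity T f) (Fn f (map Var [0..<arity T f]))"
  by (auto intro!: wf_trm.intros)

lemma subst_subst: "subst s (subst r t) = subst (\<lambda>i. subst s (r i)) t"
  by (induction t) simp_all

lemma trm_eq_subst: "trm_eq T m t u \<Longrightarrow> \<forall>i<m. wf_trm T n (s i) \<Longrightarrow> trm_eq T n (subst s t) (subst s u)"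
proof (induction rule: trm_eq.induct)
  case (refl t)
  then show ?case by (auto intro: trm_eq.refl wf_subst)
next
  case (sym t u)
  then show ?case by (blast intro: trm_eq.sym)
next
  case (trans t u v)
  then show ?case by (blast intro: trm_eq.trans)
next
  case (cong f ts us)
  have "list_all2 (trm_eq T n) (map (subst s) ts) (map (subst s) us)"
    using cong.IH cong.prems by (simp add: list_all2_conv_all_nth)
  then show ?case using cong.hyps by (simp add: trm_eq.cong)
next
  case (ax t t' k r)
  then have "\<forall>i<k. wf_trm T n (subst s (r i))" by (blast intro: wf_subst)
  then show ?case using ax.hyps by (simp add: subst_subst trm_eq.ax)
qed

definition law_Arr :: "'f alg_theory \<Rightarrow> nat \<Rightarrow> 'f trm set list \<Rightarrow> bool" where
  "law_Arr T n ts \<longleftrightarrow> (\<forall>c \<in> set ts. \<exists>t. wf_trm T n t \<and> c = trm_class T n t)"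

text \<open>In the opposite category the number of variables is the codomain and the length of the
  tuple is the domain.\<close>

lemma law_Hom: "f \<in> Hom (op_cat (lawvere T)) X Y \<longleftrightarrow> (\<exists>ts. f = (Y, ts) \<and> law_Arr T Y ts \<and> length ts = X)"
  by (cases f) (auto simp: Hom_def op_cat_def lawvere_def law_Arr_def)

lemma law_Arr_rep: "law_Arr T n ts \<Longrightarrow> c \<in> set ts \<Longrightarrow> wf_trm T n (rep c)"
  by (auto simp: law_Arr_def wf_rep)

lemma trm_class_cong: "trm_eq T n t u \<Longrightarrow> trm_class T n t = trm_class T n u"
  unfolding trm_class_def by (blast intro: trm_eq.sym trm_eq.trans)

section \<open>Tapes of terms\<close>

context tapes
begin

definition TT :: "nat \<Rightarrow> 's list \<Rightarrow> 'f trm \<Rightarrow> ('s, 'g, 'f) tape set" where "TT n U t = cl (trm_tape n U t)"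

lemma TT_simps [simp]:
  assumes "wf_trm T n t" "U \<in> Wd"
  shows "TT n U t \<in> Arr TC" "Dom TC (TT n U t) = [U]" "Cod TC (TT n U t) = replicate n U"
  using assms by (simp_all add: TT_def)

lemma nin_eq: "U \<in> Wd \<Longrightarrow> i < n \<Longrightarrow> tsum.nin [U] n i = tB (replicate i U) \<boxplus> \<iota> [U] \<boxplus> tB (replicate (n - Suc i) U)"
  using tsum.nin_explicit[of "[U]" i n] by simp

lemma TT_Var [simp]: "i < n \<Longrightarrow> U \<in> Wd \<Longrightarrow> TT n U (Var i) = tsum.nin [U] n i"
  by (simp add: TT_def nin_eq)

lemma cl_tnabla_n: "P \<in> Pl \<Longrightarrow> cl (tnabla_n n P) = tsum.ncopair P (replicate n (\<iota> P))"
proof (induction n)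
  case (Suc n)
  have "concat (replicate n P) \<in> Pl" using Suc.prems by (induction n) auto
  then show ?case using Suc by simp
qed simp

lemma cl_tsum: "\<forall>t \<in> set ts. wt t \<Longrightarrow> cl (tsum ts) = tsum.nsumar (map cl ts)"
  by (induction ts) auto

text \<open>This is how the syntax forms tuples; both \<open>trm_tape\<close> and
  \<open>tape_incl\<close> contain such a composite.\<close>

lemma cl_tsum_tnabla_n:
  assumes "\<forall>t \<in> set ts. wt t \<and> td t = [U] \<and> tc t = P" "U \<in> Wd" "P \<in> Pl"
  shows "cl (TSeq (tsum ts) (tnabla_n (length ts) P)) = tsum.ncopair P (map cl ts)"
proof -
  have h: "set (map cl ts) \<subseteq> Hom TC [U] P" using assms(1) by (auto simp: Hom_def)
  have "map tc ts = replicate (length ts) P" using assms(1) by (auto simp: map_replicate_const cong: map_cong)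
  then have "cl (TSeq (tsum ts) (tnabla_n (length ts) P)) = tsum.nsumar (map cl ts) \<Zsemi> tsum.ncopair P (replicate (length ts) (\<iota> P))"
    using assms by (simp add: cl_tsum cl_tnabla_n)
  also have "\<dots> = tsum.ncopair P (map2 (\<Zsemi>) (map cl ts) (replicate (length ts) (\<iota> P)))"
    by (rule tsum.nsumar_ncopair[OF h]) (simp_all add: assms Hom_def set_replicate_conv_if)
  also have "map2 (\<Zsemi>) (map cl ts) (replicate (length ts) (\<iota> P)) = map cl ts"
    using assms(1) by (induction ts) (auto simp: assms(3))
  finally show ?thesis .
qed

lemma TT_Fn:
  assumes "wf_trm T n (Fn f ts)" "U \<in> Wd"
  shows "TT n U (Fn f ts) = OP f [U] \<Zsemi> tsum.ncopair (replicate n U) (map (TT n U) ts)"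
proof -
  have w: "f \<in> ops T" "length ts = arity T f" "\<And>t. t \<in> set ts \<Longrightarrow> wf_trm T n t"
    using assms(1) by (auto elim: wf_Fn)
  have c: "\<forall>t \<in> set (map (trm_tape n U) ts). wt t \<and> td t = [U] \<and> tc t = replicate n U"
    using w assms(2) by auto
  have m: "map tc (map (trm_tape n U) ts) = replicate (arity T f) (replicate n U)" "map td (map (trm_tape n U) ts) = replicate (arity T f) [U]"
    using w by (auto simp: map_replicate_const cong: map_cong)
  have 1: "wt (TOp f U)" "wt (tsum (map (trm_tape n U) ts))" "wt (tnabla_n (length ts) (replicate n U))"
    "tc (TOp f U) = td (tsum (map (trm_tape n U) ts))" "tc (tsum (map (trm_tape n U) ts)) = td (tnabla_n (length ts) (replicate n U))"
    using w assms(2) c m by simp_all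
  then have "TT n U (Fn f ts) = cl (TOp f U) \<Zsemi> cl (TSeq (tsum (map (trm_tape n U) ts)) (tnabla_n (length (map (trm_tape n U) ts)) (replicate n U)))"
    unfolding TT_def trm_tape.simps using assms(2) w
    by (simp del: tsum_typing tnabla_n_typing tsum_simps tcod.simps wt_tape.simps tdom.simps add: wt_tape.simps(5) tdom.simps(5) tcod.simps(5))
  then show ?thesis using cl_tsum_tnabla_n[OF c assms(2)] w assms(2) by (simp add: OP_sing TT_def[abs_def] o_def)
qed

lemma TT_list_Hom: "\<forall>t \<in> set ts. wf_trm T n t \<Longrightarrow> U \<in> Wd \<Longrightarrow> set (map (TT n U) ts) \<subseteq> Hom TC [U] (replicate n U)"
  by (simp add: Hom_def image_subset_iff)

lemma TT_ncopair [simp]: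
  assumes "\<forall>t \<in> set ts. wf_trm T n t" and [simp]: "U \<in> Wd"
  shows "tsum.ncopair (replicate n U) (map (TT n U) ts) \<in> Arr TC" "Dom TC (tsum.ncopair (replicate n U) (map (TT n U) ts)) = replicate (length ts) U"
   "Cod TC (tsum.ncopair (replicate n U) (map (TT n U) ts)) = replicate n U"
  using tsum.ncopair_props[OF TT_list_Hom[OF assms]] by simp_all

text \<open>Variables are injections, which select the component \<open>s i\<close>; at an
  application \<open>ncopair_Comp\<close> distributes the copairing over the arguments.\<close>

lemma TT_subst:
  assumes "wf_trm T m t" and s: "\<forall>i<m. wf_trm T n (s i)" and U [simp]: "U \<in> Wd"
  shows "TT n U (subst s t) = TT m U t \<Zsemi> tsum.ncopair (replicate n U) (map (TT n U) (map s [0..<m]))"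
  using assms(1)
proof induction
  case (1 i)
  have "set (map (TT n U) (map s [0..<m])) \<subseteq> Hom TC [U] (replicate n U)"
    by (rule TT_list_Hom) (use s in auto)
  from tsum.nin_ncopair[OF this, of i m] 1 s show ?case by simp
next
  case (2 f ts)
  let ?h = "tsum.ncopair (replicate n U) (map (TT n U) (map s [0..<m]))"
  have h: "?h \<in> Arr TC" "Dom TC ?h = replicate m U" "Cod TC ?h = replicate n U"
    using TT_ncopair[of "map s [0..<m]" n U] s by simp_all
  have w: "wf_trm T m (Fn f ts)" "wf_trm T n (Fn f (map (subst s) ts))"
    using 2 wf_subst[of T m _ n s] s by (auto intro!: wf_trm.intros)
  have t: "set (map (TT m U) ts) \<subseteq> Hom TC [U] (replicate m U)"
    by (rule TT_list_Hom) (use 2 in auto)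
  have "TT m U (Fn f ts) \<Zsemi> ?h = OP f [U] \<Zsemi> (tsum.ncopair (replicate m U) (map (TT m U) ts) \<Zsemi> ?h)"
    unfolding TT_Fn[OF w(1) U] using 2 h by simp
  also have "tsum.ncopair (replicate m U) (map (TT m U) ts) \<Zsemi> ?h = tsum.ncopair (replicate n U) (map (\<lambda>t. TT m U t \<Zsemi> ?h) ts)"
    using tsum.ncopair_Comp[OF t, of ?h] h by (simp add: o_def)
  also have "map (\<lambda>t. TT m U t \<Zsemi> ?h) ts = map (TT n U) (map (subst s) ts)"
    using 2 by simp
  finally show ?case using TT_Fn[OF w(2) U] by simp
qed

lemma TT_cong: "trm_eq T n t u \<Longrightarrow> U \<in> Wd \<Longrightarrow> TT n U t = TT n U u"
proof (induction rule: trm_eq.induct)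
  case (cong f ts us)
  have l: "length us = length ts" "\<forall>t \<in> set ts. wf_trm T n t" "\<forall>t \<in> set us. wf_trm T n t"
  proof -
    have "list_all2 (\<lambda>t u. wf_trm T n t \<and> wf_trm T n u) ts us"
      using cong.IH by (rule list_all2_mono) (auto dest: trm_eq_wf)
    then show "length us = length ts" "\<forall>t \<in> set ts. wf_trm T n t" "\<forall>t \<in> set us. wf_trm T n t"
      by (auto simp: list_all2_conv_all_nth in_set_conv_nth)
  qed
  then have w: "wf_trm T n (Fn f ts)" "wf_trm T n (Fn f us)" using cong by (auto intro!: wf_trm.intros)
  have "map (TT n U) ts = map (TT n U) us"
    using cong.IH cong.prems by (auto simp: list_all2_conv_all_nth list_eq_iff_nth_eq)
  then show ?case using TT_Fn[OF w(1) cong.prems] TT_Fn[OF w(2) cong.prems] by simp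
next
  \<comment> \<open>The rule \<open>theory_ax\<close> covers the equation itself; its substitution
    instances follow from \<open>TT_subst\<close>.\<close>
  case (ax t t' m s)
  then have "TT m U t = TT m U t'" unfolding TT_def by (intro eq_cl tape_eq.theory_ax)
  then show ?case using ax TT_subst[of m t n s U] TT_subst[of m t' n s U] by simp
qed simp_all

lemma TT_rep: "wf_trm T n t \<Longrightarrow> U \<in> Wd \<Longrightarrow> TT n U (rep (trm_class T n t)) = TT n U t"
  using TT_cong[OF trm_eq_rep] by simp

lemma nin_list_Hom: "U \<in> Wd \<Longrightarrow> set (map (tsum.nin [U] n) [0..<n]) \<subseteq> Hom TC [U] (replicate n U)"
  by (simp add: Hom_def image_subset_iff)

lemma nin_ranges:
  assumes [simp]: "U \<in> Wd"
  shows "tsum.ncopair (replicate (n + m) U) (map (tsum.nin [U] (n + m)) [0..<n]) = tsum.in1 (replicate n U) (replicate m U)"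
    "tsum.ncopair (replicate (n + m) U) (map (tsum.nin [U] (n + m)) [n..<n + m]) = tsum.in2 (replicate n U) (replicate m U)"
proof -
  have m: "map (tsum.nin [U] (n + m)) [0..<n] = map (\<lambda>f. f \<Zsemi> tsum.in1 (replicate n U) (replicate m U)) (map (tsum.nin [U] n) [0..<n])"
    using tsum.nin_add(1)[of "[U]" _ n m] by simp
  have "tsum.in1 (replicate n U) (replicate m U) = tsum.ncopair (replicate n U) (map (tsum.nin [U] n) [0..<n]) \<Zsemi> tsum.in1 (replicate n U) (replicate m U)"
    using tsum.ncopair_nin[of "[U]" n] by simp
  also have "\<dots> = tsum.ncopair (replicate (n + m) U) (map (\<lambda>f. f \<Zsemi> tsum.in1 (replicate n U) (replicate m U)) (map (tsum.nin [U] n) [0..<n]))"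
    by (subst tsum.ncopair_Comp[OF nin_list_Hom]) (simp_all add: replicate_add)
  finally show "tsum.ncopair (replicate (n + m) U) (map (tsum.nin [U] (n + m)) [0..<n]) = tsum.in1 (replicate n U) (replicate m U)"
    unfolding m ..
  have "map (tsum.nin [U] (n + m)) [n..<n + m] = map (tsum.nin [U] (n + m)) (map (\<lambda>i. n + i) [0..<m])"
    using map_add_upt[of n m] by (simp only: add.commute)
  also have "\<dots> = map (\<lambda>f. f \<Zsemi> tsum.in2 (replicate n U) (replicate m U)) (map (tsum.nin [U] m) [0..<m])"
    using tsum.nin_add(2)[of "[U]" _ m n] by simp
  finally have m: "map (tsum.nin [U] (n + m)) [n..<n + m] = map (\<lambda>f. f \<Zsemi> tsum.in2 (replicate n U) (replicate m U)) (map (tsum.nin [U] m) [0..<m])" .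
  have "tsum.in2 (replicate n U) (replicate m U) = tsum.ncopair (replicate m U) (map (tsum.nin [U] m) [0..<m]) \<Zsemi> tsum.in2 (replicate n U) (replicate m U)"
    using tsum.ncopair_nin[of "[U]" m] by simp
  also have "\<dots> = tsum.ncopair (replicate (n + m) U) (map (\<lambda>f. f \<Zsemi> tsum.in2 (replicate n U) (replicate m U)) (map (tsum.nin [U] m) [0..<m]))"
    by (subst tsum.ncopair_Comp[OF nin_list_Hom]) (simp_all add: replicate_add)
  finally show "tsum.ncopair (replicate (n + m) U) (map (tsum.nin [U] (n + m)) [n..<n + m]) = tsum.in2 (replicate n U) (replicate m U)"
    unfolding m ..
qed

text \<open>Weakening substitutes variables for variables, so \<open>TT_subst\<close> applies and
  the copairing is one of initial injections; with \<open>TT_shift\<close> this gives the action of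
  the inclusion on sums of arrows.\<close>

lemma TT_weaken:
  assumes "wf_trm T n t" and [simp]: "U \<in> Wd"
  shows "TT (n + m) U t = TT n U t \<Zsemi> tsum.in1 (replicate n U) (replicate m U)"
proof -
  have e: "map (TT (n + m) U) (map Var [0..<n]) = map (tsum.nin [U] (n + m)) [0..<n]" by simp
  have "TT (n + m) U (subst Var t) = TT n U t \<Zsemi> tsum.ncopair (replicate (n + m) U) (map (TT (n + m) U) (map Var [0..<n]))"
    by (rule TT_subst) (use assms in \<open>auto intro: wf_trm.intros\<close>)
  then show ?thesis unfolding e nin_ranges(1)[OF assms(2)] by simp
qed

lemma TT_shift:
  assumes "wf_trm T m t" and [simp]: "U \<in> Wd"
  shows "TT (n + m) U (subst (\<lambda>i. Var (n + i)) t) = TT m U t \<Zsemi> tsum.in2 (replicate n U) (replicate m U)"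
proof -
  have e: "map (TT (n + m) U) (map (\<lambda>i. Var (n + i)) [0..<m]) = map (tsum.nin [U] (n + m)) [n..<n + m]"
  proof -
    have "map (TT (n + m) U) (map (\<lambda>i. Var (n + i)) [0..<m]) = map (tsum.nin [U] (n + m)) (map (\<lambda>i. n + i) [0..<m])" by simp
    then show ?thesis using map_add_upt[of n m] by (simp only: add.commute)
  qed
  have "TT (n + m) U (subst (\<lambda>i. Var (n + i)) t) = TT m U t \<Zsemi> tsum.ncopair (replicate (n + m) U) (map (TT (n + m) U) (map (\<lambda>i. Var (n + i)) [0..<m]))"
    by (rule TT_subst) (use assms in \<open>auto intro: wf_trm.intros\<close>)
  then show ?thesis unfolding e nin_ranges(2)[OF assms(2)] .
qed

section \<open>The functor from the Lawvere category to tapes\<close>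

lemma incl_amap:
  assumes "law_Arr T n ts"
  shows "amap (tape_incl T \<Gamma>) (n, ts) = tsum.ncopair (replicate n []) (map (TT n []) (map rep ts))"
proof -
  have "\<forall>t \<in> set (map (trm_tape n [] \<circ> rep) ts). wt t \<and> td t = [[]] \<and> tc t = replicate n []"
    using law_Arr_rep[OF assms] by auto
  from cl_tsum_tnabla_n[OF this] show ?thesis by (simp add: tape_incl_def TT_def o_def)
qed

text \<open>Frees the image of a tuple from the representatives that \<open>tape_incl\<close>
  picks.\<close>

lemma incl_class:
  assumes "\<forall>t \<in> set ts. wf_trm T n t"
  shows "amap (tape_incl T \<Gamma>) (n, map (trm_class T n) ts) = tsum.ncopair (replicate n []) (map (TT n []) ts)"
proof -
  have "law_Arr T n (map (trm_class T n) ts)" using assms by (auto simp: law_Arr_def)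
  note a = incl_amap[OF this]
  have m: "map (TT n []) (map rep (map (trm_class T n) ts)) = map (TT n []) ts"
    using assms by (simp add: TT_rep)
  show ?thesis unfolding a m ..
qed

lemma incl_d_arr:
  assumes "\<forall>k \<in> set ks. k < n"
  shows "amap (tape_incl T \<Gamma>) (d_arr T (n, ks)) = tsum.ncopair (replicate n []) (map (tsum.nin [[]] n) ks)"
proof -
  have m: "map (TT n []) (map Var ks) = map (tsum.nin [[]] n) ks" using assms by simp
  have "d_arr T (n, ks) = (n, map (trm_class T n) (map Var ks))" by (simp add: d_arr_def)
  moreover have "amap (tape_incl T \<Gamma>) \<dots> = tsum.ncopair (replicate n []) (map (TT n []) (map Var ks))"
    by (rule incl_class) (use assms in \<open>auto intro: wf_trm.intros\<close>)
  ultimately show ?thesis unfolding m by simp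
qed

lemma incl_simps [simp]: "omap (tape_incl T \<Gamma>) n = replicate n []" "mu (tape_incl T \<Gamma>) m n = \<iota> (replicate (m + n) [])"
  "eps (tape_incl T \<Gamma>) = \<iota> []"
  using cl_tid[of "[]"] by (simp_all add: tape_incl_def)

lemma incl_Hom: "law_Arr T n ts \<Longrightarrow> amap (tape_incl T \<Gamma>) (n, ts) \<in> Hom TC (replicate (length ts) []) (replicate n [])"
  using TT_ncopair[of "map rep ts" n "[]"] law_Arr_rep[of T n ts] by (simp add: incl_amap Hom_def)

lemma incl_op:
  assumes "f \<in> ops T"
  shows "amap (tape_incl T \<Gamma>) (op_arrow T f) = cl (TOp f [])"
proof -
  let ?n = "arity T f"
  have w: "wf_trm T ?n (Fn f (map Var [0..<?n]))" by (rule wf_op[OF assms])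
  have m: "map (TT ?n []) (map Var [0..<?n]) = map (tsum.nin [[]] ?n) [0..<?n]" by simp
  have "TT ?n [] (Fn f (map Var [0..<?n])) = OP f [[]]"
    unfolding TT_Fn[OF w, of "[]", OF lists.Nil] m using tsum.ncopair_nin[of "[[]]" ?n] assms by simp
  \<comment> \<open>A copairing of one component still ends with a cobang, which the codiagonal
    absorbs.\<close>
  moreover have "tsum.ncopair (replicate ?n []) [OP f [[]]] = OP f [[]]"
  proof -
    have "OP f [[]] \<boxplus> tB (replicate ?n []) = OP f [[]] \<Zsemi> tsum.in1 (replicate ?n []) (replicate ?n [])"
      using tsum.in_tar(1)[of "OP f [[]]" "tB (replicate ?n [])" "[[]]" "[]"] assms by simp
    then show ?thesis using assms by simp
  qed
  ultimately show ?thesis using incl_class[of "[Fn f (map Var [0..<?n])]" ?n] w assms by (simp add: op_arrow_def OP_sing)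
qed

lemma incl_d_range:
  "amap (tape_incl T \<Gamma>) (d_arr T (n + m, [0..<n])) = tsum.in1 (replicate n []) (replicate m [])"
  "amap (tape_incl T \<Gamma>) (d_arr T (n + m, [n..<n + m])) = tsum.in2 (replicate n []) (replicate m [])"
  by (subst incl_d_arr; simp add: nin_ranges)+

lemma incl_Id [simp]: "amap (tape_incl T \<Gamma>) (Id (lawvere T) n) = \<iota> (replicate n [])"
proof -
  have "Id (lawvere T) n = d_arr T (n, [0..<n])" by (simp add: lawvere_def d_arr_def)
  then show ?thesis using incl_d_range(1)[of n 0] by simp
qed

lemma incl_append:
  assumes "law_Arr T n ts" "law_Arr T n us"
  shows "amap (tape_incl T \<Gamma>) (n, ts @ us) = (amap (tape_incl T \<Gamma>) (n, ts) \<boxplus> amap (tape_incl T \<Gamma>) (n, us)) \<Zsemi> tN (replicate n [])"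
proof -
  have w: "law_Arr T n (ts @ us)" using assms by (auto simp: law_Arr_def)
  have "set (map (TT n []) (map rep ts)) \<subseteq> Hom TC [[]] (replicate n [])" "set (map (TT n []) (map rep us)) \<subseteq> Hom TC [[]] (replicate n [])"
    by (rule TT_list_Hom; use assms law_Arr_rep[of T] in auto)+
  from tsum.ncopair_append[OF this] show ?thesis using assms w by (simp add: incl_amap del: map_map)
qed

lemma law_Arr_d: "\<forall>k \<in> set ks. k < n \<Longrightarrow> law_Arr T n (snd (d_arr T (n, ks)))"
  by (auto simp: law_Arr_def d_arr_def intro: wf_trm.intros)

lemma incl_d_append:
  assumes "\<forall>k \<in> set ks. k < n" "\<forall>k \<in> set ls. k < n"
  shows "amap (tape_incl T \<Gamma>) (d_arr T (n, ks @ ls)) = (amap (tape_incl T \<Gamma>) (d_arr T (n, ks)) \<boxplus> amap (tape_incl T \<Gamma>) (d_arr T (n, ls))) \<Zsemi> tN (replicate n [])"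
  using incl_append[OF law_Arr_d[OF assms(1)] law_Arr_d[OF assms(2)]] by (simp add: d_arr_def)

lemma incl_functor: "strong_symmetric_monoidal_functor (fcat (lawvere_op T)) (fsum (lawvere_op T)) TC TS (tape_incl T \<Gamma>)"
proof unfold_locales
  let ?F = "tape_incl T \<Gamma>"
  have F [simp]: "fcat (lawvere_op T) = op_cat (lawvere T)" by (simp add: lawvere_op_def)
  have S [simp]: "tob (fsum (lawvere_op T)) = (+)" "tunit (fsum (lawvere_op T)) = 0"
    "assoc (fsum (lawvere_op T)) k m n = Id (lawvere T) (k + m + n)" "lunit (fsum (lawvere_op T)) = Id (lawvere T)"
    "runit (fsum (lawvere_op T)) = Id (lawvere T)" "symm (fsum (lawvere_op T)) m n = d_arr T (n + m, [n..<n + m] @ [0..<n])" for k m n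
    by (simp_all add: lawvere_op_def aleph0_def)
  have [simp]: "Id (op_cat (lawvere T)) = Id (lawvere T)" by (simp add: op_cat_def)
  have [simp]: "tsum.in1 (replicate n []) [] = \<iota> (replicate n [])" for n by simp
  show "X \<in> Obj (fcat (lawvere_op T)) \<Longrightarrow> omap ?F X \<in> Obj TC" for X by simp
  show "f \<in> Hom (fcat (lawvere_op T)) X Y \<Longrightarrow> amap ?F f \<in> Hom TC (omap ?F X) (omap ?F Y)" for f X Y
    using incl_Hom by (auto simp: law_Hom)
  show "amap ?F (Id (fcat (lawvere_op T)) X) = \<iota> (omap ?F X)" for X by simp
  show "amap ?F (Comp (fcat (lawvere_op T)) f g) = amap ?F f \<Zsemi> amap ?F g"
    if fg: "f \<in> Hom (fcat (lawvere_op T)) X Y" "g \<in> Hom (fcat (lawvere_op T)) Y Z" for f g X Y Z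
  proof -
    obtain ts us where f: "f = (Y, ts)" "law_Arr T Y ts" "length ts = X" and g: "g = (Z, us)" "law_Arr T Z us" "length us = Y"
      using fg unfolding F law_Hom by blast
    let ?s = "\<lambda>i. rep (us ! i)"
    have s: "\<forall>i<Y. wf_trm T Z (?s i)" using g law_Arr_rep[of T Z us] by auto
    have m: "map ?s [0..<Y] = map rep us" using g(3) by (auto intro: nth_equalityI)
    \<comment> \<open>In the opposite category the components of \<open>g\<close> are substituted
      into those of \<open>f\<close>, which \<open>TT_subst\<close> turns into composition in this
      order.\<close>
    have "Comp (fcat (lawvere_op T)) f g = (Z, map (trm_class T Z) (map (subst ?s) (map rep ts)))"
      using f g by (simp add: op_cat_def lawvere_def)
    also have "amap ?F \<dots> = tsum.ncopair (replicate Z []) (map (TT Z []) (map (subst ?s) (map rep ts)))"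
      by (rule incl_class) (use f s law_Arr_rep[of T Y ts] in \<open>auto intro!: wf_subst[of T Y]\<close>)
    also have "map (TT Z []) (map (subst ?s) (map rep ts)) = map (\<lambda>a. a \<Zsemi> amap ?F g) (map (TT Y []) (map rep ts))"
      using TT_subst[OF _ s, of _ "[]"] law_Arr_rep[OF f(2)] g by (simp add: m incl_amap del: map_map) simp
    also have "tsum.ncopair (replicate Z []) \<dots> = amap ?F f \<Zsemi> amap ?F g"
    proof -
      have "set (map (TT Y []) (map rep ts)) \<subseteq> Hom TC [[]] (replicate Y [])"
        by (rule TT_list_Hom) (use f law_Arr_rep[of T] in auto)
      from tsum.ncopair_Comp[OF this, of "amap ?F g"] show ?thesis
        using incl_Hom[OF g(2)] f g by (simp add: incl_amap[OF f(2)] Hom_def)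
    qed
    finally show ?thesis .
  qed
  show "mu ?F X Y \<in> Hom TC (tob TS (omap ?F X) (omap ?F Y)) (omap ?F (tob (fsum (lawvere_op T)) X Y))" for X Y
    by (simp add: Hom_def replicate_add)
  show "is_iso TC (mu ?F X Y)" for X Y by (simp add: tape.is_iso_Id)
  show "tar TS (amap ?F f) (amap ?F g) \<Zsemi> mu ?F X' Y' = mu ?F X Y \<Zsemi> amap ?F (tar (fsum (lawvere_op T)) f g)"
    if fg: "f \<in> Hom (fcat (lawvere_op T)) X X'" "g \<in> Hom (fcat (lawvere_op T)) Y Y'" for f g X X' Y Y'
  proof -
    obtain ts us where f: "f = (X', ts)" "law_Arr T X' ts" "length ts = X" and g: "g = (Y', us)" "law_Arr T Y' us" "length us = Y"
      using fg unfolding F law_Hom by blast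
    let ?i1 = "tsum.in1 (replicate X' []) (replicate Y' [])" let ?i2 = "tsum.in2 (replicate X' []) (replicate Y' [])"
    let ?w = "\<lambda>t. subst (\<lambda>i. Var (X' + i)) t"
    have w1: "\<forall>t \<in> set (map rep ts). wf_trm T (X' + Y') t"
      using law_Arr_rep[OF f(2)] wf_subst[of T X' _ "X' + Y'" Var] by (auto simp: wf_trm.intros)
    have w2: "\<forall>t \<in> set (map ?w (map rep us)). wf_trm T (X' + Y') t"
      using law_Arr_rep[OF g(2)] wf_subst[of T Y' _ "X' + Y'" "\<lambda>i. Var (X' + i)"] by (auto simp: wf_trm.intros)
    have "tar (fsum (lawvere_op T)) f g = (X' + Y', map (trm_class T (X' + Y')) (map rep ts @ map ?w (map rep us)))"
      using f g by (simp add: lawvere_op_def)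
    also have "amap ?F \<dots> = tsum.ncopair (replicate (X' + Y') []) (map (TT (X' + Y') []) (map rep ts @ map ?w (map rep us)))"
      by (rule incl_class) (use w1 w2 in auto)
    also have "\<dots> = (tsum.ncopair (replicate (X' + Y') []) (map (TT (X' + Y') []) (map rep ts)) \<boxplus>
        tsum.ncopair (replicate (X' + Y') []) (map (TT (X' + Y') []) (map ?w (map rep us)))) \<Zsemi> tN (replicate (X' + Y') [])"
      using tsum.ncopair_append[OF TT_list_Hom[OF w1, of "[]"] TT_list_Hom[OF w2, of "[]"]] by simp
    also have "map (TT (X' + Y') []) (map rep ts) = map (\<lambda>a. a \<Zsemi> ?i1) (map (TT X' []) (map rep ts))"
      using law_Arr_rep[OF f(2)] by (simp add: TT_weaken)
    also have "tsum.ncopair (replicate (X' + Y') []) \<dots> = amap ?F f \<Zsemi> ?i1"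
    proof -
      have "set (map (TT X' []) (map rep ts)) \<subseteq> Hom TC [[]] (replicate X' [])"
        by (rule TT_list_Hom) (use f law_Arr_rep[of T] in auto)
      from tsum.ncopair_Comp[OF this, of ?i1] show ?thesis using f by (simp add: incl_amap[OF f(2)] replicate_add)
    qed
    also have "map (TT (X' + Y') []) (map ?w (map rep us)) = map (\<lambda>a. a \<Zsemi> ?i2) (map (TT Y' []) (map rep us))"
      using law_Arr_rep[OF g(2)] by (simp add: TT_shift)
    also have "tsum.ncopair (replicate (X' + Y') []) \<dots> = amap ?F g \<Zsemi> ?i2"
    proof -
      have "set (map (TT Y' []) (map rep us)) \<subseteq> Hom TC [[]] (replicate Y' [])"
        by (rule TT_list_Hom) (use g law_Arr_rep[of T] in auto)
      from tsum.ncopair_Comp[OF this, of ?i2] show ?thesis using g by (simp add: incl_amap[OF g(2)] replicate_add)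
    qed
    also have "((amap ?F f \<Zsemi> ?i1) \<boxplus> (amap ?F g \<Zsemi> ?i2)) \<Zsemi> tN (replicate (X' + Y') []) = amap ?F f \<boxplus> amap ?F g"
      using tsum.tar_eq_copair[of "amap ?F f" "amap ?F g"] HomD[OF incl_Hom[OF f(2)]] HomD[OF incl_Hom[OF g(2)]] f g
      by (simp add: replicate_add)
    finally show ?thesis using HomD[OF incl_Hom[OF f(2)]] HomD[OF incl_Hom[OF g(2)]] f g by (simp add: replicate_add)
  qed
  show "eps ?F \<in> Hom TC (tunit TS) (omap ?F (tunit (fsum (lawvere_op T))))" by (simp add: Hom_def)
  show "is_iso TC (eps ?F)" by (simp add: tape.is_iso_Id)
  show "mu ?F X Y \<Zsemi> amap ?F (symm (fsum (lawvere_op T)) X Y) = symm TS (omap ?F X) (omap ?F Y) \<Zsemi> mu ?F Y X" for X Y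
  proof -
    \<comment> \<open>The symmetry of \<open>lawvere_op\<close> is a list of variables made of two
      blocks of consecutive ones, that is, the copairing of the two injections in exchanged
      order.\<close>
    have "amap ?F (d_arr T (Y + X, [Y..<Y + X] @ [0..<Y])) =
       (tsum.in2 (replicate Y []) (replicate X []) \<boxplus> tsum.in1 (replicate Y []) (replicate X [])) \<Zsemi> tN (replicate (Y + X) [])"
      by (subst incl_d_append) (simp_all add: incl_d_range)
    also have "\<dots> = \<sigma> (replicate X []) (replicate Y [])"
      by (rule tsum.coprod_ext[of "replicate X []" "replicate Y []"]) (simp_all add: replicate_add)
    finally show ?thesis by (simp add: replicate_add)
  qed
qed (simp_all add: replicate_add[symmetric] add.assoc tape.smc.assoc_Id lawvere_op_def)

lemma tape_theory_rig: "theory_rig_category T TR"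
proof -
  have n: "amap (tape_incl T \<Gamma>) (nabla (lawvere_op T) X) = tN (replicate X [])" for X
  proof -
    have i: "amap (tape_incl T \<Gamma>) (d_arr T (X, [0..<X])) = \<iota> (replicate X [])"
      using incl_d_range(1)[of X 0] by simp
    have "nabla (lawvere_op T) X = d_arr T (X, [0..<X] @ [0..<X])" by (simp add: lawvere_op_def aleph0_def)
    then show ?thesis using incl_d_append[of "[0..<X]" X "[0..<X]"] i by simp
  qed
  have c: "amap (tape_incl T \<Gamma>) (cobang (lawvere_op T) X) = tB (replicate X [])" for X
    using incl_d_arr[of "[]" X] by (simp add: lawvere_op_def aleph0_def)
  have "fc_morphism (lawvere_op T) (sum_fc TR) (incl TR)"
    unfolding fc_morphism_def using incl_functor n c by (simp add: sum_fc_def replicate_add)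
  moreover have "mfun_eq aleph0_cat (mfun_comp (rcat TR) (d_morphism T) (incl TR))
       (canonical_fc.canonical (rcat TR) (rsum TR) (rnabla TR) (rcobang TR) (tunit (rprod TR)))"
  proof -
    have i: "amap (tape_incl T \<Gamma>) (Id (lawvere T) X) = \<iota> (replicate X [])" for X
      using incl_d_range(1)[of X 0] by (simp add: lawvere_def d_arr_def o_def)
    show ?thesis
      unfolding mfun_eq_def mfun_comp_def canonical_fc.canonical_def d_morphism_def
      using tsum.copair_eq[of "[[]]"] tsum.nsum_add_eq[of "[[]]"] i
      by (auto simp: aleph0_cat_def incl_d_arr)
  qed
  ultimately show ?thesis unfolding theory_rig_category_def using tape_fc_rig by simp
qed

lemma tape_sesquistrict_theory: "sesquistrict_theory_rig_category T (tape_sesqui T \<Gamma>)"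
  unfolding sesquistrict_theory_rig_category_def using tape_sesquistrict tape_theory_rig by (simp add: tape_sesqui_def)

end

section \<open>Interpretation of tapes\<close>

text \<open>A converse of \<open>is_rig_category\<close>: in a right strict rig category with
  coproducts the distributors necessarily act on injections as \<open>dist_rig\<close> demands, so
  the target can be handled with the same rules as the tapes.\<close>

lemma right_strict_dist_rig:
  assumes "right_strict_rig R" "fc_category (rcat R) (rsum R) (rnabla R) (rcobang R)"
  shows "dist_rig R (\<lambda>X Y Z. inv_of (rcat R) (distl R X Y Z))"
proof -
  interpret rig_category R using assms(1) by (simp add: right_strict_rig_def)
  have st: "strict_tensor (rcat R) (rsum R)" "strict_tensor (rcat R) (rprod R)" using assms(1) by (simp_all add: right_strict_rig_def)
  interpret S: strict_cocart "rcat R" "rsum R" "rnabla R" "rcobang R" by (rule strict_cocartI[OF assms(2) st(1)])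
  interpret P: strict_smc "rcat R" "rprod R" by (rule strict_smc.intro[OF prod_symmetric_monoidal]) (simp add: strict_smc_axioms_def st)
  have d: "\<delta>\<^sub>r X Y Z = \<iota> ((X \<otimes> Z) \<oplus> (Y \<otimes> Z))" "(X \<oplus> Y) \<otimes> Z = (X \<otimes> Z) \<oplus> (Y \<otimes> Z)" if [simp]: "X \<in> Ob" "Y \<in> Ob" "Z \<in> Ob" for X Y Z
  proof -
    have i: "is_identity (rcat R) (\<delta>\<^sub>r X Y Z)" using assms(1) that unfolding right_strict_rig_def by blast
    show "\<delta>\<^sub>r X Y Z = \<iota> ((X \<otimes> Z) \<oplus> (Y \<otimes> Z))" "(X \<oplus> Y) \<otimes> Z = (X \<otimes> Z) \<oplus> (Y \<otimes> Z)"
      using S.is_identityD[OF i distr_in_Hom] that by auto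
  qed
  have l: "l\<^sub>0 X = \<iota> \<zero>" "\<zero> \<otimes> X = \<zero>" if "X \<in> Ob" for X
  proof -
    have i: "is_identity (rcat R) (l\<^sub>0 X)" using assms(1) that by (simp add: right_strict_rig_def)
    show "l\<^sub>0 X = \<iota> \<zero>" "\<zero> \<otimes> X = \<zero>" using S.is_identityD[OF i annl_in_Hom] that by auto
  qed
  have r: "r\<^sub>0 X = \<iota> \<zero>" "X \<otimes> \<zero> = \<zero>" if "X \<in> Ob" for X
  proof -
    have i: "is_identity (rcat R) (r\<^sub>0 X)" using assms(1) that by (simp add: right_strict_rig_def)
    show "r\<^sub>0 X = \<iota> \<zero>" "X \<otimes> \<zero> = \<zero>" using S.is_identityD[OF i annr_in_Hom] that by auto
  qed
  have sp: "(f \<oplus>\<^sub>a g) \<otimes>\<^sub>a h = (f \<otimes>\<^sub>a h) \<oplus>\<^sub>a (g \<otimes>\<^sub>a h)" if [simp]: "f \<in> Arr (rcat R)" "g \<in> Arr (rcat R)" "h \<in> Arr (rcat R)" for f g h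
    using distr_natural[of f "Dom (rcat R) f" "Cod (rcat R) f" g "Dom (rcat R) g" "Cod (rcat R) g" h "Dom (rcat R) h" "Cod (rcat R) h"]
    by (simp add: Hom_def d)
  have cp: "rcobang R X \<otimes>\<^sub>a \<iota> Y = rcobang R (X \<otimes> Y)" "\<iota> Y \<otimes>\<^sub>a rcobang R X = rcobang R (Y \<otimes> X)" if "X \<in> Ob" "Y \<in> Ob" for X Y
    by (rule S.initial_ext; simp add: that l r)+
  have ip: "S.in1 X Y \<otimes>\<^sub>a \<iota> Z = S.in1 (X \<otimes> Z) (Y \<otimes> Z)" "S.in2 X Y \<otimes>\<^sub>a \<iota> Z = S.in2 (X \<otimes> Z) (Y \<otimes> Z)"
    if "X \<in> Ob" "Y \<in> Ob" "Z \<in> Ob" for X Y Z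
    using that by (simp_all add: S.in1_def S.in2_def sp cp)
  \<comment> \<open>Laplaza 19 and 21, in which annihilators and units are now identities.\<close>
  have dz: "\<delta>\<^sub>l X \<zero> Y = \<iota> (X \<otimes> Y)" "\<delta>\<^sub>l X Y \<zero> = \<iota> (X \<otimes> Y)" if [simp]: "X \<in> Ob" "Y \<in> Ob" for X Y
    using laplaza_19[of X Y] laplaza_21[of X Y] HomD[OF distl_in_Hom[of X \<zero> Y]] HomD[OF distl_in_Hom[of X Y \<zero>]]
    by (simp_all add: r)
  have dl: "\<delta>\<^sub>l X Y Z \<in> Arr (rcat R)" "Dom (rcat R) (\<delta>\<^sub>l X Y Z) = X \<otimes> (Y \<oplus> Z)" "Cod (rcat R) (\<delta>\<^sub>l X Y Z) = (X \<otimes> Y) \<oplus> (X \<otimes> Z)"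
    if "X \<in> Ob" "Y \<in> Ob" "Z \<in> Ob" for X Y Z
    using HomD[OF distl_in_Hom[OF that]] by auto
  \<comment> \<open>An injection is a sum of an identity and \<open>rcobang\<close>, so naturality
    of the distributor reduces the claim to a zero summand, where \<open>dz\<close> applies.\<close>
  have id: "(\<iota> X \<otimes>\<^sub>a S.in1 Y Z) \<Zsemi> \<delta>\<^sub>l X Y Z = S.in1 (X \<otimes> Y) (X \<otimes> Z)" "(\<iota> X \<otimes>\<^sub>a S.in2 Y Z) \<Zsemi> \<delta>\<^sub>l X Y Z = S.in2 (X \<otimes> Y) (X \<otimes> Z)"
    if [simp]: "X \<in> Ob" "Y \<in> Ob" "Z \<in> Ob" for X Y Z
    using distl_natural[of "\<iota> X" X X "\<iota> Y" Y Y "rcobang R Z" \<zero> Z] distl_natural[of "\<iota> X" X X "rcobang R Y" \<zero> Y "\<iota> Z" Z Z]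
    by (simp_all add: Hom_def dz S.in1_def S.in2_def cp r)
  have inv: "inverse_arrows (rcat R) (\<delta>\<^sub>l X Y Z) (inv_of (rcat R) (\<delta>\<^sub>l X Y Z))" if "X \<in> Ob" "Y \<in> Ob" "Z \<in> Ob" for X Y Z
    using distl_iso[OF that] S.inv_of_eq unfolding is_iso_def by auto
  show ?thesis
  proof unfold_locales
    fix X Y Z assume X: "X \<in> Ob" "Y \<in> Ob" "Z \<in> Ob"
    show "inv_of (rcat R) (\<delta>\<^sub>l X Y Z) \<in> hom ((X \<otimes> Y) \<oplus> (X \<otimes> Z)) (X \<otimes> (Y \<oplus> Z))"
      "\<delta>\<^sub>l X Y Z \<Zsemi> inv_of (rcat R) (\<delta>\<^sub>l X Y Z) = \<iota> (X \<otimes> (Y \<oplus> Z))"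
      "inv_of (rcat R) (\<delta>\<^sub>l X Y Z) \<Zsemi> \<delta>\<^sub>l X Y Z = \<iota> ((X \<otimes> Y) \<oplus> (X \<otimes> Z))"
      using inv[OF X] dl[OF X] by (simp_all add: inverse_arrows_def)
  qed (simp_all add: d l r ip id distl_in_Hom)
qed

context dist_rig
begin

lemma npow_prod [simp]: "X \<in> Ob \<Longrightarrow> Z \<in> Ob \<Longrightarrow> S.npow X n \<otimes> Z = S.npow (X \<otimes> Z) n"
  by (induction n) simp_all

lemma nin_prod: "X \<in> Ob \<Longrightarrow> Z \<in> Ob \<Longrightarrow> k < n \<Longrightarrow> S.nin X n k \<otimes>\<^sub>a \<iota> Z = S.nin (X \<otimes> Z) n k"
proof (induction n arbitrary: k)
  case (Suc n)
  then show ?case by (cases k) (simp_all add: in_prod P.whisk_right del: P.tar_fuse)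
qed simp

lemma nab_prod:
  assumes [simp]: "X \<in> Ob" "Z \<in> Ob"
  shows "rnabla R X \<otimes>\<^sub>a \<iota> Z = rnabla R (X \<otimes> Z)"
  by (rule S.coprod_ext[of "X \<otimes> Z" "X \<otimes> Z"]) (simp_all add: in_prod_Comp)

lemma cob_prod:
  assumes [simp]: "X \<in> Ob" "Z \<in> Ob"
  shows "rcobang R X \<otimes>\<^sub>a \<iota> Z = rcobang R (X \<otimes> Z)" "\<iota> Z \<otimes>\<^sub>a rcobang R X = rcobang R (Z \<otimes> X)"
  by (rule S.initial_ext; simp)+

lemma ncopair_prod:
  assumes "set fs \<subseteq> hom X Y" and [simp]: "X \<in> Ob" "Y \<in> Ob" "Z \<in> Ob"
  shows "S.ncopair Y fs \<otimes>\<^sub>a \<iota> Z = S.ncopair (Y \<otimes> Z) (map (\<lambda>f. f \<otimes>\<^sub>a \<iota> Z) fs)"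
  using assms(1)
proof (induction fs)
  case Nil
  then show ?case by (simp add: cob_prod)
next
  case (Cons f fs)
  have [simp]: "f \<in> Arr (rcat R)" "Cod (rcat R) f = Y" using Cons.prems by (auto simp: Hom_def)
  have [simp]: "S.ncopair Y fs \<in> Arr (rcat R)" "Cod (rcat R) (S.ncopair Y fs) = Y"
    using S.ncopair_props[of fs X Y] Cons.prems by auto
  have "S.ncopair Y (f # fs) \<otimes>\<^sub>a \<iota> Z = ((f \<oplus>\<^sub>a S.ncopair Y fs) \<otimes>\<^sub>a \<iota> Z) \<Zsemi> (rnabla R Y \<otimes>\<^sub>a \<iota> Z)"
    by simp
  then show ?case using Cons by (simp add: sum_prod nab_prod del: P.tar_fuse)
qed

end

text \<open>What a target must provide, with the functor out of the Lawvere category reduced to its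
  values: \<open>opr f\<close> at operations and \<open>itm n t\<close> at terms. The assumptions on
  \<open>itm\<close> say that it is computed from \<open>opr\<close> and validates the equations of
  the theory.\<close>

locale tape_interp = dist_rig R dli + sg: signature T \<Gamma>
  for R :: "('o, 'a, 'z) fc_rig_scheme" and dli and T :: "'f alg_theory" and \<Gamma> :: "('s, 'g) monsig" +
  fixes ob :: "'s \<Rightarrow> 'o" and gen :: "'g \<Rightarrow> 'a" and opr :: "'f \<Rightarrow> 'a" and itm :: "nat \<Rightarrow> 'f trm \<Rightarrow> 'a"
  assumes ob_Ob [simp]: "A \<in> sorts \<Gamma> \<Longrightarrow> ob A \<in> Ob"
    and ob_dl: "A \<in> sorts \<Gamma> \<Longrightarrow> X \<in> Ob \<Longrightarrow> Y \<in> Ob \<Longrightarrow> \<delta>\<^sub>l (ob A) X Y = \<iota> ((ob A \<otimes> X) \<oplus> (ob A \<otimes> Y))"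
    and ob_dl_ob: "A \<in> sorts \<Gamma> \<Longrightarrow> X \<in> Ob \<Longrightarrow> Y \<in> Ob \<Longrightarrow> ob A \<otimes> (X \<oplus> Y) = (ob A \<otimes> X) \<oplus> (ob A \<otimes> Y)"
    and gen_Hom: "s \<in> gens \<Gamma> \<Longrightarrow> gen s \<in> hom (foldr (\<lambda>A X. ob A \<otimes> X) (ar \<Gamma> s) \<one>) (foldr (\<lambda>A X. ob A \<otimes> X) (coar \<Gamma> s) \<one>)"
    and opr_Hom: "f \<in> ops T \<Longrightarrow> opr f \<in> hom \<one> (S.npow \<one> (arity T f))"
    and itm_Var: "i < n \<Longrightarrow> itm n (Var i) = S.nin \<one> n i"
    and itm_Fn: "wf_trm T n (Fn f ts) \<Longrightarrow> itm n (Fn f ts) = opr f \<Zsemi> S.ncopair (S.npow \<one> n) (map (itm n) ts)"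
    and itm_eqs: "(t, t') \<in> eqs T \<Longrightarrow> wf_trm T n t \<Longrightarrow> wf_trm T n t' \<Longrightarrow> itm n t = itm n t'"
begin

definition wd :: "'s list \<Rightarrow> 'o" where "wd U = foldr (\<lambda>A X. ob A \<otimes> X) U \<one>"
definition pl :: "'s poly \<Rightarrow> 'o" where "pl P = foldr (\<lambda>U X. wd U \<oplus> X) P \<zero>"

lemma wd_simps [simp]: "wd [] = \<one>" "wd (A # U) = ob A \<otimes> wd U"
  by (simp_all add: wd_def)

lemma pl_simps [simp]: "pl [] = \<zero>" "pl (U # P) = wd U \<oplus> pl P"
  by (simp_all add: pl_def)

lemma wd_Ob [simp]: "U \<in> lists (sorts \<Gamma>) \<Longrightarrow> wd U \<in> Ob"
  by (induction U rule: lists.induct) simp_all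

lemma pl_Ob [simp]: "P \<in> lists (lists (sorts \<Gamma>)) \<Longrightarrow> pl P \<in> Ob"
  by (induction P rule: lists.induct) simp_all

lemma wd_append [simp]: "U \<in> lists (sorts \<Gamma>) \<Longrightarrow> V \<in> lists (sorts \<Gamma>) \<Longrightarrow> wd (U @ V) = wd U \<otimes> wd V"
  by (induction U rule: lists.induct) simp_all

lemma pl_append [simp]: "P \<in> sg.Pl \<Longrightarrow> Q \<in> sg.Pl \<Longrightarrow> pl (P @ Q) = pl P \<oplus> pl Q"
  by (induction P rule: lists.induct) simp_all

text \<open>Sesquistrictness concerns sorts only. Laplaza 6 passes from \<open>A\<close> and
  \<open>U\<close> to the word \<open>A # U\<close>, and Laplaza 23 gives the empty word.\<close>

lemma wd_dl [simp]:
  assumes "U \<in> sg.Wd" and [simp]: "X \<in> Ob" "Y \<in> Ob"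
  shows "wd U \<otimes> (X \<oplus> Y) = (wd U \<otimes> X) \<oplus> (wd U \<otimes> Y)" "\<delta>\<^sub>l (wd U) X Y = \<iota> ((wd U \<otimes> X) \<oplus> (wd U \<otimes> Y))"
  using assms(1)
proof (induction U)
  case Nil
  { case 1 show ?case by simp }
  { case 2 show ?case using lap23[of X Y] by simp }
next
  case (Cons A U)
  note [simp] = Cons.hyps
  { case 1 show ?case using Cons.IH(1) by (simp add: ob_dl_ob) }
  { case 2
    have "\<delta>\<^sub>l (ob A \<otimes> wd U) X Y = (\<iota> (ob A) \<otimes>\<^sub>a \<delta>\<^sub>l (wd U) X Y) \<Zsemi> \<delta>\<^sub>l (ob A) (wd U \<otimes> X) (wd U \<otimes> Y)"
      by (rule lap6[symmetric]) simp_all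
    then show ?case using Cons.IH(2) by (simp add: ob_dl ob_dl_ob) }
qed

lemma wd_pl [simp]: "Q \<in> sg.Pl \<Longrightarrow> U \<in> sg.Wd \<Longrightarrow> pl (map ((@) U) Q) = wd U \<otimes> pl Q"
  by (induction Q rule: lists.induct) simp_all

lemma pl_prod [simp]: "P \<in> sg.Pl \<Longrightarrow> Q \<in> sg.Pl \<Longrightarrow> pl (poly_prod P Q) = pl P \<otimes> pl Q"
  by (induction P rule: lists.induct) simp_all

lemma pl_replicate [simp]: "U \<in> sg.Wd \<Longrightarrow> pl (replicate n U) = S.npow (wd U) n"
  by (induction n) simp_all

lemma sum_whisk_wd:
  assumes [simp]: "U \<in> sg.Wd" "f \<in> Arr (rcat R)" "g \<in> Arr (rcat R)"
  shows "\<iota> (wd U) \<otimes>\<^sub>a (f \<oplus>\<^sub>a g) = (\<iota> (wd U) \<otimes>\<^sub>a f) \<oplus>\<^sub>a (\<iota> (wd U) \<otimes>\<^sub>a g)"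
  using dl_nat[of "\<iota> (wd U)" f g] by simp

text \<open>Since the distributor at a word is an identity, left whiskering by a word keeps
  injections and therefore codiagonals.\<close>

lemma wd_nab:
  assumes [simp]: "U \<in> sg.Wd" "X \<in> Ob"
  shows "\<iota> (wd U) \<otimes>\<^sub>a rnabla R X = rnabla R (wd U \<otimes> X)"
proof -
  have i: "\<iota> (wd U) \<otimes>\<^sub>a S.in1 X X = S.in1 (wd U \<otimes> X) (wd U \<otimes> X)" "\<iota> (wd U) \<otimes>\<^sub>a S.in2 X X = S.in2 (wd U \<otimes> X) (wd U \<otimes> X)"
    using prod_in_dl[of "wd U" X X] by simp_all
  have "(\<iota> (wd U) \<otimes>\<^sub>a S.in1 X X) \<Zsemi> (\<iota> (wd U) \<otimes>\<^sub>a rnabla R X) = \<iota> (wd U \<otimes> X)"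
    "(\<iota> (wd U) \<otimes>\<^sub>a S.in2 X X) \<Zsemi> (\<iota> (wd U) \<otimes>\<^sub>a rnabla R X) = \<iota> (wd U \<otimes> X)" by simp_all
  note e = this[unfolded i]
  show ?thesis by (rule S.coprod_ext[of "wd U \<otimes> X" "wd U \<otimes> X"]) (simp_all add: e)
qed

lemma opr_simps [simp]:
  assumes "f \<in> ops T"
  shows "opr f \<in> Arr (rcat R)" "Dom (rcat R) (opr f) = \<one>" "Cod (rcat R) (opr f) = S.npow \<one> (arity T f)"
  using HomD[OF opr_Hom[OF assms]] by auto

text \<open>By Laplaza 2 the symmetry past a sum of units is assembled from symmetries past a unit,
  which are identities.\<close>

lemma symm_npow:
  assumes [simp]: "U \<in> sg.Wd"
  shows "\<sigma>\<^sub>p (S.npow \<one> n) (wd U) = \<iota> (S.npow (wd U) n)" "wd U \<otimes> S.npow \<one> n = S.npow (wd U) n"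
proof (induction n)
  case 0
  { case 1 show ?case by (rule S.initial_ext) simp_all }
  { case 2 show ?case by simp }
next
  case (Suc n)
  { case 2 show ?case using Suc by simp }
  { case 1 show ?case using Suc lap2[of \<one> "S.npow \<one> n" "wd U"] by simp }
qed

text \<open>Naturality of the symmetry combined with \<open>symm_npow\<close>. The syntax whiskers
  an operation on either side to an operation tape, while \<open>ti\<close> always places
  \<open>opr f\<close> on the left.\<close>

lemma wd_opr:
  assumes [simp]: "U \<in> sg.Wd" "f \<in> ops T"
  shows "\<iota> (wd U) \<otimes>\<^sub>a opr f = opr f \<otimes>\<^sub>a \<iota> (wd U)"
  using P.symm_nat[of "opr f" "\<iota> (wd U)" "S.npow \<one> (arity T f)" "wd U"] by (simp add: symm_npow)

section \<open>The interpretation of circuits and tapes\<close>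

primrec ci :: "('s, 'g) circ \<Rightarrow> 'a" where
  "ci (CId A) = \<iota> (ob A)"
| "ci CUnit = \<iota> \<one>"
| "ci (CGen s) = gen s"
| "ci (CSym A B) = \<sigma>\<^sub>p (ob A) (ob B)"
| "ci (CSeq c d) = ci c \<Zsemi> ci d"
| "ci (CPar c d) = ci c \<otimes>\<^sub>a ci d"

primrec ti :: "('s, 'g, 'f) tape \<Rightarrow> 'a" where
  "ti (TId U) = \<iota> (wd U)"
| "ti TZero = \<iota> \<zero>"
| "ti (TCirc c) = ci c"
| "ti (TSym U V) = \<sigma>\<^sub>s (wd U) (wd V)"
| "ti (TSeq t u) = ti t \<Zsemi> ti u"
| "ti (TPar t u) = ti t \<oplus>\<^sub>a ti u"
| "ti (TCobang U) = rcobang R (wd U)"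
| "ti (TNabla U) = rnabla R (wd U)"
| "ti (TOp f U) = opr f \<otimes>\<^sub>a \<iota> (wd U)"

lemma ci_simps [simp]:
  assumes "wt_circ \<Gamma> c"
  shows "ci c \<in> Arr (rcat R)" "Dom (rcat R) (ci c) = wd (cdom \<Gamma> c)" "Cod (rcat R) (ci c) = wd (ccod \<Gamma> c)"
proof -
  have "ci c \<in> Arr (rcat R) \<and> Dom (rcat R) (ci c) = wd (cdom \<Gamma> c) \<and> Cod (rcat R) (ci c) = wd (ccod \<Gamma> c)"
    using assms by (induction c) (auto simp: HomD[OF gen_Hom] wd_def[symmetric] sg.wt_circ_words)
  then show "ci c \<in> Arr (rcat R)" "Dom (rcat R) (ci c) = wd (cdom \<Gamma> c)" "Cod (rcat R) (ci c) = wd (ccod \<Gamma> c)" by auto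
qed

lemma ti_simps [simp]:
  assumes "wt_tape T \<Gamma> t"
  shows "ti t \<in> Arr (rcat R)" "Dom (rcat R) (ti t) = pl (tdom T \<Gamma> t)" "Cod (rcat R) (ti t) = pl (tcod T \<Gamma> t)"
proof -
  have "ti t \<in> Arr (rcat R) \<and> Dom (rcat R) (ti t) = pl (tdom T \<Gamma> t) \<and> Cod (rcat R) (ti t) = pl (tcod T \<Gamma> t)"
    using assms by (induction t) (auto simp: sg.wt_circ_words sg.wt_poly)
  then show "ti t \<in> Arr (rcat R)" "Dom (rcat R) (ti t) = pl (tdom T \<Gamma> t)" "Cod (rcat R) (ti t) = pl (tcod T \<Gamma> t)" by auto
qed

lemma ci_cid [simp]: "U \<in> sg.Wd \<Longrightarrow> ci (cid U) = \<iota> (wd U)"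
  by (induction U rule: lists.induct) simp_all

lemma ci_csym1:
  assumes [simp]: "A \<in> sorts \<Gamma>" and "V \<in> sg.Wd"
  shows "ci (csym1 A V) = \<sigma>\<^sub>p (ob A) (wd V)"
  using assms(2) by (induction V) (simp_all add: P.symm_tob_right)

lemma ci_csym [simp]:
  assumes "U \<in> sg.Wd" and [simp]: "V \<in> sg.Wd"
  shows "ci (csym U V) = \<sigma>\<^sub>p (wd U) (wd V)"
  using assms(1) by (induction U) (simp_all add: P.symm_tob_left ci_csym1)

lemma ci_sound: "circ_eq \<Gamma> c d \<Longrightarrow> ci c = ci d"
proof (induction rule: circ_eq.induct)
  case (seq_cong c c' d d') then show ?case by simp
next
  case (sym_natural c d)
  then show ?case using P.symm_nat[of "ci c" "ci d" "wd (ccod \<Gamma> c)" "wd (ccod \<Gamma> d)"] by (simp add: sg.wt_circ_words)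
qed (auto simp: sg.wt_circ_words)

lemma ti_tid [simp]: "P \<in> sg.Pl \<Longrightarrow> ti (tid P) = \<iota> (pl P)"
  by (induction P rule: lists.induct) simp_all

lemma ti_tcobang [simp]: "P \<in> sg.Pl \<Longrightarrow> ti (tcobang P) = rcobang R (pl P)"
  by (induction P rule: lists.induct) (simp_all add: S.cob_tob)

lemma ti_tsym1:
  assumes [simp]: "U \<in> sg.Wd" and "Q \<in> sg.Pl"
  shows "ti (tsym1 U Q) = \<sigma>\<^sub>s (wd U) (pl Q)"
  using assms(2) by (induction Q) (simp_all add: S.symm_tob_right)

lemma ti_tsym [simp]:
  assumes "P \<in> sg.Pl" and [simp]: "Q \<in> sg.Pl"
  shows "ti (tsym P Q) = \<sigma>\<^sub>s (pl P) (pl Q)"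
  using assms(1) by (induction P) (simp_all add: S.symm_tob_left ti_tsym1)

lemma ti_tnabla [simp]: "P \<in> sg.Pl \<Longrightarrow> ti (tnabla P) = rnabla R (pl P)"
  by (induction P rule: lists.induct) (simp_all add: S.nab_tob S.nab_I)

text \<open>The recursion of \<open>tdistl\<close> holds in the target: it is Laplaza 9 with the
  middle swap moved to the other side, the distributor at the word \<open>W\<close> being an
  identity. The inverse follows by cancellation.\<close>

lemma dl_Cons:
  assumes [simp]: "W \<in> sg.Wd" "X \<in> Ob" "Y \<in> Ob" "Z \<in> Ob"
  shows "\<delta>\<^sub>l (wd W \<oplus> X) Y Z = (\<iota> ((wd W \<otimes> Y) \<oplus> (wd W \<otimes> Z)) \<oplus>\<^sub>a \<delta>\<^sub>l X Y Z) \<Zsemi> (\<iota> (wd W \<otimes> Y) \<oplus>\<^sub>a \<sigma>\<^sub>s (wd W \<otimes> Z) (X \<otimes> Y) \<oplus>\<^sub>a \<iota> (X \<otimes> Z))" (is "_ = ?r")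
    and "dli (wd W \<oplus> X) Y Z = (\<iota> (wd W \<otimes> Y) \<oplus>\<^sub>a \<sigma>\<^sub>s (X \<otimes> Y) (wd W \<otimes> Z) \<oplus>\<^sub>a \<iota> (X \<otimes> Z)) \<Zsemi> (\<iota> ((wd W \<otimes> Y) \<oplus> (wd W \<otimes> Z)) \<oplus>\<^sub>a dli X Y Z)" (is "_ = ?r'")
proof -
  let ?m = "\<iota> (wd W \<otimes> Y) \<oplus>\<^sub>a \<sigma>\<^sub>s (X \<otimes> Y) (wd W \<otimes> Z) \<oplus>\<^sub>a \<iota> (X \<otimes> Z)"
  let ?m' = "\<iota> (wd W \<otimes> Y) \<oplus>\<^sub>a \<sigma>\<^sub>s (wd W \<otimes> Z) (X \<otimes> Y) \<oplus>\<^sub>a \<iota> (X \<otimes> Z)"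
  have m: "?m \<Zsemi> ?m' = \<iota> ((wd W \<otimes> Y) \<oplus> (X \<otimes> Y) \<oplus> (wd W \<otimes> Z) \<oplus> (X \<otimes> Z))" "?m' \<Zsemi> ?m = \<iota> ((wd W \<otimes> Y) \<oplus> (wd W \<otimes> Z) \<oplus> (X \<otimes> Y) \<oplus> (X \<otimes> Z))" by simp_all
  have "\<delta>\<^sub>l (wd W \<oplus> X) Y Z = \<delta>\<^sub>l (wd W \<oplus> X) Y Z \<Zsemi> (?m \<Zsemi> ?m')" unfolding m by simp
  also have "\<dots> = (\<delta>\<^sub>l (wd W \<oplus> X) Y Z \<Zsemi> ?m) \<Zsemi> ?m'" by (rule S.Comp_assoc_simp[symmetric]) simp_all
  also have "\<delta>\<^sub>l (wd W \<oplus> X) Y Z \<Zsemi> ?m = \<delta>\<^sub>l (wd W) Y Z \<oplus>\<^sub>a \<delta>\<^sub>l X Y Z" by (rule lap9) simp_all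
  finally show 1: "\<delta>\<^sub>l (wd W \<oplus> X) Y Z = ?r" by simp
  show "dli (wd W \<oplus> X) Y Z = ?r'"
  proof (rule S.iso_inj[of "\<delta>\<^sub>l (wd W \<oplus> X) Y Z" "dli (wd W \<oplus> X) Y Z"])
    have "?r' \<Zsemi> ?r = ?m \<Zsemi> (((\<iota> ((wd W \<otimes> Y) \<oplus> (wd W \<otimes> Z)) \<oplus>\<^sub>a dli X Y Z) \<Zsemi> (\<iota> ((wd W \<otimes> Y) \<oplus> (wd W \<otimes> Z)) \<oplus>\<^sub>a \<delta>\<^sub>l X Y Z)) \<Zsemi> ?m')"
      by (simp del: S.tar_fuse S.tar_fuse_assoc)
    also have "\<dots> = ?m \<Zsemi> ?m'" by (simp add: dli_dl del: S.tar_fuse_assoc)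
    also have "\<dots> = \<iota> ((wd W \<otimes> Y) \<oplus> (X \<otimes> Y) \<oplus> (wd W \<otimes> Z) \<oplus> (X \<otimes> Z))" by (rule m)
    also have "\<dots> = dli (wd W \<oplus> X) Y Z \<Zsemi> \<delta>\<^sub>l (wd W \<oplus> X) Y Z" using dli_dl[of "wd W \<oplus> X" Y Z] by simp
    finally show "dli (wd W \<oplus> X) Y Z \<Zsemi> \<delta>\<^sub>l (wd W \<oplus> X) Y Z = ?r' \<Zsemi> \<delta>\<^sub>l (wd W \<oplus> X) Y Z"
      unfolding 1 by simp
  qed (simp_all add: dl_dli)
qed

lemma ti_tdistl [simp]:
  assumes "P \<in> sg.Pl" and [simp]: "Q \<in> sg.Pl" "R' \<in> sg.Pl"
  shows "ti (tdistl P Q R') = \<delta>\<^sub>l (pl P) (pl Q) (pl R')" "ti (tdistl_inv P Q R') = dli (pl P) (pl Q) (pl R')"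
  using assms(1)
proof (induction P)
  case Nil
  { case 1 show ?case by (rule S.initial_ext) simp_all }
  { case 2 show ?case by (rule S.initial_ext) simp_all }
next
  case (Cons U P)
  { case 1 show ?case using Cons by (simp add: dl_Cons) }
  { case 2 show ?case using Cons by (simp add: dl_Cons) }
qed

text \<open>Operations use \<open>wd_opr\<close>, symmetries of sums use Laplaza 1, and sums and
  codiagonals use that a word distributes strictly.\<close>

lemma ti_lwhisk1:
  assumes [simp]: "U \<in> sg.Wd" and "wt_tape T \<Gamma> t"
  shows "ti (lwhisk1 U t) = \<iota> (wd U) \<otimes>\<^sub>a ti t"
  using assms(2)
proof (induction t)
  case (TOp f V)
  then show ?case using P.tar_assoc[of "\<iota> (wd U)" "opr f" "\<iota> (wd V)"] P.tar_assoc[of "opr f" "\<iota> (wd U)" "\<iota> (wd V)"]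
    by (simp add: wd_opr)
next
  case (TSym V W)
  then show ?case using lap1[of "wd U" "wd V" "wd W"] by simp
next
  case (TZero)
  show ?case by (rule S.initial_ext) simp_all
qed (simp_all add: sum_whisk_wd wd_nab cob_prod sg.wt_circ_words sg.wt_poly)

lemma ti_rwhisk1:
  assumes [simp]: "U \<in> sg.Wd" and "wt_tape T \<Gamma> t"
  shows "ti (rwhisk1 U t) = ti t \<otimes>\<^sub>a \<iota> (wd U)"
  using assms(2)
proof (induction t)
  case (TZero)
  show ?case by (rule S.initial_ext) simp_all
qed (simp_all add: sum_prod nab_prod cob_prod lap3 sg.wt_circ_words sg.wt_poly)

lemma ti_lwhisk:
  assumes "P \<in> sg.Pl" and [simp]: "wt_tape T \<Gamma> t"
  shows "ti (lwhisk P t) = \<iota> (pl P) \<otimes>\<^sub>a ti t"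
  using assms(1)
proof (induction P)
  case Nil
  show ?case by (rule S.initial_ext) (simp_all add: sg.wt_poly)
next
  case (Cons U P)
  then show ?case using sum_prod[of "\<iota> (wd U)" "\<iota> (pl P)" "ti t"] by (simp add: ti_lwhisk1)
qed

text \<open>Naturality moves the first distributor past the sum, where it meets its inverse.\<close>

lemma ti_rwhisk:
  assumes "P \<in> sg.Pl" and [simp]: "wt_tape T \<Gamma> t"
  shows "ti (rwhisk T \<Gamma> P t) = ti t \<otimes>\<^sub>a \<iota> (pl P)"
  using assms(1)
proof (induction P)
  case Nil
  show ?case by (rule S.initial_ext) (simp_all add: sg.wt_poly)
next
  case (Cons W P)
  note [simp] = Cons.hyps sg.wt_poly
  let ?X = "pl (tdom T \<Gamma> t)" let ?Y = "pl (tcod T \<Gamma> t)"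
  have "ti (rwhisk T \<Gamma> (W # P) t) = (\<delta>\<^sub>l ?X (wd W) (pl P) \<Zsemi> ((ti t \<otimes>\<^sub>a \<iota> (wd W)) \<oplus>\<^sub>a (ti t \<otimes>\<^sub>a \<iota> (pl P)))) \<Zsemi> dli ?Y (wd W) (pl P)"
    using Cons.IH by (simp add: ti_rwhisk1)
  also have "\<dots> = ((ti t \<otimes>\<^sub>a (\<iota> (wd W) \<oplus>\<^sub>a \<iota> (pl P))) \<Zsemi> \<delta>\<^sub>l ?Y (wd W) (pl P)) \<Zsemi> dli ?Y (wd W) (pl P)"
    using dl_nat[of "ti t" "\<iota> (wd W)" "\<iota> (pl P)"] by simp
  also have "\<dots> = ti t \<otimes>\<^sub>a \<iota> (pl (W # P))" by (simp add: dl_dli)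
  finally show ?case .
qed

lemma ti_tprod:
  assumes "wt_tape T \<Gamma> t" "wt_tape T \<Gamma> u"
  shows "ti (tprod T \<Gamma> t u) = ti t \<otimes>\<^sub>a ti u"
  using assms by (simp add: tprod_def ti_lwhisk ti_rwhisk sg.wt_poly)

text \<open>As for right whiskering, but here the distributor at the domain is the one at
  \<open>\<one>\<close>, an identity; this is why the recursion of \<open>tops\<close> carries only
  an inverse distributor.\<close>

lemma ti_tops:
  assumes [simp]: "f \<in> ops T" and "P \<in> sg.Pl"
  shows "ti (tops T f P) = opr f \<otimes>\<^sub>a \<iota> (pl P)"
  using assms(2)
proof (induction P)
  case Nil
  show ?case by (rule S.initial_ext) simp_all
next
  case (Cons U P)
  note [simp] = Cons.hyps
  let ?N = "S.npow \<one> (arity T f)"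
  have "ti (tops T f (U # P)) = ((opr f \<otimes>\<^sub>a \<iota> (wd U)) \<oplus>\<^sub>a (opr f \<otimes>\<^sub>a \<iota> (pl P))) \<Zsemi> dli ?N (wd U) (pl P)"
    using Cons.IH by simp
  also have "\<dots> = ((opr f \<otimes>\<^sub>a (\<iota> (wd U) \<oplus>\<^sub>a \<iota> (pl P))) \<Zsemi> \<delta>\<^sub>l ?N (wd U) (pl P)) \<Zsemi> dli ?N (wd U) (pl P)"
    using dl_nat[of "opr f" "\<iota> (wd U)" "\<iota> (pl P)"] lap23[of "wd U" "pl P"] by simp
  also have "\<dots> = opr f \<otimes>\<^sub>a \<iota> (pl (U # P))" by (simp add: dl_dli)
  finally show ?case .
qed

lemma ti_tsum_replicate: "wt_tape T \<Gamma> t \<Longrightarrow> ti (tsum (replicate n t)) = \<iota> (S.npow \<one> n) \<otimes>\<^sub>a ti t"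
proof (induction n)
  case 0
  then show ?case by (intro S.initial_ext) (simp_all add: sg.wt_poly)
next
  case (Suc n)
  then show ?case using sum_prod[of "\<iota> \<one>" "\<iota> (S.npow \<one> n)" "ti t"] by simp
qed

lemma ti_tsum: "ti (tsum ts) = S.nsumar (map ti ts)"
  by (induction ts) simp_all

lemma ti_tnabla_n: "P \<in> sg.Pl \<Longrightarrow> ti (tnabla_n n P) = S.ncopair (pl P) (replicate n (\<iota> (pl P)))"
  by (induction n) simp_all

lemma itm_simps:
  assumes "wf_trm T n t"
  shows "itm n t \<in> hom \<one> (S.npow \<one> n)"
  using assms
proof induction
  case (1 i)
  then show ?case by (simp add: itm_Var Hom_def)
next
  case (2 f ts)
  then have s: "set (map (itm n) ts) \<subseteq> hom \<one> (S.npow \<one> n)" by auto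
  have "wf_trm T n (Fn f ts)" using 2 by (auto intro: wf_trm.intros)
  then show ?case using S.ncopair_props[OF s] 2 by (simp add: itm_Fn Hom_def)
qed

text \<open>Kept apart from \<open>ti_trm\<close> because \<open>ev_incl\<close> applies it to the
  tuples of the Lawvere category as well.\<close>

lemma ti_tuple:
  assumes wf: "\<forall>t \<in> set ts. wf_trm T n t" and ti: "\<forall>t \<in> set ts. ti (trm_tape n U t) = itm n t \<otimes>\<^sub>a \<iota> (wd U)" and [simp]: "U \<in> sg.Wd"
  shows "ti (TSeq (tsum (map (trm_tape n U) ts)) (tnabla_n (length ts) (replicate n U))) =
    S.ncopair (S.npow \<one> n) (map (itm n) ts) \<otimes>\<^sub>a \<iota> (wd U)"
proof -
  let ?Z = "S.npow (wd U) n"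
  have s: "set (map (itm n) ts) \<subseteq> hom \<one> (S.npow \<one> n)" using wf itm_simps by auto
  let ?fs = "map (\<lambda>h. h \<otimes>\<^sub>a \<iota> (wd U)) (map (itm n) ts)"
  have m: "map ti (map (trm_tape n U) ts) = ?fs" using ti by simp
  have h: "set ?fs \<subseteq> hom (wd U) ?Z" using s by (auto simp: Hom_def)
  have "ti (TSeq (tsum (map (trm_tape n U) ts)) (tnabla_n (length ts) (replicate n U))) =
      S.nsumar ?fs \<Zsemi> S.ncopair ?Z (replicate (length ts) (\<iota> ?Z))"
    unfolding ti.simps ti_tsum m by (simp add: ti_tnabla_n)
  also have "\<dots> = S.ncopair ?Z (map2 (\<Zsemi>) ?fs (replicate (length ts) (\<iota> ?Z)))"
    by (rule S.nsumar_ncopair[OF h]) (simp_all add: Hom_def set_replicate_conv_if)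
  also have "map2 (\<Zsemi>) ?fs (replicate (length ts) (\<iota> ?Z)) = ?fs"
    using h by (induction ts) (auto simp: Hom_def)
  also have "S.ncopair ?Z ?fs = S.ncopair (S.npow \<one> n) (map (itm n) ts) \<otimes>\<^sub>a \<iota> (wd U)"
    using ncopair_prod[OF s, of "wd U"] by simp
  finally show ?thesis .
qed

lemma ti_trm:
  assumes "wf_trm T n t" and [simp]: "U \<in> sg.Wd"
  shows "ti (trm_tape n U t) = itm n t \<otimes>\<^sub>a \<iota> (wd U)"
  using assms(1)
proof induction
  case (1 i)
  then show ?case using S.nin_explicit[of "wd U" i n] nin_prod[of \<one> "wd U" i n] by (simp add: itm_Var)
next
  case (2 f ts)
  let ?tup = "TSeq (tsum (map (trm_tape n U) ts)) (tnabla_n (length ts) (replicate n U))"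
  have w: "wf_trm T n (Fn f ts)" using 2 by (auto intro: wf_trm.intros)
  have f: "f \<in> ops T" "length ts = arity T f" using 2 by auto
  have s: "set (map (itm n) ts) \<subseteq> hom \<one> (S.npow \<one> n)" using 2 itm_simps by auto
  have e: "ti ?tup = S.ncopair (S.npow \<one> n) (map (itm n) ts) \<otimes>\<^sub>a \<iota> (wd U)"
    by (rule ti_tuple) (use 2 in auto)
  \<comment> \<open>The typing of the parts is read off from that of the whole term tape.\<close>
  have p: "wt_tape T \<Gamma> (TOp f U)" "wt_tape T \<Gamma> (tsum (map (trm_tape n U) ts))"
    "wt_tape T \<Gamma> (tnabla_n (length ts) (replicate n U))"
    "tcod T \<Gamma> (TOp f U) = tdom T \<Gamma> (tsum (map (trm_tape n U) ts))"
    "tcod T \<Gamma> (tsum (map (trm_tape n U) ts)) = tdom T \<Gamma> (tnabla_n (length ts) (replicate n U))"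
    using sg.trm_tape_typing(3)[OF w assms(2), unfolded trm_tape.simps wt_tape.simps(5)] by simp_all
  have "ti (trm_tape n U (Fn f ts)) = ti (TOp f U) \<Zsemi> ti ?tup"
    unfolding trm_tape.simps ti.simps(5) by (rule S.Comp_assoc_simp) (simp_all only: ti_simps p)
  also have "\<dots> = (opr f \<otimes>\<^sub>a \<iota> (wd U)) \<Zsemi> (S.ncopair (S.npow \<one> n) (map (itm n) ts) \<otimes>\<^sub>a \<iota> (wd U))"
    unfolding e by simp
  also have "\<dots> = itm n (Fn f ts) \<otimes>\<^sub>a \<iota> (wd U)"
    using f S.ncopair_props[OF s] by (simp add: itm_Fn[OF w])
  finally show ?case .
qed

lemma ti_tsym_prod [simp]:
  assumes [simp]: "P \<in> sg.Pl" and "Q \<in> sg.Pl"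
  shows "ti (tsym_prod P Q) = \<sigma>\<^sub>p (pl P) (pl Q)"
  using assms(2)
proof (induction Q)
  case Nil
  show ?case by (rule S.initial_ext) simp_all
next
  case (Cons V Q)
  note [simp] = Cons.hyps
  have m: "S.nsumar (map (\<lambda>U. ci (csym U V)) P) = \<sigma>\<^sub>p (pl P) (wd V)"
    using assms(1)
  proof (induction P)
    case Nil
    show ?case by (rule S.initial_ext) simp_all
  next
    case (Cons U P)
    then show ?case using lap2[of "wd U" "pl P" "wd V"] by simp
  qed
  let ?P = "pl P" let ?V = "wd V" let ?Q = "pl Q"
  have "ti (tsym_prod P (V # Q)) = \<delta>\<^sub>l ?P ?V ?Q \<Zsemi> (\<sigma>\<^sub>p ?P ?V \<oplus>\<^sub>a \<sigma>\<^sub>p ?P ?Q)"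
    using Cons.IH m by (simp add: ti_tsum o_def)
  \<comment> \<open>Inserts a symmetry and its inverse so that Laplaza 2 can absorb the
    distributor.\<close>
  also have "\<dots> = (\<sigma>\<^sub>p ?P (?V \<oplus> ?Q) \<Zsemi> (\<sigma>\<^sub>p (?V \<oplus> ?Q) ?P \<Zsemi> \<delta>\<^sub>l ?P ?V ?Q)) \<Zsemi> (\<sigma>\<^sub>p ?P ?V \<oplus>\<^sub>a \<sigma>\<^sub>p ?P ?Q)"
    using P.symm_inv_assoc[of ?P "?V \<oplus> ?Q" "\<delta>\<^sub>l ?P ?V ?Q"] by simp
  also have "\<dots> = \<sigma>\<^sub>p ?P (?V \<oplus> ?Q)"
    unfolding lap2[OF wd_Ob[OF Cons.hyps(1)] pl_Ob[OF Cons.hyps(2)] pl_Ob[OF assms(1)]] by simp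
  finally show ?case by simp
qed

interpretation fc: fc_category "rcat R" "rsum R" "rnabla R" "rcobang R"
  by (rule S.is_fc_category)

lemma tape_sound: "tape_eq T \<Gamma> t u \<Longrightarrow> ti t = ti u"
proof (induction rule: tape_eq.induct)
  case (prod_cong t t' u u')
  then show ?case using sg.tape_eq_typing[of t t'] sg.tape_eq_typing[of u u'] by (simp add: ti_tprod)
next
  case (sym_natural t u)
  then show ?case using S.symm_nat[of "ti t" "ti u" "pl (tcod T \<Gamma> t)" "pl (tcod T \<Gamma> u)"] by (simp add: sg.wt_poly)
next
  case (nabla_assoc U) then show ?case using fc.nabla_assoc[of "wd U"] by simp
next
  case (nabla_unit U) then show ?case by (simp add: S.nab_unit_left)
next
  case (nabla_comm U) then show ?case using fc.nabla_comm[of "wd U"] by simp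
next
  case (nabla_circ c)
  then show ?case using S.nab_nat[of "ci c"] by (simp add: sg.wt_circ_words)
next
  case (nabla_op f U)
  then show ?case using S.nab_nat[of "opr f \<otimes>\<^sub>a \<iota> (wd U)"] by simp
next
  \<comment> \<open>By interchange in the target both composites are \<open>opr f\<close> tensored
    with \<open>ti t\<close>.\<close>
  case (op_natural t f)
  then show ?case using P.tar_fuse[of "\<iota> \<one>" "opr f" "ti t" "\<iota> (pl (tcod T \<Gamma> t))"] by (simp add: ti_tops ti_tsum_replicate sg.wt_poly)
next
  case (circ c d) then show ?case by (simp add: ci_sound)
next
  case (theory_ax t t' n U) then show ?case by (simp add: ti_trm itm_eqs)
qed (simp_all add: sg.wt_poly sg.wt_circ_words)

end

section \<open>The universal property\<close>

context tapes
begin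

lemma cl_TCirc_CId: "A \<in> sorts \<Gamma> \<Longrightarrow> cl (TCirc (CId A)) = Id TC [[A]]"
  using cl_TCirc_cong[OF circ_eq.par_unit[of \<Gamma> "CId A"]] cl_TCirc_cid[of "[A]"] by simp

lemma cl_TCirc_CUnit: "cl (TCirc CUnit) = Id TC [[]]"
  using cl_TCirc_cid[of "[]"] by simp

lemma cl_TCirc_CSym:
  assumes "A \<in> sorts \<Gamma>" "B \<in> sorts \<Gamma>"
  shows "cl (TCirc (CSym A B)) = symm TP [[A]] [[B]]"
proof -
  have "csym [A] [B] \<approx>\<^sub>c CSym A B"
    using circ.sw_eq_sy[of A B] assms by (intro circ.cls_eqD) (simp_all add: circ.symm_quot_tensor del: csym.simps)
  then show ?thesis using assms SG_sing_sing[of "[A]" "[B]"] cl_TCirc_cong by simp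
qed

lemma cl_TCirc_CPar:
  assumes "wt_circ \<Gamma> c" "wt_circ \<Gamma> d"
  shows "cl (TCirc (CPar c d)) = tar TP (cl (TCirc c)) (cl (TCirc d))"
  using assms cl_TCirc_CPar1[OF assms] by (simp add: tar_TP LW_sing_cl RW_sing_cl wt_circ_words)

text \<open>\<open>rwhisk1\<close> by \<open>U\<close> takes \<open>TOp f []\<close> to
  \<open>TOp f U\<close>. A strict morphism is therefore determined on every operation tape by its
  values on the image of the Lawvere category.\<close>

lemma cl_TOp:
  assumes "f \<in> ops T" and [simp]: "U \<in> Wd"
  shows "cl (TOp f U) = tar TP (cl (TOp f [])) (Id TC [U])"
  using assms RW_sing_cl[of U "TOp f []"] by (simp add: tar_TP)

lemma tape_interpretation: "is_interpretation \<Gamma> (tape_sesqui T \<Gamma>) (\<lambda>A. A) (tape_gen T \<Gamma>)"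
proof -
  have w: "word_ext (tape_sesqui T \<Gamma>) (\<lambda>A. A) U = [U]" for U
    by (induction U) (simp_all add: word_ext_def tape_sesqui_def)
  show ?thesis unfolding is_interpretation_def w
    by (auto simp: tape_sesqui_def tape_gen_def Hom_def)
qed

end

section \<open>The functor from the Lawvere category into a right strict target\<close>

locale strict_theory_rig =
  fixes T :: "'f alg_theory" and R :: "('o, 'a, 'f) theory_rig"
  assumes right_strict: "right_strict_rig R" and theory_rig: "theory_rig_category T R"
begin

abbreviation "dli \<equiv> \<lambda>X Y Z. inv_of (rcat R) (distl R X Y Z)"

sublocale dist_rig R dli
  using right_strict theory_rig
  by (intro right_strict_dist_rig) (simp_all add: theory_rig_category_def fc_rig_category_def)

abbreviation "F \<equiv> incl R"
abbreviation "F' \<equiv> amap (incl R)"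
abbreviation "trm n t \<equiv> F' (n, [trm_class T n t])"

lemma fc_morphism_F: "fc_morphism (lawvere_op T) (sum_fc R) F"
  using theory_rig by (simp add: theory_rig_category_def)

lemma F_functor: "strong_symmetric_monoidal_functor (op_cat (lawvere T)) (fsum (lawvere_op T)) (rcat R) (rsum R) F"
  using fc_morphism_F by (simp add: fc_morphism_def sum_fc_def lawvere_op_def)

lemma F_canonical: "mfun_eq aleph0_cat (mfun_comp (rcat R) (d_morphism T) F)
  (canonical_fc.canonical (rcat R) (rsum R) (rnabla R) (rcobang R) \<one>)"
  using theory_rig by (simp add: theory_rig_category_def)

lemma F_omap [simp]: "omap F n = S.npow \<one> n"
  using F_canonical by (simp add: mfun_eq_def mfun_comp_def d_morphism_def canonical_fc.canonical_def aleph0_cat_def)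

lemma F_Id [simp]: "F' (Id (lawvere T) n) = \<iota> (S.npow \<one> n)"
  using strong_symmetric_monoidal_functor.amap_Id[OF F_functor, of n] by (simp add: op_cat_def lawvere_def)

text \<open>The condition \<open>d;i = c\<close> compares monoidal functors together with their
  comparison arrows, and those of the canonical functor are identities in a strict target.\<close>

lemma F_mu [simp]: "mu F m n = \<iota> (S.npow \<one> (m + n))"
proof -
  have "mu F m n \<in> hom (S.npow \<one> m \<oplus> S.npow \<one> n) (omap F (m + n))"
    using strong_symmetric_monoidal_functor.mu_in_Hom[OF F_functor, of m n] by (simp add: op_cat_def lawvere_def lawvere_op_def)
  moreover have "mu F m n \<Zsemi> F' (Id (lawvere T) (m + n)) = \<iota> (S.npow \<one> (m + n))"
    using F_canonical by (simp add: mfun_eq_def mfun_comp_def d_morphism_def canonical_fc.canonical_def aleph0_cat_def)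
  ultimately show ?thesis by (simp add: Hom_def)
qed

lemma F_eps [simp]: "eps F = \<iota> \<zero>"
proof -
  have "eps F \<in> hom \<zero> \<zero>"
    using strong_symmetric_monoidal_functor.eps_in_Hom[OF F_functor] by (simp add: lawvere_op_def)
  moreover have "eps F \<Zsemi> F' (Id (lawvere T) 0) = \<iota> \<zero>"
    using F_canonical by (simp add: mfun_eq_def mfun_comp_def d_morphism_def canonical_fc.canonical_def aleph0_cat_def)
  ultimately show ?thesis by (simp add: Hom_def)
qed

lemma F_d_arr:
  assumes "\<forall>k \<in> set ks. k < n"
  shows "F' (d_arr T (n, ks)) = S.ncopair (S.npow \<one> n) (map (S.nin \<one> n) ks)"
  using F_canonical assms S.copair_eq[of \<one> ks n]
  by (auto simp: mfun_eq_def mfun_comp_def d_morphism_def canonical_fc.canonical_def aleph0_cat_def)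

lemma F_simps [simp]:
  assumes "law_Arr T n ts"
  shows "F' (n, ts) \<in> Arr (rcat R)" "Dom (rcat R) (F' (n, ts)) = S.npow \<one> (length ts)" "Cod (rcat R) (F' (n, ts)) = S.npow \<one> n"
proof -
  have "(n, ts) \<in> Hom (op_cat (lawvere T)) (length ts) n" using assms by (simp add: law_Hom)
  from HomD[OF strong_symmetric_monoidal_functor.amap_in_Hom[OF F_functor this]]
  show "F' (n, ts) \<in> Arr (rcat R)" "Dom (rcat R) (F' (n, ts)) = S.npow \<one> (length ts)" "Cod (rcat R) (F' (n, ts)) = S.npow \<one> n"
    by simp_all
qed

text \<open>Composition in \<open>lawvere\<close> substitutes into a chosen representative;
  \<open>trm_eq_subst\<close> allows \<open>u\<close> itself to be used instead.\<close>

lemma F_Comp: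
  assumes "law_Arr T n ts" and wf: "wf_trm T (length ts) u"
  shows "F' (length ts, [trm_class T (length ts) u]) \<Zsemi> F' (n, ts) = trm n (subst (\<lambda>i. rep (ts ! i)) u)"
proof -
  let ?m = "length ts" and ?s = "\<lambda>i. rep (ts ! i)"
  have s: "\<forall>i<?m. wf_trm T n (?s i)" using law_Arr_rep[OF assms(1)] by simp
  have "(?m, [trm_class T ?m u]) \<in> Hom (op_cat (lawvere T)) 1 ?m" "(n, ts) \<in> Hom (op_cat (lawvere T)) ?m n"
    using assms by (auto simp: law_Hom law_Arr_def)
  from strong_symmetric_monoidal_functor.amap_Comp[OF F_functor this]
  have "F' (?m, [trm_class T ?m u]) \<Zsemi> F' (n, ts) = F' (n, [trm_class T n (subst ?s (rep (trm_class T ?m u)))])"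
    by (simp add: op_cat_def lawvere_def)
  moreover have "trm_eq T n (subst ?s (rep (trm_class T ?m u))) (subst ?s u)"
    by (rule trm_eq_subst[OF _ s]) (rule trm_eq.sym[OF trm_eq_rep[OF wf]])
  ultimately show ?thesis by (simp add: trm_class_cong)
qed

lemma trm_Var: "i < n \<Longrightarrow> trm n (Var i) = S.nin \<one> n i"
proof -
  assume i: "i < n"
  have "S.nin \<one> n i \<oplus>\<^sub>a rcobang R (S.npow \<one> n) = S.nin \<one> n i \<Zsemi> S.in1 (S.npow \<one> n) (S.npow \<one> n)"
    using S.in_tar(1)[of "S.nin \<one> n i" "rcobang R (S.npow \<one> n)" \<one> \<zero>] i by simp
  then show ?thesis using F_d_arr[of "[i]" n] i by (simp add: d_arr_def)
qed

lemma trm_Hom: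
  assumes "wf_trm T n t"
  shows "trm n t \<in> hom \<one> (S.npow \<one> n)"
proof -
  have "law_Arr T n [trm_class T n t]" using assms by (auto simp: law_Arr_def)
  from F_simps[OF this] show ?thesis by (simp add: Hom_def)
qed

text \<open>By \<open>d;i = c\<close> the variables, which are the projections of the Lawvere
  category, become the coproduct injections; composing with them recovers the components.\<close>

lemma F_tuple:
  assumes ts: "law_Arr T n ts"
  shows "F' (n, ts) = S.ncopair (S.npow \<one> n) (map (\<lambda>c. trm n (rep c)) ts)"
proof (rule S.npow_ext[of "length ts" \<one>])
  let ?fs = "map (\<lambda>c. trm n (rep c)) ts"
  have h: "set ?fs \<subseteq> hom \<one> (S.npow \<one> n)" using trm_Hom law_Arr_rep[OF ts] by auto
  note p = S.ncopair_props[OF h]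
  show "S.ncopair (S.npow \<one> n) ?fs \<in> Arr (rcat R)" "Dom (rcat R) (S.ncopair (S.npow \<one> n) ?fs) = S.npow \<one> (length ts)"
    "Cod (rcat R) (F' (n, ts)) = Cod (rcat R) (S.ncopair (S.npow \<one> n) ?fs)"
    using p ts by simp_all
  fix k assume k: "k < length ts"
  have v: "wf_trm T (length ts) (Var k)" using k by (rule wf_trm.intros)
  have "S.nin \<one> (length ts) k \<Zsemi> F' (n, ts) = trm n (rep (ts ! k))"
    unfolding trm_Var[OF k, symmetric] by (rule F_Comp[OF ts v, unfolded subst.simps])
  also have "\<dots> = ?fs ! k" using k by simp
  also have "\<dots> = S.nin \<one> (length ts) k \<Zsemi> S.ncopair (S.npow \<one> n) ?fs"
    by (rule S.nin_ncopair[OF h, symmetric]) (use k in simp_all)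
  finally show "S.nin \<one> (length ts) k \<Zsemi> F' (n, ts) = S.nin \<one> (length ts) k \<Zsemi> S.ncopair (S.npow \<one> n) ?fs" .
qed (use ts in simp_all)

text \<open>The term is the generic application \<open>op_arrow T f\<close> with the tuple of its
  arguments substituted, so \<open>F_Comp\<close> and \<open>F_tuple\<close> apply.\<close>

lemma trm_Fn:
  assumes wf: "wf_trm T n (Fn f ts)"
  shows "trm n (Fn f ts) = F' (op_arrow T f) \<Zsemi> S.ncopair (S.npow \<one> n) (map (trm n) ts)"
proof -
  have w: "f \<in> ops T" "length ts = arity T f" "\<forall>t \<in> set ts. wf_trm T n t" using wf by (auto elim: wf_Fn)
  let ?cs = "map (trm_class T n) ts" and ?v = "Fn f (map Var [0..<arity T f])"
  have c: "law_Arr T n ?cs" using w by (auto simp: law_Arr_def)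
  have m: "map (\<lambda>c. trm n (rep c)) ?cs = map (trm n) ts"
    using w(3) by (simp add: trm_class_cong[OF trm_eq_rep, symmetric])
  have "F' (op_arrow T f) \<Zsemi> F' (n, ?cs) = trm n (subst (\<lambda>i. rep (?cs ! i)) ?v)"
    using F_Comp[OF c, of ?v] wf_op[OF w(1)] w(2) by (simp add: op_arrow_def)
  also have "\<dots> = trm n (Fn f ts)"
  proof -
    have "list_all2 (trm_eq T n) (map (\<lambda>i. rep (?cs ! i)) [0..<arity T f]) ts"
      using w by (simp add: list_all2_conv_all_nth trm_eq.sym[OF trm_eq_rep])
    then have "trm_eq T n (subst (\<lambda>i. rep (?cs ! i)) ?v) (Fn f ts)" using w by (simp add: o_def trm_eq.cong)
    then show ?thesis by (simp add: trm_class_cong)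
  qed
  finally show ?thesis unfolding F_tuple[OF c] m ..
qed

text \<open>The equation is instantiated with the identity substitution \<open>Var\<close>.\<close>

lemma trm_ax: "(t, t') \<in> eqs T \<Longrightarrow> wf_trm T n t \<Longrightarrow> wf_trm T n t' \<Longrightarrow> trm n t = trm n t'"
  using trm_class_cong[OF trm_eq.ax[of t t' T n n Var]] by (simp add: wf_trm.intros(1))

lemma op_Hom: "f \<in> ops T \<Longrightarrow> F' (op_arrow T f) \<in> hom \<one> (S.npow \<one> (arity T f))"
  using trm_Hom[OF wf_op] by (simp add: op_arrow_def)

end

section \<open>Existence of the extension\<close>

locale sesqui_interp = strict_theory_rig T R + sg: signature T \<Gamma>
  for T :: "'f alg_theory" and R :: "('o, 'a, 'f) theory_rig" and \<Gamma> :: "('s, 'g) monsig" +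
  fixes H :: "('n, 'o, 'a, 'f) sesqui" and aS :: "'s \<Rightarrow> 'n" and aG :: "'g \<Rightarrow> 'a"
  assumes srig_H [simp]: "srig H = R" and sesquistrict: "sesquistrict_rig_category H" and interp: "is_interpretation \<Gamma> H aS aG"
begin

lemma base_Ob: "A \<in> sorts \<Gamma> \<Longrightarrow> bmap H (aS A) \<in> Ob"
  using interp sesquistrict by (simp add: is_interpretation_def sesquistrict_rig_category_def)

lemma base_dl:
  assumes "A \<in> sorts \<Gamma>" "X \<in> Ob" "Y \<in> Ob"
  shows "\<delta>\<^sub>l (bmap H (aS A)) X Y = \<iota> ((bmap H (aS A) \<otimes> X) \<oplus> (bmap H (aS A) \<otimes> Y))"
    "bmap H (aS A) \<otimes> (X \<oplus> Y) = (bmap H (aS A) \<otimes> X) \<oplus> (bmap H (aS A) \<otimes> Y)"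
proof -
  have "is_identity (rcat R) (\<delta>\<^sub>l (bmap H (aS A)) X Y)"
    using interp sesquistrict assms by (simp add: is_interpretation_def sesquistrict_rig_category_def)
  from S.is_identityD[OF this dl_Hom[OF base_Ob[OF assms(1)] assms(2,3)]]
  show "\<delta>\<^sub>l (bmap H (aS A)) X Y = \<iota> ((bmap H (aS A) \<otimes> X) \<oplus> (bmap H (aS A) \<otimes> Y))"
    "bmap H (aS A) \<otimes> (X \<oplus> Y) = (bmap H (aS A) \<otimes> X) \<oplus> (bmap H (aS A) \<otimes> Y)" by simp_all
qed

sublocale tape_interp R dli T \<Gamma> "\<lambda>A. bmap H (aS A)" aG "\<lambda>f. F' (op_arrow T f)" "\<lambda>n t. trm n t"
proof unfold_locales
  show "aG s \<in> hom (foldr (\<lambda>A. (\<otimes>) (bmap H (aS A))) (ar \<Gamma> s) \<one>) (foldr (\<lambda>A. (\<otimes>) (bmap H (aS A))) (coar \<Gamma> s) \<one>)"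
    if "s \<in> gens \<Gamma>" for s
    using interp that by (simp add: is_interpretation_def word_ext_def)
qed (auto simp: trm_Var trm_Fn op_Hom base_dl base_Ob intro: trm_ax)

definition ev :: "('s, 'g, 'f) tape set \<Rightarrow> 'a" where "ev a = ti (rep a)"

lemma ev_class [simp]: "wt_tape T \<Gamma> t \<Longrightarrow> ev (tape_class T \<Gamma> t) = ti t"
proof -
  assume "wt_tape T \<Gamma> t"
  then have "t \<in> tape_class T \<Gamma> t" by (simp add: tape_class_def tape_eq.refl)
  then have "rep (tape_class T \<Gamma> t) \<in> tape_class T \<Gamma> t" unfolding rep_def by (rule someI)
  then show ?thesis unfolding ev_def tape_class_def by (simp add: tape_sound)
qed

abbreviation "TC \<equiv> tape_cat T \<Gamma>"
abbreviation "TS \<equiv> tape_sum T \<Gamma>"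
abbreviation "TP \<equiv> tape_prod T \<Gamma>"

lemma is_tapes: "tapes \<Gamma>"
  by unfold_locales

lemma rep_Arr [simp]:
  assumes "a \<in> Arr TC"
  shows "wt_tape T \<Gamma> (rep a)" "tdom T \<Gamma> (rep a) = Dom TC a" "tcod T \<Gamma> (rep a) = Cod TC a" "tape_class T \<Gamma> (rep a) = a"
  using tapes.wt_rep[OF is_tapes assms] tapes.td_rep[OF is_tapes assms] tapes.cl_rep[OF is_tapes assms] by simp_all

lemma Pl_Arr [simp]: "a \<in> Arr TC \<Longrightarrow> Dom TC a \<in> sg.Pl" "a \<in> Arr TC \<Longrightarrow> Cod TC a \<in> sg.Pl"
  by (erule tapes.Dom_Pl[OF is_tapes] tapes.Cod_Pl[OF is_tapes])+

lemma ev_simps [simp]: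
  assumes "a \<in> Arr TC"
  shows "ev a \<in> Arr (rcat R)" "Dom (rcat R) (ev a) = pl (Dom TC a)" "Cod (rcat R) (ev a) = pl (Cod TC a)"
  using assms by (simp_all add: ev_def)

abbreviation "TR \<equiv> tape_rig T \<Gamma>"

lemma tape_rig_simps [simp]: "rcat TR = TC" "rsum TR = TS" "rprod TR = TP" "distl TR P Q N = tape_class T \<Gamma> (tdistl P Q N)"
    "distr TR P Q N = Id TC (poly_prod (P @ Q) N)" "annl TR P = Id TC []" "annr TR P = Id TC []"
    "rnabla TR P = tape_class T \<Gamma> (tnabla P)" "rcobang TR P = tape_class T \<Gamma> (tcobang P)" "incl TR = tape_incl T \<Gamma>"
  and tape_sum_simps [simp]: "tob TS = (@)" "tunit TS = []" "assoc TS P Q N = Id TC (P @ Q @ N)" "lunit TS P = Id TC P" "runit TS P = Id TC P"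
    "symm TS P Q = tape_class T \<Gamma> (tsym P Q)"
  and tape_prod_simps [simp]: "tob TP = poly_prod" "tunit TP = [[]]" "assoc TP P Q N = Id TC (poly_prod P (poly_prod Q N))"
    "lunit TP P = Id TC P" "runit TP P = Id TC P" "symm TP P Q = tape_class T \<Gamma> (tsym_prod P Q)"
  and Obj_tape [simp]: "Obj TC = sg.Pl"
  and Id_tape: "Id TC P = tape_class T \<Gamma> (tid P)"
  and Comp_tape: "Comp TC a b = tape_class T \<Gamma> (TSeq (rep a) (rep b))"
  and tar_tape: "tar TS a b = tape_class T \<Gamma> (TPar (rep a) (rep b))" "tar TP a b = tape_class T \<Gamma> (tprod T \<Gamma> (rep a) (rep b))"
  by (simp_all add: tape_rig_def tape_sum_def tape_prod_def tape_cat_def del: rep_Arr)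

lemma ev_Id [simp]: "P \<in> sg.Pl \<Longrightarrow> ev (Id TC P) = \<iota> (pl P)"
  by (simp add: Id_tape)

lemma ev_Comp: "a \<in> Arr TC \<Longrightarrow> b \<in> Arr TC \<Longrightarrow> Cod TC a = Dom TC b \<Longrightarrow> ev (Comp TC a b) = ev a \<Zsemi> ev b"
  using ev_class[of "TSeq (rep a) (rep b)"] by (simp add: Comp_tape ev_def)

lemma ev_sum: "a \<in> Arr TC \<Longrightarrow> b \<in> Arr TC \<Longrightarrow> ev (tar TS a b) = ev a \<oplus>\<^sub>a ev b"
  using ev_class[of "TPar (rep a) (rep b)"] by (simp add: tar_tape ev_def)

lemma ev_prod: "a \<in> Arr TC \<Longrightarrow> b \<in> Arr TC \<Longrightarrow> ev (tar TP a b) = ev a \<otimes>\<^sub>a ev b"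
  using ev_class[of "tprod T \<Gamma> (rep a) (rep b)"] by (simp add: tar_tape ev_def ti_tprod)

definition evf :: "('s poly, ('s, 'g, 'f) tape set, 'o, 'a) rig_fun" where
  "evf = \<lparr>robj = pl, rarr = ev, mu_sum = \<lambda>P Q. \<iota> (pl (P @ Q)), eps_sum = \<iota> \<zero>,
     mu_prod = \<lambda>P Q. \<iota> (pl (poly_prod P Q)), eps_prod = \<iota> \<one>\<rparr>"

lemma sum_evf: "strong_symmetric_monoidal_functor TC TS (rcat R) (rsum R) (sum_fun evf)"
proof unfold_locales
  fix X Y Z f g assume "f \<in> Hom TC X Y" "g \<in> Hom TC Y Z"
  then show "amap (sum_fun evf) (Comp TC f g) = amap (sum_fun evf) f \<Zsemi> amap (sum_fun evf) g"
    by (auto simp: Hom_def sum_fun_def evf_def ev_Comp)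
next
  fix X X' Y Y' f g assume "f \<in> Hom TC X X'" "g \<in> Hom TC Y Y'"
  then show "(amap (sum_fun evf) f \<oplus>\<^sub>a amap (sum_fun evf) g) \<Zsemi> mu (sum_fun evf) X' Y' =
    mu (sum_fun evf) X Y \<Zsemi> amap (sum_fun evf) (tar TS f g)"
    using ev_sum[of f g] by (auto simp: Hom_def sum_fun_def evf_def)
qed (simp_all add: sum_fun_def evf_def Hom_def S.is_iso_Id)

lemma prod_evf: "strong_symmetric_monoidal_functor TC TP (rcat R) (rprod R) (prod_fun evf)"
proof unfold_locales
  fix X Y Z f g assume "f \<in> Hom TC X Y" "g \<in> Hom TC Y Z"
  then show "amap (prod_fun evf) (Comp TC f g) = amap (prod_fun evf) f \<Zsemi> amap (prod_fun evf) g"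
    by (auto simp: Hom_def prod_fun_def evf_def ev_Comp)
next
  fix X X' Y Y' f g assume "f \<in> Hom TC X X'" "g \<in> Hom TC Y Y'"
  then show "(amap (prod_fun evf) f \<otimes>\<^sub>a amap (prod_fun evf) g) \<Zsemi> mu (prod_fun evf) X' Y' =
    mu (prod_fun evf) X Y \<Zsemi> amap (prod_fun evf) (tar TP f g)"
    using ev_prod[of f g] by (auto simp: Hom_def prod_fun_def evf_def)
qed (simp_all add: prod_fun_def evf_def Hom_def S.is_iso_Id)

lemma rig_evf: "rig_functor (tape_rig T \<Gamma>) R evf"
  by (rule rig_functor.intro) (simp_all add: sum_evf prod_evf, simp_all add: evf_def)

text \<open>Both functors send a tuple to the copairing of its components, so
  \<open>ti_tuple\<close> at the empty word and \<open>F_tuple\<close> meet.\<close>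

lemma ev_incl:
  assumes "law_Arr T n ts"
  shows "ev (amap (tape_incl T \<Gamma>) (n, ts)) = F' (n, ts)"
proof -
  let ?ts = "map rep ts"
  let ?t = "TSeq (tsum (map (trm_tape n []) ?ts)) (tnabla_n (length ?ts) (replicate n []))"
  have w: "\<forall>t \<in> set ?ts. wf_trm T n t" using law_Arr_rep[OF assms] by auto
  have m: "map (trm n) ?ts = map (\<lambda>c. trm n (rep c)) ts" by simp
  have h: "set (map (trm n) ?ts) \<subseteq> hom \<one> (S.npow \<one> n)" using w trm_Hom by auto
  have "ti ?t = S.ncopair (S.npow \<one> n) (map (trm n) ?ts) \<otimes>\<^sub>a \<iota> (wd [])"
    by (rule ti_tuple) (use w ti_trm[of n _ "[]"] in auto)
  also have "\<dots> = F' (n, ts)"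
    using S.ncopair_props[OF h] unfolding F_tuple[OF assms] m by simp
  finally have "ti ?t = F' (n, ts)" .
  moreover have "wt_tape T \<Gamma> ?t"
  proof -
    have "\<forall>t \<in> set (map (trm_tape n []) ?ts). wt_tape T \<Gamma> t \<and> tdom T \<Gamma> t = [[]] \<and> tcod T \<Gamma> t = replicate n []"
      using w by auto
    then show ?thesis by (auto simp: comp_def map_replicate_const cong: map_cong)
  qed
  ultimately show ?thesis by (simp add: tape_incl_def o_def)
qed

lemma extension: "sesquistrict_theory_rig_morphism T (tape_sesqui T \<Gamma>) H aS evf"
proof -
  have s: "strict_rig_fun (tape_rig T \<Gamma>) R evf"
    unfolding strict_rig_fun_def by (intro conjI ballI) (simp_all add: evf_def S.is_identity_Id)
  have f: "fc_morphism (sum_fc (tape_rig T \<Gamma>)) (sum_fc R) (sum_fun evf)"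
    unfolding fc_morphism_def using sum_evf by (auto simp: sum_fc_def sum_fun_def evf_def)
  have i: "mfun_eq (fcat (lawvere_op T)) (mfun_comp (rcat R) (tape_incl T \<Gamma>) (sum_fun evf)) F"
  proof -
    have "amap (mfun_comp (rcat R) (tape_incl T \<Gamma>) (sum_fun evf)) a = F' a" if "a \<in> Arr (op_cat (lawvere T))" for a
    proof -
      obtain n ts where a: "a = (n, ts)" by (cases a)
      have "law_Arr T n ts" using that by (simp add: a op_cat_def lawvere_def law_Arr_def)
      then show ?thesis using ev_incl a by (simp add: mfun_comp_def sum_fun_def evf_def)
    qed
    then show ?thesis unfolding mfun_eq_def
      by (auto simp: mfun_comp_def sum_fun_def evf_def lawvere_op_def tape_incl_def S.npow_add)
  qed
  show ?thesis
    unfolding sesquistrict_theory_rig_morphism_def sesquistrict_rig_functor_def theory_rig_morphism_def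
    using rig_evf s f i interp by (auto simp: tape_sesqui_def evf_def is_interpretation_def)
qed

lemma extension_gen: "s \<in> gens \<Gamma> \<Longrightarrow> rarr evf (tape_gen T \<Gamma> s) = aG s"
  by (simp add: evf_def tape_gen_def)

end

section \<open>Uniqueness of the extension\<close>

locale sesqui_extension = sesqui_interp T R \<Gamma> H aS aG
  for T :: "'f alg_theory" and R :: "('o, 'a, 'f) theory_rig" and \<Gamma> :: "('s, 'g) monsig"
    and H :: "('n, 'o, 'a, 'f) sesqui" and aS aG +
  fixes \<alpha> :: "'s \<Rightarrow> 'n" and \<beta> :: "('s poly, ('s, 'g, 'f) tape set, 'o, 'a) rig_fun"
  assumes morphism: "sesquistrict_theory_rig_morphism T (tape_sesqui T \<Gamma>) H \<alpha> \<beta>"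
    and on_sorts: "A \<in> sorts \<Gamma> \<Longrightarrow> \<alpha> A = aS A"
    and on_gens: "s \<in> gens \<Gamma> \<Longrightarrow> rarr \<beta> (tape_gen T \<Gamma> s) = aG s"
begin

sublocale tp: tapes T \<Gamma>
  by (rule is_tapes)

text \<open>The simp rules of \<open>tp\<close> orient these two equations the other way round.\<close>

declare tape_sum_simps(6) [simp del] and tape_prod_simps(6) [simp del]

lemma ext_rig: "rig_functor TR R \<beta>" and strict_ext: "strict_rig_fun TR R \<beta>"
  and ext_base: "A \<in> sorts \<Gamma> \<Longrightarrow> bmap H (aS A) = robj \<beta> [[A]]"
  and ext_fc: "fc_morphism (sum_fc TR) (sum_fc R) (sum_fun \<beta>)"
  and ext_incl: "mfun_eq (fcat (lawvere_op T)) (mfun_comp (rcat R) (tape_incl T \<Gamma>) (sum_fun \<beta>)) F"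
  using morphism on_sorts
  by (auto simp: sesquistrict_theory_rig_morphism_def sesquistrict_rig_functor_def theory_rig_morphism_def tape_sesqui_def)

lemma ext_sum: "strong_symmetric_monoidal_functor TC TS (rcat R) (rsum R) (sum_fun \<beta>)"
  and ext_prod: "strong_symmetric_monoidal_functor TC TP (rcat R) (rprod R) (prod_fun \<beta>)"
  using rig_functor.sum_functor[OF ext_rig] rig_functor.prod_functor[OF ext_rig] by simp_all

lemma rarr_simps [simp]:
  assumes "a \<in> Arr TC"
  shows "rarr \<beta> a \<in> Arr (rcat R)" "Dom (rcat R) (rarr \<beta> a) = robj \<beta> (Dom TC a)" "Cod (rcat R) (rarr \<beta> a) = robj \<beta> (Cod TC a)"
proof -
  have "a \<in> Hom TC (Dom TC a) (Cod TC a)" using assms by (simp add: Hom_def)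
  from HomD[OF strong_symmetric_monoidal_functor.amap_in_Hom[OF ext_sum this]]
  show "rarr \<beta> a \<in> Arr (rcat R)" "Dom (rcat R) (rarr \<beta> a) = robj \<beta> (Dom TC a)" "Cod (rcat R) (rarr \<beta> a) = robj \<beta> (Cod TC a)"
    by (simp_all add: sum_fun_def)
qed

text \<open>Equality of objects is forced through the type of the comparison arrow, which strictness
  makes an identity.\<close>

lemma robj_sum [simp]: "P \<in> sg.Pl \<Longrightarrow> Q \<in> sg.Pl \<Longrightarrow> robj \<beta> (P @ Q) = robj \<beta> P \<oplus> robj \<beta> Q"
  and mu_sum_eq [simp]: "P \<in> sg.Pl \<Longrightarrow> Q \<in> sg.Pl \<Longrightarrow> mu_sum \<beta> P Q = Id (rcat R) (robj \<beta> P \<oplus> robj \<beta> Q)"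
proof -
  assume "P \<in> sg.Pl" "Q \<in> sg.Pl"
  then have "is_identity (rcat R) (mu_sum \<beta> P Q)" "mu_sum \<beta> P Q \<in> hom (robj \<beta> P \<oplus> robj \<beta> Q) (robj \<beta> (P @ Q))"
    using strict_ext strong_symmetric_monoidal_functor.mu_in_Hom[OF ext_sum, of P Q]
    by (simp_all add: strict_rig_fun_def sum_fun_def)
  from S.is_identityD[OF this]
  show "robj \<beta> (P @ Q) = robj \<beta> P \<oplus> robj \<beta> Q" "mu_sum \<beta> P Q = Id (rcat R) (robj \<beta> P \<oplus> robj \<beta> Q)" by simp_all
qed

lemma robj_prod [simp]: "P \<in> sg.Pl \<Longrightarrow> Q \<in> sg.Pl \<Longrightarrow> robj \<beta> (poly_prod P Q) = robj \<beta> P \<otimes> robj \<beta> Q"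
  and mu_prod_eq [simp]: "P \<in> sg.Pl \<Longrightarrow> Q \<in> sg.Pl \<Longrightarrow> mu_prod \<beta> P Q = Id (rcat R) (robj \<beta> P \<otimes> robj \<beta> Q)"
proof -
  assume "P \<in> sg.Pl" "Q \<in> sg.Pl"
  then have "is_identity (rcat R) (mu_prod \<beta> P Q)" "mu_prod \<beta> P Q \<in> hom (robj \<beta> P \<otimes> robj \<beta> Q) (robj \<beta> (poly_prod P Q))"
    using strict_ext strong_symmetric_monoidal_functor.mu_in_Hom[OF ext_prod, of P Q]
    by (simp_all add: strict_rig_fun_def prod_fun_def)
  from S.is_identityD[OF this]
  show "robj \<beta> (poly_prod P Q) = robj \<beta> P \<otimes> robj \<beta> Q" "mu_prod \<beta> P Q = Id (rcat R) (robj \<beta> P \<otimes> robj \<beta> Q)" by simp_all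
qed

lemma robj_zero [simp]: "robj \<beta> [] = \<zero>" and eps_sum_eq [simp]: "eps_sum \<beta> = Id (rcat R) \<zero>"
proof -
  have "is_identity (rcat R) (eps_sum \<beta>)" "eps_sum \<beta> \<in> hom \<zero> (robj \<beta> [])"
    using strict_ext strong_symmetric_monoidal_functor.eps_in_Hom[OF ext_sum] by (simp_all add: strict_rig_fun_def sum_fun_def)
  from S.is_identityD[OF this] show "robj \<beta> [] = \<zero>" "eps_sum \<beta> = Id (rcat R) \<zero>" by simp_all
qed

lemma robj_one [simp]: "robj \<beta> [[]] = \<one>" and eps_prod_eq [simp]: "eps_prod \<beta> = Id (rcat R) \<one>"
proof -
  have "is_identity (rcat R) (eps_prod \<beta>)" "eps_prod \<beta> \<in> hom \<one> (robj \<beta> [[]])"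
    using strict_ext strong_symmetric_monoidal_functor.eps_in_Hom[OF ext_prod] by (simp_all add: strict_rig_fun_def prod_fun_def)
  from S.is_identityD[OF this] show "robj \<beta> [[]] = \<one>" "eps_prod \<beta> = Id (rcat R) \<one>" by simp_all
qed

lemma robj_word: "U \<in> sg.Wd \<Longrightarrow> robj \<beta> [U] = wd U"
proof (induction U rule: lists.induct)
  case (Cons A U)
  then have "robj \<beta> [A # U] = robj \<beta> [[A]] \<otimes> robj \<beta> [U]" using robj_prod[of "[[A]]" "[U]"] by simp
  then show ?case using Cons ext_base by simp
qed simp

lemma robj_eq [simp]: "P \<in> sg.Pl \<Longrightarrow> robj \<beta> P = pl P"
proof (induction P rule: lists.induct)
  case (Cons U P)
  then show ?case using robj_sum[of "[U]" P] robj_word by simp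
qed simp

lemma rarr_Id [simp]: "P \<in> sg.Pl \<Longrightarrow> rarr \<beta> (Id TC P) = Id (rcat R) (pl P)"
  using strong_symmetric_monoidal_functor.amap_Id[OF ext_sum, of P] by (simp add: sum_fun_def)

lemma rarr_Comp: "a \<in> Arr TC \<Longrightarrow> b \<in> Arr TC \<Longrightarrow> Cod TC a = Dom TC b \<Longrightarrow> rarr \<beta> (Comp TC a b) = rarr \<beta> a \<Zsemi> rarr \<beta> b"
  using strong_symmetric_monoidal_functor.amap_Comp[OF ext_sum, of a "Dom TC a" "Cod TC a" b "Cod TC b"] by (simp add: sum_fun_def Hom_def)

text \<open>Naturality of comparison arrows that have become identities.\<close>

lemma rarr_sum: "a \<in> Arr TC \<Longrightarrow> b \<in> Arr TC \<Longrightarrow> rarr \<beta> (tar TS a b) = rarr \<beta> a \<oplus>\<^sub>a rarr \<beta> b"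
  using strong_symmetric_monoidal_functor.mu_natural[OF ext_sum, of a "Dom TC a" "Cod TC a" b "Dom TC b" "Cod TC b"]
  by (simp add: sum_fun_def Hom_def)

lemma rarr_prod: "a \<in> Arr TC \<Longrightarrow> b \<in> Arr TC \<Longrightarrow> rarr \<beta> (tar TP a b) = rarr \<beta> a \<otimes>\<^sub>a rarr \<beta> b"
  using strong_symmetric_monoidal_functor.mu_natural[OF ext_prod, of a "Dom TC a" "Cod TC a" b "Dom TC b" "Cod TC b"]
  by (simp add: prod_fun_def Hom_def)

lemma rarr_symm:
  "P \<in> sg.Pl \<Longrightarrow> Q \<in> sg.Pl \<Longrightarrow> rarr \<beta> (symm TS P Q) = \<sigma>\<^sub>s (pl P) (pl Q)"
  "P \<in> sg.Pl \<Longrightarrow> Q \<in> sg.Pl \<Longrightarrow> rarr \<beta> (symm TP P Q) = \<sigma>\<^sub>p (pl P) (pl Q)"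
  using strong_symmetric_monoidal_functor.mu_symm[OF ext_sum, of P Q] strong_symmetric_monoidal_functor.mu_symm[OF ext_prod, of P Q]
  by (simp_all add: sum_fun_def prod_fun_def)

lemma rarr_nabla: "P \<in> sg.Pl \<Longrightarrow> rarr \<beta> (tp.tN P) = rnabla R (pl P)"
  and rarr_cobang: "P \<in> sg.Pl \<Longrightarrow> rarr \<beta> (tp.tB P) = rcobang R (pl P)"
proof -
  assume "P \<in> sg.Pl"
  then show "rarr \<beta> (tp.tN P) = rnabla R (pl P)" "rarr \<beta> (tp.tB P) = rcobang R (pl P)"
    using ext_fc by (auto simp: fc_morphism_def sum_fc_def sum_fun_def)
qed

text \<open>The operation at the unit lies in the image of the Lawvere category, where
  \<open>\<beta>\<close> is prescribed.\<close>

lemma rarr_op: "f \<in> ops T \<Longrightarrow> rarr \<beta> (tape_class T \<Gamma> (TOp f [])) = F' (op_arrow T f)"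
proof -
  assume f: "f \<in> ops T"
  have "law_Arr T (arity T f) [trm_class T (arity T f) (Fn f (map Var [0..<arity T f]))]"
    using wf_op[OF f] by (auto simp: law_Arr_def)
  then have "op_arrow T f \<in> Arr (fcat (lawvere_op T))"
    by (simp add: op_arrow_def lawvere_op_def op_cat_def lawvere_def law_Arr_def)
  then show ?thesis using ext_incl tp.incl_op[OF f] by (auto simp: mfun_eq_def mfun_comp_def sum_fun_def)
qed

lemma rarr_circ: "wt_circ \<Gamma> c \<Longrightarrow> rarr \<beta> (tape_class T \<Gamma> (TCirc c)) = ci c"
proof (induction c)
  case (CId A)
  then show ?case by (simp add: tp.cl_TCirc_CId)
next
  case CUnit
  then show ?case by (simp add: tp.cl_TCirc_CUnit)
next
  case (CGen s)
  then show ?case using on_gens by (simp add: tape_gen_def)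
next
  case (CSym A B)
  then show ?case using rarr_symm(2)[of "[[A]]" "[[B]]"] by (simp add: tp.cl_TCirc_CSym)
next
  case (CSeq c d)
  then show ?case by (simp add: rarr_Comp)
next
  case (CPar c d)
  then show ?case by (simp add: tp.cl_TCirc_CPar rarr_prod)
qed

text \<open>Each generator is fixed by a preservation property of \<open>\<beta>\<close>; for
  \<open>TOp f U\<close> these are \<open>cl_TOp\<close> and \<open>rarr_op\<close>.\<close>

lemma rarr_class: "wt_tape T \<Gamma> t \<Longrightarrow> rarr \<beta> (tape_class T \<Gamma> t) = ti t"
proof (induction t)
  case (TCirc c)
  then show ?case by (simp add: rarr_circ)
next
  case (TSym U V)
  then show ?case using rarr_symm(1)[of "[U]" "[V]"] by simp
next
  case (TSeq t u)
  then show ?case by (simp add: rarr_Comp)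
next
  case (TPar t u)
  then show ?case by (simp add: rarr_sum)
next
  case (TOp f U)
  then show ?case using tp.cl_TOp[of f U] by (simp add: rarr_prod rarr_op)
qed (simp_all add: rarr_nabla rarr_cobang)

lemma extension_unique: "rig_fun_eq TR \<beta> evf"
proof -
  have "rarr \<beta> a = ev a" if "a \<in> Arr TC" for a
    using rarr_class[of "rep a"] that by (simp add: ev_def)
  then show ?thesis by (simp add: rig_fun_eq_def mfun_eq_def sum_fun_def prod_fun_def evf_def)
qed

end

theorem theorem27:
  fixes T :: "'f alg_theory" and \<Gamma> :: "('s, 'g) monsig"
  assumes "algebraic_theory T" and "monoidal_signature \<Gamma>"
  shows "freely_generated TYPE('n \<times> 'p \<times> 'b) T \<Gamma> (tape_sesqui T \<Gamma>) (\<lambda>A. A) (tape_gen T \<Gamma>) \<and>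
    (\<forall>f \<in> ops T. amap (tape_incl T \<Gamma>) (op_arrow T f) = tape_class T \<Gamma> (TOp f []))"
proof -
  interpret tapes T \<Gamma> by unfold_locales fact
  have q: "srig (tape_sesqui T \<Gamma>) = tape_rig T \<Gamma>" "base (tape_sesqui T \<Gamma>) = sorts \<Gamma>" by (simp_all add: tape_sesqui_def)
  have "\<exists>\<alpha> \<beta>. (sesquistrict_theory_rig_morphism T (tape_sesqui T \<Gamma>) H \<alpha> \<beta> \<and>
         (\<forall>A \<in> sorts \<Gamma>. \<alpha> A = aS A) \<and> (\<forall>s \<in> gens \<Gamma>. rarr \<beta> (tape_gen T \<Gamma> s) = aG s)) \<and>
       (\<forall>\<alpha>' \<beta>'. sesquistrict_theory_rig_morphism T (tape_sesqui T \<Gamma>) H \<alpha>' \<beta>' \<and>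
         (\<forall>A \<in> sorts \<Gamma>. \<alpha>' A = aS A) \<and> (\<forall>s \<in> gens \<Gamma>. rarr \<beta>' (tape_gen T \<Gamma> s) = aG s) \<longrightarrow>
         (\<forall>A \<in> base (tape_sesqui T \<Gamma>). \<alpha>' A = \<alpha> A) \<and> rig_fun_eq (srig (tape_sesqui T \<Gamma>)) \<beta>' \<beta>)"
    if H: "sesquistrict_theory_rig_category T H" "is_interpretation \<Gamma> H aS aG"
    for H :: "('n, 'p, 'b, 'f) sesqui" and aS aG
  proof -
    have s: "sesquistrict_rig_category H" "theory_rig_category T (srig H)"
      using H(1) by (simp_all add: sesquistrict_theory_rig_category_def)
    interpret I: sesqui_interp T "srig H" \<Gamma> H aS aG
      by unfold_locales (use s H(2) in \<open>simp_all add: sesquistrict_rig_category_def\<close>)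
    have "rig_fun_eq (srig (tape_sesqui T \<Gamma>)) \<beta>' I.evf"
      if "sesquistrict_theory_rig_morphism T (tape_sesqui T \<Gamma>) H \<alpha>' \<beta>'"
        "\<forall>A \<in> sorts \<Gamma>. \<alpha>' A = aS A" "\<forall>s \<in> gens \<Gamma>. rarr \<beta>' (tape_gen T \<Gamma> s) = aG s" for \<alpha>' \<beta>'
    proof -
      interpret E: sesqui_extension T "srig H" \<Gamma> H aS aG \<alpha>' \<beta>'
        by unfold_locales (use that in auto)
      show ?thesis unfolding q by (rule E.extension_unique)
    qed
    \<comment> \<open>The base of the tape category is the set of sorts itself, so the discrete
      component can only be \<open>aS\<close>; the functor component is \<open>evf\<close>.\<close>
    then show ?thesis unfolding q using I.extension I.extension_gen
      by (intro exI[of _ aS] exI[of _ I.evf]) blast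
  qed
  then show ?thesis unfolding freely_generated_def Let_def
    using tape_sesquistrict_theory tape_interpretation incl_op by auto
qed

end
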